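(* Let $n$ be a positive integer, let $k$ be a field (of arbitrary characteristic) with algebraic closure $k'$, and let $R = k\{X_1,\ldots,X_s\}/\langle f_1,\ldots,f_t\rangle$ be a finitely presented $k$-algebra. Let $v$ and $x_{ij}(\ell)$ ($1\le i,j\le n$, $1\le \ell\le s$) be commuting indeterminates, let $C := k(v)[x_{ij}(\ell) : 1\le i,j\le n,\ 1\le \ell\le s]$, and let $\mathbf{x}_\ell := (x_{ij}(\ell)) \in M_n(C)$ be the $n\times n$ generic matrices. Let $\mathit{RelEntries}\subseteq C$ be the set of all entries of the matrices $f_1(\mathbf{x}_1,\ldots,\mathbf{x}_s),\ldots,f_t(\mathbf{x}_1,\ldots,\mathbf{x}_s)$. Let $\mathit{CharCoefs}_n\subseteq C$ be the (finite) set of nonscalar coefficients of the characteristic polynomials of all matrix products of length at least $1$ and at most $n$ in $\mathbf{x}_1,\ldots,\mathbf{x}_s$. For $c\in \mathit{CharCoefs}_n$ let $J_c$ be the ideal of $C$ generated by $c-v$ and $\mathit{RelEntries}$. Then the procedure that tests, for each $c \in \mathit{CharCoefs}_n$, whether $1\in J_c$, and that returns YES if $1\notin J_c$ for some $c$ and NO otherwise, correctly decides whether there are infinitely many distinct equivalence classes of semisimple representations $R\to M_n(k')$. That is, $R$ has infinitely many equivalence classes of semisimple $n$-dimensional representations if and only if there exists $c\in \mathit{CharCoefs}_n$ with $1\notin J_c$.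
   Context: $k\{X_1,\ldots,X_s\}$ denotes the free associative unital $k$-algebra in the noncommuting indeterminates $X_1,\ldots,X_s$; $f_1,\ldots,f_t$ are elements of it, and $\langle f_1,\ldots,f_t\rangle$ is the two-sided ideal they generate. For $g\in k\{X_1,\ldots,X_s\}$, $g(\mathbf{x}_1,\ldots,\mathbf{x}_s)$ denotes the image of $g$ under the unital $k$-algebra homomorphism $k\{X_1,\ldots,X_s\}\to M_n(C)$ sending $X_\ell\mapsto \mathbf{x}_\ell$. An $m$-dimensional representation of $R$ is a unital $k$-algebra homomorphism $\rho\colon R\to M_m(k')$. Two $m$-dimensional representations $\rho,\rho'$ are equivalent if there is $Q\in GL_m(k')$ with $\rho'(a)=Q\rho(a)Q^{-1}$ for all $a\in R$. A representation $\rho\colon R\to M_m(k')$ is irreducible if the $k'$-linear span of $\rho(R)$ is all of $M_m(k')$. An $n$-dimensional representation is semisimple if it is equivalent to a block-diagonal representation $a\mapsto \operatorname{diag}(\rho_1(a),\ldots,\rho_r(a))$ with each $\rho_i$ an irreducible $m_i$-dimensional representation of $R$, where the $m_i$ are positive integers with $m_1+\cdots+m_r=n$. The nonscalar coefficients of the characteristic polynomial of a matrix product of generic matrices are the coefficients of $\lambda^0,\ldots,\lambda^{n-1}$ in its characteristic polynomial, i.e. all coefficients other than the leading coefficient $1$. *)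

theory Defs
  imports
    "HOL-Library.Poly_Mapping"
    "HOL-Computational_Algebra.Fraction_Field"
    "HOL-Algebra.QuotRing"
    "HOL-Algebra.Algebraic_Closure_Type"
    "Jordan_Normal_Form.Char_Poly"
    "Jordan_Normal_Form.VS_Connect"
begin

hide_const (open) Multiset.mult

section \<open>The free algebra and finitely presented algebras\<close>

text \<open>
  Lists are made into the free monoid, written additively because the convolution product of
  \<^typ>\<open>'a \<Rightarrow>\<^sub>0 'b\<close> is based on an additive exponent monoid. With this instance the type
  \<^typ>\<open>nat list \<Rightarrow>\<^sub>0 'k\<close> is the free associative unital algebra over \<open>'k\<close> in the noncommuting
  indeterminates \<open>X\<^sub>0, X\<^sub>1, \<dots>\<close>; a word \<open>[l\<^sub>1, \<dots>, l\<^sub>r]\<close> stands for \<open>X\<^bsub>l\<^sub>1\<^esub> \<cdots> X\<^bsub>l\<^sub>r\<^esub>\<close>.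
\<close>

instantiation list :: (type) monoid_add
begin

definition zero_list :: "'a list" where "zero_list = []"

definition plus_list :: "'a list \<Rightarrow> 'a list \<Rightarrow> 'a list" where "plus_list = (@)"

instance by standard (simp_all add: zero_list_def plus_list_def)

end

text \<open>The indeterminates are numbered \<open>0, \<dots>, s - 1\<close>.\<close>

definition free_algebra :: "nat \<Rightarrow> (nat list \<Rightarrow>\<^sub>0 'k::field) ring" where
  "free_algebra s =
     \<lparr>carrier = {p. Poly_Mapping.keys p \<subseteq> lists {..<s}}, mult = (*), one = 1, zero = 0, add = (+)\<rparr>"

definition rel_ideal :: "nat \<Rightarrow> nat \<Rightarrow> (nat \<Rightarrow> nat list \<Rightarrow>\<^sub>0 'k::field) \<Rightarrow> (nat list \<Rightarrow>\<^sub>0 'k) set" where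
  "rel_ideal s t f = genideal (free_algebra s) (f ` {..<t})"

definition fp_algebra :: "nat \<Rightarrow> nat \<Rightarrow> (nat \<Rightarrow> nat list \<Rightarrow>\<^sub>0 'k::field) \<Rightarrow> (nat list \<Rightarrow>\<^sub>0 'k) set ring" where
  "fp_algebra s t f = free_algebra s Quot rel_ideal s t f"

text \<open>The structure map \<open>k \<rightarrow> R\<close> of the \<open>k\<close>-algebra \<open>R\<close>.\<close>

definition fp_scalar :: "nat \<Rightarrow> nat \<Rightarrow> (nat \<Rightarrow> nat list \<Rightarrow>\<^sub>0 'k::field) \<Rightarrow> 'k \<Rightarrow> (nat list \<Rightarrow>\<^sub>0 'k) set" where
  "fp_scalar s t f c = rel_ideal s t f +>\<^bsub>free_algebra s\<^esub> Poly_Mapping.single [] c"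


section \<open>Representations over the algebraic closure\<close>

text \<open>
  In this section \<open>R\<close> is any ring made into a \<open>k\<close>-algebra by the structure map \<open>\<sigma> :: k \<Rightarrow> R\<close>.
  A representation is a unital ring homomorphism that is compatible with the structure maps of \<open>R\<close>
  and of the matrix algebra (equivalently, is \<open>k\<close>-linear).
\<close>

definition representation ::
  "'r ring \<Rightarrow> ('k::field \<Rightarrow> 'r) \<Rightarrow> nat \<Rightarrow> ('r \<Rightarrow> 'k alg_closure mat) \<Rightarrow> bool" where
  "representation R \<sigma> m \<rho> \<longleftrightarrow>
     \<rho> \<in> Ring.ring_hom R (ring_mat TYPE('k alg_closure) m ()) \<and>
     (\<forall>c. \<rho> (\<sigma> c) = to_ac c \<cdot>\<^sub>m 1\<^sub>m m)"

definition rep_equivalent ::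
  "'r ring \<Rightarrow> nat \<Rightarrow> ('r \<Rightarrow> 'k::field alg_closure mat) \<Rightarrow> ('r \<Rightarrow> 'k alg_closure mat) \<Rightarrow> bool" where
  "rep_equivalent R m \<rho> \<rho>' \<longleftrightarrow>
     (\<exists>Q\<in>carrier_mat m m. \<exists>Q'\<in>carrier_mat m m. Q * Q' = 1\<^sub>m m \<and> Q' * Q = 1\<^sub>m m \<and>
        (\<forall>a\<in>carrier R. \<rho>' a = Q * \<rho> a * Q'))"

definition irreducible_rep ::
  "'r ring \<Rightarrow> ('k::field \<Rightarrow> 'r) \<Rightarrow> nat \<Rightarrow> ('r \<Rightarrow> 'k alg_closure mat) \<Rightarrow> bool" where
  "irreducible_rep R \<sigma> m \<rho> \<longleftrightarrow>
     representation R \<sigma> m \<rho> \<and>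
     LinearCombinations.module.span class_ring (module_mat TYPE('k alg_closure) m m) (\<rho> ` carrier R)
       = carrier_mat m m"

text \<open>The list \<open>bs\<close> contains the pairs \<open>(m\<^sub>i, \<rho>\<^sub>i)\<close>.\<close>

definition semisimple_rep ::
  "'r ring \<Rightarrow> ('k::field \<Rightarrow> 'r) \<Rightarrow> nat \<Rightarrow> ('r \<Rightarrow> 'k alg_closure mat) \<Rightarrow> bool" where
  "semisimple_rep R \<sigma> n \<rho> \<longleftrightarrow>
     representation R \<sigma> n \<rho> \<and>
     (\<exists>bs. (\<forall>(m, \<tau>)\<in>set bs. 0 < m \<and> irreducible_rep R \<sigma> m \<tau>) \<and>
           sum_list (map fst bs) = n \<and>
           rep_equivalent R n \<rho> (\<lambda>a. diag_block_mat (map (\<lambda>(m, \<tau>). \<tau> a) bs)))"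

text \<open>
  Representations are total functions whose values outside \<open>carrier R\<close> are irrelevant. Since
  \<^const>\<open>rep_equivalent\<close> only looks at \<open>carrier R\<close>, functions that agree there (that is, that are the
  same representation) lie in the same class, so the quotient below is not affected.
\<close>

definition semisimple_classes ::
  "'r ring \<Rightarrow> ('k::field \<Rightarrow> 'r) \<Rightarrow> nat \<Rightarrow> ('r \<Rightarrow> 'k alg_closure mat) set set" where
  "semisimple_classes R \<sigma> n =
     {\<rho>. semisimple_rep R \<sigma> n \<rho>} //
     {(\<rho>, \<rho>'). semisimple_rep R \<sigma> n \<rho> \<and> semisimple_rep R \<sigma> n \<rho>' \<and> rep_equivalent R n \<rho> \<rho>'}"


section \<open>Generic matrices\<close>

text \<open>
  Polynomials over \<open>k(v)\<close> in commuting indeterminates \<open>x\<^sub>i\<^sub>j(l)\<close>, where the triple \<open>(i, j, l)\<close>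
  is the index of \<open>x\<^sub>i\<^sub>j(l)\<close>. All indices start at \<open>0\<close>. The ring \<open>C\<close> is the subring \<open>generic_ring n s\<close>.
\<close>

type_synonym 'k generic_poly = "(nat \<times> nat \<times> nat \<Rightarrow>\<^sub>0 nat) \<Rightarrow>\<^sub>0 'k poly fract"

definition generic_ring :: "nat \<Rightarrow> nat \<Rightarrow> 'k::field generic_poly ring" where
  "generic_ring n s =
     \<lparr>carrier = {p. \<forall>m\<in>Poly_Mapping.keys p. Poly_Mapping.keys m \<subseteq> {..<n} \<times> {..<n} \<times> {..<s}},
      mult = (*), one = 1, zero = 0, add = (+)\<rparr>"

definition const_C :: "'k::field \<Rightarrow> 'k generic_poly" where
  "const_C c = Poly_Mapping.single 0 (Fract [:c:] 1)"

definition v_C :: "'k::field generic_poly" where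
  "v_C = Poly_Mapping.single 0 (Fract [:0, 1:] 1)"

definition x_C :: "nat \<Rightarrow> nat \<Rightarrow> nat \<Rightarrow> 'k::field generic_poly" where
  "x_C i j l = Poly_Mapping.single (Poly_Mapping.single (i, j, l) 1) 1"

definition generic_mat :: "nat \<Rightarrow> nat \<Rightarrow> 'k::field generic_poly mat" where
  "generic_mat n l = mat n n (\<lambda>(i, j). x_C i j l)"

definition word_prod :: "nat \<Rightarrow> nat list \<Rightarrow> 'k::field generic_poly mat" where
  "word_prod n w = foldr (\<lambda>l A. generic_mat n l * A) w (1\<^sub>m n)"

text \<open>
  The value \<open>g(x\<^sub>0, \<dots>, x\<^bsub>s - 1\<^esub>)\<close>, that is \<open>\<Sum>\<^sub>w g\<^sub>w \<cdot> x\<^sub>w\<close> over the words \<open>w\<close> occurring in \<open>g\<close>; the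
  sum is written entrywise because \<^typ>\<open>'a mat\<close> is not an instance of an additive class.
\<close>

definition generic_eval :: "nat \<Rightarrow> (nat list \<Rightarrow>\<^sub>0 'k::field) \<Rightarrow> 'k generic_poly mat" where
  "generic_eval n g =
     mat n n (\<lambda>ij. \<Sum>w\<in>Poly_Mapping.keys g. const_C (Poly_Mapping.lookup g w) * word_prod n w $$ ij)"

definition RelEntries :: "nat \<Rightarrow> nat \<Rightarrow> (nat \<Rightarrow> nat list \<Rightarrow>\<^sub>0 'k::field) \<Rightarrow> 'k generic_poly set" where
  "RelEntries n t f = {generic_eval n (f r) $$ (i, j) | r i j. r < t \<and> i < n \<and> j < n}"

definition CharCoefs :: "nat \<Rightarrow> nat \<Rightarrow> 'k::field generic_poly set" where
  "CharCoefs n s =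
     {coeff (char_poly (word_prod n w)) i | w i. w \<in> lists {..<s} \<and> length w \<in> {1..n} \<and> i < n}"

definition J_ideal ::
  "nat \<Rightarrow> nat \<Rightarrow> nat \<Rightarrow> (nat \<Rightarrow> nat list \<Rightarrow>\<^sub>0 'k::field) \<Rightarrow> 'k generic_poly \<Rightarrow> 'k generic_poly set" where
  "J_ideal n s t f c = genideal (generic_ring n s) (insert (c - v_C) (RelEntries n t f))"


section \<open>The definitions are well-formed\<close>

lemma ring_free_algebra: "ring (free_algebra s :: (nat list \<Rightarrow>\<^sub>0 'k::field) ring)"
proof (intro ringI abelian_groupI monoidI)
  let ?A = "{p :: nat list \<Rightarrow>\<^sub>0 'k. Poly_Mapping.keys p \<subseteq> lists {..<s}}"
  have mult: "p * q \<in> ?A" if "p \<in> ?A" "q \<in> ?A" for p q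
    using that keys_mult[of p q] by (fastforce simp: plus_list_def)
  have add: "p + q \<in> ?A" if "p \<in> ?A" "q \<in> ?A" for p q
    using that keys_add[of p q] by fastforce
  fix x y :: "nat list \<Rightarrow>\<^sub>0 'k" assume x: "x \<in> carrier (free_algebra s)"
  then show "\<exists>y\<in>carrier (free_algebra s). y \<oplus>\<^bsub>free_algebra s\<^esub> x = \<zero>\<^bsub>free_algebra s\<^esub>"
    by (intro bexI[of _ "- x"]) (simp_all add: free_algebra_def)
  { assume "y \<in> carrier (free_algebra s)"
    with x show "x \<oplus>\<^bsub>free_algebra s\<^esub> y \<in> carrier (free_algebra s)"
      and "x \<otimes>\<^bsub>free_algebra s\<^esub> y \<in> carrier (free_algebra s)"
      using mult[of x y] add[of x y] by (simp_all add: free_algebra_def) }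
qed (auto simp: free_algebra_def algebra_simps zero_list_def)

lemma cring_generic_ring: "cring (generic_ring n s :: 'k::field generic_poly ring)"
proof (intro cringI abelian_groupI comm_monoidI)
  let ?I = "{..<n} \<times> {..<n} \<times> {..<s}"
  let ?A = "{p :: 'k generic_poly. \<forall>m\<in>Poly_Mapping.keys p. Poly_Mapping.keys m \<subseteq> ?I}"
  have mult: "p * q \<in> ?A" if "p \<in> ?A" "q \<in> ?A" for p q
  proof (intro CollectI ballI)
    fix m assume "m \<in> Poly_Mapping.keys (p * q)"
    then obtain a b where "m = a + b" "a \<in> Poly_Mapping.keys p" "b \<in> Poly_Mapping.keys q"
      using keys_mult[of p q] by blast
    with that show "Poly_Mapping.keys m \<subseteq> ?I"
      using keys_add[of a b] by blast
  qed
  have add: "p + q \<in> ?A" if "p \<in> ?A" "q \<in> ?A" for p q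
    using that keys_add[of p q] by blast
  fix x y :: "'k generic_poly" assume x: "x \<in> carrier (generic_ring n s)"
  then show "\<exists>y\<in>carrier (generic_ring n s). y \<oplus>\<^bsub>generic_ring n s\<^esub> x = \<zero>\<^bsub>generic_ring n s\<^esub>"
    by (intro bexI[of _ "- x"]) (simp_all add: generic_ring_def)
  { assume "y \<in> carrier (generic_ring n s)"
    with x show "x \<oplus>\<^bsub>generic_ring n s\<^esub> y \<in> carrier (generic_ring n s)"
      and "x \<otimes>\<^bsub>generic_ring n s\<^esub> y \<in> carrier (generic_ring n s)"
      using mult[of x y] add[of x y] by (simp_all add: generic_ring_def) }
qed (auto simp: generic_ring_def algebra_simps)

lemma generic_ring_closed:
  fixes p q :: "'k::field generic_poly"
  assumes "p \<in> carrier (generic_ring n s)" "q \<in> carrier (generic_ring n s)"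
  shows "p + q \<in> carrier (generic_ring n s)" "p * q \<in> carrier (generic_ring n s)" "- p \<in> carrier (generic_ring n s)"
proof -
  interpret cring "generic_ring n s :: 'k generic_poly ring" by (rule cring_generic_ring)
  show "p + q \<in> carrier (generic_ring n s)" "p * q \<in> carrier (generic_ring n s)" "- p \<in> carrier (generic_ring n s)"
    using a_closed[OF assms] m_closed[OF assms] assms(1) by (auto simp: generic_ring_def)
qed

lemma generic_ring_0_1: "0 \<in> carrier (generic_ring n s)" "1 \<in> carrier (generic_ring n s)"
  by (auto simp: generic_ring_def)

lemma generic_ring_sum: "(\<And>x. x \<in> A \<Longrightarrow> g x \<in> carrier (generic_ring n s)) \<Longrightarrow> sum g A \<in> carrier (generic_ring n s)"
  by (induction A rule: infinite_finite_induct) (auto intro: generic_ring_closed generic_ring_0_1)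

lemma word_prod_carrier[simp]: "word_prod n w \<in> carrier_mat n n"
  by (induction w) (auto simp: word_prod_def generic_mat_def)

lemma word_prod_dim[simp]: "dim_row (word_prod n w) = n" "dim_col (word_prod n w) = n"
  using word_prod_carrier[of n w] by blast+

lemma word_prod_entries: "w \<in> lists {..<s} \<Longrightarrow> i < n \<Longrightarrow> j < n \<Longrightarrow> (word_prod n w :: 'k::field generic_poly mat) $$ (i,j) \<in> carrier (generic_ring n s)"
proof (induction w arbitrary: i j)
  case Nil then show ?case by (auto simp: word_prod_def generic_ring_0_1)
next
  case (Cons l w)
  have W: "word_prod n w \<in> carrier_mat n n" by simp
  have x: "(x_C a b l :: 'k generic_poly) \<in> carrier (generic_ring n s)" if "a < n" "b < n" for a b
    using that Cons.prems by (auto simp: x_C_def generic_ring_def)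
  have "(word_prod n (l # w) :: 'k generic_poly mat) $$ (i,j) = (generic_mat n l * word_prod n w) $$ (i,j)" by (simp add: word_prod_def)
  also have "\<dots> = (\<Sum>k = 0..<n. x_C i k l * word_prod n w $$ (k,j))"
    using Cons.prems by (simp add: times_mat_def scalar_prod_def generic_mat_def)
  also have "\<dots> \<in> carrier (generic_ring n s)"
  proof (intro generic_ring_sum generic_ring_closed)
    fix k assume k: "k \<in> {0..<n}"
    then show "(x_C i k l :: 'k generic_poly) \<in> carrier (generic_ring n s)" using x Cons.prems by simp
    from k show "(word_prod n w :: 'k generic_poly mat) $$ (k, j) \<in> carrier (generic_ring n s)"
      using Cons.prems by (intro Cons.IH) auto
  qed
  finally show ?case .
qed

lemma const_C_v_C_closed: "const_C c \<in> carrier (generic_ring n s)" "v_C \<in> carrier (generic_ring n s)"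
  by (auto simp: const_C_def v_C_def generic_ring_def)

lemma RelEntries_subset:
  assumes "\<And>r. r < t \<Longrightarrow> f r \<in> carrier (free_algebra s)"
  shows "RelEntries n t f \<subseteq> carrier (generic_ring n s)"
proof -
  have "generic_eval n g $$ (i,j) \<in> carrier (generic_ring n s)" if "g \<in> carrier (free_algebra s)" "i < n" "j < n"
    for g :: "nat list \<Rightarrow>\<^sub>0 'a" and i j
    using that by (auto simp: generic_eval_def free_algebra_def intro!: generic_ring_sum generic_ring_closed const_C_v_C_closed word_prod_entries)
  with assms show ?thesis by (auto simp: RelEntries_def)
qed

definition poly_over where "poly_over n s = {p. \<forall>i. coeff p i \<in> carrier (generic_ring n s)}"

lemma poly_over: "0 \<in> poly_over n s" "1 \<in> poly_over n s" "p \<in> poly_over n s \<Longrightarrow> q \<in> poly_over n s \<Longrightarrow> p + q \<in> poly_over n s"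
 "p \<in> poly_over n s \<Longrightarrow> q \<in> poly_over n s \<Longrightarrow> p * q \<in> poly_over n s" "p \<in> poly_over n s \<Longrightarrow> - p \<in> poly_over n s"
  by (auto simp: poly_over_def generic_ring_0_1 generic_ring_closed coeff_mult one_pCons coeff_pCons split: nat.split intro!: generic_ring_sum generic_ring_closed generic_ring_0_1)

lemma poly_over_sum: "(\<And>x. x \<in> A \<Longrightarrow> g x \<in> poly_over n s) \<Longrightarrow> sum g A \<in> poly_over n s"
  by (induction A rule: infinite_finite_induct) (auto intro: poly_over)

lemma poly_over_prod: "(\<And>x. x \<in> A \<Longrightarrow> g x \<in> poly_over n s) \<Longrightarrow> prod g A \<in> poly_over n s"
  by (induction A rule: infinite_finite_induct) (auto intro: poly_over)

lemma CharCoefs_subset: "CharCoefs n s \<subseteq> carrier (generic_ring n s)"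
proof -
  have "char_poly (word_prod n w) \<in> poly_over n s" if w: "w \<in> lists {..<s}" for w
  proof -
    have W: "word_prod n w \<in> carrier_mat n n" by simp
    have e: "char_poly_matrix (word_prod n w) $$ (i,j) \<in> poly_over n s" if "i < n" "j < n" for i j
      using that word_prod_entries[OF w that] unfolding char_poly_matrix_def
      by (auto simp: poly_over_def coeff_pCons generic_ring_0_1 generic_ring_closed split: nat.split intro!: generic_ring_closed)
    have D: "dim_row (char_poly_matrix (word_prod n w)) = n" "dim_col (char_poly_matrix (word_prod n w)) = n"
      using char_poly_matrix_closed[OF W] by blast+
    show ?thesis unfolding char_poly_def det_def D
      by (auto intro!: poly_over_sum poly_over poly_over_prod e simp: sign_def dest: permutes_in_image)
  qed
  thus ?thesis by (auto simp: CharCoefs_def poly_over_def)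
qed

lemma finite_CharCoefs: "finite (CharCoefs n s)"
proof -
  have "CharCoefs n s \<subseteq> (\<lambda>(w, i). coeff (char_poly (word_prod n w)) i) ` ({w. set w \<subseteq> {..<s} \<and> length w \<le> n} \<times> {..<n})"
    unfolding CharCoefs_def by (force simp: lists_eq_set)
  moreover have "finite \<dots>" by (intro finite_imageI finite_cartesian_product finite_lists_length_le) auto
  ultimately show ?thesis using finite_subset by blast
qed

text \<open>
  The following facts, together with \<open>generic_eval_carrier\<close>, say that \<^const>\<open>generic_eval\<close> is the
  unital \<open>k\<close>-algebra homomorphism that sends each indeterminate to the corresponding generic matrix.
\<close>

lemma const_C_simps: "const_C 0 = 0" "const_C 1 = 1" "const_C (a+b) = const_C a + const_C b" "const_C (a*b) = const_C a * const_C b"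
proof -
  show "const_C 0 = 0" by (simp add: const_C_def fract_collapse)
  show "const_C 1 = 1" by (simp add: const_C_def fract_collapse flip: one_pCons)
  show "const_C (a+b) = const_C a + const_C b" by (simp add: const_C_def flip: single_add)
  show "const_C (a*b) = const_C a * const_C b" by (simp add: const_C_def mult_single mult.commute)
qed

lemma generic_eval_single: "generic_eval n (Poly_Mapping.single w c) = const_C c \<cdot>\<^sub>m word_prod n w"
proof -
  have "dim_row (word_prod n w) = n" "dim_col (word_prod n w) = n"
    using word_prod_carrier[of n w] by blast+
  then show ?thesis by (intro eq_matI) (auto simp: generic_eval_def const_C_simps)
qed

lemma generic_eval_carrier[simp]: "generic_eval n g \<in> carrier_mat n n" by (simp add: generic_eval_def)

lemma generic_eval_add: "generic_eval n (g + h) = generic_eval n g + generic_eval n h"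
  unfolding generic_eval_def
  by (subst setsum_keys_plus_distrib) (auto simp: const_C_simps algebra_simps intro!: eq_matI)

lemma word_prod_append: "(word_prod n (u @ w) :: 'k::field generic_poly mat) = word_prod n u * word_prod n w"
proof (induction u)
  case Nil then show ?case using left_mult_one_mat[OF word_prod_carrier[of n w]] by (metis append_Nil foldr.simps(1) id_apply word_prod_def)
next
  case (Cons l u)
  have g: "(generic_mat n l :: 'k generic_poly mat) \<in> carrier_mat n n" by (simp add: generic_mat_def)
  have "(word_prod n ((l # u) @ w) :: 'k generic_poly mat) = generic_mat n l * word_prod n (u @ w)" by (simp add: word_prod_def)
  also have "\<dots> = (generic_mat n l * word_prod n u) * word_prod n w" unfolding Cons
    by (rule assoc_mult_mat[OF g word_prod_carrier word_prod_carrier, symmetric])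
  finally show ?case by (simp add: word_prod_def)
qed

lemma poly_mapping_single_sum_induct [case_names single sum]:
  assumes S: "\<And>a b. P (Poly_Mapping.single a b)" and A: "\<And>p q. P p \<Longrightarrow> P q \<Longrightarrow> P (p + q)"
  shows "P (p :: 'a \<Rightarrow>\<^sub>0 'b::comm_monoid_add)"
proof (induction p rule: update_induct)
  case const
  show ?case using S[of undefined 0] by simp
next
  case (update f a b)
  then have "Poly_Mapping.update a b f = Poly_Mapping.single a b + f"
    by (intro poly_mapping_eqI) (auto simp: lookup_update lookup_add lookup_single in_keys_iff)
  with S A update show ?case by auto
qed

lemma generic_eval_mult: "generic_eval n (g * h) = generic_eval n g * generic_eval n h"
proof (induction g rule: poly_mapping_single_sum_induct)
  case (single u a)
  show ?case
  proof (induction h rule: poly_mapping_single_sum_induct)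
    case (single w b)
    have "generic_eval n (Poly_Mapping.single u a * Poly_Mapping.single w b) = (const_C a * const_C b) \<cdot>\<^sub>m (word_prod n u * word_prod n w)"
      by (simp add: mult_single generic_eval_single plus_list_def word_prod_append const_C_simps)
    also have "\<dots> = (const_C a \<cdot>\<^sub>m word_prod n u) * (const_C b \<cdot>\<^sub>m word_prod n w)"
      using mult_smult_assoc_mat[OF word_prod_carrier[of n u] smult_carrier_mat[OF word_prod_carrier[of n w]]]
        mult_smult_distrib[OF word_prod_carrier[of n u] word_prod_carrier[of n w]]
      by (intro eq_matI) (auto simp: mult.assoc)
    finally show ?case by (simp add: generic_eval_single)
  next
    case (sum h1 h2)
    then show ?case by (simp add: distrib_left generic_eval_add mult_add_distrib_mat[OF generic_eval_carrier generic_eval_carrier generic_eval_carrier])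
  qed
next
  case (sum g1 g2)
  then show ?case by (simp add: distrib_right generic_eval_add add_mult_distrib_mat[OF generic_eval_carrier generic_eval_carrier generic_eval_carrier])
qed

lemma generic_eval_var: "generic_eval n (Poly_Mapping.single [l] 1) = generic_mat n l"
  by (simp add: generic_eval_single const_C_simps word_prod_def) (intro eq_matI, auto simp: generic_mat_def)

lemma generic_eval_scalar: "generic_eval n (Poly_Mapping.single [] c) = const_C c \<cdot>\<^sub>m 1\<^sub>m n"
  by (simp add: generic_eval_single word_prod_def)

lemma equiv_rep_equivalent: "equiv {\<rho>. semisimple_rep R \<sigma> n \<rho>}
     {(\<rho>, \<rho>'). semisimple_rep R \<sigma> n \<rho> \<and> semisimple_rep R \<sigma> n \<rho>' \<and> rep_equivalent R n \<rho> \<rho>'}"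
proof (rule equivI)
  have c: "\<rho> a \<in> carrier_mat n n" if "semisimple_rep R \<sigma> n \<rho>" "a \<in> carrier R" for \<rho> a
    using that by (auto simp: semisimple_rep_def representation_def Ring.ring_hom_def ring_mat_simps)
  have r: "rep_equivalent R n \<rho> \<rho>" if "semisimple_rep R \<sigma> n \<rho>" for \<rho>
    unfolding rep_equivalent_def
    by (intro bexI[of _ "1\<^sub>m n"]) (use c[OF that] in \<open>auto simp: left_mult_one_mat right_mult_one_mat dest!: c[OF that]\<close>)
  have s: "rep_equivalent R n \<rho>' \<rho>" if ss: "semisimple_rep R \<sigma> n \<rho>" and eq: "rep_equivalent R n \<rho> \<rho>'" for \<rho> \<rho>'
  proof -
    obtain Q Q' where Q: "Q \<in> carrier_mat n n" "Q' \<in> carrier_mat n n" "Q * Q' = 1\<^sub>m n" "Q' * Q = 1\<^sub>m n"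
       "\<forall>a\<in>carrier R. \<rho>' a = Q * \<rho> a * Q'" using eq unfolding rep_equivalent_def by blast
    have "\<rho> a = Q' * \<rho>' a * Q" if a: "a \<in> carrier R" for a
    proof -
      note A = c[OF ss a]
      have "Q' * (Q * \<rho> a * Q') * Q = (Q' * Q) * \<rho> a * (Q' * Q)"
        using A Q(1,2) by (smt (verit, best) assoc_mult_mat mult_carrier_mat)
      thus ?thesis using A Q a by auto
    qed
    thus ?thesis unfolding rep_equivalent_def using Q by blast
  qed
  have t: "rep_equivalent R n \<rho> \<rho>''" if ss: "semisimple_rep R \<sigma> n \<rho>" and eq: "rep_equivalent R n \<rho> \<rho>'" "rep_equivalent R n \<rho>' \<rho>''" for \<rho> \<rho>' \<rho>''
  proof -
    obtain Q Q' where Q: "Q \<in> carrier_mat n n" "Q' \<in> carrier_mat n n" "Q * Q' = 1\<^sub>m n" "Q' * Q = 1\<^sub>m n"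
       "\<forall>a\<in>carrier R. \<rho>' a = Q * \<rho> a * Q'" using eq unfolding rep_equivalent_def by blast
    obtain P P' where P: "P \<in> carrier_mat n n" "P' \<in> carrier_mat n n" "P * P' = 1\<^sub>m n" "P' * P = 1\<^sub>m n"
       "\<forall>a\<in>carrier R. \<rho>'' a = P * \<rho>' a * P'" using eq unfolding rep_equivalent_def by blast
    have "\<rho>'' a = (P * Q) * \<rho> a * (Q' * P')" if a: "a \<in> carrier R" for a
    proof -
      note A = c[OF ss a]
      have "P * (Q * \<rho> a * Q') * P' = (P * Q) * \<rho> a * (Q' * P')"
        using A Q(1,2) P(1,2) by (smt (verit, best) assoc_mult_mat mult_carrier_mat)
      thus ?thesis using Q P a by auto
    qed
    moreover have "(P * Q) * (Q' * P') = 1\<^sub>m n" "(Q' * P') * (P * Q) = 1\<^sub>m n"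
      using Q(1-4) P(1-4) by (smt (verit, best) assoc_mult_mat mult_carrier_mat right_mult_one_mat)+
    ultimately show ?thesis unfolding rep_equivalent_def using Q P by (meson mult_carrier_mat)
  qed
  show "refl_on {\<rho>. semisimple_rep R \<sigma> n \<rho>} {(\<rho>, \<rho>'). semisimple_rep R \<sigma> n \<rho> \<and> semisimple_rep R \<sigma> n \<rho>' \<and> rep_equivalent R n \<rho> \<rho>'}"
    using r by (auto simp: refl_on_def)
  show "sym {(\<rho>, \<rho>'). semisimple_rep R \<sigma> n \<rho> \<and> semisimple_rep R \<sigma> n \<rho>' \<and> rep_equivalent R n \<rho> \<rho>'}"
    using s by (auto simp: sym_def)
  show "trans {(\<rho>, \<rho>'). semisimple_rep R \<sigma> n \<rho> \<and> semisimple_rep R \<sigma> n \<rho>' \<and> rep_equivalent R n \<rho> \<rho>'}"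
    using t by (auto simp: trans_def)
qed auto

end

theory Submission
  imports Defs
begin

text \<open>
  If \<open>1 \<notin> J\<^sub>c\<close>, then \<open>c\<close> takes the transcendental value \<open>v\<close> at a point of the representation
  variety over an algebraic closure of \<open>k(v)\<close>, and hence infinitely many values at points over \<open>k'\<close>.
  Every representation has the characteristic polynomials of a semisimple one, so there are
  infinitely many classes.

  Suppose conversely that \<open>1 \<in> J\<^sub>c\<close> for all \<open>c\<close>, so that every \<open>c\<close> is algebraic over \<open>k\<close> on the
  representation variety. If a characteristic coefficient of some longer word were not, it would take
  the value \<open>v\<close> at a point over an algebraic closure of \<open>k(v)\<close>. Over a valuation ring above the place
  \<open>v = \<infinity>\<close> all \<open>c\<close> are integral there. Since words of length at most \<open>n\<close> detect nilpotency
  (Ufnarovskii), the suitably scaled matrices are nilpotent modulo the maximal ideal, and conjugation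
  shrinks their entries until they are integral, a contradiction. So every characteristic coefficient
  of every word takes finitely many values. Since the traces of finitely many words determine an
  irreducible representation of given dimension, there are finitely many classes.
\<close>

section \<open>Extending homomorphisms and the Nullstellensatz\<close>

text \<open>The obstacle is that finitely many short words must control words of unbounded length.
  Growth in v does this, measured at a place where v is infinite and every element is bounded by a
  power of v (\<open>archimedean_at_infinity\<close>), so that the entries of the point start below
  some v^N. One conjugation lowers a bound D only to D^((M-1)/M), where M is a word length at which
  all entries lie in the ideal of the short coefficients. The contradiction comes before full
  integrality: a coefficient of degree e in the entries is bounded by D^e, and after enough rounds
  this is strictly below v. The length \<open>n\<close> originates in the linear dependence of
  \<open>n + 1\<close> row vectors in an \<open>n\<close>-dimensional space, applied to the prefixes
  of a single word. Rings, ideals and homomorphisms are predicates on subsets of a type: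
  \<open>C\<close> is a proper subset of the type of all polynomials, and the contraction of a prime
  to k[x] as well as the enlargement of subrings to a valuation ring compare subsets of one ambient
  ring.\<close>

definition subring_on :: "'r::comm_ring_1 set \<Rightarrow> bool" where
  "subring_on A \<longleftrightarrow> 0 \<in> A \<and> 1 \<in> A \<and> (\<forall>x\<in>A. \<forall>y\<in>A. x + y \<in> A \<and> x * y \<in> A) \<and> (\<forall>x\<in>A. - x \<in> A)"

lemma subring_onD:
  assumes "subring_on A"
  shows "0 \<in> A" "1 \<in> A" "x \<in> A \<Longrightarrow> y \<in> A \<Longrightarrow> x + y \<in> A" "x \<in> A \<Longrightarrow> y \<in> A \<Longrightarrow> x * y \<in> A"
    "x \<in> A \<Longrightarrow> - x \<in> A" "x \<in> A \<Longrightarrow> y \<in> A \<Longrightarrow> x - y \<in> A"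
  using assms unfolding subring_on_def by (auto, metis diff_conv_add_uminus)

lemma subring_on_power: "subring_on A \<Longrightarrow> x \<in> A \<Longrightarrow> x ^ n \<in> A"
  by (induction n) (auto intro: subring_onD)

lemma subring_on_sum: "subring_on A \<Longrightarrow> (\<And>i. i \<in> I \<Longrightarrow> g i \<in> A) \<Longrightarrow> sum g I \<in> A"
  by (induction I rule: infinite_finite_induct) (auto intro: subring_onD)

lemma subring_on_prod: "subring_on A \<Longrightarrow> (\<And>i. i \<in> I \<Longrightarrow> g i \<in> A) \<Longrightarrow> prod g I \<in> A"
  by (induction I rule: infinite_finite_induct) (auto intro: subring_onD)

lemma subring_on_UNIV: "subring_on UNIV"
  by (simp add: subring_on_def)

definition ideal_on :: "'r::comm_ring_1 set \<Rightarrow> 'r set \<Rightarrow> bool" where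
  "ideal_on U I \<longleftrightarrow> I \<subseteq> U \<and> 0 \<in> I \<and> (\<forall>x\<in>I. \<forall>y\<in>I. x + y \<in> I) \<and> (\<forall>u\<in>U. \<forall>x\<in>I. u * x \<in> I)"

definition prime_on :: "'r::comm_ring_1 set \<Rightarrow> 'r set \<Rightarrow> bool" where
  "prime_on U P \<longleftrightarrow> ideal_on U P \<and> 1 \<notin> P \<and> (\<forall>x\<in>U. \<forall>y\<in>U. x * y \<in> P \<longrightarrow> x \<in> P \<or> y \<in> P)"

lemma ideal_onD:
  assumes "ideal_on U I"
  shows "I \<subseteq> U" "0 \<in> I" "x \<in> I \<Longrightarrow> y \<in> I \<Longrightarrow> x + y \<in> I" "u \<in> U \<Longrightarrow> x \<in> I \<Longrightarrow> u * x \<in> I"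
    "u \<in> U \<Longrightarrow> x \<in> I \<Longrightarrow> x * u \<in> I"
  using assms unfolding ideal_on_def by (auto simp: mult.commute)

lemma ideal_on_uminus: "subring_on U \<Longrightarrow> ideal_on U I \<Longrightarrow> x \<in> I \<Longrightarrow> - x \<in> I"
  using ideal_onD(4)[of U I "-1" x] by (auto intro: subring_onD)

lemma ideal_on_diff: "subring_on U \<Longrightarrow> ideal_on U I \<Longrightarrow> x \<in> I \<Longrightarrow> y \<in> I \<Longrightarrow> x - y \<in> I"
  using ideal_on_uminus[of U I y] ideal_onD(3)[of U I x "-y"] by auto

lemma ideal_on_sum: "ideal_on U I \<Longrightarrow> (\<And>i. i \<in> S \<Longrightarrow> g i \<in> I) \<Longrightarrow> sum g S \<in> I"
  by (induction S rule: infinite_finite_induct) (auto intro: ideal_onD)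

lemma prime_onD:
  assumes "prime_on U P"
  shows "ideal_on U P" "1 \<notin> P" "x \<in> U \<Longrightarrow> y \<in> U \<Longrightarrow> x * y \<in> P \<Longrightarrow> x \<in> P \<or> y \<in> P"
  using assms unfolding prime_on_def by auto

lemma prime_on_power:
  assumes "subring_on U" "prime_on U P" "x \<in> U" "x \<notin> P"
  shows "x ^ n \<notin> P"
  using assms by (induction n) (auto dest: prime_onD intro: subring_on_power)

section \<open>Polynomials over a subring and adjunction of one element\<close>

definition polys_over :: "'r::comm_ring_1 set \<Rightarrow> 'r poly set" where
  "polys_over A = {q. \<forall>i. coeff q i \<in> A}"

lemma polys_overI: "(\<And>i. coeff q i \<in> A) \<Longrightarrow> q \<in> polys_over A"
  and polys_overD: "q \<in> polys_over A \<Longrightarrow> coeff q i \<in> A"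
  by (auto simp: polys_over_def)

lemma polys_over_closed:
  assumes A: "subring_on A"
  shows "0 \<in> polys_over A" "1 \<in> polys_over A" "p \<in> polys_over A \<Longrightarrow> q \<in> polys_over A \<Longrightarrow> p + q \<in> polys_over A"
    "p \<in> polys_over A \<Longrightarrow> q \<in> polys_over A \<Longrightarrow> p * q \<in> polys_over A"
    "p \<in> polys_over A \<Longrightarrow> - p \<in> polys_over A"
    "p \<in> polys_over A \<Longrightarrow> q \<in> polys_over A \<Longrightarrow> p - q \<in> polys_over A"
    "c \<in> A \<Longrightarrow> monom c n \<in> polys_over A" "c \<in> A \<Longrightarrow> [:c:] \<in> polys_over A"
    "c \<in> A \<Longrightarrow> p \<in> polys_over A \<Longrightarrow> smult c p \<in> polys_over A"
  using A unfolding polys_over_def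
  by (auto simp: coeff_mult one_pCons coeff_pCons split: nat.split
      intro!: subring_on_sum intro: subring_onD)

lemma subring_on_polys_over: "subring_on A \<Longrightarrow> subring_on (polys_over A)"
  using polys_over_closed[of A] by (auto simp: subring_on_def)

definition adjoin :: "'r::comm_ring_1 set \<Rightarrow> 'r \<Rightarrow> 'r set" where
  "adjoin A x = (\<lambda>q. poly q x) ` polys_over A"

lemma subring_on_adjoin:
  assumes A: "subring_on A"
  shows "subring_on (adjoin A x)"
proof -
  note c = polys_over_closed[OF A]
  show ?thesis unfolding subring_on_def adjoin_def
  proof (intro conjI ballI)
    show "0 \<in> (\<lambda>q. poly q x) ` polys_over A" by (rule image_eqI[of _ _ 0]) (auto intro: c)
    show "1 \<in> (\<lambda>q. poly q x) ` polys_over A" by (rule image_eqI[of _ _ 1]) (auto intro: c)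
    fix y assume "y \<in> (\<lambda>q. poly q x) ` polys_over A"
    then obtain p where p: "p \<in> polys_over A" "y = poly p x" by auto
    show "- y \<in> (\<lambda>q. poly q x) ` polys_over A" by (rule image_eqI[of _ _ "-p"]) (use p in \<open>auto intro: c\<close>)
    fix z assume "z \<in> (\<lambda>q. poly q x) ` polys_over A"
    then obtain q where q: "q \<in> polys_over A" "z = poly q x" by auto
    show "y + z \<in> (\<lambda>q. poly q x) ` polys_over A" by (rule image_eqI[of _ _ "p+q"]) (use p q in \<open>auto intro: c\<close>)
    show "y * z \<in> (\<lambda>q. poly q x) ` polys_over A" by (rule image_eqI[of _ _ "p*q"]) (use p q in \<open>auto intro: c\<close>)
  qed
qed

lemma adjoin_base: "subring_on A \<Longrightarrow> A \<subseteq> adjoin A x"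
proof
  fix a assume "subring_on A" "a \<in> A"
  then show "a \<in> adjoin A x" unfolding adjoin_def
    by (intro image_eqI[of _ _ "[:a:]"]) (auto intro: polys_over_closed)
qed

lemma adjoin_gen: "subring_on A \<Longrightarrow> x \<in> adjoin A x"
  unfolding adjoin_def
  by (intro image_eqI[of _ _ "monom 1 1"]) (auto simp: poly_monom intro: polys_over_closed subring_onD)

lemma poly_in_subring:
  assumes "subring_on U" "q \<in> polys_over U" "x \<in> U"
  shows "poly q x \<in> U"
  unfolding poly_altdef using assms
  by (intro subring_on_sum subring_onD(4) subring_on_power) (auto dest: polys_overD)

lemma adjoin_least: "subring_on U \<Longrightarrow> A \<subseteq> U \<Longrightarrow> x \<in> U \<Longrightarrow> adjoin A x \<subseteq> U"
  unfolding adjoin_def by (auto intro!: poly_in_subring simp: polys_over_def subset_iff)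

lemma poly_in_ideal:
  assumes "subring_on U" "ideal_on U I" "\<And>i. coeff q i \<in> I" "x \<in> U"
  shows "poly q x \<in> I"
  unfolding poly_altdef using assms
  by (intro ideal_on_sum[of U] ideal_onD(5)[of U I] subring_on_power) auto

section \<open>Homomorphisms defined on a subring\<close>

definition hom_on :: "'r::comm_ring_1 set \<Rightarrow> ('r \<Rightarrow> 'b::comm_ring_1) \<Rightarrow> bool" where
  "hom_on A \<phi> \<longleftrightarrow> \<phi> 1 = 1 \<and> (\<forall>x\<in>A. \<forall>y\<in>A. \<phi> (x + y) = \<phi> x + \<phi> y \<and> \<phi> (x * y) = \<phi> x * \<phi> y)"

lemma hom_onD:
  assumes "hom_on A \<phi>"
  shows "\<phi> 1 = 1" "x \<in> A \<Longrightarrow> y \<in> A \<Longrightarrow> \<phi> (x + y) = \<phi> x + \<phi> y" "x \<in> A \<Longrightarrow> y \<in> A \<Longrightarrow> \<phi> (x * y) = \<phi> x * \<phi> y"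
  using assms unfolding hom_on_def by auto

lemma hom_on_0: "subring_on A \<Longrightarrow> hom_on A \<phi> \<Longrightarrow> \<phi> 0 = 0"
  using hom_onD(2)[of A \<phi> 0 0] by (auto dest: subring_onD(1))

lemma hom_on_uminus: "subring_on A \<Longrightarrow> hom_on A \<phi> \<Longrightarrow> x \<in> A \<Longrightarrow> \<phi> (- x) = - \<phi> x"
  using hom_onD(2)[of A \<phi> x "-x"] hom_on_0[of A \<phi>] by (simp add: subring_onD eq_neg_iff_add_eq_0 add.commute)

lemma hom_on_sum: "subring_on A \<Longrightarrow> hom_on A \<phi> \<Longrightarrow> (\<And>i. i \<in> I \<Longrightarrow> g i \<in> A) \<Longrightarrow> \<phi> (sum g I) = (\<Sum>i\<in>I. \<phi> (g i))"
  by (induction I rule: infinite_finite_induct) (auto simp: hom_on_0 hom_onD subring_on_sum)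

lemma hom_on_power: "subring_on A \<Longrightarrow> hom_on A \<phi> \<Longrightarrow> x \<in> A \<Longrightarrow> \<phi> (x ^ n) = \<phi> x ^ n"
  by (induction n) (auto simp: hom_onD subring_on_power)

lemma hom_on_poly:
  assumes "subring_on U" "hom_on U \<phi>" "q \<in> polys_over U" "x \<in> U"
  shows "\<phi> (poly q x) = poly (map_poly \<phi> q) (\<phi> x)"
proof -
  have "\<phi> (poly q x) = (\<Sum>i\<le>degree q. \<phi> (coeff q i) * \<phi> x ^ i)" unfolding poly_altdef
    using assms by (subst hom_on_sum[OF assms(1,2)])
      (auto intro!: sum.cong subring_onD(4) simp: polys_overD subring_on_power hom_onD hom_on_power)
  also have "\<dots> = (\<Sum>i\<le>degree q. coeff (map_poly \<phi> q) i * \<phi> x ^ i)"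
    using hom_on_0[OF assms(1,2)] by (simp add: coeff_map_poly)
  also have "\<dots> = poly (map_poly \<phi> q) (\<phi> x)"
    unfolding poly_altdef
    by (rule sum.mono_neutral_right) (auto intro: le_degree order_trans[OF degree_map_poly_le])
  finally show ?thesis .
qed

lemma map_poly_const: "f 0 = 0 \<Longrightarrow> map_poly f [:a:] = [:f a:]"
  by (intro poly_eqI) (auto simp: coeff_map_poly coeff_pCons split: nat.split)

lemma map_poly_hom_on:
  assumes "subring_on A" "hom_on A \<phi>" "p \<in> polys_over A" "q \<in> polys_over A"
  shows "map_poly \<phi> (p + q) = map_poly \<phi> p + map_poly \<phi> q"
    "map_poly \<phi> (p * q) = map_poly \<phi> p * map_poly \<phi> q"
    "map_poly \<phi> (p - q) = map_poly \<phi> p - map_poly \<phi> q"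
proof -
  note z = hom_on_0[OF assms(1,2)] and c = polys_overD[OF assms(3)] polys_overD[OF assms(4)]
  show "map_poly \<phi> (p + q) = map_poly \<phi> p + map_poly \<phi> q"
    using z c by (intro poly_eqI) (auto simp: coeff_map_poly hom_onD[OF assms(2)])
  have "\<phi> (coeff p i - coeff q i) = \<phi> (coeff p i) - \<phi> (coeff q i)" for i
    using hom_onD(2)[OF assms(2) c(1)[of i], of "- coeff q i"] hom_on_uminus[OF assms(1,2) c(2)[of i]]
      subring_onD(5)[OF assms(1) c(2)] by simp
  then show "map_poly \<phi> (p - q) = map_poly \<phi> p - map_poly \<phi> q"
    using z by (intro poly_eqI) (auto simp: coeff_map_poly)
  show "map_poly \<phi> (p * q) = map_poly \<phi> p * map_poly \<phi> q"
    using z c by (intro poly_eqI) (simp add: coeff_map_poly coeff_mult hom_on_sum[OF assms(1,2)]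
        subring_onD(4)[OF assms(1)] hom_onD(3)[OF assms(2)])
qed

text \<open>The image of \<open>poly q x\<close> is prescribed as the value at \<xi> of the
  transported polynomial. Two polynomials with the same value at x differ by one whose value at x is
  0, an element of \<open>P\<close>, so the kernel condition makes the choice of q
  irrelevant.\<close>

lemma hom_on_extend:
  fixes \<phi> :: "'r::comm_ring_1 \<Rightarrow> 'b::comm_ring_1"
  assumes A: "subring_on A" and h: "hom_on A \<phi>" and "0 \<in> P"
    and k: "\<forall>q\<in>polys_over A. poly q x \<in> P \<longrightarrow> poly (map_poly \<phi> q) \<xi> = 0"
  shows "\<exists>\<psi>. hom_on (adjoin A x) \<psi> \<and> (\<forall>a\<in>A. \<psi> a = \<phi> a) \<and> (\<forall>y\<in>P \<inter> adjoin A x. \<psi> y = 0) \<and>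
    (\<forall>q\<in>polys_over A. \<psi> (poly q x) = poly (map_poly \<phi> q) \<xi>)"
proof -
  note c = polys_over_closed[OF A] and m = map_poly_hom_on[OF A h] and z = hom_on_0[OF A h]
  define \<psi> where "\<psi> y = poly (map_poly \<phi> (SOME q. q \<in> polys_over A \<and> y = poly q x)) \<xi>" for y
  have e: "\<psi> (poly q x) = poly (map_poly \<phi> q) \<xi>" if q: "q \<in> polys_over A" for q
  proof -
    define q' where "q' = (SOME q'. q' \<in> polys_over A \<and> poly q x = poly q' x)"
    have q': "q' \<in> polys_over A" "poly q x = poly q' x"
      unfolding q'_def using someI[of "\<lambda>q'. q' \<in> polys_over A \<and> poly q x = poly q' x" q] q by auto
    have "poly (map_poly \<phi> (q' - q)) \<xi> = 0"
      using q q' by (intro k[rule_format] c) (auto simp: \<open>0 \<in> P\<close>)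
    then have "poly (map_poly \<phi> q') \<xi> = poly (map_poly \<phi> q) \<xi>" using q q' by (simp add: m)
    then show ?thesis unfolding \<psi>_def q'_def .
  qed
  have a: "\<psi> a = \<phi> a" if "a \<in> A" for a
    using e[of "[:a:]"] that c(8) map_poly_const[of \<phi>, OF z] by auto
  show ?thesis
  proof (intro exI[of _ \<psi>] conjI ballI)
    show "hom_on (adjoin A x) \<psi>" unfolding hom_on_def
    proof (intro conjI ballI)
      show "\<psi> 1 = 1" using a[of 1] subring_onD(2)[OF A] hom_onD(1)[OF h] by simp
      fix y w assume "y \<in> adjoin A x" "w \<in> adjoin A x"
      then obtain p q where pq: "p \<in> polys_over A" "y = poly p x" "q \<in> polys_over A" "w = poly q x"
        by (auto simp: adjoin_def)
      show "\<psi> (y + w) = \<psi> y + \<psi> w" using e[of "p + q"] e[of p] e[of q] pq by (simp add: c m)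
      show "\<psi> (y * w) = \<psi> y * \<psi> w" using e[of "p * q"] e[of p] e[of q] pq by (simp add: c m)
    qed
    fix y assume "y \<in> P \<inter> adjoin A x"
    then show "\<psi> y = 0" using e k by (auto simp: adjoin_def)
  qed (use a e in auto)
qed

text \<open>A power of the leading coefficient of g takes the place of division by it. Induction
  runs over a bound \<open>n\<close> for the support of f, which also covers f = 0. The last
  conjunct bounds the degree of the quotient; \<open>extend_hom_step\<close> needs it to recognise a
  quotient as a relation of smaller degree.\<close>

lemma pseudo_division_over:
  assumes A: "subring_on A" and g: "g \<in> polys_over A" and f: "f \<in> polys_over A" and "\<And>i. n \<le> i \<Longrightarrow> coeff f i = 0"
  shows "\<exists>m q r. q \<in> polys_over A \<and> r \<in> polys_over A \<and> smult (lead_coeff g ^ m) f = q * g + r \<and>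
    (\<forall>i\<ge>degree g. coeff r i = 0) \<and> (\<forall>i. n \<le> i + degree g \<longrightarrow> coeff q i = 0)"
  using f assms(4)
proof (induction n arbitrary: f)
  case 0
  then have "f = 0" by (intro poly_eqI) auto
  then show ?case using polys_over_closed[OF A] by (intro exI[of _ 0]) auto
next
  case (Suc n)
  note c = polys_over_closed[OF A]
  show ?case
  proof (cases "n < degree g")
    case True
    then show ?thesis using Suc.prems c by (intro exI[of _ 0] exI[of _ f]) auto
  next
    case False
    define d where "d = n - degree g"
    define f' where "f' = smult (lead_coeff g) f - monom (coeff f n) d * g"
    have nd: "n = d + degree g" using False by (simp add: d_def)
    have f': "f' \<in> polys_over A" unfolding f'_def
      using Suc.prems(1) g by (intro c) (auto dest: polys_overD)
    have "coeff f' i = 0" if "n \<le> i" for i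
    proof (cases "i = n")
      case True
      then show ?thesis by (simp add: f'_def nd coeff_monom_mult)
    next
      case False
      then have "coeff f i = 0" using that Suc.prems(2)[of i] by auto
      moreover have "coeff g (i - d) = 0" using False that nd by (intro coeff_eq_0) auto
      ultimately show ?thesis by (simp add: f'_def coeff_monom_mult)
    qed
    from Suc.IH[OF f' this] obtain m q r where r: "q \<in> polys_over A" "r \<in> polys_over A"
      "smult (lead_coeff g ^ m) f' = q * g + r" "\<forall>i\<ge>degree g. coeff r i = 0" "\<forall>i. n \<le> i + degree g \<longrightarrow> coeff q i = 0"
      by blast
    define q' where "q' = q + monom (lead_coeff g ^ m * coeff f n) d"
    have "q' \<in> polys_over A" unfolding q'_def using r(1) Suc.prems(1) g
      by (intro c subring_onD(4)[OF A] subring_on_power[OF A]) (auto dest: polys_overD)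
    moreover have "smult (lead_coeff g ^ Suc m) f = q' * g + r"
    proof -
      have "smult (lead_coeff g ^ Suc m) f = smult (lead_coeff g ^ m) (f' + monom (coeff f n) d * g)"
        by (simp add: f'_def mult.commute)
      also have "\<dots> = q * g + r + smult (lead_coeff g ^ m) (monom (coeff f n) d) * g"
        using r(3) by (simp add: smult_add_right)
      finally show ?thesis by (simp add: q'_def smult_monom algebra_simps)
    qed
    moreover have "coeff q' i = 0" if "Suc n \<le> i + degree g" for i
      using that r(5) nd by (auto simp: q'_def)
    ultimately show ?thesis using r by blast
  qed
qed

lemma lead_coeff_not_in_prime:
  assumes A: "subring_on A" and U: "subring_on U" "A \<subseteq> U" "x \<in> U" and P: "ideal_on U P"
    and I: "ideal_on U I" "P \<subseteq> I"
    and q: "q \<in> polys_over A" "poly q x \<in> I" "coeff q k \<notin> P"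
  shows "\<exists>q'. q' \<in> polys_over A \<and> poly q' x \<in> I \<and> lead_coeff q' \<notin> P \<and> degree q' \<le> degree q"
  using q
proof (induction "degree q" arbitrary: q rule: less_induct)
  case less
  note c = polys_over_closed[OF A]
  show ?case
  proof (cases "lead_coeff q \<in> P")
    case True
    define q' where "q' = q - monom (lead_coeff q) (degree q)"
    have q': "q' \<in> polys_over A" unfolding q'_def using less.prems by (intro c) (auto dest: polys_overD)
    have k: "k \<noteq> degree q" using True less.prems by auto
    then have kc: "coeff q' k \<notin> P" using less.prems by (simp add: q'_def)
    then have "q' \<noteq> 0" using ideal_onD(2)[OF P] by auto
    have "coeff q' i = 0" if "degree q \<le> i" for i
      using that by (cases "i = degree q") (auto simp: q'_def coeff_eq_0)
    then have "degree q' < degree q" using \<open>q' \<noteq> 0\<close> by (metis leading_coeff_0_iff not_le)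
    moreover have "poly q' x \<in> I" unfolding q'_def using less.prems True I(2) U
      by (auto simp: poly_monom intro!: ideal_on_diff[OF U(1) I(1)] ideal_onD(5)[OF I(1)] subring_on_power)
    ultimately show ?thesis using less.hyps[of q'] q' kc by fastforce
  qed (use less.prems in auto)
qed

lemma alg_closed_infinite: "infinite (UNIV :: 'a::alg_closed_field set)"
proof
  assume f: "finite (UNIV :: 'a set)"
  define p :: "'a poly" where "p = (\<Prod>a\<in>UNIV. [:- a, 1:]) + 1"
  have "degree (\<Prod>a\<in>UNIV. [:- a, 1:] :: 'a poly) = card (UNIV :: 'a set)"
    by (subst degree_prod_eq_sum_degree) auto
  then have "degree p = card (UNIV :: 'a set)" unfolding p_def
    using f by (subst degree_add_eq_left) (auto simp: card_gt_0_iff)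
  then have "degree p > 0" using f by (simp add: card_gt_0_iff)
  then obtain x where "poly p x = 0" using alg_closed_imp_poly_has_root by blast
  moreover have "poly p x = 1" using f by (auto simp: p_def poly_prod)
  ultimately show False by simp
qed

text \<open>
  Modulo \<open>P\<close> this is the classical extension of homomorphisms along \<open>A \<subseteq> A[x]\<close>. If \<open>x\<close> is
  algebraic, then the condition on \<open>\<phi> a\<close> keeps the leading coefficient of a minimal equation of
  \<open>x\<close> and an \<open>A\<close>-multiple of \<open>b\<close> from vanishing.
\<close>

lemma extend_hom_step:
  assumes A: "subring_on A" and U: "subring_on U" "A \<subseteq> U" "x \<in> U" and P: "prime_on U P"
    and b: "b \<in> adjoin A x" "b \<notin> P"
  shows "\<exists>a\<in>A. a \<notin> P \<and> (\<forall>\<phi> :: 'r::comm_ring_1 \<Rightarrow> 'b::alg_closed_field.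
    hom_on A \<phi> \<longrightarrow> (\<forall>p\<in>P \<inter> A. \<phi> p = 0) \<longrightarrow> \<phi> a \<noteq> 0 \<longrightarrow>
    (\<exists>\<psi>. hom_on (adjoin A x) \<psi> \<and> (\<forall>y\<in>A. \<psi> y = \<phi> y) \<and> (\<forall>p\<in>P \<inter> adjoin A x. \<psi> p = 0) \<and> \<psi> b \<noteq> 0))"
proof -
  note c = polys_over_closed[OF A] and I = prime_onD(1)[OF P]
  have BU: "adjoin A x \<subseteq> U" by (rule adjoin_least[OF U])
  obtain qb where qb: "qb \<in> polys_over A" "b = poly qb x" using b by (auto simp: adjoin_def)
  have "\<exists>k. coeff qb k \<notin> P"
    using poly_in_ideal[OF U(1) I _ U(3), of qb] b qb by auto
  then obtain kb where kb: "coeff qb kb \<notin> P" by blast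
  have pU: "poly q x \<in> U" if "q \<in> polys_over A" for q using that BU by (auto simp: adjoin_def)
  show ?thesis
  \<comment> \<open>In the first case x is transcendental over \<open>A\<close> modulo
    \<open>P\<close>. Then every value of x respects the relations, and only the finitely many roots
    of the transported expression for b have to be avoided.\<close>
  proof (cases "\<forall>q\<in>polys_over A. poly q x \<in> P \<longrightarrow> (\<forall>i. coeff q i \<in> P)")
    case True
    show ?thesis
    proof (intro bexI[of _ "coeff qb kb"] conjI allI impI)
      fix \<phi> :: "'r \<Rightarrow> 'b" assume h: "hom_on A \<phi>" and kp: "\<forall>p\<in>P \<inter> A. \<phi> p = 0" and nz: "\<phi> (coeff qb kb) \<noteq> 0"
      have z: "\<phi> 0 = 0" by (rule hom_on_0[OF A h])
      have "map_poly \<phi> qb \<noteq> 0"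
        using nz z by (auto simp: poly_eq_iff coeff_map_poly)
      then have "finite {\<xi>. poly (map_poly \<phi> qb) \<xi> = 0}" by (rule poly_roots_finite)
      then obtain \<xi> where \<xi>: "poly (map_poly \<phi> qb) \<xi> \<noteq> 0"
        using alg_closed_infinite ex_new_if_finite by (metis (mono_tags, lifting) mem_Collect_eq)
      have "poly (map_poly \<phi> q) \<xi> = 0" if "q \<in> polys_over A" "poly q x \<in> P" for q
      proof -
        have "map_poly \<phi> q = 0"
          using True that kp z by (auto simp: poly_eq_iff coeff_map_poly polys_over_def)
        then show ?thesis by simp
      qed
      then have "\<forall>q\<in>polys_over A. poly q x \<in> P \<longrightarrow> poly (map_poly \<phi> q) \<xi> = 0" by blast
      from hom_on_extend[OF A h ideal_onD(2)[OF I] this]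
      obtain \<psi> where \<psi>: "hom_on (adjoin A x) \<psi>" "\<forall>a\<in>A. \<psi> a = \<phi> a" "\<forall>y\<in>P \<inter> adjoin A x. \<psi> y = 0"
        "\<forall>q\<in>polys_over A. \<psi> (poly q x) = poly (map_poly \<phi> q) \<xi>" by (elim exE conjE)
      then show "\<exists>\<psi>. hom_on (adjoin A x) \<psi> \<and> (\<forall>y\<in>A. \<psi> y = \<phi> y) \<and> (\<forall>p\<in>P \<inter> adjoin A x. \<psi> p = 0) \<and> \<psi> b \<noteq> 0"
        using \<xi> qb by (intro exI[of _ \<psi>]) auto
    qed (use kb qb in \<open>auto dest: polys_overD\<close>)
  next
    case False
    then obtain q0 k0 where "q0 \<in> polys_over A" "poly q0 x \<in> P" "coeff q0 k0 \<notin> P" by blast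
    from lead_coeff_not_in_prime[OF A U I I subset_refl this]
    obtain g0 where "g0 \<in> polys_over A \<and> poly g0 x \<in> P \<and> lead_coeff g0 \<notin> P" by blast
    from ex_has_least_nat[of "\<lambda>q. q \<in> polys_over A \<and> poly q x \<in> P \<and> lead_coeff q \<notin> P", OF this, of degree]
    obtain g where "(g \<in> polys_over A \<and> poly g x \<in> P \<and> lead_coeff g \<notin> P) \<and>
      (\<forall>q. q \<in> polys_over A \<and> poly q x \<in> P \<and> lead_coeff q \<notin> P \<longrightarrow> degree g \<le> degree q)" by (elim exE)
    then have g: "g \<in> polys_over A" "poly g x \<in> P" "lead_coeff g \<notin> P"
      and gmin: "\<And>q. q \<in> polys_over A \<Longrightarrow> poly q x \<in> P \<Longrightarrow> lead_coeff q \<notin> P \<Longrightarrow> degree g \<le> degree q" by blast+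
    have dpos: "degree g > 0" using g by (intro Nat.gr0I) (auto elim!: degree_eq_zeroE)
    \<comment> \<open>The minimal equation g of x modulo \<open>P\<close> makes every relation of
      smaller degree trivial modulo \<open>P\<close>.\<close>
    have Min: "coeff q i \<in> P" if q: "q \<in> polys_over A" "poly q x \<in> P" "\<And>i. degree g \<le> i \<Longrightarrow> coeff q i = 0" for q i
    proof (rule ccontr)
      assume "coeff q i \<notin> P"
      from lead_coeff_not_in_prime[OF A U I I subset_refl q(1,2) this]
      obtain q' where "q' \<in> polys_over A" "poly q' x \<in> P" "lead_coeff q' \<notin> P" "degree q' \<le> degree q" by blast
      then have "degree g \<le> degree q" using gmin by force
      then have "q = 0" using q(3)[of "degree q"] by auto
      then show False using \<open>coeff q i \<notin> P\<close> ideal_onD(2)[OF I] by auto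
    qed
    \<comment> \<open>The ideal of A[x] generated by b and \<open>P\<close>. The aim is an element
      \<open>h0 = u * b + p\<close> of it that lies in \<open>A\<close> but not in \<open>P\<close>:
      a homomorphism that kills p and not \<open>h0\<close> cannot kill b.\<close>
    define QB where "QB = {u * b + p | u p. u \<in> adjoin A x \<and> p \<in> P \<inter> adjoin A x}"
    have bU: "b \<in> U" using b BU by auto
    have B: "subring_on (adjoin A x)" by (rule subring_on_adjoin[OF A])
    have IB: "ideal_on (adjoin A x) (P \<inter> adjoin A x)" unfolding ideal_on_def
      using ideal_onD[OF I] subring_onD[OF B] BU by auto
    have QBI: "ideal_on (adjoin A x) QB" unfolding ideal_on_def
    proof (intro conjI ballI)
      show "QB \<subseteq> adjoin A x" unfolding QB_def using b by (auto intro!: subring_onD[OF B])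
      show "0 \<in> QB" unfolding QB_def using subring_onD(1)[OF B] ideal_onD(2)[OF IB]
        by (auto intro!: exI[of _ 0])
      fix y assume "y \<in> QB" then obtain u p where y: "y = u * b + p" "u \<in> adjoin A x" "p \<in> P \<inter> adjoin A x" unfolding QB_def by blast
      { fix z assume "z \<in> QB" then obtain u' p' where z: "z = u' * b + p'" "u' \<in> adjoin A x" "p' \<in> P \<inter> adjoin A x" unfolding QB_def by blast
        have "y + z = (u + u') * b + (p + p')" using y z by (simp add: algebra_simps)
        then show "y + z \<in> QB" unfolding QB_def using y z subring_onD(3)[OF B] ideal_onD(3)[OF IB] by blast }
      { fix z assume z: "z \<in> adjoin A x"
        have "z * y = (z * u) * b + z * p" using y by (simp add: algebra_simps)
        then show "z * y \<in> QB" unfolding QB_def using y z subring_onD(4)[OF B] ideal_onD(4)[OF IB] by blast }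
    qed
    have PQB: "P \<inter> adjoin A x \<subseteq> QB"
    proof
      fix p assume "p \<in> P \<inter> adjoin A x"
      then show "p \<in> QB" unfolding QB_def using subring_onD(1)[OF B]
        by (intro CollectI exI[of _ 0] exI[of _ p]) auto
    qed
    have AB: "A \<subseteq> adjoin A x" "x \<in> adjoin A x" using adjoin_base[OF A] adjoin_gen[OF A] by auto
    have inP: "a \<in> P \<inter> adjoin A x \<longleftrightarrow> a \<in> P" if "a \<in> A" for a using that AB by auto
    have bQB: "b \<in> QB" unfolding QB_def using subring_onD(2)[OF B] ideal_onD(2)[OF IB]
      by (intro CollectI exI[of _ 1] exI[of _ 0]) auto
    have lc: "\<exists>q'. q' \<in> polys_over A \<and> poly q' x \<in> QB \<and> lead_coeff q' \<notin> P \<and> degree q' \<le> degree q"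
      if "q \<in> polys_over A" "poly q x \<in> QB" "coeff q k \<notin> P" for q k
      using lead_coeff_not_in_prime[OF A B AB IB QBI PQB that(1,2), of k] that inP
      by (metis polys_overD)
    from lc[OF qb(1) _ kb] qb bQB
    obtain h0 where "h0 \<in> polys_over A \<and> poly h0 x \<in> QB \<and> lead_coeff h0 \<notin> P" by blast
    from ex_has_least_nat[of "\<lambda>q. q \<in> polys_over A \<and> poly q x \<in> QB \<and> lead_coeff q \<notin> P", OF this, of degree]
    obtain h where "(h \<in> polys_over A \<and> poly h x \<in> QB \<and> lead_coeff h \<notin> P) \<and>
      (\<forall>q. q \<in> polys_over A \<and> poly q x \<in> QB \<and> lead_coeff q \<notin> P \<longrightarrow> degree h \<le> degree q)" by (elim exE)
    then have h: "h \<in> polys_over A" "poly h x \<in> QB" "lead_coeff h \<notin> P"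
      and hmin: "\<And>q. q \<in> polys_over A \<Longrightarrow> poly q x \<in> QB \<Longrightarrow> lead_coeff q \<notin> P \<Longrightarrow> degree h \<le> degree q" by blast+
    have MinQ: "coeff q i \<in> P" if q: "q \<in> polys_over A" "poly q x \<in> QB" "\<And>i. degree h \<le> i \<Longrightarrow> coeff q i = 0" for q i
    proof (rule ccontr)
      assume "coeff q i \<notin> P"
      from lc[OF q(1,2) this]
      obtain q' where "q' \<in> polys_over A" "poly q' x \<in> QB" "lead_coeff q' \<notin> P" "degree q' \<le> degree q" by blast
      then have "degree h \<le> degree q" using hmin by force
      then have "q = 0" using q(3)[of "degree q"] by auto
      then show False using \<open>coeff q i \<notin> P\<close> ideal_onD(2)[OF I] by auto
    qed
    have pB: "poly q x \<in> adjoin A x" if "q \<in> polys_over A" for q using that by (auto simp: adjoin_def)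
    have lch: "lead_coeff h ^ m \<in> A" "lead_coeff h ^ m \<notin> P" for m
      using polys_overD[OF h(1)] U h(3) by (auto intro: subring_on_power[OF A] prime_on_power[OF U(1) P, THEN notE])
    have divh: "\<exists>m q r. q \<in> polys_over A \<and> r \<in> polys_over A \<and> smult (lead_coeff h ^ m) f = q * h + r \<and>
        (\<forall>i. coeff r i \<in> P) \<and> poly r x \<in> P \<and> (\<forall>i. Suc (degree f) \<le> i + degree h \<longrightarrow> coeff q i = 0)"
      if f: "f \<in> polys_over A" "poly f x \<in> QB" for f
    proof -
      from pseudo_division_over[OF A h(1) f(1), of "Suc (degree f)"]
      obtain m q r where r: "q \<in> polys_over A" "r \<in> polys_over A" "smult (lead_coeff h ^ m) f = q * h + r"
        "\<forall>i\<ge>degree h. coeff r i = 0" "\<forall>i. Suc (degree f) \<le> i + degree h \<longrightarrow> coeff q i = 0"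
        by (auto simp: coeff_eq_0)
      have "poly r x = lead_coeff h ^ m * poly f x - poly q x * poly h x"
        using arg_cong[OF r(3), of "\<lambda>p. poly p x"] by simp
      also have "\<dots> \<in> QB"
        using f h lch AB r by (intro ideal_on_diff[OF B QBI] ideal_onD(4)[OF QBI]) (auto intro: pB)
      finally have *: "coeff r i \<in> P" for i using MinQ[OF r(2)] r(4) by blast
      moreover have "poly r x \<in> P" by (rule poly_in_ideal[OF U(1) I * U(3)])
      ultimately show ?thesis using r by blast
    qed
    \<comment> \<open>Dividing the expression for b by h shows that h does not vanish at x modulo
      \<open>P\<close>. Dividing g by h then gives a quotient that does vanish there. If h had
      positive degree, the quotient would have smaller degree than g and hence all its coefficients
      in \<open>P\<close>, and so would a product of leading coefficients that lie outside
      \<open>P\<close>.\<close>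
    have "degree h = 0"
    proof (rule ccontr)
      assume e: "degree h \<noteq> 0"
      have hU: "poly h x \<in> U" by (rule pU[OF h(1)])
      from divh[OF qb(1)] qb(2) bQB obtain m q r where r: "q \<in> polys_over A" "r \<in> polys_over A"
        "smult (lead_coeff h ^ m) qb = q * h + r" "poly r x \<in> P" by blast
      have "lead_coeff h ^ m * b = poly q x * poly h x + poly r x"
        using arg_cong[OF r(3), of "\<lambda>p. poly p x"] qb by simp
      moreover have "lead_coeff h ^ m * b \<notin> P"
        using prime_onD(3)[OF P, of "lead_coeff h ^ m" b] lch b bU U by blast
      ultimately have hP: "poly h x \<notin> P"
        using r(4) pU[OF r(1)] by (metis ideal_onD(3,4)[OF I])
      have gQB: "poly g x \<in> QB" using g(2) PQB pB[OF g(1)] by blast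
      from divh[OF g(1) gQB] obtain m q r where r: "q \<in> polys_over A" "r \<in> polys_over A"
        "smult (lead_coeff h ^ m) g = q * h + r" "poly r x \<in> P" "\<forall>i. coeff r i \<in> P"
        "\<forall>i. Suc (degree g) \<le> i + degree h \<longrightarrow> coeff q i = 0" by (elim exE conjE)
      have "poly q x * poly h x = lead_coeff h ^ m * poly g x - poly r x"
        using arg_cong[OF r(3), of "\<lambda>p. poly p x"] by simp
      also have "\<dots> \<in> P" using g r lch U by (intro ideal_on_diff[OF U(1) I] ideal_onD(4)[OF I]) auto
      finally have "poly q x \<in> P" using prime_onD(3)[OF P pU[OF r(1)] hU] hP by auto
      then have qP: "coeff q i \<in> P" for i using Min[OF r(1)] r(6) e by auto
      have "lead_coeff h ^ m * lead_coeff g = coeff (q * h + r) (degree g)" by (simp flip: r(3))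
      also have "\<dots> \<in> P" using qP r(5) polys_overD[OF h(1)] U
        by (auto simp: coeff_mult intro!: ideal_onD(3)[OF I] ideal_on_sum[OF I] ideal_onD(5)[OF I])
      finally show False
        using prime_onD(3)[OF P, of "lead_coeff h ^ m" "lead_coeff g"] lch g polys_overD[OF g(1)] U by blast
    qed
    then obtain h0 where h0: "h = [:h0:]" by (elim degree_eq_zeroE)
    with h have h0': "h0 \<in> A" "h0 \<notin> P" "h0 \<in> QB" using polys_overD[OF h(1), of 0] by auto
    then obtain u p where up: "h0 = u * b + p" "u \<in> adjoin A x" "p \<in> P \<inter> adjoin A x" unfolding QB_def by blast
    define lg where "lg = lead_coeff g"
    have lg: "lg \<in> A" "lg \<notin> P" using g polys_overD by (auto simp: lg_def)
    show ?thesis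
    proof (intro bexI[of _ "lg * h0"] conjI allI impI)
      show "lg * h0 \<notin> P" using prime_onD(3)[OF P, of lg h0] lg h0' U by blast
      show "lg * h0 \<in> A" using lg h0' subring_onD(4)[OF A] by blast
      fix \<phi> :: "'r \<Rightarrow> 'b" assume hm: "hom_on A \<phi>" and kp: "\<forall>p\<in>P \<inter> A. \<phi> p = 0" and nz: "\<phi> (lg * h0) \<noteq> 0"
      have z: "\<phi> 0 = 0" by (rule hom_on_0[OF A hm])
      have nz: "\<phi> lg \<noteq> 0" "\<phi> h0 \<noteq> 0" using nz hom_onD(3)[OF hm lg(1) h0'(1)] by auto
      have "degree (map_poly \<phi> g) \<ge> degree g" using nz z by (intro le_degree) (simp add: coeff_map_poly lg_def)
      then obtain \<xi> where \<xi>: "poly (map_poly \<phi> g) \<xi> = 0"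
        using alg_closed_imp_poly_has_root[of "map_poly \<phi> g"] dpos by auto
      \<comment> \<open>Any root \<xi> of the transported minimal equation is admissible: up to a
        power of \<open>lg\<close>, every relation q is a multiple of g plus a remainder whose
        coefficients lie in \<open>P\<close> and are therefore killed by \<phi>.\<close>
      have "poly (map_poly \<phi> q) \<xi> = 0" if q: "q \<in> polys_over A" "poly q x \<in> P" for q
      proof -
        from pseudo_division_over[OF A g(1) q(1), of "Suc (degree q)"]
        obtain m q' r where r: "q' \<in> polys_over A" "r \<in> polys_over A" "smult (lg ^ m) q = q' * g + r"
          "\<forall>i\<ge>degree g. coeff r i = 0"
          by (auto simp: coeff_eq_0 lg_def)
        have lgm: "lg ^ m \<in> A" by (rule subring_on_power[OF A lg(1)])
        have "poly r x = lg ^ m * poly q x - poly q' x * poly g x"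
          using arg_cong[OF r(3), of "\<lambda>p. poly p x"] by simp
        also have "\<dots> \<in> P"
          using q g lgm U r pU by (intro ideal_on_diff[OF U(1) I] ideal_onD(4)[OF I]) auto
        finally have "map_poly \<phi> r = 0"
          using Min[OF r(2)] r(4) kp polys_overD[OF r(2)] z by (auto simp: poly_eq_iff coeff_map_poly)
        moreover have "smult (lg ^ m) q = [:lg ^ m:] * q" by simp
        ultimately have "map_poly \<phi> [:lg ^ m:] * map_poly \<phi> q = map_poly \<phi> q' * map_poly \<phi> g"
          using r(3) q g r lgm by (metis (no_types, lifting) add.right_neutral c(4,8) map_poly_hom_on(1,2)[OF A hm])
        then have "poly (map_poly \<phi> [:lg ^ m:]) \<xi> * poly (map_poly \<phi> q) \<xi> = 0"
          using \<xi> by (metis mult_zero_right poly_mult)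
        moreover have "poly (map_poly \<phi> [:lg ^ m:]) \<xi> = \<phi> lg ^ m"
          using map_poly_const[of \<phi>, OF z] hom_on_power[OF A hm lg(1)] by simp
        ultimately show ?thesis using nz by auto
      qed
      then have "\<forall>q\<in>polys_over A. poly q x \<in> P \<longrightarrow> poly (map_poly \<phi> q) \<xi> = 0" by blast
      from hom_on_extend[OF A hm ideal_onD(2)[OF I] this]
      obtain \<psi> where \<psi>: "hom_on (adjoin A x) \<psi>" "\<forall>a\<in>A. \<psi> a = \<phi> a" "\<forall>y\<in>P \<inter> adjoin A x. \<psi> y = 0"
        by (elim exE conjE)
      have "\<phi> h0 = \<psi> u * \<psi> b + \<psi> p"
        using \<psi>(2) h0'(1) up hom_onD(2,3)[OF \<psi>(1)] b subring_onD(4)[OF B] by auto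
      then have "\<psi> b \<noteq> 0" using nz \<psi>(3) up by auto
      then show "\<exists>\<psi>. hom_on (adjoin A x) \<psi> \<and> (\<forall>y\<in>A. \<psi> y = \<phi> y) \<and> (\<forall>p\<in>P \<inter> adjoin A x. \<psi> p = 0) \<and> \<psi> b \<noteq> 0"
        using \<psi> by (intro exI[of _ \<psi>]) auto
    qed
  qed
qed

section \<open>Extension along finitely many generators\<close>

primrec adjoin_list :: "'r::comm_ring_1 set \<Rightarrow> 'r list \<Rightarrow> 'r set" where
  "adjoin_list A [] = A"
| "adjoin_list A (x # xs) = adjoin_list (adjoin A x) xs"

lemma adjoin_list_subring: "subring_on A \<Longrightarrow> subring_on (adjoin_list A xs)"
  by (induction xs arbitrary: A) (auto intro: subring_on_adjoin)

lemma adjoin_list_base: "subring_on A \<Longrightarrow> A \<subseteq> adjoin_list A xs"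
  by (induction xs arbitrary: A) (use adjoin_base subring_on_adjoin in fastforce)+

lemma adjoin_list_gen: "subring_on A \<Longrightarrow> set xs \<subseteq> adjoin_list A xs"
proof (induction xs arbitrary: A)
  case (Cons x xs)
  then show ?case using adjoin_gen[of A x] adjoin_list_base[of "adjoin A x" xs] subring_on_adjoin[of A x] by auto
qed auto

lemma adjoin_list_least: "subring_on U \<Longrightarrow> A \<subseteq> U \<Longrightarrow> set xs \<subseteq> U \<Longrightarrow> adjoin_list A xs \<subseteq> U"
proof (induction xs arbitrary: A)
  case (Cons x xs)
  then show ?case using adjoin_least[of U A x] by auto
qed auto

text \<open>The condition obtained for the remaining generators is an element of A[x] outside
  \<open>P\<close>; it becomes the element that the one-generator step has to keep from vanishing.
  In this way the condition descends to a single element of \<open>A\<close>.\<close>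

theorem extend_hom:
  assumes "subring_on A" "subring_on U" "A \<subseteq> U" "set xs \<subseteq> U" "prime_on U P"
    and "b \<in> adjoin_list A xs" "b \<notin> P"
  shows "\<exists>a\<in>A. a \<notin> P \<and> (\<forall>\<phi> :: 'r::comm_ring_1 \<Rightarrow> 'b::alg_closed_field.
    hom_on A \<phi> \<longrightarrow> (\<forall>p\<in>P \<inter> A. \<phi> p = 0) \<longrightarrow> \<phi> a \<noteq> 0 \<longrightarrow>
    (\<exists>\<psi>. hom_on (adjoin_list A xs) \<psi> \<and> (\<forall>y\<in>A. \<psi> y = \<phi> y) \<and> (\<forall>p\<in>P \<inter> adjoin_list A xs. \<psi> p = 0) \<and> \<psi> b \<noteq> 0))"
  using assms
proof (induction xs arbitrary: A)
  case Nil
  then show ?case by auto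
next
  case (Cons x xs)
  have x: "x \<in> U" using Cons.prems by auto
  have B: "subring_on (adjoin A x)" "adjoin A x \<subseteq> U" "A \<subseteq> adjoin A x"
    using Cons.prems by (auto intro: subring_on_adjoin adjoin_least[THEN subsetD] adjoin_base[THEN subsetD])
  from Cons.IH[OF B(1) Cons.prems(2) B(2) _ Cons.prems(5)] Cons.prems
  obtain b' where b': "b' \<in> adjoin A x" "b' \<notin> P" "\<And>\<phi> :: 'r \<Rightarrow> 'b.
    hom_on (adjoin A x) \<phi> \<Longrightarrow> (\<forall>p\<in>P \<inter> adjoin A x. \<phi> p = 0) \<Longrightarrow> \<phi> b' \<noteq> 0 \<Longrightarrow>
    (\<exists>\<psi>. hom_on (adjoin_list A (x # xs)) \<psi> \<and> (\<forall>y\<in>adjoin A x. \<psi> y = \<phi> y) \<and> (\<forall>p\<in>P \<inter> adjoin_list A (x # xs). \<psi> p = 0) \<and> \<psi> b \<noteq> 0)"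
    by auto
  from extend_hom_step[OF Cons.prems(1,2,3) x Cons.prems(5) b'(1,2), where ?'b = 'b]
  obtain a where a: "a \<in> A" "a \<notin> P" "\<And>\<phi> :: 'r \<Rightarrow> 'b.
    hom_on A \<phi> \<Longrightarrow> (\<forall>p\<in>P \<inter> A. \<phi> p = 0) \<Longrightarrow> \<phi> a \<noteq> 0 \<Longrightarrow>
    (\<exists>\<psi>. hom_on (adjoin A x) \<psi> \<and> (\<forall>y\<in>A. \<psi> y = \<phi> y) \<and> (\<forall>p\<in>P \<inter> adjoin A x. \<psi> p = 0) \<and> \<psi> b' \<noteq> 0)" by blast
  show ?case
  proof (intro bexI[OF _ a(1)] conjI a(2) allI impI)
    fix \<phi> :: "'r \<Rightarrow> 'b" assume "hom_on A \<phi>" "\<forall>p\<in>P \<inter> A. \<phi> p = 0" "\<phi> a \<noteq> 0"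
    from a(3)[OF this] obtain \<psi> where \<psi>: "hom_on (adjoin A x) \<psi>" "\<forall>y\<in>A. \<psi> y = \<phi> y" "\<forall>p\<in>P \<inter> adjoin A x. \<psi> p = 0" "\<psi> b' \<noteq> 0"
      by blast
    from b'(3)[OF \<psi>(1,3,4)] \<psi>(2) B(3) show "\<exists>\<psi>. hom_on (adjoin_list A (x # xs)) \<psi> \<and> (\<forall>y\<in>A. \<psi> y = \<phi> y) \<and>
      (\<forall>p\<in>P \<inter> adjoin_list A (x # xs). \<psi> p = 0) \<and> \<psi> b \<noteq> 0" by (metis subsetD)
  qed
qed

lemma hom_on_adjoin_eq:
  assumes A: "subring_on A" and h: "hom_on (adjoin A x) \<phi>" "hom_on (adjoin A x) \<psi>"
    and "\<And>a. a \<in> A \<Longrightarrow> \<phi> a = \<psi> a" "\<phi> x = \<psi> x" "y \<in> adjoin A x"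
  shows "\<phi> y = \<psi> y"
proof -
  obtain q where q: "q \<in> polys_over A" "y = poly q x" using assms by (auto simp: adjoin_def)
  have B: "subring_on (adjoin A x)" by (rule subring_on_adjoin[OF A])
  have q': "q \<in> polys_over (adjoin A x)" using q adjoin_base[OF A] by (auto simp: polys_over_def)
  have "map_poly \<phi> q = map_poly \<psi> q"
    using q assms by (intro map_poly_cong) (auto simp: polys_over_def set_conv_nth nth_coeffs_coeff)
  then show ?thesis
    using hom_on_poly[OF B h(1) q' adjoin_gen[OF A]] hom_on_poly[OF B h(2) q' adjoin_gen[OF A]] assms q by simp
qed

lemma hom_on_subset: "hom_on B \<phi> \<Longrightarrow> A \<subseteq> B \<Longrightarrow> hom_on A \<phi>"
  unfolding hom_on_def by blast

lemma hom_on_adjoin_list_eq: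
  assumes "subring_on A" "hom_on (adjoin_list A xs) \<phi>" "hom_on (adjoin_list A xs) \<psi>"
    and "\<And>a. a \<in> A \<Longrightarrow> \<phi> a = \<psi> a" "\<And>x. x \<in> set xs \<Longrightarrow> \<phi> x = \<psi> x" "y \<in> adjoin_list A xs"
  shows "\<phi> y = \<psi> y"
  using assms
proof (induction xs arbitrary: A)
  case (Cons x xs)
  have B: "subring_on (adjoin A x)" by (rule subring_on_adjoin[OF Cons.prems(1)])
  have sub: "adjoin A x \<subseteq> adjoin_list A (x # xs)" using adjoin_list_base[OF B] by simp
  have "\<phi> a = \<psi> a" if "a \<in> adjoin A x" for a
  proof (rule hom_on_adjoin_eq[OF Cons.prems(1) _ _ _ _ that])
    show "hom_on (adjoin A x) \<phi>" by (rule hom_on_subset[OF Cons.prems(2) sub])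
    show "hom_on (adjoin A x) \<psi>" by (rule hom_on_subset[OF Cons.prems(3) sub])
    show "\<phi> x = \<psi> x" by (rule Cons.prems(5)) simp
  qed (rule Cons.prems(4))
  note eq = this
  show ?case
  proof (rule Cons.IH[OF B])
    show "hom_on (adjoin_list (adjoin A x) xs) \<phi>" using Cons.prems(2) by simp
    show "hom_on (adjoin_list (adjoin A x) xs) \<psi>" using Cons.prems(3) by simp
    show "\<phi> a = \<psi> a" if "a \<in> adjoin A x" for a by (rule eq[OF that])
    show "\<phi> a = \<psi> a" if "a \<in> set xs" for a by (rule Cons.prems(5)) (use that in simp)
    show "y \<in> adjoin_list (adjoin A x) xs" using Cons.prems(6) by simp
  qed
qed auto

section \<open>Words in matrices\<close>

definition word_mat :: "(nat \<Rightarrow> 'r::comm_ring_1 mat) \<Rightarrow> nat \<Rightarrow> nat list \<Rightarrow> 'r mat" where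
  "word_mat Z n w = foldr (\<lambda>l A. Z l * A) w (1\<^sub>m n)"

lemma word_mat_simps [simp]: "word_mat Z n [] = 1\<^sub>m n" "word_mat Z n (l # w) = Z l * word_mat Z n w"
  by (simp_all add: word_mat_def)

lemma word_mat_carrier [simp]:
  assumes "\<And>l. Z l \<in> carrier_mat n n" shows "word_mat Z n w \<in> carrier_mat n n"
  by (induction w) (auto intro: mult_carrier_mat[OF assms])

lemma word_mat_append:
  assumes "\<And>l. Z l \<in> carrier_mat n n"
  shows "word_mat Z n (u @ w) = word_mat Z n u * word_mat Z n w"
proof (induction u)
  case Nil
  show ?case using left_mult_one_mat[OF word_mat_carrier[of Z n w]] assms by simp
next
  case (Cons l u)
  then show ?case using assoc_mult_mat[OF assms word_mat_carrier[of Z n u] word_mat_carrier[of Z n w]] assms by simp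
qed

text \<open>The coefficients of the relation form a kernel vector of the matrix whose columns are
  the n + 1 vectors. A zero row is added to make it square, which makes its determinant
  vanish.\<close>

lemma linear_relation:
  fixes v :: "nat \<Rightarrow> nat \<Rightarrow> 'a::field"
  shows "\<exists>\<alpha>. (\<exists>i\<le>n. \<alpha> i \<noteq> 0) \<and> (\<forall>c<n. (\<Sum>i\<le>n. \<alpha> i * v i c) = 0)"
proof -
  define M where "M = mat (Suc n) (Suc n) (\<lambda>(c, i). if c < n then v i c else 0)"
  have M: "M \<in> carrier_mat (Suc n) (Suc n)" by (simp add: M_def)
  have "transpose_mat M *\<^sub>v unit_vec (Suc n) n = 0\<^sub>v (Suc n)"
    by (intro eq_vecI) (auto simp: M_def scalar_prod_def unit_vec_def intro!: sum.neutral)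
  moreover have "unit_vec (Suc n) n \<noteq> (0\<^sub>v (Suc n) :: 'a vec)"
    by (metis index_unit_vec(2) index_zero_vec(1) lessI zero_neq_one)
  ultimately have "det (transpose_mat M) = 0"
    using M by (subst det_0_iff_vec_prod_zero_field[of _ "Suc n"]) (auto intro!: exI[of _ "unit_vec (Suc n) n"])
  then have "det M = 0" using det_transpose[OF M] by simp
  then obtain x where x: "x \<in> carrier_vec (Suc n)" "x \<noteq> 0\<^sub>v (Suc n)" "M *\<^sub>v x = 0\<^sub>v (Suc n)"
    using det_0_iff_vec_prod_zero_field[OF M] by blast
  show ?thesis
  proof (intro exI[of _ "\<lambda>i. x $ i"] conjI allI impI)
    show "\<exists>i\<le>n. x $ i \<noteq> 0"
    proof (rule ccontr)
      assume "\<not> ?thesis"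
      then have "x = 0\<^sub>v (Suc n)" using x(1) by (intro eq_vecI) auto
      with x(2) show False by simp
    qed
    fix c assume c: "c < n"
    have "(M *\<^sub>v x) $ c = (\<Sum>i\<le>n. x $ i * v i c)"
      using c x(1) by (auto simp: M_def scalar_prod_def mult.commute atLeast0LessThan lessThan_Suc_atMost intro!: sum.cong)
    then show "(\<Sum>i\<le>n. x $ i * v i c) = 0" using x(3) c by simp
  qed
qed

lemma row_relation_mult:
  fixes v :: "nat \<Rightarrow> 'a::comm_ring_1 mat"
  assumes v: "\<And>i. v i \<in> carrier_mat 1 n" and M: "M \<in> carrier_mat n n" and c: "c < n"
    and r: "\<forall>c<n. (\<Sum>i\<le>m. \<alpha> i * v i $$ (0, c)) = 0"
  shows "(\<Sum>i\<le>m. \<alpha> i * (v i * M) $$ (0, c)) = 0"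
proof -
  have "(v i * M) $$ (0, c) = (\<Sum>d<n. v i $$ (0, d) * M $$ (d, c))" for i
    using v[of i] M c by (simp add: times_mat_def scalar_prod_def atLeast0LessThan)
  then have "(\<Sum>i\<le>m. \<alpha> i * (v i * M) $$ (0, c)) = (\<Sum>i\<le>m. \<Sum>d<n. (\<alpha> i * v i $$ (0, d)) * M $$ (d, c))"
    by (simp add: sum_distrib_left mult.assoc)
  also have "\<dots> = (\<Sum>d<n. (\<Sum>i\<le>m. \<alpha> i * v i $$ (0, d)) * M $$ (d, c))"
    by (subst sum.swap) (simp add: sum_distrib_right)
  also have "\<dots> = 0" using r by simp
  finally show ?thesis .
qed

lemma row_eq_0_iff: "x \<in> carrier_mat 1 n \<Longrightarrow> x = 0\<^sub>m 1 n \<longleftrightarrow> (\<forall>c<n. x $$ (0, c) = 0)"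
  by (auto simp: mat_eq_iff)

subsection \<open>Non-nilpotent matrices have a nonzero eigenvalue\<close>

text \<open>Read X as the shift on sequences: a relation (X - \<mu>) q for the sequence g is the
  relation q for the sequence obtained from g by applying the shift minus \<mu>.\<close>

lemma sum_coeff_linear_factor:
  fixes g :: "nat \<Rightarrow> 'a::field"
  assumes "(\<Sum>i\<le>degree ([:- \<mu>, 1:] * q). coeff ([:- \<mu>, 1:] * q) i * g i) = 0"
  shows "(\<Sum>i\<le>degree q. coeff q i * (g (Suc i) - \<mu> * g i)) = 0"
proof -
  let ?p = "[:- \<mu>, 1:] * q"
  have e: "(\<Sum>i\<le>degree p. coeff p i * h i) = (\<Sum>i\<le>N. coeff p i * h i)" if "degree p \<le> N"
    for p :: "'a poly" and N and h :: "nat \<Rightarrow> 'a"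
    using that by (intro sum.mono_neutral_left) (auto simp: coeff_eq_0)
  have "degree ?p \<le> Suc (degree q)" by (rule order_trans[OF degree_mult_le]) auto
  from e[OF this, of g] have "0 = (\<Sum>i\<le>Suc (degree q). coeff ?p i * g i)" using assms by argo
  also have "\<dots> = (\<Sum>i\<le>Suc (degree q). coeff (pCons 0 q) i * g i) - (\<Sum>i\<le>Suc (degree q). \<mu> * coeff q i * g i)"
  proof -
    have "coeff ?p i * g i = coeff (pCons 0 q) i * g i - \<mu> * coeff q i * g i" for i
      by (simp add: algebra_simps)
    then show ?thesis by (simp only: sum_subtractf)
  qed
  also have "(\<Sum>i\<le>Suc (degree q). coeff (pCons 0 q) i * g i) = (\<Sum>i\<le>degree q. coeff q i * g (Suc i))"
    by (subst sum.atMost_Suc_shift) simp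
  also have "(\<Sum>i\<le>Suc (degree q). \<mu> * coeff q i * g i) = (\<Sum>i\<le>degree q. \<mu> * coeff q i * g i)"
    by (simp add: coeff_eq_0)
  finally show ?thesis by (simp add: sum_subtractf algebra_simps)
qed

lemma char_poly_root_iff_det:
  fixes A :: "'a::field mat"
  assumes "A \<in> carrier_mat n n"
  shows "poly (char_poly A) \<mu> = 0 \<longleftrightarrow> det (A - \<mu> \<cdot>\<^sub>m 1\<^sub>m n) = 0"
proof -
  have "char_matrix A \<mu> = A - \<mu> \<cdot>\<^sub>m 1\<^sub>m n" using assms
    by (intro eq_matI) (auto simp: char_matrix_def)
  then show ?thesis
    using eigenvalue_root_char_poly[OF assms, of \<mu>] eigenvalue_det[OF assms, of \<mu>] by simp
qed

text \<open>The vectors x A^i satisfy a polynomial relation p. For a root \<mu> of p, either \<mu>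
  is a nonzero eigenvalue, or x can be replaced by x (A - \<mu>) and p by p / (X - \<mu>). In the
  second case survival under all powers of A persists: trivially if \<mu> = 0, and by the adjugate
  if A - \<mu> is invertible. Degree 0 is impossible since x itself is nonzero.\<close>

lemma nonzero_eigenvalue:
  fixes A :: "'a::alg_closed_field mat"
  assumes A: "A \<in> carrier_mat n n" and x: "x \<in> carrier_mat 1 n" "\<And>k. x * (A ^\<^sub>m k) \<noteq> 0\<^sub>m 1 n"
  shows "\<exists>\<mu>. \<mu> \<noteq> 0 \<and> poly (char_poly A) \<mu> = 0"
proof -
  have Ap: "A ^\<^sub>m k \<in> carrier_mat n n" for k using A by simp
  have main: "\<exists>\<mu>. \<mu> \<noteq> 0 \<and> poly (char_poly A) \<mu> = 0"
    if "p \<noteq> 0" "\<And>c. c < n \<Longrightarrow> (\<Sum>i\<le>degree p. coeff p i * (y * (A ^\<^sub>m i)) $$ (0, c)) = 0"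
      "y \<in> carrier_mat 1 n" "\<And>k. y * (A ^\<^sub>m k) \<noteq> 0\<^sub>m 1 n" for p y
    using that
  proof (induction "degree p" arbitrary: p y)
    case 0
    then obtain a where p: "p = [:a:]" "a \<noteq> 0" by (metis degree_eq_zeroE pCons_0_0)
    have "y * (A ^\<^sub>m 0) = 0\<^sub>m 1 n" using 0 p A
      by (subst row_eq_0_iff) (auto simp: mult_carrier_mat[OF \<open>y \<in> carrier_mat 1 n\<close> Ap])
    with 0 show ?case by blast
  next
    case (Suc d)
    then obtain \<mu> where "poly p \<mu> = 0" using alg_closed_imp_poly_has_root[of p] by auto
    then obtain q where q: "p = [:- \<mu>, 1:] * q" by (auto simp: poly_eq_0_iff_dvd dvd_def)
    have q0: "q \<noteq> 0" using Suc.prems q by auto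
    have "degree p = degree [:- \<mu>, 1:] + degree q" unfolding q by (rule degree_mult_eq) (use q0 in auto)
    then have dq: "degree q = d" using Suc.hyps(2) by simp
    define C where "C = A - \<mu> \<cdot>\<^sub>m 1\<^sub>m n"
    have C: "C \<in> carrier_mat n n" unfolding C_def by (intro minus_carrier_mat) simp
    have y: "y \<in> carrier_mat 1 n" by fact
    have CA: "C * (A ^\<^sub>m k) = A ^\<^sub>m (Suc k) - \<mu> \<cdot>\<^sub>m (A ^\<^sub>m k)" for k
    proof -
      have "C * (A ^\<^sub>m k) = A * (A ^\<^sub>m k) - (\<mu> \<cdot>\<^sub>m 1\<^sub>m n) * (A ^\<^sub>m k)" unfolding C_def
        by (rule minus_mult_distrib_mat[OF A _ Ap]) simp
      also have "A * (A ^\<^sub>m k) = A ^\<^sub>m (Suc k)" using A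
        by (induction k) (auto simp: assoc_mult_mat[OF A Ap A, symmetric])
      also have "(\<mu> \<cdot>\<^sub>m 1\<^sub>m n) * (A ^\<^sub>m k) = \<mu> \<cdot>\<^sub>m (A ^\<^sub>m k)"
        by (subst mult_smult_assoc_mat[OF one_carrier_mat Ap]) (simp add: left_mult_one_mat[OF Ap])
      finally show ?thesis .
    qed
    have AC: "(A ^\<^sub>m k) * C = A ^\<^sub>m (Suc k) - \<mu> \<cdot>\<^sub>m (A ^\<^sub>m k)" for k
    proof -
      have "(A ^\<^sub>m k) * C = (A ^\<^sub>m k) * A - (A ^\<^sub>m k) * (\<mu> \<cdot>\<^sub>m 1\<^sub>m n)" unfolding C_def
        by (rule mult_minus_distrib_mat[OF Ap A]) simp
      also have "(A ^\<^sub>m k) * (\<mu> \<cdot>\<^sub>m 1\<^sub>m n) = \<mu> \<cdot>\<^sub>m (A ^\<^sub>m k)"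
        by (subst mult_smult_distrib[OF Ap one_carrier_mat]) (simp add: right_mult_one_mat[OF Ap])
      finally show ?thesis by simp
    qed
    have y': "y * C \<in> carrier_mat 1 n" using y C by simp
    have rel: "(\<Sum>i\<le>degree q. coeff q i * (y * C * (A ^\<^sub>m i)) $$ (0, c)) = 0" if c: "c < n" for c
    proof -
      have "(y * C * (A ^\<^sub>m i)) $$ (0, c) = (y * (A ^\<^sub>m (Suc i))) $$ (0, c) - \<mu> * (y * (A ^\<^sub>m i)) $$ (0, c)" for i
      proof -
        have "y * C * (A ^\<^sub>m i) = y * (A ^\<^sub>m (Suc i)) - y * (\<mu> \<cdot>\<^sub>m (A ^\<^sub>m i))"
          unfolding assoc_mult_mat[OF y C Ap] CA
          by (rule mult_minus_distrib_mat[OF y Ap]) (simp add: A)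
        also have "y * (\<mu> \<cdot>\<^sub>m (A ^\<^sub>m i)) = \<mu> \<cdot>\<^sub>m (y * (A ^\<^sub>m i))" by (rule mult_smult_distrib[OF y Ap])
        finally show ?thesis using c y A by auto
      qed
      then show ?thesis using sum_coeff_linear_factor[of \<mu> q "\<lambda>i. (y * (A ^\<^sub>m i)) $$ (0, c)"] Suc.prems(2)[OF c] q by simp
    qed
    show ?case
    proof (cases "\<mu> \<noteq> 0 \<and> det C = 0")
      case True
      then show ?thesis using char_poly_root_iff_det[OF A, of \<mu>] C_def by blast
    next
      case False
      have "y * C * (A ^\<^sub>m k) \<noteq> 0\<^sub>m 1 n" for k
      proof (cases "\<mu> = 0")
        case True
        have "C = A" using A True by (intro eq_matI) (auto simp: C_def)
        then have "y * C * (A ^\<^sub>m k) = y * (A ^\<^sub>m Suc k)"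
          using assoc_mult_mat[OF y C Ap] CA[of k] True Ap[of "Suc k"] by (metis AC pow_mat.simps(2))
        then show ?thesis using Suc.prems(4)[of "Suc k"] by metis
      next
        case m: False
        then have dC: "det C \<noteq> 0" using False by blast
        have "y * C * (A ^\<^sub>m k) = y * (A ^\<^sub>m k) * C"
          unfolding assoc_mult_mat[OF y C Ap] assoc_mult_mat[OF y Ap C] CA AC ..
        moreover have "y * (A ^\<^sub>m k) * C * adj_mat C = det C \<cdot>\<^sub>m (y * (A ^\<^sub>m k))"
        proof -
          have "y * (A ^\<^sub>m k) * C * adj_mat C = y * (A ^\<^sub>m k) * (det C \<cdot>\<^sub>m 1\<^sub>m n)"
            using assoc_mult_mat[OF mult_carrier_mat[OF y Ap] C adj_mat(1)[OF C]] adj_mat(2)[OF C] by simp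
          also have "\<dots> = det C \<cdot>\<^sub>m (y * (A ^\<^sub>m k))"
            by (subst mult_smult_distrib[OF mult_carrier_mat[OF y Ap] one_carrier_mat])
              (simp add: right_mult_one_mat[OF mult_carrier_mat[OF y Ap]])
          finally show ?thesis .
        qed
        moreover have "det C \<cdot>\<^sub>m (y * (A ^\<^sub>m k)) \<noteq> 0\<^sub>m 1 n"
        proof -
          obtain c where c: "c < n" "(y * (A ^\<^sub>m k)) $$ (0, c) \<noteq> 0"
            using Suc.prems(4)[of k] row_eq_0_iff[OF mult_carrier_mat[OF y Ap]] by blast
          then have "(det C \<cdot>\<^sub>m (y * (A ^\<^sub>m k))) $$ (0, c) \<noteq> 0"
            using dC carrier_matD[OF y] carrier_matD[OF Ap[of k]] by simp
          then show ?thesis using c(1) by auto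
        qed
        ultimately show ?thesis using adj_mat(1)[OF C] by (metis left_mult_zero_mat)
      qed
      then show ?thesis using Suc.hyps(1)[OF dq[symmetric] q0 rel y'] by blast
    qed
  qed
  obtain \<alpha> where \<alpha>: "\<exists>i\<le>n. \<alpha> i \<noteq> 0" "\<forall>c<n. (\<Sum>i\<le>n. \<alpha> i * (x * (A ^\<^sub>m i)) $$ (0, c)) = 0"
    using linear_relation[of n "\<lambda>i c. (x * (A ^\<^sub>m i)) $$ (0, c)"] by blast
  define p where "p = (\<Sum>i\<le>n. monom (\<alpha> i) i)"
  have cp: "coeff p i = (if i \<le> n then \<alpha> i else 0)" for i
    by (auto simp: p_def coeff_sum coeff_monom)
  have "p \<noteq> 0" using \<alpha>(1) cp by (metis coeff_0)
  moreover have "degree p \<le> n" by (rule degree_le) (auto simp: cp)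
  then have "(\<Sum>i\<le>degree p. coeff p i * (x * (A ^\<^sub>m i)) $$ (0, c)) = 0" if "c < n" for c
  proof -
    have "(\<Sum>i\<le>degree p. coeff p i * (x * (A ^\<^sub>m i)) $$ (0, c)) = (\<Sum>i\<le>n. coeff p i * (x * (A ^\<^sub>m i)) $$ (0, c))"
      using \<open>degree p \<le> n\<close> by (intro sum.mono_neutral_left) (auto simp: coeff_eq_0)
    also have "\<dots> = 0" using \<alpha>(2) that by (simp add: cp)
    finally show ?thesis .
  qed
  ultimately show ?thesis using main[of p x] x by blast
qed

lemma map_upt_shift: "map f [i..<i + k] = map (\<lambda>q. f (i + q)) [0..<k]"
  by (rule nth_equalityI) auto

subsection \<open>Words of length at most \<open>n\<close> detect nilpotency\<close>

text \<open>Stated without antisymmetry because it serves two orders: the lexicographic order of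
  infinite words, and divisibility of determinants over a valuation ring.\<close>

lemma finite_max_preorder:
  assumes "finite S" "S \<noteq> {}" and "\<And>x y. x \<in> S \<Longrightarrow> y \<in> S \<Longrightarrow> leq x y \<or> leq y x"
    and "\<And>x y z. leq x y \<Longrightarrow> leq y z \<Longrightarrow> leq x z"
  shows "\<exists>m\<in>S. \<forall>x\<in>S. leq x m"
  using assms(1-3)
proof (induction S rule: finite_ne_induct)
  case (singleton x)
  then show ?case by blast
next
  case (insert x F)
  then obtain m where m: "m \<in> F" "\<forall>y\<in>F. leq y m" by blast
  show ?case
  proof (cases "leq x m")
    case False
    then have mx: "leq m x" using insert.prems[of x m] m by blast
    moreover have "leq x x" using insert.prems[of x x] by blast
    ultimately have "\<forall>y\<in>insert x F. leq y x" using m assms(4) by blast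
    then show ?thesis by blast
  qed (use m in blast)
qed

definition lexle :: "(nat \<Rightarrow> nat) \<Rightarrow> (nat \<Rightarrow> nat) \<Rightarrow> bool" where
  "lexle Xw Y \<longleftrightarrow> Xw = Y \<or> (\<exists>p. (\<forall>q<p. Xw q = Y q) \<and> Xw p < Y p)"

lemma first_difference: "(Xw :: nat \<Rightarrow> nat) \<noteq> Y \<Longrightarrow> \<exists>p. (\<forall>q<p. Xw q = Y q) \<and> Xw p \<noteq> Y p"
proof -
  assume "Xw \<noteq> Y"
  then obtain p where "Xw p \<noteq> Y p" by (meson ext)
  then have "Xw (LEAST p. Xw p \<noteq> Y p) \<noteq> Y (LEAST p. Xw p \<noteq> Y p)" by (rule LeastI)
  moreover have "\<forall>q<(LEAST p. Xw p \<noteq> Y p). Xw q = Y q" using not_less_Least by blast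
  ultimately show ?thesis by blast
qed

lemma lexle_total: "lexle Xw Y \<or> lexle Y Xw"
proof (cases "Xw = Y")
  case False
  then obtain p where "\<forall>q<p. Xw q = Y q" "Xw p \<noteq> Y p" using first_difference by blast
  moreover from this have "\<forall>q<p. Y q = Xw q" by simp
  moreover have "Xw p < Y p \<or> Y p < Xw p" using \<open>Xw p \<noteq> Y p\<close> by linarith
  ultimately show ?thesis unfolding lexle_def by blast
qed (simp add: lexle_def)

lemma lexle_trans: "lexle Xw Y \<Longrightarrow> lexle Y V \<Longrightarrow> lexle Xw V"
proof -
  assume a: "lexle Xw Y" "lexle Y V"
  show ?thesis
  proof (cases "Xw = Y \<or> Y = V")
    case False
    then obtain p p' where p: "\<forall>q<p. Xw q = Y q" "Xw p < Y p" "\<forall>q<p'. Y q = V q" "Y p' < V p'"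
      using a unfolding lexle_def by blast
    have "(\<forall>q<min p p'. Xw q = V q) \<and> Xw (min p p') < V (min p p')"
      using p by (cases p p' rule: linorder_cases) (auto simp: min_def)
    then show ?thesis unfolding lexle_def by blast
  qed (use a in auto)
qed

lemma lexle_antisym: "lexle Xw Y \<Longrightarrow> lexle Y Xw \<Longrightarrow> Xw = Y"
proof (rule ccontr)
  assume a: "lexle Xw Y" "lexle Y Xw" "Xw \<noteq> Y"
  then obtain p p' where "\<forall>q<p. Xw q = Y q" "Xw p < Y p" "\<forall>q<p'. Y q = Xw q" "Y p' < Xw p'"
    unfolding lexle_def by blast
  then show False by (cases p p' rule: linorder_cases) auto
qed

text \<open>
  Ufnarovskii's independence argument. Along the lexicographically greatest infinite word \<open>W\<close> on
  which \<open>v\<close> survives, the vectors \<open>v W[0..<i]\<close>, \<open>i \<le> n\<close>, satisfy a linear relation. Comparing its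
  terms on the greatest of the corresponding tails of \<open>W\<close> makes two of these tails coincide, so
  \<open>W\<close> is eventually periodic with a period of length at most \<open>n\<close>.
\<close>

lemma surviving_word_eigenvalue:
  fixes Z :: "nat \<Rightarrow> 'a::alg_closed_field mat"
  assumes Z: "\<And>l. Z l \<in> carrier_mat n n" and v: "v \<in> carrier_mat 1 n"
    and surv: "\<And>N. \<exists>w\<in>lists {..<s}. length w = N \<and> v * word_mat Z n w \<noteq> 0\<^sub>m 1 n"
  shows "\<exists>u\<in>lists {..<s}. 1 \<le> length u \<and> length u \<le> n \<and> (\<exists>\<mu>. \<mu> \<noteq> 0 \<and> poly (char_poly (word_mat Z n u)) \<mu> = 0)"
proof -
  define m where "m = word_mat Z n"
  have m: "m w \<in> carrier_mat n n" for w using Z by (simp add: m_def)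
  have mapp: "m (u @ w) = m u * m w" for u w using word_mat_append[OF Z] by (simp add: m_def)
  have app: "y * m (u @ w) = y * m u * m w" if "y \<in> carrier_mat 1 n" for y u w
    unfolding mapp using assoc_mult_mat[OF that m m] by simp
  have pre: "y * m u \<noteq> 0\<^sub>m 1 n" if "y \<in> carrier_mat 1 n" "y * m (u @ w) \<noteq> 0\<^sub>m 1 n" for y u w
    using that app[OF that(1), of u w] left_mult_zero_mat[OF m[of w], of 1] by auto
  have vm: "v * m u \<in> carrier_mat 1 n" for u using v m by simp
  \<comment> \<open>Koenig's lemma: a prefix is alive if it extends to arbitrarily long words on
    which v survives.\<close>
  define alive where "alive u \<longleftrightarrow> u \<in> lists {..<s} \<and> (\<forall>N. \<exists>z\<in>lists {..<s}. length z = N \<and> v * m (u @ z) \<noteq> 0\<^sub>m 1 n)" for u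
  have alive0: "alive []" using surv by (simp add: alive_def m_def)
  \<comment> \<open>If the extension by each letter l dies after \<open>N l\<close> further letters,
    then the sum of all \<open>N l\<close> is a common bound for all letters, against the survival
    of longer extensions of u.\<close>
  have aliveS: "\<exists>l<s. alive (u @ [l])" if u: "alive u" for u
  proof (rule ccontr)
    assume "\<not> ?thesis"
    then have "\<forall>l. \<exists>N. l < s \<longrightarrow> (\<forall>z\<in>lists {..<s}. length z = N \<longrightarrow> v * m ((u @ [l]) @ z) = 0\<^sub>m 1 n)"
      using u unfolding alive_def by auto
    from choice[OF this] obtain N where N: "\<forall>l. l < s \<longrightarrow> (\<forall>z\<in>lists {..<s}. length z = N l \<longrightarrow> v * m ((u @ [l]) @ z) = 0\<^sub>m 1 n)"
      by (elim exE)
    obtain z where z: "z \<in> lists {..<s}" "length z = Suc (\<Sum>l<s. N l)" "v * m (u @ z) \<noteq> 0\<^sub>m 1 n"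
      using u unfolding alive_def by blast
    then obtain l z' where lz: "z = l # z'" "l < s" "z' \<in> lists {..<s}" "length z' = (\<Sum>l<s. N l)" by (cases z) auto
    have "N l \<le> (\<Sum>l<s. N l)" using lz(2) by (intro member_le_sum) auto
    then have "v * m ((u @ [l]) @ take (N l) z') = 0\<^sub>m 1 n"
      using lz by (intro N[rule_format]) (auto dest: in_set_takeD)
    moreover have "u @ z = ((u @ [l]) @ take (N l) z') @ drop (N l) z'" using lz by simp
    ultimately show False using pre[OF v, of "(u @ [l]) @ take (N l) z'" "drop (N l) z'"] z(3) by metis
  qed
  define next_letter where "next_letter u = Max {l. l < s \<and> alive (u @ [l])}" for u
  have nl: "alive (u @ [next_letter u])" "next_letter u < s" if "alive u" for u
    using Max_in[of "{l. l < s \<and> alive (u @ [l])}"] aliveS[OF that] by (auto simp: next_letter_def)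
  have nlmax: "l \<le> next_letter u" if "l < s" "alive (u @ [l])" for l u
    using that by (auto simp: next_letter_def)
  define Pr where "Pr = rec_nat [] (\<lambda>_ u. u @ [next_letter u])"
  have Pr: "Pr 0 = []" "Pr (Suc k) = Pr k @ [next_letter (Pr k)]" for k by (simp_all add: Pr_def)
  define W where "W k = next_letter (Pr k)" for k
  have Pal: "alive (Pr k)" for k by (induction k) (auto simp: Pr alive0 nl)
  have Ws: "W k < s" for k using nl(2)[OF Pal] by (simp add: W_def)
  have PW: "Pr k = map W [0..<k]" for k by (induction k) (auto simp: Pr W_def)
  have Pnz: "v * m (map W [0..<k]) \<noteq> 0\<^sub>m 1 n" for k
    using Pal[of k] unfolding alive_def PW by (metis append_Nil2 length_0_conv)
  \<comment> \<open>The greedy choice of the greatest living letter makes \<open>W\<close>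
    lexicographically greatest: a surviving infinite word that agrees with \<open>W\<close> before p
    has a living prefix there, so its next letter is at most that of \<open>W\<close>.\<close>
  have Wmax: "Xw p \<le> W p" if Xw: "\<And>k. Xw k < s" "\<And>k. v * m (map Xw [0..<k]) \<noteq> 0\<^sub>m 1 n" and eq: "\<And>q. q < p \<Longrightarrow> Xw q = W q" for Xw p
  proof -
    have e: "Pr p = map Xw [0..<p]" unfolding PW using eq by auto
    have "alive (Pr p @ [Xw p])" unfolding alive_def
    proof (intro conjI allI)
      show "Pr p @ [Xw p] \<in> lists {..<s}" unfolding e using Xw(1) by auto
      fix N
      have "(Pr p @ [Xw p]) @ map Xw [Suc p..<Suc p + N] = map Xw [0..<Suc p + N]"
      proof -
        have "[0..<Suc p + N] = [0..<Suc p] @ [Suc p..<Suc p + N]" by (rule upt_add_eq_append) simp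
        then show ?thesis unfolding e by simp
      qed
      then show "\<exists>z\<in>lists {..<s}. length z = N \<and> v * m ((Pr p @ [Xw p]) @ z) \<noteq> 0\<^sub>m 1 n"
        using Xw(1) Xw(2)[of "Suc p + N"]
        by (intro bexI[of _ "map Xw [Suc p..<Suc p + N]"] conjI) (simp_all only: length_map length_upt, auto)
    qed
    then show ?thesis unfolding W_def using nlmax Xw(1) by blast
  qed
  define vv where "vv i = v * m (map W [0..<i])" for i
  have vv: "vv i \<in> carrier_mat 1 n" for i using vm by (simp add: vv_def)
  define T where "T i k = W (i + k)" for i k
  have split: "map W [0..<i + k] = map W [0..<i] @ map (T i) [0..<k]" for i k
    using upt_add_eq_append[of 0 i k] map_upt_shift[of W i k] by (simp add: T_def)
  have vT: "vv i * m (map (T i) [0..<k]) \<noteq> 0\<^sub>m 1 n" for i k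
    using Pnz[of "i + k"] app[OF v] by (simp add: split vv_def)
  obtain \<alpha> where \<alpha>: "\<exists>i\<le>n. \<alpha> i \<noteq> 0" "\<forall>c<n. (\<Sum>i\<le>n. \<alpha> i * vv i $$ (0, c)) = 0"
    using linear_relation[of n "\<lambda>i c. vv i $$ (0, c)"] by blast
  define I where "I = {i. i \<le> n \<and> \<alpha> i \<noteq> 0}"
  have I: "finite I" "I \<noteq> {}" using \<alpha> by (auto simp: I_def)
  have "\<exists>t\<in>T ` I. \<forall>x\<in>T ` I. lexle x t"
    by (rule finite_max_preorder[OF _ _ lexle_total lexle_trans]) (use I in auto)
  then obtain i where i: "i \<in> I" "\<And>j. j \<in> I \<Longrightarrow> lexle (T j) (T i)" by blast
  \<comment> \<open>Otherwise, after multiplication by a long enough prefix of the tail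
    \<open>T i\<close>, every other term of the relation vanishes and only the term at i is left,
    although \<open>vv i\<close> survives along its own tail.\<close>
  have "\<exists>j\<in>I - {i}. \<forall>N. vv j * m (map (T i) [0..<N]) \<noteq> 0\<^sub>m 1 n"
  proof (rule ccontr)
    assume "\<not> ?thesis"
    then have "\<forall>j\<in>I - {i}. \<exists>N. vv j * m (map (T i) [0..<N]) = 0\<^sub>m 1 n" by blast
    from bchoice[OF this] obtain N where N: "\<forall>j\<in>I - {i}. vv j * m (map (T i) [0..<N j]) = 0\<^sub>m 1 n" by (elim exE)
    define K where "K = (\<Sum>j\<in>I - {i}. N j)"
    have z: "vv j * m (map (T i) [0..<K]) = 0\<^sub>m 1 n" if j: "j \<in> I - {i}" for j
    proof -
      have "N j \<le> K" unfolding K_def using j I by (intro member_le_sum) auto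
      then have "map (T i) [0..<K] = map (T i) [0..<N j] @ map (T i) [N j..<K]"
        by (metis le_add_diff_inverse map_append upt_add_eq_append zero_le)
      then show ?thesis using pre[OF vv, of j "map (T i) [0..<N j]" "map (T i) [N j..<K]"] N j by metis
    qed
    have "(vv i * m (map (T i) [0..<K])) $$ (0, c) = 0" if c: "c < n" for c
    proof -
      have "0 = (\<Sum>j\<le>n. \<alpha> j * (vv j * m (map (T i) [0..<K])) $$ (0, c))"
        using row_relation_mult[OF vv m c \<alpha>(2)] by simp
      also have "\<dots> = (\<Sum>j\<in>{i}. \<alpha> j * (vv j * m (map (T i) [0..<K])) $$ (0, c))"
      proof (rule sum.mono_neutral_right)
        show "\<forall>j\<in>{..n} - {i}. \<alpha> j * (vv j * m (map (T i) [0..<K])) $$ (0, c) = 0"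
        proof
          fix j assume "j \<in> {..n} - {i}"
          then show "\<alpha> j * (vv j * m (map (T i) [0..<K])) $$ (0, c) = 0"
            using z[of j] c by (cases "\<alpha> j = 0") (auto simp: I_def)
        qed
      qed (use i in \<open>auto simp: I_def\<close>)
      finally show ?thesis using i(1) by (simp add: I_def)
    qed
    then have "vv i * m (map (T i) [0..<K]) = 0\<^sub>m 1 n"
      using row_eq_0_iff[OF mult_carrier_mat[OF vv m]] by blast
    then show False using vT by blast
  qed
  then obtain j where j: "j \<in> I" "j \<noteq> i" "\<And>N. vv j * m (map (T i) [0..<N]) \<noteq> 0\<^sub>m 1 n" by blast
  \<comment> \<open>Splice the first j letters of \<open>W\<close> with the tail \<open>T i\<close>.
    By the choice of j this word survives, so it does not exceed \<open>W\<close>; cancelling the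
    common prefix gives \<open>T i\<close> at most \<open>T j\<close>, the converse of the
    maximality of \<open>T i\<close>.\<close>
  define Xw where "Xw k = (if k < j then W k else T i (k - j))" for k
  have Xp: "map Xw [0..<j + k] = map W [0..<j] @ map (T i) [0..<k]" for k
  proof (rule nth_equalityI)
    fix q assume "q < length (map Xw [0..<j + k])"
    then show "map Xw [0..<j + k] ! q = (map W [0..<j] @ map (T i) [0..<k]) ! q"
      by (auto simp: nth_append Xw_def)
  qed simp
  have "v * m (map Xw [0..<j + k]) \<noteq> 0\<^sub>m 1 n" for k unfolding Xp app[OF v] using j(3)[of k] by (simp add: vv_def)
  then have "v * m (map Xw [0..<k]) \<noteq> 0\<^sub>m 1 n" for k
    using pre[OF v, of "map Xw [0..<k]" "map Xw [k..<k + j]"]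
    by (metis add.commute map_append upt_add_eq_append zero_le)
  moreover have "Xw k < s" for k using Ws by (simp add: Xw_def T_def)
  ultimately have Xmax: "Xw p \<le> W p" if "\<And>q. q < p \<Longrightarrow> Xw q = W q" for p using Wmax that by blast
  have "lexle (T i) (T j)"
  proof (cases "T i = T j")
    case False
    then obtain p where p: "\<forall>q<p. T i q = T j q" "T i p \<noteq> T j p" using first_difference by blast
    have "Xw (j + p) \<le> W (j + p)"
    proof (rule Xmax)
      fix q assume "q < j + p"
      then show "Xw q = W q" using p(1)[rule_format, of "q - j"] by (auto simp: Xw_def T_def)
    qed
    then have "T i p < T j p" using p(2) by (simp add: Xw_def T_def)
    then show ?thesis using p by (auto simp: lexle_def)
  qed (simp add: lexle_def)
  then have Tij: "T i = T j" using i(2)[OF j(1)] lexle_antisym by blast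
  define a where "a = min i j"
  define d where "d = max i j - a"
  \<comment> \<open>The indices i and j are distinct and both at most n, since n + 1 prefixes
    sufficed for the relation; this is the origin of the length bound for the period.\<close>
  have d: "1 \<le> d" "d \<le> n" using j i by (auto simp: a_def d_def I_def)
  have Tper: "T a (k + d) = T a k" for k
  proof -
    have "T a (k + d) = T (max i j) k" using d by (simp add: T_def d_def a_def add.commute)
    then show ?thesis using Tij by (simp add: max_def a_def min_def split: if_splits)
  qed
  define u where "u = map (T a) [0..<d]"
  have um: "m (map (T a) [0..<k * d]) = m u ^\<^sub>m k" for k
  proof (induction k)
    case 0 then show ?case using m[of u] by (auto simp: m_def)
  next
    case (Suc k)
    have per: "T a (q + k * d) = T a q" for q
    proof (induction k)
      case (Suc k)
      have "T a (q + Suc k * d) = T a ((q + k * d) + d)" by (simp add: algebra_simps)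
      then show ?case unfolding Tper using Suc by simp
    qed simp
    have "map (T a) [0..<Suc k * d] = map (T a) [0..<k * d] @ u"
      using upt_add_eq_append[of 0 "k * d" d] map_upt_shift[of "T a" "k * d" d] per
      by (simp add: u_def add.commute)
    then show ?case using Suc mapp by simp
  qed
  have "vv a * (m u ^\<^sub>m k) \<noteq> 0\<^sub>m 1 n" for k using vT[of a "k * d"] um by simp
  from nonzero_eigenvalue[OF m vv this] obtain \<mu> where "\<mu> \<noteq> 0" "poly (char_poly (m u)) \<mu> = 0" by blast
  moreover have "u \<in> lists {..<s}" using Ws by (auto simp: u_def T_def)
  ultimately show ?thesis using d by (intro bexI[of _ u]) (auto simp: m_def u_def)
qed

lemma mat_row_ne_0:
  assumes "M \<in> carrier_mat n n" "M \<noteq> 0\<^sub>m n n"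
  shows "\<exists>r<n. mat 1 n (\<lambda>(_, c). if c = r then 1 else 0) * M \<noteq> (0\<^sub>m 1 n :: 'a::comm_ring_1 mat)"
proof -
  obtain r c where rc: "r < n" "c < n" "M $$ (r, c) \<noteq> 0"
    using assms by (auto simp: mat_eq_iff)
  have "(mat 1 n (\<lambda>(_, c). if c = r then 1 else 0) * M) $$ (0, c) = (\<Sum>k<n. (if k = r then 1 else 0) * M $$ (k, c))"
    using assms rc by (simp add: times_mat_def scalar_prod_def atLeast0LessThan)
  also have "\<dots> = M $$ (r, c)" using rc by (simp add: if_distrib[of "\<lambda>x. x * _"] cong: if_cong)
  finally show ?thesis using rc by (intro exI[of _ r]) (auto simp: mat_eq_iff)
qed

text \<open>By \<open>surviving_word_eigenvalue\<close> no row vector survives arbitrarily long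
  words, so all words beyond some length N vanish. The bound N is then lowered to n by a linear
  relation among the n + 1 prefixes of one word w: the earliest prefix occurring in it is a
  combination of longer ones.\<close>

theorem short_words_nilpotent_imp_zero:
  fixes Z :: "nat \<Rightarrow> 'a::alg_closed_field mat"
  assumes Z: "\<And>l. Z l \<in> carrier_mat n n"
    and nil: "\<And>u \<mu>. u \<in> lists {..<s} \<Longrightarrow> 1 \<le> length u \<Longrightarrow> length u \<le> n \<Longrightarrow> poly (char_poly (word_mat Z n u)) \<mu> = 0 \<Longrightarrow> \<mu> = 0"
    and w: "w \<in> lists {..<s}" "length w = n"
  shows "word_mat Z n w = 0\<^sub>m n n"
proof -
  define m where "m = word_mat Z n"
  have m: "m w \<in> carrier_mat n n" for w using Z by (simp add: m_def)
  have app: "y * m (u @ w) = y * m u * m w" if "y \<in> carrier_mat 1 n" for y u w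
    using word_mat_append[OF Z] assoc_mult_mat[OF that m m] by (simp add: m_def)
  define e :: "nat \<Rightarrow> 'a mat" where "e r = mat 1 n (\<lambda>(_, c). if c = r then 1 else 0)" for r
  have e: "e r \<in> carrier_mat 1 n" for r by (simp add: e_def)
  have "\<exists>N. \<forall>r<n. \<forall>z\<in>lists {..<s}. N \<le> length z \<longrightarrow> e r * m z = 0\<^sub>m 1 n"
  proof -
    have "\<exists>N. \<forall>z\<in>lists {..<s}. length z = N \<longrightarrow> e r * m z = 0\<^sub>m 1 n" for r
    proof (rule ccontr)
      assume "\<not> ?thesis"
      then have "\<exists>w\<in>lists {..<s}. length w = N \<and> e r * word_mat Z n w \<noteq> 0\<^sub>m 1 n" for N
        unfolding m_def by blast
      from surviving_word_eigenvalue[OF Z e this] show False using nil by blast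
    qed
    then have "\<forall>r. \<exists>N. \<forall>z\<in>lists {..<s}. length z = N \<longrightarrow> e r * m z = 0\<^sub>m 1 n" by blast
    from choice[OF this] obtain N where N: "\<forall>r. \<forall>z\<in>lists {..<s}. length z = N r \<longrightarrow> e r * m z = 0\<^sub>m 1 n"
      by (elim exE)
    show ?thesis
    proof (intro exI[of _ "\<Sum>r<n. N r"] allI impI ballI)
      fix r z assume rz: "r < n" "z \<in> lists {..<s}" "(\<Sum>r<n. N r) \<le> length z"
      have "N r \<le> (\<Sum>r<n. N r)" using rz(1) by (intro member_le_sum) auto
      then have "e r * m (take (N r) z) = 0\<^sub>m 1 n" using rz by (intro N[rule_format]) (auto dest: in_set_takeD)
      then show "e r * m z = 0\<^sub>m 1 n"
        using app[OF e, of r "take (N r) z" "drop (N r) z"] left_mult_zero_mat[OF m] by simp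
    qed
  qed
  then obtain N where N: "\<And>r z. r < n \<Longrightarrow> z \<in> lists {..<s} \<Longrightarrow> N \<le> length z \<Longrightarrow> e r * m z = 0\<^sub>m 1 n" by blast
  have mz: "m z = 0\<^sub>m n n" if "z \<in> lists {..<s}" "N \<le> length z" for z
    using mat_row_ne_0[OF m, of z] N[OF _ that] by (auto simp: e_def)
  show ?thesis
  proof (rule ccontr)
    assume "word_mat Z n w \<noteq> 0\<^sub>m n n"
    then obtain r where r: "r < n" "e r * m w \<noteq> 0\<^sub>m 1 n" using mat_row_ne_0[OF m[of w]] by (auto simp: e_def m_def)
    define vv where "vv i = e r * m (take i w)" for i
    have vv: "vv i \<in> carrier_mat 1 n" for i unfolding vv_def by (rule mult_carrier_mat[OF e m])
    obtain \<alpha> where \<alpha>: "\<exists>i\<le>n. \<alpha> i \<noteq> 0" "\<forall>c<n. (\<Sum>i\<le>n. \<alpha> i * vv i $$ (0, c)) = 0"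
      using linear_relation[of n "\<lambda>i c. vv i $$ (0, c)"] by blast
    define i where "i = (LEAST i. i \<le> n \<and> \<alpha> i \<noteq> 0)"
    have i: "i \<le> n" "\<alpha> i \<noteq> 0" using LeastI_ex[of "\<lambda>i. i \<le> n \<and> \<alpha> i \<noteq> 0"] \<alpha>(1) by (auto simp: i_def)
    have imin: "\<alpha> j = 0" if "j < i" for j
      using not_less_Least[of j "\<lambda>i. i \<le> n \<and> \<alpha> i \<noteq> 0"] that i by (auto simp: i_def)
    \<comment> \<open>Every later prefix of w is \<open>vv i\<close> followed by at least one more
      letter. If \<open>vv i\<close> kills all words of length at least L, the later prefixes
      therefore kill words of length at least L - 1, and by the relation so does
      \<open>vv i\<close>.\<close>
    have down: "\<forall>z\<in>lists {..<s}. N - k \<le> length z \<longrightarrow> vv i * m z = 0\<^sub>m 1 n" for k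
    proof (induction k)
      case 0
      then show ?case using mz right_mult_zero_mat[OF vv] by auto
    next
      case (Suc k)
      show ?case
      proof (intro ballI impI)
        fix z assume z: "z \<in> lists {..<s}" "N - Suc k \<le> length z"
        have zero: "vv j * m z = 0\<^sub>m 1 n" if j: "i < j" "j \<le> n" for j
        proof -
          have "take j w = take i w @ take (j - i) (drop i w)" using j w by (metis add_diff_inverse_nat less_imp_not_less take_add)
          then have "vv j * m z = vv i * m (take (j - i) (drop i w)) * m z"
            using app[OF e] by (simp add: vv_def)
          also have "\<dots> = vv i * m (take (j - i) (drop i w) @ z)" using app[OF vv] by simp
          also have "\<dots> = 0\<^sub>m 1 n"
          proof (rule Suc.IH[rule_format])
            show "take (j - i) (drop i w) @ z \<in> lists {..<s}" using w z by (auto dest!: in_set_takeD in_set_dropD)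
            show "N - k \<le> length (take (j - i) (drop i w) @ z)" using j w z by simp
          qed
          finally show ?thesis .
        qed
        have "(vv i * m z) $$ (0, c) = 0" if c: "c < n" for c
        proof -
          have "0 = (\<Sum>j\<le>n. \<alpha> j * (vv j * m z) $$ (0, c))" using row_relation_mult[OF vv m c \<alpha>(2)] by simp
          also have "\<dots> = (\<Sum>j\<in>{i}. \<alpha> j * (vv j * m z) $$ (0, c))"
          proof (rule sum.mono_neutral_right)
            show "\<forall>j\<in>{..n} - {i}. \<alpha> j * (vv j * m z) $$ (0, c) = 0"
            proof
              fix j assume "j \<in> {..n} - {i}"
              then show "\<alpha> j * (vv j * m z) $$ (0, c) = 0"
                using zero[of j] imin[of j] c by (cases "j < i") auto
            qed
          qed (use i in auto)
          finally show ?thesis using i by simp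
        qed
        then show "vv i * m z = 0\<^sub>m 1 n" using row_eq_0_iff[OF mult_carrier_mat[OF vv m]] by blast
      qed
    qed
    have "e r * m w = vv i * m (drop i w)" using app[OF e, of r "take i w" "drop i w"] by (simp add: vv_def)
    moreover have "drop i w \<in> lists {..<s}" using w by (auto dest!: in_set_dropD)
    ultimately show False using down[of N] r(2) by auto
  qed
qed

section \<open>Prime ideals avoiding a multiplicative family\<close>

lemma ideal_on_extend:
  assumes U: "subring_on U" and I: "ideal_on U I" and x: "x \<in> U"
  shows "ideal_on U {m + u * x | m u. m \<in> I \<and> u \<in> U}"
  unfolding ideal_on_def
proof (intro conjI ballI)
  show "{m + u * x | m u. m \<in> I \<and> u \<in> U} \<subseteq> U"
    using ideal_onD(1)[OF I] x subring_onD(3,4)[OF U] by blast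
  have "0 = 0 + 0 * x" by simp
  then show "0 \<in> {m + u * x | m u. m \<in> I \<and> u \<in> U}" using ideal_onD(2)[OF I] subring_onD(1)[OF U] by blast
  fix y assume "y \<in> {m + u * x | m u. m \<in> I \<and> u \<in> U}"
  then obtain m u where y: "y = m + u * x" "m \<in> I" "u \<in> U" by blast
  { fix z assume "z \<in> {m + u * x | m u. m \<in> I \<and> u \<in> U}"
    then obtain m' u' where z: "z = m' + u' * x" "m' \<in> I" "u' \<in> U" by blast
    have "y + z = (m + m') + (u + u') * x" using y z by (simp add: algebra_simps)
    then show "y + z \<in> {m + u * x | m u. m \<in> I \<and> u \<in> U}"
      using y z ideal_onD(3)[OF I] subring_onD(3)[OF U] by blast }
  { fix z assume z: "z \<in> U"
    have "z * y = z * m + (z * u) * x" using y by (simp add: algebra_simps)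
    then show "z * y \<in> {m + u * x | m u. m \<in> I \<and> u \<in> U}"
      using y z ideal_onD(4)[OF I] subring_onD(4)[OF U] by blast }
qed

text \<open>For \<open>E N = {1}\<close> this is the existence of maximal ideals.\<close>

lemma prime_avoiding:
  fixes E :: "nat \<Rightarrow> 'r::comm_ring_1 set"
  assumes U: "subring_on U" and I0: "ideal_on U I0" and fin: "\<And>N. finite (E N)" "\<And>N. E N \<subseteq> U"
    and avoid: "\<And>N. \<not> E N \<subseteq> I0"
    and mult: "\<And>N N'. \<exists>N''. \<forall>I. ideal_on U I \<longrightarrow> (\<forall>a\<in>E N. \<forall>b\<in>E N'. a * b \<in> I) \<longrightarrow> E N'' \<subseteq> I"
  shows "\<exists>P. prime_on U P \<and> I0 \<subseteq> P \<and> (\<forall>N. \<not> E N \<subseteq> P)"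
proof -
  define \<A> where "\<A> = {I. ideal_on U I \<and> I0 \<subseteq> I \<and> (\<forall>N. \<not> E N \<subseteq> I)}"
  have "\<exists>M\<in>\<A>. \<forall>X'\<in>\<A>. M \<subseteq> X' \<longrightarrow> X' = M"
  proof (rule subset_Zorn_nonempty)
    show "\<A> \<noteq> {}" using I0 avoid by (auto simp: \<A>_def)
    fix \<C> assume C: "\<C> \<noteq> {}" "subset.chain \<A> \<C>"
    have s: "R \<in> \<A>" if "R \<in> \<C>" for R using that C by (auto simp: subset_chain_def)
    then have si: "ideal_on U R" if "R \<in> \<C>" for R using that by (auto simp: \<A>_def)
    obtain R0 where R0: "R0 \<in> \<C>" using C by blast
    have "ideal_on U (\<Union>\<C>)" unfolding ideal_on_def
    proof (intro conjI ballI)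
      show "\<Union>\<C> \<subseteq> U" using ideal_onD(1)[OF si] by blast
      show "0 \<in> \<Union>\<C>" using R0 ideal_onD(2)[OF si[OF R0]] by blast
      fix x assume "x \<in> \<Union>\<C>"
      then obtain R where R: "R \<in> \<C>" "x \<in> R" by blast
      { fix u assume "u \<in> U"
        then show "u * x \<in> \<Union>\<C>" using R ideal_onD(4)[OF si[OF R(1)]] by blast }
      { fix y assume "y \<in> \<Union>\<C>"
        then obtain S where S: "S \<in> \<C>" "y \<in> S" by blast
        have "R \<subseteq> S \<or> S \<subseteq> R" using C(2) R S by (simp add: subset_chain_def)
        then show "x + y \<in> \<Union>\<C>"
        proof
          assume "R \<subseteq> S"
          then show ?thesis using R S ideal_onD(3)[OF si[OF S(1)]] by blast
        next
          assume "S \<subseteq> R"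
          then show ?thesis using R S ideal_onD(3)[OF si[OF R(1)]] by blast
        qed }
    qed
    \<comment> \<open>Finiteness of \<open>E N\<close> is what carries avoidance over to unions of
      chains.\<close>
    moreover have "\<not> E N \<subseteq> \<Union>\<C>" for N
    proof
      assume "E N \<subseteq> \<Union>\<C>"
      from finite_subset_Union_chain[OF fin(1) this C] obtain R where "R \<in> \<C>" "E N \<subseteq> R" .
      then show False using s by (auto simp: \<A>_def)
    qed
    ultimately show "\<Union>\<C> \<in> \<A>" using s[OF R0] R0 by (auto simp: \<A>_def)
  qed
  then obtain M where MA: "M \<in> \<A>" and max: "\<forall>X'\<in>\<A>. M \<subseteq> X' \<longrightarrow> X' = M" by (elim bexE)
  have M: "ideal_on U M" "I0 \<subseteq> M" "\<forall>N. \<not> E N \<subseteq> M" using MA by (auto simp: \<A>_def)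
  have big: "\<exists>N. E N \<subseteq> {m + u * x | m u. m \<in> M \<and> u \<in> U}" if x: "x \<in> U" "x \<notin> M" for x
  proof (rule ccontr)
    let ?I = "{m + u * x | m u. m \<in> M \<and> u \<in> U}"
    assume "\<not> ?thesis"
    moreover have sub: "M \<subseteq> ?I"
    proof
      fix m assume "m \<in> M"
      moreover have "m = m + 0 * x" by simp
      ultimately show "m \<in> ?I" using subring_onD(1)[OF U] by blast
    qed
    ultimately have "?I \<in> \<A>" using ideal_on_extend[OF U M(1) x(1)] M(2) by (auto simp: \<A>_def)
    then have "?I = M" using max sub by blast
    moreover have "x = 0 + 1 * x" by simp
    then have "x \<in> ?I" using ideal_onD(2)[OF M(1)] subring_onD(2)[OF U] by blast
    ultimately show False using x by blast
  qed
  have "prime_on U M" unfolding prime_on_def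
  proof (intro conjI ballI impI M(1))
    show "1 \<notin> M"
    proof
      assume "1 \<in> M"
      then have "u \<in> M" if "u \<in> U" for u using ideal_onD(4)[OF M(1) that] by force
      then show False using M(3) fin(2) by blast
    qed
    fix x y assume xy: "x \<in> U" "y \<in> U" "x * y \<in> M"
    show "x \<in> M \<or> y \<in> M"
    proof (rule ccontr)
      assume "\<not> ?thesis"
      then have n: "x \<notin> M" "y \<notin> M" by auto
      from big[OF xy(1) n(1)] obtain N where N: "E N \<subseteq> {m + u * x | m u. m \<in> M \<and> u \<in> U}" by blast
      from big[OF xy(2) n(2)] obtain N' where N': "E N' \<subseteq> {m + u * y | m u. m \<in> M \<and> u \<in> U}" by blast
      \<comment> \<open>The product of the two enlarged ideals lies in \<open>M\<close> because x y
        does. By \<open>mult\<close> the maximal ideal \<open>M\<close> would then contain some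
        \<open>E N''\<close>.\<close>
      have "a * b \<in> M" if ab: "a \<in> E N" "b \<in> E N'" for a b
      proof -
        obtain m u where a: "a = m + u * x" "m \<in> M" "u \<in> U" using N ab by blast
        obtain m' u' where b: "b = m' + u' * y" "m' \<in> M" "u' \<in> U" using N' ab by blast
        have mU: "m \<in> U" using a ideal_onD(1)[OF M(1)] by blast
        have "a * b = m * m' + ((u' * y) * m + ((u * x) * m' + (u * u') * (x * y)))"
          using a b by (simp add: algebra_simps)
        also have "\<dots> \<in> M"
          by (intro ideal_onD(3)[OF M(1)] ideal_onD(4)[OF M(1)] subring_onD(4)[OF U] a b xy mU)
        finally show ?thesis .
      qed
      then show False using mult[of N N'] M(1,3) by blast
    qed
  qed
  then show ?thesis using M by blast
qed

lemma prime_ideal_exists: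
  assumes "subring_on U" "ideal_on U I" "1 \<notin> I"
  shows "\<exists>P. prime_on U P \<and> I \<subseteq> P"
  using prime_avoiding[OF assms(1,2), of "\<lambda>_. {1}"] assms(3) subring_onD(2)[OF assms(1)] by auto

section \<open>Evaluation of polynomials in several variables\<close>

definition mono_eval :: "('i \<Rightarrow> 'b::comm_ring_1) \<Rightarrow> ('i \<Rightarrow>\<^sub>0 nat) \<Rightarrow> 'b" where
  "mono_eval z m = (\<Prod>i\<in>Poly_Mapping.keys m. z i ^ Poly_Mapping.lookup m i)"

definition mpoly_eval :: "('a::comm_ring_1 \<Rightarrow> 'b::comm_ring_1) \<Rightarrow> ('i \<Rightarrow> 'b) \<Rightarrow> (('i \<Rightarrow>\<^sub>0 nat) \<Rightarrow>\<^sub>0 'a) \<Rightarrow> 'b" where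
  "mpoly_eval h z p = (\<Sum>m\<in>Poly_Mapping.keys p. h (Poly_Mapping.lookup p m) * mono_eval z m)"

lemma mono_eval_superset:
  assumes "finite S" "Poly_Mapping.keys m \<subseteq> S"
  shows "mono_eval z m = (\<Prod>i\<in>S. z i ^ Poly_Mapping.lookup m i)"
  unfolding mono_eval_def using assms by (intro prod.mono_neutral_left) (auto simp: in_keys_iff)

lemma mono_eval_add: "mono_eval z (m + m') = mono_eval z m * mono_eval z m'"
proof -
  let ?S = "Poly_Mapping.keys m \<union> Poly_Mapping.keys m'"
  have "mono_eval z (m + m') = (\<Prod>i\<in>?S. z i ^ Poly_Mapping.lookup (m + m') i)"
    using keys_add[of m m'] by (intro mono_eval_superset) auto
  also have "\<dots> = (\<Prod>i\<in>?S. z i ^ Poly_Mapping.lookup m i) * (\<Prod>i\<in>?S. z i ^ Poly_Mapping.lookup m' i)"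
    by (simp add: lookup_add power_add prod.distrib)
  also have "\<dots> = mono_eval z m * mono_eval z m'"
    using mono_eval_superset[of ?S m z] mono_eval_superset[of ?S m' z] by simp
  finally show ?thesis .
qed

lemma mpoly_eval_single:
  assumes "h 0 = 0"
  shows "mpoly_eval h z (Poly_Mapping.single m a) = h a * mono_eval z m"
  using assms by (auto simp: mpoly_eval_def)

lemma comm_ring_hom_mpoly_eval:
  assumes "comm_ring_hom h"
  shows "comm_ring_hom (mpoly_eval h z)"
proof -
  interpret h: comm_ring_hom h by fact
  have single: "mpoly_eval h z (Poly_Mapping.single m a) = h a * mono_eval z m" for m a
    by (rule mpoly_eval_single) simp
  have add: "mpoly_eval h z (p + q) = mpoly_eval h z p + mpoly_eval h z q" for p q
    unfolding mpoly_eval_def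
    by (rule setsum_keys_plus_distrib) (auto simp: h.hom_add algebra_simps)
  have mult: "mpoly_eval h z (p * q) = mpoly_eval h z p * mpoly_eval h z q" for p q
  proof (induction p rule: poly_mapping_single_sum_induct)
    case (single m a)
    show ?case
    proof (induction q rule: poly_mapping_single_sum_induct)
      case (single m' a')
      show ?case
        by (simp add: mult_single \<open>\<And>m a. mpoly_eval h z (Poly_Mapping.single m a) = h a * mono_eval z m\<close>
            h.hom_mult mono_eval_add mult_ac)
    next
      case (sum q1 q2)
      then show ?case by (simp add: distrib_left add)
    qed
  next
    case (sum p1 p2)
    then show ?case by (simp add: distrib_right add)
  qed
  show ?thesis
  proof
    show "mpoly_eval h z 1 = 1" using single[of 0 1] by (simp add: mono_eval_def h.hom_one)
    show "mpoly_eval h z 0 = 0" by (simp add: mpoly_eval_def)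
  qed (rule add mult)+
qed

definition mvar :: "'i \<Rightarrow> ('i \<Rightarrow>\<^sub>0 nat) \<Rightarrow>\<^sub>0 'a::comm_ring_1" where
  "mvar i = Poly_Mapping.single (Poly_Mapping.single i 1) 1"

lemma mpoly_eval_mvar: "comm_ring_hom h \<Longrightarrow> mpoly_eval h z (mvar i) = z i"
proof -
  assume "comm_ring_hom h"
  then interpret h: comm_ring_hom h .
  show ?thesis unfolding mvar_def by (subst mpoly_eval_single) (auto simp: mono_eval_def h.hom_one)
qed

lemma mpoly_eval_const: "comm_ring_hom h \<Longrightarrow> mpoly_eval h z (Poly_Mapping.single 0 a) = h a"
proof -
  assume "comm_ring_hom h"
  then interpret h: comm_ring_hom h .
  show ?thesis by (subst mpoly_eval_single) (auto simp: mono_eval_def)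
qed

lemma comm_ring_hom_imp_hom_on: "comm_ring_hom h \<Longrightarrow> hom_on A h"
proof -
  assume "comm_ring_hom h"
  then interpret h: comm_ring_hom h .
  show ?thesis by (simp add: hom_on_def h.hom_add h.hom_mult h.hom_one)
qed

section \<open>Generic matrices and their specializations\<close>

text \<open>Generic matrices over an arbitrary coefficient ring. Besides k(v) the proof uses k[v],
  because polynomials over k[v] can be specialised at points over an extension of k by choosing a
  value of v.\<close>

definition gen_mat :: "nat \<Rightarrow> nat \<Rightarrow> ((nat \<times> nat \<times> nat \<Rightarrow>\<^sub>0 nat) \<Rightarrow>\<^sub>0 'a::comm_ring_1) mat" where
  "gen_mat n l = mat n n (\<lambda>(i, j). mvar (i, j, l))"

definition point_mat :: "nat \<Rightarrow> (nat \<times> nat \<times> nat \<Rightarrow> 'b) \<Rightarrow> nat \<Rightarrow> 'b mat" where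
  "point_mat n z l = mat n n (\<lambda>(i, j). z (i, j, l))"

lemma gen_mat_carrier [simp]: "gen_mat n l \<in> carrier_mat n n"
  and point_mat_carrier [simp]: "point_mat n z l \<in> carrier_mat n n"
  by (simp_all add: gen_mat_def point_mat_def)

lemma generic_mat_eq_gen_mat: "generic_mat n = gen_mat n"
  by (rule ext) (simp add: generic_mat_def gen_mat_def x_C_def mvar_def)

lemma word_prod_eq_word_mat: "word_prod n w = word_mat (gen_mat n) n w"
  by (simp add: word_prod_def word_mat_def generic_mat_eq_gen_mat)

lemma map_mat_word_mat:
  assumes "comm_ring_hom h" "\<And>l. Z l \<in> carrier_mat n n"
  shows "map_mat h (word_mat Z n w) = word_mat (\<lambda>l. map_mat h (Z l)) n w"
proof -
  interpret h: comm_ring_hom h by fact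
  show ?thesis
  proof (induction w)
    case Nil
    show ?case by (simp add: h.mat_hom_one)
  next
    case (Cons l w)
    then show ?case using h.mat_hom_mult[OF assms(2) word_mat_carrier[of Z n w]] assms(2) by simp
  qed
qed

lemma map_mat_gen_mat: "comm_ring_hom h \<Longrightarrow> map_mat (mpoly_eval h z) (gen_mat n l) = point_mat n z l"
  by (intro eq_matI) (auto simp: gen_mat_def point_mat_def mpoly_eval_mvar)

lemma map_mat_gen_word:
  assumes "comm_ring_hom h"
  shows "map_mat (mpoly_eval h z) (word_mat (gen_mat n) n w) = word_mat (point_mat n z) n w"
  using map_mat_word_mat[OF comm_ring_hom_mpoly_eval[OF assms], of "gen_mat n" n z w]
  by (simp add: map_mat_gen_mat[OF assms])

lemma eval_char_coeff:
  assumes "comm_ring_hom h"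
  shows "mpoly_eval h z (coeff (char_poly (word_mat (gen_mat n) n w)) i) = coeff (char_poly (word_mat (point_mat n z) n w)) i"
proof -
  interpret h: comm_ring_hom "mpoly_eval h z" by (rule comm_ring_hom_mpoly_eval[OF assms])
  have "word_mat (gen_mat n) n w \<in> carrier_mat n n" by simp
  from h.char_poly_hom[OF this] show ?thesis by (simp add: map_mat_gen_word[OF assms] h.coeff_map_poly_hom)
qed

section \<open>Valuation rings\<close>

definition valuation_ring :: "'a::field set \<Rightarrow> bool" where
  "valuation_ring V \<longleftrightarrow> subring_on V \<and> (\<forall>y. y \<in> V \<or> inverse y \<in> V)"

text \<open>If the inverse of c = 1 - b/v were missing from \<open>V\<close>, adjoining it would
  bring in v, so that v c^d lies in \<open>V\<close> for some d. The identity v c^k = v c^(k+1) + b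
  c^k strips off the powers of c one at a time and puts v itself into \<open>V\<close>.\<close>

lemma inverse_one_minus_in_maximal:
  fixes v :: "'a::field"
  assumes V: "subring_on V" and t: "inverse v \<in> V" and v: "v \<notin> V" and b: "b \<in> V"
    and max: "\<And>R. subring_on R \<Longrightarrow> V \<subseteq> R \<Longrightarrow> v \<notin> R \<Longrightarrow> R = V"
  shows "1 - inverse v * b \<noteq> 0" "inverse (1 - inverse v * b) \<in> V"
proof -
  have v0: "v \<noteq> 0" using v subring_onD(1)[OF V] by auto
  define c where "c = 1 - inverse v * b"
  have cV: "c \<in> V" unfolding c_def using t b by (intro subring_onD[OF V])
  show c0: "1 - inverse v * b \<noteq> 0"
  proof
    assume "1 - inverse v * b = 0"
    then have "b = v" using v0 by (simp add: field_simps)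
    with v b show False by simp
  qed
  show "inverse (1 - inverse v * b) \<in> V"
  proof (rule ccontr)
    assume n: "inverse (1 - inverse v * b) \<notin> V"
    have "v \<in> adjoin V (inverse c)"
      using max[OF subring_on_adjoin[OF V] adjoin_base[OF V], of "inverse c"] adjoin_gen[OF V, of "inverse c"] n
      by (auto simp: c_def)
    then obtain q where q: "q \<in> polys_over V" "v = poly q (inverse c)" by (auto simp: adjoin_def)
    have "v * c ^ degree q = (\<Sum>i\<le>degree q. coeff q i * c ^ (degree q - i))"
    proof -
      have "inverse c ^ i * c ^ degree q = c ^ (degree q - i)" if "i \<le> degree q" for i
        using that c0 by (simp add: c_def power_diff field_simps)
      then show ?thesis unfolding q(2) poly_altdef by (simp add: sum_distrib_right mult.assoc)
    qed
    also have "\<dots> \<in> V"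
      using q cV by (intro subring_on_sum[OF V] subring_onD(4)[OF V] subring_on_power[OF V]) (auto dest: polys_overD)
    finally have "v * c ^ degree q \<in> V" .
    moreover have "v \<in> V" if "v * c ^ k \<in> V" for k
      using that
    proof (induction k)
      case (Suc k)
      have "v * c ^ k = v * c ^ Suc k + b * c ^ k" using v0 by (simp add: c_def algebra_simps)
      also have "\<dots> \<in> V"
        by (rule subring_onD(3)[OF V Suc.prems subring_onD(4)[OF V b subring_on_power[OF V cV]]])
      finally show ?case by (rule Suc.IH)
    qed simp
    ultimately show False using v by blast
  qed
qed

text \<open>Divide the expression of v in 1/y by v. By the previous lemma the constant term leaves a
  unit c, and multiplying by y^(degree p) expresses this power of y by smaller powers. Substituting
  into the top term of p contradicts its minimal degree.\<close>

lemma valuation_ring_degree_reduction: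
  fixes v :: "'a::field"
  assumes V: "subring_on V" and t: "inverse v \<in> V" and v: "v \<notin> V" and y: "y \<noteq> 0"
    and max: "\<And>R. subring_on R \<Longrightarrow> V \<subseteq> R \<Longrightarrow> v \<notin> R \<Longrightarrow> R = V"
    and p: "p \<in> polys_over V" "poly p y = v"
    and pmin: "\<And>p'. p' \<in> polys_over V \<Longrightarrow> poly p' y = v \<Longrightarrow> degree p \<le> degree p'"
    and q: "q \<in> polys_over V" "poly q (inverse y) = v" and le: "degree q \<le> degree p"
  shows False
proof -
  note cl = polys_over_closed[OF V]
  have v0: "v \<noteq> 0" using v subring_onD(1)[OF V] by auto
  define P where "P = degree p"
  define c where "c = 1 - inverse v * coeff q 0"
  have c: "c \<noteq> 0" "inverse c \<in> V"
    using inverse_one_minus_in_maximal[OF V t v polys_overD[OF q(1)] max] by (auto simp: c_def)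
  have P0: "P > 0"
  proof (rule Nat.gr0I)
    assume "P = 0"
    then obtain a where "p = [:a:]" by (auto simp: P_def elim: degree_eq_zeroE)
    then show False using p v polys_overD[OF p(1), of 0] by simp
  qed
  define r where "r = (\<Sum>i\<in>{1..degree q}. monom (inverse v * coeff q i * inverse c) (P - i))"
  have r: "r \<in> polys_over V" unfolding r_def
    using t c q by (intro subring_on_sum[OF subring_on_polys_over[OF V]] cl subring_onD(4)[OF V]) (auto dest: polys_overD)
  have "inverse v * poly q (inverse y) = 1" using q v0 by simp
  then have "1 = (\<Sum>i\<le>degree q. inverse v * coeff q i * inverse y ^ i)"
    unfolding poly_altdef sum_distrib_left by (simp add: mult.assoc)
  also have "{..degree q} = insert 0 {1..degree q}" by auto
  finally have "1 = inverse v * coeff q 0 + (\<Sum>i\<in>{1..degree q}. inverse v * coeff q i * inverse y ^ i)"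
    by simp
  then have "c = (\<Sum>i\<in>{1..degree q}. inverse v * coeff q i * inverse y ^ i)" 
    unfolding c_def by (simp add: algebra_simps)
  then have "1 = inverse c * (\<Sum>i\<in>{1..degree q}. inverse v * coeff q i * inverse y ^ i)" using c by (metis left_inverse)
  then have "y ^ P = inverse c * (\<Sum>i\<in>{1..degree q}. inverse v * coeff q i * inverse y ^ i) * y ^ P" by simp
  also have "\<dots> = poly r y"
  proof -
    have "inverse y ^ i * y ^ P = y ^ (P - i)" if "i \<le> P" for i
      using that y by (simp add: power_diff field_simps)
    then have eq: "inverse c * (inverse v * coeff q i * inverse y ^ i) * y ^ P = inverse v * coeff q i * inverse c * y ^ (P - i)" if "i \<in> {1..degree q}" for i
      using that le by (simp add: P_def mult.assoc mult.left_commute)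
    show ?thesis unfolding r_def poly_sum poly_monom sum_distrib_left sum_distrib_right
      by (rule sum.cong[OF refl]) (rule eq)
  qed
  finally have yr: "y ^ P = poly r y" .
  define p' where "p' = p - monom (lead_coeff p) P + smult (lead_coeff p) r"
  have "p' \<in> polys_over V" unfolding p'_def using p r by (intro cl) (auto dest: polys_overD)
  moreover have "poly p' y = v" using p(2) yr by (simp add: p'_def poly_monom)
  moreover have "coeff p' i = 0" if "P \<le> i" for i
  proof -
    have "coeff r i = 0" unfolding r_def coeff_sum using that P0 by (intro sum.neutral) auto
    then show ?thesis using that by (cases "i = P") (auto simp: p'_def P_def coeff_eq_0)
  qed
  then have "degree p' < P" using P0 by (metis degree_0 leading_coeff_0_iff not_le)
  ultimately show False using pmin[of p'] by (simp add: P_def)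
qed

text \<open>Chevalley's extension theorem, with the omission of v in the role usually played by a
  prime ideal. If neither y nor 1/y lies in a maximal such ring \<open>V\<close>, then v lies in
  both V[y] and V[1/y]; take expressions of least degree and reduce the one of larger degree.
  Exchanging y and 1/y covers both cases.\<close>

theorem valuation_ring_exists:
  fixes v :: "'a::field"
  assumes A: "subring_on A" "inverse v \<in> A" "v \<notin> A"
  shows "\<exists>V. valuation_ring V \<and> A \<subseteq> V \<and> v \<notin> V"
proof -
  define \<A> where "\<A> = {R. subring_on R \<and> A \<subseteq> R \<and> v \<notin> R}"
  have "\<exists>V\<in>\<A>. \<forall>R\<in>\<A>. V \<subseteq> R \<longrightarrow> R = V"
  proof (rule subset_Zorn_nonempty)
    show "\<A> \<noteq> {}" using A by (auto simp: \<A>_def)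
    fix \<C> assume C: "\<C> \<noteq> {}" "subset.chain \<A> \<C>"
    have s: "R \<in> \<A>" if "R \<in> \<C>" for R using that C by (auto simp: subset_chain_def)
    have two: "\<exists>R\<in>\<C>. x \<in> R \<and> y \<in> R" if "x \<in> \<Union>\<C>" "y \<in> \<Union>\<C>" for x y
    proof -
      obtain R S where RS: "R \<in> \<C>" "x \<in> R" "S \<in> \<C>" "y \<in> S" using \<open>x \<in> \<Union>\<C>\<close> \<open>y \<in> \<Union>\<C>\<close> by (elim UnionE)
      then have "R \<subseteq> S \<or> S \<subseteq> R" using C(2) by (simp add: subset_chain_def)
      then show ?thesis using RS by (elim disjE) (blast intro: bexI[of _ S] bexI[of _ R])+
    qed
    obtain R0 where R0: "R0 \<in> \<C>" using C by blast
    have "subring_on (\<Union>\<C>)" unfolding subring_on_def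
    proof (intro conjI ballI)
      show "0 \<in> \<Union>\<C>" "1 \<in> \<Union>\<C>" using R0 s[OF R0] subring_onD(1,2)[of R0] by (auto simp: \<A>_def)
      fix x assume x: "x \<in> \<Union>\<C>"
      then obtain R where R: "R \<in> \<C>" "x \<in> R" by blast
      then have "- x \<in> R" using s[OF R(1)] subring_onD(5) by (auto simp: \<A>_def)
      then show "- x \<in> \<Union>\<C>" using R by blast
      fix y assume y: "y \<in> \<Union>\<C>"
      from two[OF x y] obtain R where "R \<in> \<C>" "x \<in> R" "y \<in> R" by blast
      moreover from this have "subring_on R" using s by (auto simp: \<A>_def)
      ultimately show "x + y \<in> \<Union>\<C>" "x * y \<in> \<Union>\<C>" using subring_onD(3,4) by blast+
    qed
    then show "\<Union>\<C> \<in> \<A>" using s R0 by (auto simp: \<A>_def)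
  qed
  then obtain V where M: "V \<in> \<A>" "\<forall>R\<in>\<A>. V \<subseteq> R \<longrightarrow> R = V" by (elim bexE)
  then have V: "subring_on V" "A \<subseteq> V" "v \<notin> V" by (simp_all add: \<A>_def)
  have max: "R = V" if "subring_on R" "V \<subseteq> R" "v \<notin> R" for R
  proof -
    have "A \<subseteq> R" using V(2) that(2) by (rule subset_trans)
    then show ?thesis using M(2) that by (simp add: \<A>_def)
  qed
  have t: "inverse v \<in> V" using A V by auto
  have mn: "\<exists>p. p \<in> polys_over V \<and> poly p y = v \<and> (\<forall>p'. p' \<in> polys_over V \<and> poly p' y = v \<longrightarrow> degree p \<le> degree p')"
    if "y \<notin> V" for y
  proof -
    have "v \<in> adjoin V y"
      using max[OF subring_on_adjoin[OF V(1)] adjoin_base[OF V(1)], of y] adjoin_gen[OF V(1), of y] that by auto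
    then obtain q where "q \<in> polys_over V \<and> poly q y = v" by (auto simp: adjoin_def)
    from ex_has_least_nat[of "\<lambda>q. q \<in> polys_over V \<and> poly q y = v", OF this, of degree] show ?thesis by blast
  qed
  have "y \<in> V \<or> inverse y \<in> V" for y
  proof (rule ccontr)
    assume "\<not> ?thesis"
    then have n: "y \<notin> V" "inverse y \<notin> V" by auto
    have y0: "y \<noteq> 0" using n subring_onD(1)[OF V(1)] by auto
    from mn[OF n(1)] obtain p where p: "p \<in> polys_over V" "poly p y = v"
      "\<forall>p'. p' \<in> polys_over V \<and> poly p' y = v \<longrightarrow> degree p \<le> degree p'" by blast
    from mn[OF n(2)] obtain q where q: "q \<in> polys_over V" "poly q (inverse y) = v"
      "\<forall>p'. p' \<in> polys_over V \<and> poly p' (inverse y) = v \<longrightarrow> degree q \<le> degree p'" by blast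
    show False
    proof (cases "degree q \<le> degree p")
      case True
      show False
        by (rule valuation_ring_degree_reduction[OF V(1) t V(3) y0 max p(1,2) _ q(1,2) True]) (use p(3) in auto)
    next
      case False
      show False
        by (rule valuation_ring_degree_reduction[OF V(1) t V(3) _ max q(1,2) _ p(1), of ])
          (use q(3) p(2) y0 False in auto)
    qed
  qed
  then show ?thesis using V by (auto simp: valuation_ring_def)
qed

lemma valuation_ring_integrally_closed:
  assumes V: "valuation_ring V" and q: "q \<in> polys_over V" "lead_coeff q = 1" "poly q y = 0"
  shows "y \<in> V"
proof (rule ccontr)
  assume n: "y \<notin> V"
  have s: "subring_on V" using V by (simp add: valuation_ring_def)
  have y0: "y \<noteq> 0" using n subring_onD(1)[OF s] by auto
  have i: "inverse y \<in> V" using V n by (auto simp: valuation_ring_def)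
  obtain d where d: "degree q = Suc d"
    using q by (cases "degree q") (auto elim!: degree_eq_zeroE)
  have "0 = poly q y * inverse y ^ d" using q by simp
  also have "\<dots> = (\<Sum>i\<le>d. coeff q i * y ^ i * inverse y ^ d) + y ^ Suc d * inverse y ^ d"
    using q(2) d by (simp add: poly_altdef sum_distrib_right distrib_right)
  also have "y ^ Suc d * inverse y ^ d = y" using y0 by (simp add: field_simps)
  also have "(\<Sum>i\<le>d. coeff q i * y ^ i * inverse y ^ d) = (\<Sum>i\<le>d. coeff q i * inverse y ^ (d - i))"
    using y0 by (intro sum.cong) (auto simp: power_diff field_simps)
  finally have "y = - (\<Sum>i\<le>d. coeff q i * inverse y ^ (d - i))" by (simp add: eq_neg_iff_add_eq_0 add.commute)
  also have "\<dots> \<in> V" using q i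
    by (intro subring_onD(5)[OF s] subring_on_sum[OF s] subring_onD(4)[OF s] subring_on_power[OF s]) (auto dest: polys_overD)
  finally show False using n by simp
qed

text \<open>The element y is a root of the monic polynomial X^k - y^k over \<open>V\<close>.\<close>

lemma valuation_ring_power:
  assumes V: "valuation_ring V" and "0 < k" "y ^ k \<in> V"
  shows "y \<in> V"
proof -
  have s: "subring_on V" using V by (simp add: valuation_ring_def)
  let ?q = "monom 1 k + [:- (y ^ k):]"
  have "degree ?q = k" using assms by (subst degree_add_eq_left) (auto simp: degree_monom_eq)
  then have "lead_coeff ?q = 1" using assms(2) by (auto simp: coeff_pCons split: nat.split)
  moreover have "?q \<in> polys_over V"
    by (intro polys_over_closed(3,7,8)[OF s] subring_onD(2,5)[OF s] assms(3))
  moreover have "poly ?q y = 0" by (simp add: poly_monom)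
  ultimately show ?thesis using valuation_ring_integrally_closed[OF V] by blast
qed

section \<open>Balancing matrices over a valuation ring\<close>

text \<open>
  The columns of all \<open>p\<^sup>-\<^sup>|\<^sup>w\<^sup>| w(Z)\<close>, \<open>|w| < k\<close>, span a lattice that every \<open>Z\<^sub>l\<close> maps into
  its \<open>p\<close>-multiple. By Cramer's rule, \<open>n\<close> of these columns with determinant of greatest absolute value
  form a basis of the lattice.
\<close>

lemma balance_words:
  fixes Z :: "nat \<Rightarrow> 'a::field mat"
  assumes V: "valuation_ring V" and Z: "\<And>l. Z l \<in> carrier_mat n n" and p: "p \<noteq> 0" and k: "0 < k"
    and words: "\<And>w i j. w \<in> lists {..<s} \<Longrightarrow> length w = k \<Longrightarrow> i < n \<Longrightarrow> j < n \<Longrightarrow> word_mat Z n w $$ (i, j) / p ^ k \<in> V"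
  shows "\<exists>g\<in>carrier_mat n n. \<exists>g'\<in>carrier_mat n n. g * g' = 1\<^sub>m n \<and> g' * g = 1\<^sub>m n \<and>
    (\<forall>l<s. \<forall>i<n. \<forall>j<n. (g' * Z l * g) $$ (i, j) / p \<in> V)"
proof -
  have s: "subring_on V" using V by (simp add: valuation_ring_def)
  have m: "word_mat Z n w \<in> carrier_mat n n" for w using Z by simp
  define gv where "gv w j = vec n (\<lambda>i. word_mat Z n w $$ (i, j) / p ^ length w)" for w j
  define G where "G = {gv w j | w j. w \<in> lists {..<s} \<and> length w < k \<and> j < n}"
  have Gc: "y \<in> carrier_vec n" if "y \<in> G" for y using that by (auto simp: G_def gv_def)
  have "finite ({w. set w \<subseteq> {..<s} \<and> length w \<le> k} \<times> {..<n})"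
    by (intro finite_cartesian_product finite_lists_length_le) auto
  then have "finite ((\<lambda>(w, j). gv w j) ` ({w. set w \<subseteq> {..<s} \<and> length w \<le> k} \<times> {..<n}))" by (rule finite_imageI)
  moreover have "G \<subseteq> (\<lambda>(w, j). gv w j) ` ({w. set w \<subseteq> {..<s} \<and> length w \<le> k} \<times> {..<n})"
  proof
    fix y assume "y \<in> G"
    then obtain w j where "y = gv w j" "w \<in> lists {..<s}" "length w < k" "j < n" by (auto simp: G_def)
    then show "y \<in> (\<lambda>(w, j). gv w j) ` ({w. set w \<subseteq> {..<s} \<and> length w \<le> k} \<times> {..<n})"
      by (intro image_eqI[of _ _ "(w, j)"]) (auto simp: lists_eq_set)
  qed
  ultimately have fG: "finite G" by (rule finite_subset[rotated])
  define MM where "MM = mat_of_cols n ` {cs. set cs \<subseteq> G \<and> length cs = n}"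
  have fM: "finite MM" unfolding MM_def using finite_lists_length_eq[OF fG] by simp
  have GI: "gv w j \<in> G" if "w \<in> lists {..<s}" "length w < k" "j < n" for w j
    unfolding G_def using that by blast
  have unit: "unit_vec n j \<in> G" if "j < n" for j
  proof -
    have "unit_vec n j = gv [] j" using that by (intro eq_vecI) (auto simp: gv_def unit_vec_def)
    then show ?thesis using GI[of "[]" j] that k by simp
  qed
  \<comment> \<open>The empty word contributes the unit vectors. Hence the identity matrix competes,
    which forces the maximal determinant to be nonzero and makes \<open>g'\<close> integral.\<close>
  have one: "1\<^sub>m n \<in> MM" unfolding MM_def
  proof (rule image_eqI)
    show "1\<^sub>m n = mat_of_cols n (map (unit_vec n) [0..<n])"
      by (intro eq_matI) (auto simp: mat_of_cols_def unit_vec_def)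
  qed (auto simp: unit)
  have "\<exists>g\<in>MM. \<forall>h\<in>MM. \<exists>a\<in>V. det h = a * det g"
  proof (rule finite_max_preorder[OF fM, of "\<lambda>h g. \<exists>a\<in>V. det h = a * det g"])
    show "MM \<noteq> {}" using one by blast
    show "(\<exists>a\<in>V. det x = a * det y) \<or> (\<exists>a\<in>V. det y = a * det x)" for x y :: "'a mat"
    proof (cases "det x = 0 \<or> det y = 0")
      case True
      then show ?thesis using subring_onD(1)[OF s] by (metis mult_zero_left)
    next
      case False
      have "det x / det y \<in> V \<or> det y / det x \<in> V"
        using V unfolding valuation_ring_def by (metis inverse_divide)
      moreover have "det x = det x / det y * det y" "det y = det y / det x * det x" using False by auto
      ultimately show ?thesis by blast
    qed
    show "\<exists>a\<in>V. det x = a * det z" if "\<exists>a\<in>V. det x = a * det y" "\<exists>a\<in>V. det y = a * det z" for x y z :: "'a mat"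
      using that subring_onD(4)[OF s] by (metis mult.assoc)
  qed
  then obtain g where g: "g \<in> MM" "\<And>h. h \<in> MM \<Longrightarrow> \<exists>a\<in>V. det h = a * det g" by blast
  then obtain cs where cs: "set cs \<subseteq> G" "length cs = n" "g = mat_of_cols n cs" by (auto simp: MM_def)
  have gc: "g \<in> carrier_mat n n" using cs by auto
  have d: "det g \<noteq> 0" using g(2)[OF one] by auto
  define g' where "g' = inverse (det g) \<cdot>\<^sub>m adj_mat g"
  have g'c: "g' \<in> carrier_mat n n" using adj_mat(1)[OF gc] by (simp add: g'_def)
  have gg: "g * g' = 1\<^sub>m n" "g' * g = 1\<^sub>m n"
    using adj_mat[OF gc] d gc unfolding g'_def
    by (auto simp: mult_smult_distrib[OF gc adj_mat(1)[OF gc]] mult_smult_assoc_mat[OF adj_mat(1)[OF gc] gc] intro!: eq_matI)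
  \<comment> \<open>Coordinates with respect to g are quotients of determinants of two matrices in
    \<open>MM\<close>, and the denominator is the maximal one.\<close>
  have coord: "(g' *\<^sub>v y) $ i \<in> V" if y: "y \<in> G" and i: "i < n" for y i
  proof -
    have x: "g' *\<^sub>v y \<in> carrier_vec n" using g'c Gc[OF y] by simp
    have "g *\<^sub>v (g' *\<^sub>v y) = y" using Gc[OF y] gg by (simp flip: assoc_mult_mat_vec[OF gc g'c Gc[OF y]])
    then have "det (replace_col g y i) = (g' *\<^sub>v y) $ i * det g" using cramer_lemma_mat[OF gc x i] by simp
    moreover have "replace_col g y i \<in> MM" unfolding MM_def
    proof (rule image_eqI)
      show "replace_col g y i = mat_of_cols n (cs[i := y])"
        using cs i Gc[OF y] by (intro eq_matI) (auto simp: replace_col_def mat_of_cols_def nth_list_update)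
      show "cs[i := y] \<in> {cs. set cs \<subseteq> G \<and> length cs = n}"
        using cs y set_update_subset_insert[of cs i y] by auto
    qed
    ultimately show ?thesis using g(2)[of "replace_col g y i"] d by (metis mult_cancel_right)
  qed
  have g'V: "g' $$ (r, i) \<in> V" if "r < n" "i < n" for r i
  proof -
    have "(g' *\<^sub>v unit_vec n i) $ r = g' $$ (r, i)" using g'c that by simp
    then show ?thesis using coord[OF unit that(1), of i] that by simp
  qed
  have "(g' * Z l * g) $$ (i, j) / p \<in> V" if l: "l < s" and ij: "i < n" "j < n" for l i j
  proof -
    have "cs ! j \<in> set cs" using cs ij by simp
    then have "cs ! j \<in> G" using cs by blast
    then obtain w q where wq: "cs ! j = gv w q" "w \<in> lists {..<s}" "length w < k" "q < n"
      unfolding G_def by blast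
    have gj: "g $$ (r, j) = word_mat Z n w $$ (r, q) / p ^ length w" if "r < n" for r
      using that wq cs ij by (simp add: mat_of_cols_def gv_def)
    have zc: "(Z l * g) $$ (r, j) / p = word_mat Z n (l # w) $$ (r, q) / p ^ Suc (length w)" if r: "r < n" for r
    proof -
      have "(Z l * g) $$ (r, j) = (\<Sum>b<n. Z l $$ (r, b) * g $$ (b, j))"
        using Z[of l] gc r ij by (simp add: times_mat_def scalar_prod_def atLeast0LessThan)
      also have "\<dots> = (\<Sum>b<n. Z l $$ (r, b) * word_mat Z n w $$ (b, q)) / p ^ length w"
        by (simp add: gj sum_divide_distrib)
      also have "(\<Sum>b<n. Z l $$ (r, b) * word_mat Z n w $$ (b, q)) = word_mat Z n (l # w) $$ (r, q)"
        using Z[of l] m[of w] r wq by (simp add: times_mat_def scalar_prod_def atLeast0LessThan)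
      finally show ?thesis by simp
    qed
    have "(g' * Z l * g) $$ (i, j) = (\<Sum>r<n. g' $$ (i, r) * (Z l * g) $$ (r, j))"
      unfolding assoc_mult_mat[OF g'c Z gc]
      using g'c gc Z[of l] ij by (simp add: times_mat_def scalar_prod_def atLeast0LessThan)
    then have "(g' * Z l * g) $$ (i, j) / p = (\<Sum>r<n. g' $$ (i, r) * ((Z l * g) $$ (r, j) / p))"
      by (simp add: sum_divide_distrib)
    also have "\<dots> = (\<Sum>r<n. g' $$ (i, r) * (word_mat Z n (l # w) $$ (r, q) / p ^ Suc (length w)))"
      by (rule sum.cong[OF refl]) (simp only: zc lessThan_iff)
    finally have e: "(g' * Z l * g) $$ (i, j) / p = (\<Sum>r<n. g' $$ (i, r) * (word_mat Z n (l # w) $$ (r, q) / p ^ Suc (length w)))" .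
    \<comment> \<open>A column of \<open>Z l * g\<close>, divided by p, is the column of a word with
      one more letter. Below length k it is again one of the generators; at length k the hypothesis
      on words applies, together with the integrality of \<open>g'\<close>.\<close>
    show ?thesis
    proof (cases "Suc (length w) = k")
      case True
      then show ?thesis unfolding e using ij g'V words[of "l # w"] l wq
        by (intro subring_on_sum[OF s] subring_onD(4)[OF s]) (auto simp del: word_mat_simps)
    next
      case False
      then have G: "gv (l # w) q \<in> G" using wq l by (intro GI) auto
      have "(g' *\<^sub>v gv (l # w) q) $ i = (\<Sum>r<n. g' $$ (i, r) * (word_mat Z n (l # w) $$ (r, q) / p ^ Suc (length w)))"
        using g'c ij by (simp add: gv_def scalar_prod_def atLeast0LessThan del: word_mat_simps)
      then show ?thesis unfolding e using coord[OF G ij(1)] by simp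
    qed
  qed
  then show ?thesis using gc g'c gg by blast
qed

section \<open>The ideals \<open>J\<close> and points of the representation variety\<close>

text \<open>Evaluation with a free choice of coefficient map and of matrices, so that generic
  evaluation, its image under a specialisation, and a representation are instances of one
  function.\<close>

definition falg_eval :: "('k::zero \<Rightarrow> 'r::comm_ring_1) \<Rightarrow> (nat \<Rightarrow> 'r mat) \<Rightarrow> nat \<Rightarrow> (nat list \<Rightarrow>\<^sub>0 'k) \<Rightarrow> 'r mat" where
  "falg_eval \<kappa> Z n g = mat n n (\<lambda>ij. \<Sum>w\<in>Poly_Mapping.keys g. \<kappa> (Poly_Mapping.lookup g w) * word_mat Z n w $$ ij)"

lemma falg_eval_carrier [simp]: "falg_eval \<kappa> Z n g \<in> carrier_mat n n"
  and falg_eval_dim [simp]: "dim_row (falg_eval \<kappa> Z n g) = n" "dim_col (falg_eval \<kappa> Z n g) = n"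
  by (simp_all add: falg_eval_def)

lemma generic_eval_eq_falg_eval: "generic_eval n g = falg_eval const_C (gen_mat n) n g"
  by (simp add: generic_eval_def falg_eval_def word_prod_eq_word_mat)

lemma falg_eval_hom:
  assumes h: "comm_ring_hom h" and Z: "\<And>l. Z l \<in> carrier_mat n n" and ij: "i < n" "j < n"
  shows "h (falg_eval \<kappa> Z n g $$ (i, j)) = falg_eval (\<lambda>c. h (\<kappa> c)) (\<lambda>l. map_mat h (Z l)) n g $$ (i, j)"
proof -
  interpret h: comm_ring_hom h by fact
  have "h (word_mat Z n w $$ (i, j)) = word_mat (\<lambda>l. map_mat h (Z l)) n w $$ (i, j)" for w
    using map_mat_word_mat[of h Z n w, OF h Z] ij word_mat_carrier[of Z n w, OF Z]
    by (metis carrier_matD index_map_mat(1))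
  then show ?thesis using ij by (simp add: falg_eval_def h.hom_sum h.hom_mult)
qed

text \<open>The points of the representation variety with coordinates in a ring B, made a k-algebra
  by \<phi>; B is the closure of k or of k(v).\<close>

definition rel_point :: "nat \<Rightarrow> nat \<Rightarrow> (nat \<Rightarrow> nat list \<Rightarrow>\<^sub>0 'k::field) \<Rightarrow> ('k \<Rightarrow> 'b::comm_ring_1) \<Rightarrow> (nat \<times> nat \<times> nat \<Rightarrow> 'b) \<Rightarrow> bool" where
  "rel_point n t f \<phi> z \<longleftrightarrow> (\<forall>r<t. falg_eval \<phi> (point_mat n z) n (f r) = 0\<^sub>m n n)"

definition gen_coeff :: "nat \<Rightarrow> nat list \<Rightarrow> nat \<Rightarrow> (nat \<times> nat \<times> nat \<Rightarrow>\<^sub>0 nat) \<Rightarrow>\<^sub>0 'a::comm_ring_1" where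
  "gen_coeff n w i = coeff (char_poly (word_mat (gen_mat n) n w)) i"

definition point_coeff :: "nat \<Rightarrow> nat list \<Rightarrow> nat \<Rightarrow> (nat \<times> nat \<times> nat \<Rightarrow> 'b::comm_ring_1) \<Rightarrow> 'b" where
  "point_coeff n w i z = coeff (char_poly (word_mat (point_mat n z) n w)) i"

lemma mpoly_eval_gen_coeff: "comm_ring_hom h \<Longrightarrow> mpoly_eval h z (gen_coeff n w i) = point_coeff n w i z"
  unfolding gen_coeff_def point_coeff_def by (rule eval_char_coeff)

lemma word_mat_in_subring:
  assumes W: "subring_on W" and Z: "\<And>l. Z l \<in> carrier_mat n n"
    and e: "\<And>l i j. l \<in> set w \<Longrightarrow> i < n \<Longrightarrow> j < n \<Longrightarrow> Z l $$ (i, j) \<in> W" and ij: "i < n" "j < n"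
  shows "word_mat Z n w $$ (i, j) \<in> W"
  using e ij
proof (induction w arbitrary: i j)
  case Nil
  then show ?case using subring_onD(1,2)[OF W] by simp
next
  case (Cons l w)
  have "word_mat Z n (l # w) $$ (i, j) = (\<Sum>k<n. Z l $$ (i, k) * word_mat Z n w $$ (k, j))"
    using Cons.prems Z[of l] word_mat_carrier[of Z n w, OF Z]
    by (simp add: times_mat_def scalar_prod_def atLeast0LessThan)
  also have "\<dots> \<in> W" using Cons by (intro subring_on_sum[OF W] subring_onD(4)[OF W]) auto
  finally show ?case .
qed

lemma char_poly_in_subring:
  assumes W: "subring_on W" and A: "A \<in> carrier_mat n n" and e: "\<And>i j. i < n \<Longrightarrow> j < n \<Longrightarrow> A $$ (i, j) \<in> W"
  shows "coeff (char_poly A) i \<in> W"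
proof -
  note pW = subring_on_polys_over[OF W] and cl = polys_over_closed[OF W]
  have M: "char_poly_matrix A \<in> carrier_mat n n" using A by simp
  have X: "[:0, 1:] \<in> polys_over W" using subring_onD(1,2)[OF W] by (auto simp: polys_over_def coeff_pCons split: nat.split)
  have ent: "char_poly_matrix A $$ (i, j) \<in> polys_over W" if "i < n" "j < n" for i j
  proof -
    have "char_poly_matrix A $$ (i, j) = (if i = j then [:0, 1:] else 0) + [:- (A $$ (i, j)):]"
      using that A by (simp add: char_poly_matrix_def)
    also have "\<dots> \<in> polys_over W"
      using e[OF that] X by (intro cl(3) cl(8) subring_onD(5)[OF W]) (auto intro: cl(1))
    finally show ?thesis .
  qed
  have sg: "signof p \<in> polys_over W" for p :: "nat \<Rightarrow> nat"
    by (cases p rule: sign_cases) (auto intro: cl(2,5))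
  have "char_poly A \<in> polys_over W"
    unfolding char_poly_def det_def'[OF M]
    by (intro subring_on_sum[OF pW] subring_onD(4)[OF pW] subring_on_prod[OF pW] sg ent) (auto dest: permutes_in_image)
  then show ?thesis by (rule polys_overD)
qed

lemma gen_coeff_in_subring:
  assumes W: "subring_on W" and v: "\<And>a b l. a < n \<Longrightarrow> b < n \<Longrightarrow> l \<in> set w \<Longrightarrow> mvar (a, b, l) \<in> W"
  shows "gen_coeff n w i \<in> W"
  unfolding gen_coeff_def
  by (intro char_poly_in_subring[OF W word_mat_carrier] word_mat_in_subring[OF W] gen_mat_carrier)
    (auto simp: gen_mat_def v)

lemma falg_eval_in_subring:
  assumes W: "subring_on W" and v: "\<And>a b l. a < n \<Longrightarrow> b < n \<Longrightarrow> l < s \<Longrightarrow> mvar (a, b, l) \<in> W"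
    and k: "\<And>c. \<kappa> c \<in> W" and g: "Poly_Mapping.keys g \<subseteq> lists {..<s}" and ij: "i < n" "j < n"
  shows "falg_eval \<kappa> (gen_mat n) n g $$ (i, j) \<in> W"
proof -
  have "word_mat (gen_mat n) n w $$ (i, j) \<in> W" if "w \<in> Poly_Mapping.keys g" for w
    using that g ij by (intro word_mat_in_subring[OF W] gen_mat_carrier) (auto simp: gen_mat_def intro!: v)
  then show ?thesis using ij k
    by (auto simp: falg_eval_def intro!: subring_on_sum[OF W] subring_onD(4)[OF W])
qed

lemma CharCoefs_eq:
  "CharCoefs n s = {gen_coeff n w i | w i. w \<in> lists {..<s} \<and> length w \<in> {1..n} \<and> i < n}"
  by (simp add: CharCoefs_def gen_coeff_def word_prod_eq_word_mat)

subsection \<open>Clearing denominators\<close>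

text \<open>The inclusion of k[v][x] into k(v)[x]. Written as an evaluation, it inherits its
  homomorphism laws.\<close>

definition emb :: "((nat \<times> nat \<times> nat \<Rightarrow>\<^sub>0 nat) \<Rightarrow>\<^sub>0 'k::field poly) \<Rightarrow> 'k generic_poly" where
  "emb = mpoly_eval (\<lambda>a. Poly_Mapping.single 0 (to_fract a)) mvar"

lemma comm_ring_hom_emb_coeff: "comm_ring_hom (\<lambda>a :: 'a::idom. Poly_Mapping.single 0 (to_fract a) :: ('i \<Rightarrow>\<^sub>0 nat) \<Rightarrow>\<^sub>0 'a fract)"
  by unfold_locales (simp_all add: single_add mult_single)

lemma comm_ring_hom_emb: "comm_ring_hom emb"
  unfolding emb_def by (rule comm_ring_hom_mpoly_eval[OF comm_ring_hom_emb_coeff])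

lemma mvar_power: "mvar i ^ k = (Poly_Mapping.single (Poly_Mapping.single i k) 1 :: ('i \<Rightarrow>\<^sub>0 nat) \<Rightarrow>\<^sub>0 'a::comm_ring_1)"
proof (induction k)
  case (Suc k)
  have "Poly_Mapping.single i (1::nat) + Poly_Mapping.single i k = Poly_Mapping.single i (Suc k)"
    by (simp flip: single_add)
  moreover have "mvar i ^ Suc k = (mvar i * Poly_Mapping.single (Poly_Mapping.single i k) 1 :: ('i \<Rightarrow>\<^sub>0 nat) \<Rightarrow>\<^sub>0 'a)"
    by (simp add: Suc)
  ultimately show ?case unfolding mvar_def mult_single by simp
qed simp

lemma mono_eval_mvar: "mono_eval mvar m = (Poly_Mapping.single m 1 :: ('i \<Rightarrow>\<^sub>0 nat) \<Rightarrow>\<^sub>0 'a::comm_ring_1)"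
proof (induction m rule: poly_mapping_single_sum_induct)
  case (single i k)
  have "mono_eval mvar (Poly_Mapping.single i k) = (mvar i ^ k :: ('i \<Rightarrow>\<^sub>0 nat) \<Rightarrow>\<^sub>0 'a)"
    by (auto simp: mono_eval_def)
  then show ?case by (simp add: mvar_power)
next
  case (sum p q)
  then show ?case by (simp add: mono_eval_add mult_single)
qed

lemma emb_single: "emb (Poly_Mapping.single m a) = Poly_Mapping.single m (to_fract a)"
  unfolding emb_def by (subst mpoly_eval_single) (simp_all add: mono_eval_mvar mult_single)

lemma lookup_emb: "Poly_Mapping.lookup (emb p) m = to_fract (Poly_Mapping.lookup p m)"
proof -
  interpret e: comm_ring_hom emb by (rule comm_ring_hom_emb)
  show ?thesis
    by (induction p rule: poly_mapping_single_sum_induct)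
      (simp_all add: emb_single e.hom_add lookup_add lookup_single when_def)
qed

lemma emb_const: "emb (Poly_Mapping.single 0 [:c:]) = const_C c" "emb (Poly_Mapping.single 0 [:0, 1:]) = v_C"
  by (simp_all add: emb_single const_C_def v_C_def to_fract_def)

lemma emb_mvar: "emb (mvar i) = mvar i"
  by (simp add: mvar_def emb_single)

lemma map_mat_emb_gen_mat: "map_mat emb (gen_mat n l) = gen_mat n l"
  by (intro eq_matI) (auto simp: gen_mat_def emb_mvar)

lemma emb_gen_coeff: "emb (gen_coeff n w i) = (gen_coeff n w i :: 'k::field generic_poly)"
proof -
  have "point_mat n mvar = (gen_mat n :: nat \<Rightarrow> 'k generic_poly mat)" by (rule ext) (simp add: point_mat_def gen_mat_def)
  then show ?thesis unfolding emb_def mpoly_eval_gen_coeff[OF comm_ring_hom_emb_coeff]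
    by (simp add: gen_coeff_def point_coeff_def)
qed

lemma emb_falg_eval:
  assumes "i < n" "j < n"
  shows "emb (falg_eval (\<lambda>c. Poly_Mapping.single 0 [:c:]) (gen_mat n) n g $$ (i, j)) = generic_eval n g $$ (i, j)"
  using falg_eval_hom[of emb "gen_mat n" n i j "\<lambda>c. Poly_Mapping.single 0 [:c:]" g, OF comm_ring_hom_emb gen_mat_carrier assms]
  by (simp add: generic_eval_eq_falg_eval emb_const map_mat_emb_gen_mat)

lemma clear_denominators: "\<exists>d q. d \<noteq> 0 \<and> Poly_Mapping.single 0 (to_fract d) * p = emb q"
proof (induction p rule: poly_mapping_single_sum_induct)
  case (single m x)
  obtain a b where x: "x = Fract a b" "b \<noteq> 0" by (cases x)
  have "to_fract b * x = to_fract a" using x by (simp add: to_fract_def eq_fract)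
  then show ?case using x by (intro exI[of _ b] exI[of _ "Poly_Mapping.single m a"]) (simp add: mult_single emb_single)
next
  case (sum p1 p2)
  interpret e: comm_ring_hom emb by (rule comm_ring_hom_emb)
  from sum obtain d1 q1 d2 q2 where d: "d1 \<noteq> 0" "Poly_Mapping.single 0 (to_fract d1) * p1 = emb q1"
    "d2 \<noteq> 0" "Poly_Mapping.single 0 (to_fract d2) * p2 = emb q2" by blast
  have s: "Poly_Mapping.single 0 (to_fract (d1 * d2)) = Poly_Mapping.single 0 (to_fract d1) * (Poly_Mapping.single 0 (to_fract d2) :: 'a generic_poly)"
    by (simp add: mult_single)
  have "Poly_Mapping.single 0 (to_fract (d1 * d2)) * (p1 + p2) = emb (Poly_Mapping.single 0 d2 * q1 + Poly_Mapping.single 0 d1 * q2)"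
    unfolding s e.hom_add e.hom_mult d(2,4)[symmetric] emb_single by (simp add: algebra_simps)
  then show ?case using d by (intro exI[of _ "d1 * d2"]) auto
qed

text \<open>The homomorphism from k[v] that extends \<phi> and sends v to u.\<close>

definition poly_point :: "('k::field \<Rightarrow> 'b::comm_ring_1) \<Rightarrow> 'b \<Rightarrow> 'k poly \<Rightarrow> 'b" where
  "poly_point \<phi> u a = poly (map_poly \<phi> a) u"

lemma comm_ring_hom_poly_point: "comm_ring_hom \<phi> \<Longrightarrow> comm_ring_hom (poly_point \<phi> u)"
proof -
  assume "comm_ring_hom \<phi>"
  then interpret p: comm_ring_hom \<phi> .
  interpret m: map_poly_comm_ring_hom \<phi> ..
  show ?thesis by unfold_locales (simp_all add: poly_point_def p.map_poly_hom_add m.hom_mult)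
qed

lemma poly_point_simps:
  assumes "comm_ring_hom \<phi>" shows "poly_point \<phi> u [:c:] = \<phi> c" "poly_point \<phi> u [:0, 1:] = u"
proof -
  interpret p: comm_ring_hom \<phi> by fact
  show "poly_point \<phi> u [:c:] = \<phi> c" "poly_point \<phi> u [:0, 1:] = u"
    by (simp_all add: poly_point_def p.map_poly_pCons_hom)
qed

lemma eval_falg_eval_point:
  assumes h: "comm_ring_hom h" and "i < n" "j < n"
  shows "mpoly_eval h z (falg_eval \<kappa> (gen_mat n) n g $$ (i, j)) =
    falg_eval (\<lambda>c. mpoly_eval h z (\<kappa> c)) (point_mat n z) n g $$ (i, j)"
  using falg_eval_hom[of "mpoly_eval h z" "gen_mat n" n i j \<kappa> g, OF comm_ring_hom_mpoly_eval[OF h] gen_mat_carrier assms(2,3)]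
  by (simp add: map_mat_gen_mat[OF h])

section \<open>The ideals \<open>J_ideal\<close> and algebraicity of characteristic
  coefficients\<close>

lemma generic_ring_eq: "carrier (generic_ring n s) = {p. \<forall>m\<in>Poly_Mapping.keys p. Poly_Mapping.keys m \<subseteq> {..<n} \<times> {..<n} \<times> {..<s}}"
  "mult (generic_ring n s) = (*)" "one (generic_ring n s) = 1" "zero (generic_ring n s) = 0" "add (generic_ring n s) = (+)"
  by (simp_all add: generic_ring_def)

lemma subring_on_generic_ring: "subring_on (carrier (generic_ring n s :: 'k::field generic_poly ring))"
  unfolding subring_on_def by (auto intro: generic_ring_closed generic_ring_0_1)

lemma ideal_generic_ring_iff:
  "ideal I (generic_ring n s) \<longleftrightarrow> ideal_on (carrier (generic_ring n s :: 'k::field generic_poly ring)) I"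
proof
  assume "ideal I (generic_ring n s)"
  then interpret ideal I "generic_ring n s" .
  show "ideal_on (carrier (generic_ring n s)) I" unfolding ideal_on_def
    using a_subset additive_subgroup.zero_closed[OF additive_subgroup_axioms]
      additive_subgroup.a_closed[OF additive_subgroup_axioms] I_l_closed by (simp add: generic_ring_eq(2-))
next
  assume I: "ideal_on (carrier (generic_ring n s)) I"
  interpret R: cring "generic_ring n s :: 'k generic_poly ring" by (rule cring_generic_ring)
  have inv: "\<ominus>\<^bsub>generic_ring n s\<^esub> x = - x" if "x \<in> carrier (generic_ring n s)" for x :: "'k generic_poly"
    using that generic_ring_closed(3) by (intro R.minus_equality) (simp_all add: generic_ring_eq(2-))
  show "ideal I (generic_ring n s)"
  proof (rule idealI)
    show "subgroup I (add_monoid (generic_ring n s))"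
    proof (rule subgroup.intro)
      show "I \<subseteq> carrier (add_monoid (generic_ring n s))" using ideal_onD(1)[OF I] by simp
      show "x \<otimes>\<^bsub>add_monoid (generic_ring n s)\<^esub> y \<in> I" if "x \<in> I" "y \<in> I" for x y
        using ideal_onD(3)[OF I that] by (simp add: generic_ring_eq(2-))
      show "\<one>\<^bsub>add_monoid (generic_ring n s)\<^esub> \<in> I" using ideal_onD(2)[OF I] by (simp add: generic_ring_eq(2-))
      show "inv\<^bsub>add_monoid (generic_ring n s)\<^esub> x \<in> I" if "x \<in> I" for x
        using inv[of x] ideal_on_uminus[OF subring_on_generic_ring I that] ideal_onD(1)[OF I] that
        by (auto simp: a_inv_def)
    qed
    show "x \<otimes>\<^bsub>generic_ring n s\<^esub> a \<in> I" "a \<otimes>\<^bsub>generic_ring n s\<^esub> x \<in> I" if "a \<in> I" "x \<in> carrier (generic_ring n s)" for a x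
      using ideal_onD(4,5)[OF I that(2,1)] by (simp_all add: generic_ring_eq(2-))
  qed (rule R.ring_axioms)
qed

context
  fixes n s t :: nat and f :: "nat \<Rightarrow> (nat list \<Rightarrow>\<^sub>0 'k::field)" and w :: "nat list" and i :: nat
  assumes f: "\<forall>r<t. f r \<in> carrier (free_algebra s)" and w: "w \<in> lists {..<s}" and i: "i < n"
begin

lemma generators_in_generic_ring:
  "insert (gen_coeff n w i - v_C) (RelEntries n t f) \<subseteq> carrier (generic_ring n s)"
proof -
  have "(mvar (a, b, l) :: 'k generic_poly) \<in> carrier (generic_ring n s)" if "a < n" "b < n" "l < s" for a b l
    using that by (auto simp: generic_ring_eq mvar_def)
  then have "(gen_coeff n w i :: 'k generic_poly) \<in> carrier (generic_ring n s)"
    using w by (intro gen_coeff_in_subring subring_on_generic_ring) auto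
  then have "(gen_coeff n w i - v_C :: 'k generic_poly) \<in> carrier (generic_ring n s)"
    by (intro subring_onD(6)[OF subring_on_generic_ring] const_C_v_C_closed(2))
  then show ?thesis using RelEntries_subset[of t f s n] f by simp
qed

lemma J_ideal_on: "ideal_on (carrier (generic_ring n s)) (J_ideal n s t f (gen_coeff n w i))"
  "insert (gen_coeff n w i - v_C) (RelEntries n t f) \<subseteq> J_ideal n s t f (gen_coeff n w i)"
proof -
  interpret R: cring "generic_ring n s :: 'k generic_poly ring" by (rule cring_generic_ring)
  show "ideal_on (carrier (generic_ring n s)) (J_ideal n s t f (gen_coeff n w i))"
    "insert (gen_coeff n w i - v_C) (RelEntries n t f) \<subseteq> J_ideal n s t f (gen_coeff n w i)"
    using R.genideal_ideal[OF generators_in_generic_ring] R.genideal_self[OF generators_in_generic_ring]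
    unfolding J_ideal_def ideal_generic_ring_iff by auto
qed

text \<open>Clearing denominators in an expression of 1 by the generators gives a nonzero d in k[v]
  that is a combination of c - v and the relations over k[v][x]. At a point z with v replaced by the
  value of c at z all generators vanish, hence so does d. The polynomial d depends on the ideal only
  and serves all points at once.\<close>

lemma J_ideal_one_imp_algebraic:
  assumes "1 \<in> J_ideal n s t f (gen_coeff n w i)"
  shows "\<exists>d. d \<noteq> 0 \<and> (\<forall>(\<phi> :: 'k \<Rightarrow> 'b::comm_ring_1) z. comm_ring_hom \<phi> \<longrightarrow> rel_point n t f \<phi> z \<longrightarrow>
    poly (map_poly \<phi> d) (point_coeff n w i z) = 0)"
proof -
  interpret R: cring "generic_ring n s :: 'k generic_poly ring" by (rule cring_generic_ring)
  interpret e: comm_ring_hom "emb :: _ \<Rightarrow> 'k generic_poly" by (rule comm_ring_hom_emb)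
  \<comment> \<open>The variable v receives the value of the coefficient itself, which makes c - v
    vanish at every point.\<close>
  define ev where "ev \<phi> z = mpoly_eval (poly_point \<phi> (point_coeff n w i z)) z" for \<phi> :: "'k \<Rightarrow> 'b" and z
  define van where "van q \<longleftrightarrow> (\<forall>(\<phi> :: 'k \<Rightarrow> 'b) z. comm_ring_hom \<phi> \<longrightarrow> rel_point n t f \<phi> z \<longrightarrow> ev \<phi> z q = 0)" for q
  have evh: "comm_ring_hom (ev \<phi> z)" if "comm_ring_hom \<phi>" for \<phi> z
    unfolding ev_def by (intro comm_ring_hom_mpoly_eval comm_ring_hom_poly_point that)
  have van_add: "van (p + q)" if "van p" "van q" for p q
    unfolding van_def
  proof (intro allI impI)
    fix \<phi> :: "'k \<Rightarrow> 'b" and z assume h: "comm_ring_hom \<phi>" "rel_point n t f \<phi> z"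
    interpret ev: comm_ring_hom "ev \<phi> z" by (rule evh[OF h(1)])
    show "ev \<phi> z (p + q) = 0" using that h by (simp add: van_def ev.hom_add)
  qed
  have van_mult: "van (p * q)" if "van q" for p q
    unfolding van_def
  proof (intro allI impI)
    fix \<phi> :: "'k \<Rightarrow> 'b" and z assume h: "comm_ring_hom \<phi>" "rel_point n t f \<phi> z"
    interpret ev: comm_ring_hom "ev \<phi> z" by (rule evh[OF h(1)])
    show "ev \<phi> z (p * q) = 0" using that h by (simp add: van_def ev.hom_mult)
  qed
  \<comment> \<open>Instead of writing elements of the ideal as combinations, collect all elements
    that have a nonzero k[v]-multiple in k[v][x] vanishing under every \<open>ev\<close>. This set
    is an ideal containing the generators, so it contains \<open>J_ideal\<close>.\<close>
  define S where "S = {p \<in> carrier (generic_ring n s). \<exists>d q. d \<noteq> 0 \<and> Poly_Mapping.single 0 (to_fract d) * p = emb q \<and> van q}"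
  have SI: "p \<in> S" if "p \<in> carrier (generic_ring n s)" "d \<noteq> 0" "Poly_Mapping.single 0 (to_fract d) * p = emb q" "van q" for p d q
    unfolding S_def using that by blast
  have "ideal_on (carrier (generic_ring n s)) S" unfolding ideal_on_def
  proof (intro conjI ballI)
    show "S \<subseteq> carrier (generic_ring n s)" by (auto simp: S_def)
    have "van 0" using hom_on_0[OF subring_on_UNIV comm_ring_hom_imp_hom_on[OF evh]] by (simp add: van_def)
    then show "0 \<in> S" by (intro SI[of 0 1 0] generic_ring_0_1(1)) (simp_all add: e.hom_zero)
    fix p assume p: "p \<in> S"
    then obtain d q where d: "d \<noteq> 0" "Poly_Mapping.single 0 (to_fract d) * p = emb q" "van q" unfolding S_def by blast
    { fix p' assume p': "p' \<in> S"
      then obtain d' q' where d': "d' \<noteq> 0" "Poly_Mapping.single 0 (to_fract d') * p' = emb q'" "van q'" unfolding S_def by blast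
      have s: "Poly_Mapping.single 0 (to_fract (d * d')) = Poly_Mapping.single 0 (to_fract d) * (Poly_Mapping.single 0 (to_fract d') :: 'k generic_poly)"
        by (simp add: mult_single)
      have "Poly_Mapping.single 0 (to_fract (d * d')) * (p + p') = emb (Poly_Mapping.single 0 d' * q + Poly_Mapping.single 0 d * q')"
        unfolding s e.hom_add e.hom_mult d(2)[symmetric] d'(2)[symmetric] emb_single by (simp add: algebra_simps)
      moreover have "van (Poly_Mapping.single 0 d' * q + Poly_Mapping.single 0 d * q')"
        by (intro van_add van_mult d d')
      moreover have "p + p' \<in> carrier (generic_ring n s)" using p p' generic_ring_closed(1) by (auto simp: S_def)
      ultimately show "p + p' \<in> S" using d(1) d'(1) by (intro SI[of "p + p'" "d * d'"]) simp_all }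
    { fix p' :: "'k generic_poly" assume p': "p' \<in> carrier (generic_ring n s)"
      obtain d' q' where d': "d' \<noteq> 0" "Poly_Mapping.single 0 (to_fract d') * p' = emb q'" using clear_denominators by blast
      have s: "Poly_Mapping.single 0 (to_fract (d * d')) = Poly_Mapping.single 0 (to_fract d) * (Poly_Mapping.single 0 (to_fract d') :: 'k generic_poly)"
        by (simp add: mult_single)
      have "Poly_Mapping.single 0 (to_fract (d * d')) * (p' * p) = emb (q' * q)"
        unfolding s e.hom_mult d(2)[symmetric] d'(2)[symmetric] by (simp add: algebra_simps)
      moreover have "van (q' * q)" by (intro van_mult d)
      moreover have "p' * p \<in> carrier (generic_ring n s)" using p p' generic_ring_closed(2) by (auto simp: S_def)
      ultimately show "p' * p \<in> S" using d(1) d'(1) by (intro SI[of "p' * p" "d * d'"]) simp_all }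
  qed
  moreover have "insert (gen_coeff n w i - v_C) (RelEntries n t f) \<subseteq> S"
  proof
    fix p assume p: "p \<in> insert (gen_coeff n w i - v_C) (RelEntries n t f)"
    have pc: "p \<in> carrier (generic_ring n s)" using p generators_in_generic_ring by blast
    have "\<exists>q. p = emb q \<and> van q"
    proof (cases "p = gen_coeff n w i - v_C")
      case True
      define q where "q = gen_coeff n w i - Poly_Mapping.single 0 [:0, 1 :: 'k:]"
      have "p = emb q" using True by (simp add: q_def e.hom_minus emb_gen_coeff emb_const)
      moreover have "van q" unfolding van_def
      proof (intro allI impI)
        fix \<phi> :: "'k \<Rightarrow> 'b" and z assume h: "comm_ring_hom \<phi>"
        interpret ev: comm_ring_hom "ev \<phi> z" by (rule evh[OF h])
        show "ev \<phi> z q = 0" unfolding q_def ev.hom_minus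
          by (simp add: ev_def mpoly_eval_gen_coeff[OF comm_ring_hom_poly_point[OF h]]
              mpoly_eval_const[OF comm_ring_hom_poly_point[OF h]] poly_point_simps[OF h])
      qed
      ultimately show ?thesis by blast
    next
      case False
      then obtain r a b where r: "p = generic_eval n (f r) $$ (a, b)" "r < t" "a < n" "b < n"
        using p by (auto simp: RelEntries_def)
      define q where "q = falg_eval (\<lambda>c. Poly_Mapping.single 0 [:c:]) (gen_mat n) n (f r) $$ (a, b)"
      have "p = emb q" unfolding r(1) q_def by (rule emb_falg_eval[OF r(3,4), symmetric])
      moreover have "van q" unfolding van_def
      proof (intro allI impI)
        fix \<phi> :: "'k \<Rightarrow> 'b" and z assume h: "comm_ring_hom \<phi>" and rp: "rel_point n t f \<phi> z"
        note hp = comm_ring_hom_poly_point[OF h]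
        have "ev \<phi> z q = falg_eval \<phi> (point_mat n z) n (f r) $$ (a, b)"
          unfolding ev_def q_def eval_falg_eval_point[OF hp r(3,4)]
          by (simp add: mpoly_eval_const[OF hp] poly_point_simps[OF h])
        then show "ev \<phi> z q = 0" using rp r by (simp add: rel_point_def)
      qed
      ultimately show ?thesis by blast
    qed
    then obtain q where "p = emb q" "van q" by blast
    then show "p \<in> S" using pc by (intro SI[of p 1 q]) simp_all
  qed
  ultimately have "J_ideal n s t f (gen_coeff n w i) \<subseteq> S"
    unfolding J_ideal_def by (intro R.genideal_minimal) (simp_all add: ideal_generic_ring_iff)
  with assms obtain d q where d: "d \<noteq> 0" "Poly_Mapping.single 0 (to_fract d) = emb q" "van q" by (auto simp: S_def)
  \<comment> \<open>The inclusion \<open>emb\<close> acts on each coefficient and is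
    injective.\<close>
  have "q = Poly_Mapping.single 0 d"
  proof (rule poly_mapping_eqI)
    fix m
    have "to_fract (Poly_Mapping.lookup q m) = to_fract (Poly_Mapping.lookup (Poly_Mapping.single 0 d) m)"
      using lookup_emb[of q m] d(2)[symmetric] by (cases "m = 0") (auto simp: lookup_single)
    then show "Poly_Mapping.lookup q m = Poly_Mapping.lookup (Poly_Mapping.single 0 d) m"
      unfolding to_fract_eq_iff .
  qed
  then have "poly (map_poly \<phi> d) (point_coeff n w i z) = 0" if "comm_ring_hom \<phi>" "rel_point n t f \<phi> z"
    for \<phi> :: "'k \<Rightarrow> 'b" and z
  proof -
    have "ev \<phi> z q = 0" using d(3) that by (simp add: van_def)
    then show ?thesis using \<open>q = Poly_Mapping.single 0 d\<close>
      by (simp add: ev_def mpoly_eval_const[OF comm_ring_hom_poly_point[OF that(1)]] poly_point_def)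
  qed
  then show ?thesis using d(1) by blast
qed

end

section \<open>Nullstellensatz: points on a prime ideal off a given function\<close>

lemma comm_ring_hom_range_subring: "comm_ring_hom \<kappa> \<Longrightarrow> subring_on (range \<kappa>)"
proof -
  assume "comm_ring_hom \<kappa>"
  then interpret k: comm_ring_hom \<kappa> .
  show ?thesis unfolding subring_on_def
    by (auto simp flip: k.hom_add k.hom_mult k.hom_uminus) (metis k.hom_zero rangeI, metis k.hom_one rangeI)
qed

text \<open>Here \<open>extend_hom\<close> is applied over the field \<open>range \<kappa>\<close>:
  an element of it outside \<open>P\<close> is nonzero and hence has nonzero image, so the condition
  on \<open>a\<close> holds by itself. The point consists of the images of the variables. Only the
  ring generated by \<open>range \<kappa>\<close> and the variables is specialised; it may be
  smaller than the whole polynomial ring, as for k[x] inside k[v][x].\<close>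

theorem mpoly_nullstellensatz:
  fixes \<kappa> :: "'c::field \<Rightarrow> ('i \<Rightarrow>\<^sub>0 nat) \<Rightarrow>\<^sub>0 'a::comm_ring_1" and \<phi> :: "'c \<Rightarrow> 'b::alg_closed_field" and h :: "'a \<Rightarrow> 'b"
  assumes \<kappa>: "comm_ring_hom \<kappa>" and \<phi>: "comm_ring_hom \<phi>" and h: "comm_ring_hom h"
    and hk: "\<And>z c. mpoly_eval h z (\<kappa> c) = \<phi> c"
    and U: "subring_on U" "range \<kappa> \<subseteq> U" "mvar ` set xs \<subseteq> U" and P: "prime_on U P"
    and b: "b \<in> adjoin_list (range \<kappa>) (map mvar xs)" "b \<notin> P"
  shows "\<exists>z. (\<forall>p\<in>P \<inter> adjoin_list (range \<kappa>) (map mvar xs). mpoly_eval h z p = 0) \<and> mpoly_eval h z b \<noteq> 0"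
proof -
  interpret k: comm_ring_hom \<kappa> by fact
  interpret p: comm_ring_hom \<phi> by fact
  let ?R = "range \<kappa>" let ?W = "adjoin_list ?R (map mvar xs)"
  have R: "subring_on ?R" by (rule comm_ring_hom_range_subring[OF \<kappa>])
  define \<phi>0 :: "(('i \<Rightarrow>\<^sub>0 nat) \<Rightarrow>\<^sub>0 'a) \<Rightarrow> 'b" where "\<phi>0 = mpoly_eval h (\<lambda>_. 0)"
  have \<phi>0: "\<phi>0 (\<kappa> c) = \<phi> c" for c by (simp add: \<phi>0_def hk)
  have hom0: "hom_on ?R \<phi>0" unfolding \<phi>0_def
    by (rule comm_ring_hom_imp_hom_on[OF comm_ring_hom_mpoly_eval[OF h]])
  have inP: "c = 0" if "\<kappa> c \<in> P" for c
  proof (rule ccontr)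
    assume "c \<noteq> 0"
    then have "1 = \<kappa> (inverse c) * \<kappa> c" by (simp flip: k.hom_mult add: k.hom_one)
    also have "\<dots> \<in> P" using that U by (intro ideal_onD(4)[OF prime_onD(1)[OF P]]) auto
    finally show False using prime_onD(2)[OF P] by simp
  qed
  have "set (map mvar xs) \<subseteq> U" using U by simp
  from extend_hom[OF R U(1,2) this P b, where ?'b = 'b] obtain a where a: "a \<in> ?R" "a \<notin> P"
    and ext: "\<forall>\<phi> :: _ \<Rightarrow> 'b. hom_on ?R \<phi> \<longrightarrow> (\<forall>p\<in>P \<inter> ?R. \<phi> p = 0) \<longrightarrow> \<phi> a \<noteq> 0 \<longrightarrow>
      (\<exists>\<psi>. hom_on ?W \<psi> \<and> (\<forall>y\<in>?R. \<psi> y = \<phi> y) \<and> (\<forall>p\<in>P \<inter> ?W. \<psi> p = 0) \<and> \<psi> b \<noteq> 0)" by blast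
  obtain c where c: "a = \<kappa> c" using a by blast
  have "c \<noteq> 0" using a(2) ideal_onD(2)[OF prime_onD(1)[OF P]] c k.hom_zero by metis
  then have "\<phi> c * \<phi> (inverse c) = 1" by (simp flip: p.hom_mult add: p.hom_one)
  then have "\<phi>0 a \<noteq> 0" using \<phi>0 c by auto
  moreover have "\<forall>p\<in>P \<inter> ?R. \<phi>0 p = 0"
  proof
    fix p assume "p \<in> P \<inter> ?R"
    then obtain c where "p = \<kappa> c" "\<kappa> c \<in> P" by auto
    then show "\<phi>0 p = 0" using inP[of c] \<phi>0[of c] p.hom_zero by simp
  qed
  ultimately obtain \<psi> where \<psi>: "hom_on ?W \<psi>" "\<forall>y\<in>?R. \<psi> y = \<phi>0 y" "\<forall>p\<in>P \<inter> ?W. \<psi> p = 0" "\<psi> b \<noteq> 0"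
    using ext[rule_format, OF hom0] by blast
  define z where "z i = \<psi> (mvar i)" for i
  have eq: "\<psi> y = mpoly_eval h z y" if "y \<in> ?W" for y
  proof (rule hom_on_adjoin_list_eq[OF R \<psi>(1) _ _ _ that])
    show "hom_on ?W (mpoly_eval h z)" by (rule comm_ring_hom_imp_hom_on[OF comm_ring_hom_mpoly_eval[OF h]])
    show "\<psi> a = mpoly_eval h z a" if "a \<in> ?R" for a using that \<psi>(2) \<phi>0 hk by auto
    show "\<psi> x = mpoly_eval h z x" if "x \<in> set (map mvar xs)" for x
      using that by (auto simp: z_def mpoly_eval_mvar[OF h])
  qed
  show ?thesis using \<psi>(3,4) eq b(1) by (intro exI[of _ z]) auto
qed

definition var_list :: "nat \<Rightarrow> nat \<Rightarrow> (nat \<times> nat \<times> nat) list" where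
  "var_list n s = List.product [0..<n] (List.product [0..<n] [0..<s])"

lemma set_var_list: "set (var_list n s) = {..<n} \<times> {..<n} \<times> {..<s}"
  by (simp add: var_list_def atLeast0LessThan)

lemma mvar_in_adjoin_list:
  assumes "subring_on R" "a < n" "b < n" "l < s"
  shows "mvar (a, b, l) \<in> adjoin_list R (map mvar (var_list n s))"
  using adjoin_list_gen[OF assms(1), of "map mvar (var_list n s)"] assms(2-) by (auto simp: set_var_list)

lemma poly_diff_in_ideal:
  assumes U: "subring_on U" and I: "ideal_on U I" and "x \<in> U" "y \<in> U" "x - y \<in> I"
  shows "q \<in> polys_over U \<Longrightarrow> poly q x - poly q y \<in> I"
proof (induction q)
  case 0
  then show ?case using ideal_onD(2)[OF I] by simp
next
  case (pCons a q)
  have q: "q \<in> polys_over U"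
  proof (rule polys_overI)
    fix i show "coeff q i \<in> U" using polys_overD[OF pCons.prems, of "Suc i"] by simp
  qed
  have "poly (pCons a q) x - poly (pCons a q) y = x * (poly q x - poly q y) + poly q y * (x - y)"
    by (simp add: algebra_simps)
  also have "\<dots> \<in> I" using assms pCons.IH[OF q] poly_in_subring[OF U q]
    by (intro ideal_onD(3,4)[OF I]) auto
  finally show ?case .
qed

lemma comm_ring_hom_to_ac: "comm_ring_hom to_ac"
  by unfold_locales simp_all

lemma map_poly_pCons_comm_ring_hom: "comm_ring_hom h \<Longrightarrow> map_poly h (pCons a q) = pCons (h a) (map_poly h q)"
proof -
  assume "comm_ring_hom h"
  then interpret h: comm_ring_hom h .
  show ?thesis by (rule h.map_poly_pCons_hom)
qed

lemma comm_ring_hom_comp_base: "comm_ring_hom (\<lambda>a :: 'k::field. to_ac (Fract [:a:] 1))"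
proof -
  have "Fract [:0:] 1 = (0 :: 'k poly fract)" "Fract [:1:] 1 = (1 :: 'k poly fract)"
    by (simp_all add: fract_collapse flip: one_pCons)
  then show ?thesis by unfold_locales (auto simp flip: to_ac_add to_ac_mult simp: mult.commute)
qed

lemma comm_ring_hom_single: "comm_ring_hom (Poly_Mapping.single 0 :: 'a::comm_ring_1 \<Rightarrow> ('i \<Rightarrow>\<^sub>0 nat) \<Rightarrow>\<^sub>0 'a)"
  by unfold_locales (simp_all add: single_add mult_single)

lemma comm_ring_hom_single_const: "comm_ring_hom (\<lambda>c :: 'k::field. Poly_Mapping.single 0 [:c:] :: ('i \<Rightarrow>\<^sub>0 nat) \<Rightarrow>\<^sub>0 'k poly)"
  by unfold_locales (simp_all add: mult_single flip: single_add one_pCons, simp add: mult.commute)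

section \<open>Points supplied by a proper ideal\<close>

context
  fixes n s t :: nat and f :: "nat \<Rightarrow> (nat list \<Rightarrow>\<^sub>0 'k::field)" and w :: "nat list" and i :: nat
  assumes f: "\<forall>r<t. f r \<in> carrier (free_algebra s)" and w: "w \<in> lists {..<s}" and i: "i < n"
begin

lemma keys_f: "r < t \<Longrightarrow> Poly_Mapping.keys (f r) \<subseteq> lists {..<s}"
  using f by (simp add: free_algebra_def)

lemma relation_in_J_ideal:
  assumes "r < t" "a < n" "b < n"
  shows "generic_eval n (f r) $$ (a, b) \<in> J_ideal n s t f (gen_coeff n w i)"
proof -
  have "generic_eval n (f r) $$ (a, b) \<in> RelEntries n t f" unfolding RelEntries_def using assms by blast
  then show ?thesis using J_ideal_on(2)[OF f w i] by blast
qed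

text \<open>The Nullstellensatz is used over the base field k(v), with the function 1 as the one not
  to vanish. The homomorphism is fixed on k(v), so the generator c - v forces the coefficient to
  take the value v itself.\<close>

lemma J_ideal_proper_imp_transcendental_point:
  assumes "1 \<notin> J_ideal n s t f (gen_coeff n w i)"
  shows "\<exists>z. rel_point n t f (\<lambda>a. to_ac (Fract [:a:] 1)) z \<and> point_coeff n w i z = to_ac (Fract [:0, 1 :: 'k:] 1)"
proof -
  let ?U = "carrier (generic_ring n s :: 'k generic_poly ring)"
  let ?R = "range (Poly_Mapping.single 0 :: 'k poly fract \<Rightarrow> 'k generic_poly)"
  let ?W = "adjoin_list ?R (map mvar (var_list n s))"
  note J = J_ideal_on[OF f w i]
  obtain P where P: "prime_on ?U P" "J_ideal n s t f (gen_coeff n w i) \<subseteq> P"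
    using prime_ideal_exists[OF subring_on_generic_ring J(1) assms] by blast
  have R: "subring_on ?R" by (rule comm_ring_hom_range_subring[OF comm_ring_hom_single])
  have W: "subring_on ?W" by (rule adjoin_list_subring[OF R])
  have RU: "?R \<subseteq> ?U" by (auto simp: generic_ring_eq split: if_splits)
  have vU: "mvar ` set (var_list n s) \<subseteq> ?U" by (auto simp: generic_ring_eq set_var_list mvar_def)
  have RW: "?R \<subseteq> ?W" by (rule adjoin_list_base[OF R])
  have hk: "mpoly_eval to_ac z (Poly_Mapping.single 0 c) = to_ac c" for z and c :: "'k poly fract"
    by (rule mpoly_eval_const[OF comm_ring_hom_to_ac])
  from mpoly_nullstellensatz[OF comm_ring_hom_single comm_ring_hom_to_ac comm_ring_hom_to_ac hk
      subring_on_generic_ring RU vU P(1) subring_onD(2)[OF W] prime_onD(2)[OF P(1)]]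
  obtain z where z: "\<forall>p\<in>P \<inter> ?W. mpoly_eval to_ac z p = 0" by blast
  interpret ev: comm_ring_hom "mpoly_eval to_ac z :: 'k generic_poly \<Rightarrow> _" by (rule comm_ring_hom_mpoly_eval[OF comm_ring_hom_to_ac])
  have vW: "mvar (a, b, l) \<in> ?W" if "a < n" "b < n" "l < s" for a b l by (rule mvar_in_adjoin_list[OF R that])
  have gW: "gen_coeff n w i \<in> ?W" using w by (intro gen_coeff_in_subring[OF W] vW) auto
  have cW: "const_C c \<in> ?W" "v_C \<in> ?W" for c using RW by (auto simp: const_C_def v_C_def)
  have "gen_coeff n w i - v_C \<in> P" by (rule subsetD[OF P(2)], rule subsetD[OF J(2)], rule insertI1)
  moreover have "gen_coeff n w i - v_C \<in> ?W" by (rule subring_onD(6)[OF W gW cW(2)])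
  ultimately have "gen_coeff n w i - v_C \<in> P \<inter> ?W" by simp
  then have "mpoly_eval to_ac z (gen_coeff n w i - v_C) = 0" using z by blast
  then have "point_coeff n w i z = to_ac (Fract [:0, 1 :: 'k:] 1)"
    unfolding ev.hom_minus mpoly_eval_gen_coeff[OF comm_ring_hom_to_ac] by (simp add: v_C_def hk)
  moreover have "rel_point n t f (\<lambda>a. to_ac (Fract [:a:] 1)) z" unfolding rel_point_def
  proof (intro allI impI eq_matI)
    fix r a b assume r: "r < t" and "a < dim_row (0\<^sub>m n n :: 'k poly fract alg_closure mat)" "b < dim_col (0\<^sub>m n n :: 'k poly fract alg_closure mat)"
    then have ab: "a < n" "b < n" by auto
    have "falg_eval const_C (gen_mat n) n (f r) $$ (a, b) \<in> P"
      using subsetD[OF P(2) relation_in_J_ideal[OF r ab]] by (simp add: generic_eval_eq_falg_eval)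
    moreover have "falg_eval const_C (gen_mat n) n (f r) $$ (a, b) \<in> ?W"
      using keys_f[OF r] ab by (intro falg_eval_in_subring[OF W vW cW(1)])
    ultimately have "mpoly_eval to_ac z (falg_eval const_C (gen_mat n) n (f r) $$ (a, b)) = 0" using z by blast
    then show "falg_eval (\<lambda>a. to_ac (Fract [:a:] 1)) (point_mat n z) n (f r) $$ (a, b) = 0\<^sub>m n n $$ (a, b)"
      unfolding eval_falg_eval_point[OF comm_ring_hom_to_ac ab] using ab by (simp add: const_C_def hk)
  qed simp_all
  ultimately show ?thesis by blast
qed

text \<open>Finitely many values over the closure of k are all roots of one nonzero p over k, so
  p(c) vanishes at every such point. Modulo a prime P above \<open>J_ideal\<close>, however, c
  equals v, and p(v) is a unit of k(v). Thus p(c) is outside the contraction of P to k[x], and the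
  Nullstellensatz over k yields a point where it does not vanish.\<close>

lemma J_ideal_proper_imp_infinite_values:
  assumes "1 \<notin> J_ideal n s t f (gen_coeff n w i)"
  shows "infinite {point_coeff n w i z | z. rel_point n t f to_ac z}"
proof
  assume fin: "finite {point_coeff n w i z | z. rel_point n t f to_ac z}"
  have "\<forall>u :: 'k alg_closure. \<exists>p :: 'k poly. p \<noteq> 0 \<and> poly (map_poly to_ac p) u = 0"
    using alg_closure_algebraic by metis
  from choice[OF this] obtain d where d: "\<forall>u :: 'k alg_closure. d u \<noteq> 0 \<and> poly (map_poly to_ac (d u)) u = 0" by (elim exE)
  define p where "p = (\<Prod>u\<in>{point_coeff n w i z | z. rel_point n t f to_ac z}. d u)"
  have p0: "p \<noteq> 0" using d fin by (simp add: p_def)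
  interpret m: map_poly_comm_ring_hom "to_ac :: 'k \<Rightarrow> _" by (intro map_poly_comm_ring_hom.intro comm_ring_hom_to_ac)
  have pz: "poly (map_poly to_ac p) (point_coeff n w i z) = 0" if "rel_point n t f to_ac z" for z
    unfolding p_def m.hom_prod poly_prod using that d fin by (intro prod_zero) auto
  let ?U = "carrier (generic_ring n s :: 'k generic_poly ring)"
  let ?\<kappa> = "\<lambda>c :: 'k. Poly_Mapping.single 0 [:c:] :: (nat \<times> nat \<times> nat \<Rightarrow>\<^sub>0 nat) \<Rightarrow>\<^sub>0 'k poly"
  let ?R = "range ?\<kappa>"
  let ?W = "adjoin_list ?R (map mvar (var_list n s))"
  note J = J_ideal_on[OF f w i]
  obtain P where P: "prime_on ?U P" "J_ideal n s t f (gen_coeff n w i) \<subseteq> P"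
    using prime_ideal_exists[OF subring_on_generic_ring J(1) assms] by blast
  note PI = prime_onD(1)[OF P(1)]
  interpret e: comm_ring_hom "emb :: _ \<Rightarrow> 'k generic_poly" by (rule comm_ring_hom_emb)
  interpret k: comm_ring_hom ?\<kappa> by (rule comm_ring_hom_single_const)
  have R: "subring_on ?R" by (rule comm_ring_hom_range_subring[OF comm_ring_hom_single_const])
  have W: "subring_on ?W" by (rule adjoin_list_subring[OF R])
  have RW: "?R \<subseteq> ?W" by (rule adjoin_list_base[OF R])
  have vW: "mvar (a, b, l) \<in> ?W" if "a < n" "b < n" "l < s" for a b l by (rule mvar_in_adjoin_list[OF R that])
  define E where "E = {q. emb q \<in> ?U}"
  have Es: "subring_on E" unfolding E_def subring_on_def
    by (simp add: e.hom_add e.hom_mult e.hom_uminus e.hom_zero e.hom_one generic_ring_0_1 generic_ring_closed)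
  have WE: "?W \<subseteq> E"
  proof (rule adjoin_list_least[OF Es])
    show "?R \<subseteq> E" by (auto simp: E_def emb_const const_C_v_C_closed)
    show "set (map mvar (var_list n s)) \<subseteq> E"
      by (auto simp: E_def emb_mvar generic_ring_eq set_var_list) (auto simp: mvar_def)
  qed
  \<comment> \<open>The contraction of P to k[x]. It still contains the relations, which have
    coefficients in k, while the generator c - v is left behind.\<close>
  define P2 where "P2 = {q \<in> ?W. emb q \<in> P}"
  have P2: "prime_on ?W P2" unfolding prime_on_def ideal_on_def
  proof (intro conjI ballI impI)
    show "P2 \<subseteq> ?W" by (auto simp: P2_def)
    show "0 \<in> P2" using subring_onD(1)[OF W] ideal_onD(2)[OF PI] by (simp add: P2_def e.hom_zero)
    show "1 \<notin> P2" using prime_onD(2)[OF P(1)] by (simp add: P2_def e.hom_one)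
    fix x
    { fix y assume "x \<in> P2" "y \<in> P2"
      then show "x + y \<in> P2" using subring_onD(3)[OF W] ideal_onD(3)[OF PI] by (simp add: P2_def e.hom_add) }
    { fix y assume "x \<in> ?W" "y \<in> P2"
      then show "x * y \<in> P2" using subring_onD(4)[OF W] ideal_onD(4)[OF PI] WE
        by (auto simp: P2_def e.hom_mult E_def) }
    { fix y assume xy: "x \<in> ?W" "y \<in> ?W" "x * y \<in> P2"
      then have "emb x * emb y \<in> P" by (simp add: P2_def e.hom_mult)
      moreover have "emb x \<in> ?U" "emb y \<in> ?U" using xy WE by (auto simp: E_def)
      ultimately show "x \<in> P2 \<or> y \<in> P2" using prime_onD(3)[OF P(1)] xy by (auto simp: P2_def) }
  qed
  define b where "b = poly (map_poly ?\<kappa> p) (gen_coeff n w i)"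
  have gW: "gen_coeff n w i \<in> ?W" using w by (intro gen_coeff_in_subring[OF W] vW) auto
  have bW: "b \<in> ?W" unfolding b_def
    by (intro poly_in_subring[OF W _ gW] polys_overI) (use RW in \<open>auto simp: coeff_map_poly\<close>)
  have emb_poly: "emb (poly (map_poly ?\<kappa> q) x) = poly (map_poly const_C q) (emb x)" for q x
  proof (induction q)
    case (pCons a q)
    interpret c: comm_ring_hom "const_C :: 'k \<Rightarrow> 'k generic_poly" by unfold_locales (simp_all add: const_C_simps)
    show ?case using pCons(2) by (simp add: k.map_poly_pCons_hom c.map_poly_pCons_hom e.hom_add e.hom_mult emb_const)
  qed (simp add: e.hom_zero)
  have v: "poly (map_poly const_C q) v_C = (Poly_Mapping.single 0 (to_fract q) :: 'k generic_poly)" for q :: "'k poly"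
  proof (induction q)
    case (pCons a q)
    interpret c: comm_ring_hom "const_C :: 'k \<Rightarrow> 'k generic_poly" by unfold_locales (simp_all add: const_C_simps)
    have "pCons a q = [:a:] + [:0, 1:] * q" by simp
    then have "to_fract (pCons a q) = Fract [:a:] 1 + Fract [:0, 1:] 1 * to_fract q"
      by (simp only: to_fract_add to_fract_mult) (simp add: to_fract_def)
    then have "const_C a + v_C * Poly_Mapping.single 0 (to_fract q) = (Poly_Mapping.single 0 (to_fract (pCons a q)) :: 'k generic_poly)"
      by (simp add: const_C_def v_C_def mult_single single_add)
    then show ?case using pCons(2) by (simp add: c.map_poly_pCons_hom)
  qed simp
  have "b \<notin> P2"
  proof
    assume "b \<in> P2"
    then have "poly (map_poly const_C p) (gen_coeff n w i) \<in> P"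
      by (simp add: P2_def b_def emb_poly emb_gen_coeff)
    moreover have "poly (map_poly const_C p) (gen_coeff n w i) - poly (map_poly const_C p) v_C \<in> P"
    proof (rule poly_diff_in_ideal[OF subring_on_generic_ring PI])
      show g: "gen_coeff n w i \<in> ?U" using subsetD[OF WE gW] unfolding E_def by (simp add: emb_gen_coeff)
      show "v_C \<in> ?U" by (rule const_C_v_C_closed)
      show "gen_coeff n w i - v_C \<in> P" by (rule subsetD[OF P(2)], rule subsetD[OF J(2)], rule insertI1)
      show "map_poly const_C p \<in> polys_over ?U"
        by (auto simp: polys_over_def coeff_map_poly const_C_simps const_C_v_C_closed)
    qed
    ultimately have "poly (map_poly const_C p) (gen_coeff n w i) - (poly (map_poly const_C p) (gen_coeff n w i) - poly (map_poly const_C p) v_C) \<in> P"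
      by (rule ideal_on_diff[OF subring_on_generic_ring PI])
    then have "Poly_Mapping.single 0 (to_fract p) \<in> P" by (simp add: v)
    then have "Poly_Mapping.single 0 (inverse (to_fract p)) * Poly_Mapping.single 0 (to_fract p) \<in> P"
      by (intro ideal_onD(4)[OF PI]) (auto simp: generic_ring_eq split: if_splits)
    then show False using prime_onD(2)[OF P(1)] p0 by (simp add: mult_single)
  qed
  \<comment> \<open>Some value must be assigned to v by the evaluation of k[v][x]; 0 is arbitrary,
    as \<open>?W\<close> consists of polynomials without v.\<close>
  note hp = comm_ring_hom_poly_point[OF comm_ring_hom_to_ac, of 0]
  have hk: "mpoly_eval (poly_point to_ac 0) z (?\<kappa> c) = to_ac c" for z c
    by (simp add: mpoly_eval_const[OF hp] poly_point_simps[OF comm_ring_hom_to_ac])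
  have vW': "mvar ` set (var_list n s) \<subseteq> ?W" using vW by (auto simp: set_var_list)
  from mpoly_nullstellensatz[OF comm_ring_hom_single_const comm_ring_hom_to_ac hp hk W RW vW' P2 bW \<open>b \<notin> P2\<close>]
  obtain z where z: "\<forall>p\<in>P2 \<inter> ?W. mpoly_eval (poly_point to_ac 0) z p = 0" "mpoly_eval (poly_point to_ac 0) z b \<noteq> 0" by blast
  let ?ev = "mpoly_eval (poly_point to_ac 0) z"
  interpret ev: comm_ring_hom ?ev by (rule comm_ring_hom_mpoly_eval[OF hp])
  have "rel_point n t f to_ac z" unfolding rel_point_def
  proof (intro allI impI eq_matI)
    fix r a b assume r: "r < t" and "a < dim_row (0\<^sub>m n n :: 'k alg_closure mat)" "b < dim_col (0\<^sub>m n n :: 'k alg_closure mat)"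
    then have ab: "a < n" "b < n" by auto
    let ?x = "falg_eval ?\<kappa> (gen_mat n) n (f r) $$ (a, b)"
    have "?x \<in> ?W" using keys_f[OF r] ab RW by (intro falg_eval_in_subring[OF W vW]) auto
    moreover have "emb ?x \<in> P" unfolding emb_falg_eval[OF ab]
      by (rule subsetD[OF P(2) relation_in_J_ideal[OF r ab]])
    ultimately have "?ev ?x = 0" using z(1) by (auto simp: P2_def)
    then show "falg_eval to_ac (point_mat n z) n (f r) $$ (a, b) = 0\<^sub>m n n $$ (a, b)"
      unfolding eval_falg_eval_point[OF hp ab] using ab by (simp add: hk)
  qed simp_all
  from pz[OF this] have "poly (map_poly to_ac p) (?ev (gen_coeff n w i)) = 0"
    by (simp add: mpoly_eval_gen_coeff[OF hp])
  moreover have "?ev (poly (map_poly ?\<kappa> q) x) = poly (map_poly to_ac q) (?ev x)" for q x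
  proof (induction q)
    case (pCons a q)
    show ?case using pCons(2) by (simp add: k.map_poly_pCons_hom map_poly_pCons_comm_ring_hom[OF comm_ring_hom_to_ac] ev.hom_add ev.hom_mult hk)
  qed (simp add: ev.hom_zero)
  ultimately show False using z(2) by (simp add: b_def)
qed

end

section \<open>Integrality of all characteristic coefficients\<close>

text \<open>
  By the independence argument and the Nullstellensatz, the words of length \<open>n\<close> in the generic
  matrices vanish wherever the coefficients in \<open>CharCoefs\<close> do. The prime ideals that avoid long words
  give a uniform statement without passing to powers of single entries.
\<close>

definition short_coeffs :: "nat \<Rightarrow> nat \<Rightarrow> ((nat \<times> nat \<times> nat \<Rightarrow>\<^sub>0 nat) \<Rightarrow>\<^sub>0 'a::comm_ring_1) set" where
  "short_coeffs n s = {gen_coeff n w i | w i. w \<in> lists {..<s} \<and> length w \<in> {1..n} \<and> i < n}"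

text \<open>The ring k[x], realised inside k[v][x] so that the evaluations and the Nullstellensatz
  above apply to it without a change of type.\<close>

definition poly_subring :: "nat \<Rightarrow> nat \<Rightarrow> ((nat \<times> nat \<times> nat \<Rightarrow>\<^sub>0 nat) \<Rightarrow>\<^sub>0 'k::field poly) set" where
  "poly_subring n s = adjoin_list (range (\<lambda>c. Poly_Mapping.single 0 [:c:])) (map mvar (var_list n s))"

lemma subring_on_poly_subring: "subring_on (poly_subring n s)"
  unfolding poly_subring_def
  by (rule adjoin_list_subring[OF comm_ring_hom_range_subring[OF comm_ring_hom_single_const]])

lemma mvar_in_poly_subring: "a < n \<Longrightarrow> b < n \<Longrightarrow> l < s \<Longrightarrow> mvar (a, b, l) \<in> poly_subring n s"
  unfolding poly_subring_def
  by (rule mvar_in_adjoin_list[OF comm_ring_hom_range_subring[OF comm_ring_hom_single_const]])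

lemma const_in_poly_subring: "range (\<lambda>c. Poly_Mapping.single 0 [:c:]) \<subseteq> poly_subring n s"
  unfolding poly_subring_def
  by (rule adjoin_list_base[OF comm_ring_hom_range_subring[OF comm_ring_hom_single_const]])

lemma gen_coeff_in_poly_subring: "w \<in> lists {..<s} \<Longrightarrow> gen_coeff n w i \<in> poly_subring n s"
  by (intro gen_coeff_in_subring[OF subring_on_poly_subring] mvar_in_poly_subring) auto

lemma gen_word_in_poly_subring:
  "w \<in> lists {..<s} \<Longrightarrow> i < n \<Longrightarrow> j < n \<Longrightarrow> word_mat (gen_mat n) n w $$ (i, j) \<in> poly_subring n s"
  by (intro word_mat_in_subring[OF subring_on_poly_subring] gen_mat_carrier)
    (auto simp: gen_mat_def intro!: mvar_in_poly_subring)

lemma finite_words: "finite {w \<in> lists {..<s}. length w \<le> N}" for s :: nat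
  using finite_lists_length_le[OF finite_lessThan, of s N] by (simp add: lists_eq_set)

lemma finite_short_coeffs: "finite (short_coeffs n s)"
proof -
  have "short_coeffs n s \<subseteq> (\<lambda>(w, i). gen_coeff n w i) ` ({w \<in> lists {..<s}. length w \<le> n} \<times> {..<n})"
    unfolding short_coeffs_def by (force simp: image_iff)
  moreover have "finite ({w \<in> lists {..<s}. length w \<le> n} \<times> {..<n})"
    by (intro finite_cartesian_product finite_words finite_lessThan)
  ultimately show ?thesis by (rule finite_surj[rotated])
qed

lemma long_words_in_coeff_ideal:
  fixes n s :: nat
  shows "\<exists>M>0. \<forall>w i j. w \<in> lists {..<s} \<longrightarrow> length w = M \<longrightarrow> i < n \<longrightarrow> j < n \<longrightarrow>
    (\<exists>h. (\<forall>c. h c \<in> poly_subring n s) \<and>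
      word_mat (gen_mat n) n w $$ (i, j) = (\<Sum>c\<in>short_coeffs n s. c * h c :: (nat \<times> nat \<times> nat \<Rightarrow>\<^sub>0 nat) \<Rightarrow>\<^sub>0 'k::field poly))"
proof -
  let ?U = "poly_subring n s :: ((nat \<times> nat \<times> nat \<Rightarrow>\<^sub>0 nat) \<Rightarrow>\<^sub>0 'k poly) set"
  let ?C = "short_coeffs n s :: ((nat \<times> nat \<times> nat \<Rightarrow>\<^sub>0 nat) \<Rightarrow>\<^sub>0 'k poly) set"
  let ?W = "\<lambda>w. word_mat (gen_mat n) n w :: ((nat \<times> nat \<times> nat \<Rightarrow>\<^sub>0 nat) \<Rightarrow>\<^sub>0 'k poly) mat"
  have U: "subring_on ?U" by (rule subring_on_poly_subring)
  have CU: "?C \<subseteq> ?U" using gen_coeff_in_poly_subring by (auto simp: short_coeffs_def)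
  define I where "I = {(\<Sum>c\<in>?C. c * h c) | h. \<forall>c. h c \<in> ?U}"
  have I: "ideal_on ?U I" unfolding ideal_on_def
  proof (intro conjI ballI)
    show "I \<subseteq> ?U" unfolding I_def using CU by (auto intro!: subring_on_sum[OF U] subring_onD(4)[OF U])
    show "0 \<in> I" unfolding I_def using subring_onD(1)[OF U] by (intro CollectI exI[of _ "\<lambda>_. 0"]) simp
    fix x assume "x \<in> I"
    then obtain h where h: "x = (\<Sum>c\<in>?C. c * h c)" "\<forall>c. h c \<in> ?U" unfolding I_def by blast
    { fix y assume "y \<in> I"
      then obtain h' where h': "y = (\<Sum>c\<in>?C. c * h' c)" "\<forall>c. h' c \<in> ?U" unfolding I_def by blast
      have "x + y = (\<Sum>c\<in>?C. c * (h c + h' c))" using h h' by (simp add: sum.distrib distrib_left)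
      then show "x + y \<in> I" unfolding I_def using h h' subring_onD(3)[OF U]
        by (intro CollectI exI[of _ "\<lambda>c. h c + h' c"]) simp }
    { fix y assume y: "y \<in> ?U"
      have "y * x = (\<Sum>c\<in>?C. c * (y * h c))" using h by (simp add: sum_distrib_left mult.left_commute)
      then show "y * x \<in> I" unfolding I_def using h y subring_onD(4)[OF U]
        by (intro CollectI exI[of _ "\<lambda>c. y * h c"]) simp }
  qed
  have CI: "c \<in> I" if c: "c \<in> ?C" for c
  proof -
    have "(\<Sum>d\<in>?C. d * (if d = c then 1 else 0)) = (\<Sum>d\<in>{c}. d * (if d = c then 1 else 0))"
      using c finite_short_coeffs by (intro sum.mono_neutral_right) auto
    then have "c = (\<Sum>d\<in>?C. d * (if d = c then 1 else 0))" by simp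
    then show ?thesis unfolding I_def using subring_onD(1,2)[OF U]
      by (intro CollectI exI[of _ "\<lambda>d. if d = c then 1 else 0"]) simp
  qed
  define E where "E N = {?W w $$ (i, j) | w i j. w \<in> lists {..<s} \<and> length w = N \<and> i < n \<and> j < n}" for N
  have EI: "?W w $$ (i, j) \<in> E N" if "w \<in> lists {..<s}" "length w = N" "i < n" "j < n" for w i j N
    unfolding E_def using that by blast
  have fE: "finite (E N)" for N
  proof -
    have "E N \<subseteq> (\<lambda>(w, i, j). ?W w $$ (i, j)) ` ({w \<in> lists {..<s}. length w \<le> N} \<times> {..<n} \<times> {..<n})"
    proof
      fix x assume "x \<in> E N"
      then obtain w i j where "x = ?W w $$ (i, j)" "w \<in> lists {..<s}" "length w = N" "i < n" "j < n" unfolding E_def by blast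
      then show "x \<in> (\<lambda>(w, i, j). ?W w $$ (i, j)) ` ({w \<in> lists {..<s}. length w \<le> N} \<times> {..<n} \<times> {..<n})"
        by (intro image_eqI[of _ _ "(w, i, j)"]) auto
    qed
    moreover have "finite ({w \<in> lists {..<s}. length w \<le> N} \<times> {..<n} \<times> {..<n})"
      by (intro finite_cartesian_product finite_words finite_lessThan)
    ultimately show ?thesis by (rule finite_surj[rotated])
  qed
  have EU: "E N \<subseteq> ?U" for N using gen_word_in_poly_subring unfolding E_def by blast
  have prod_entry: "?W (u @ w) $$ (i, j) = (\<Sum>k<n. ?W u $$ (i, k) * ?W w $$ (k, j))" if "i < n" "j < n" for u w i j
  proof -
    have c: "?W u \<in> carrier_mat n n" "?W w \<in> carrier_mat n n" by simp_all
    show ?thesis unfolding word_mat_append[of "gen_mat n" n u w, OF gen_mat_carrier]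
      using that carrier_matD[OF c(1)] carrier_matD[OF c(2)]
      by (simp add: times_mat_def scalar_prod_def atLeast0LessThan)
  qed
  \<comment> \<open>An entry of a word of length N + N' is a sum of products of an entry of its
    initial part and an entry of its final part, so the families \<open>E N\<close> have the
    multiplicativity that \<open>prime_avoiding\<close> demands.\<close>
  have mult: "\<exists>N''. \<forall>J. ideal_on ?U J \<longrightarrow> (\<forall>a\<in>E N. \<forall>b\<in>E N'. a * b \<in> J) \<longrightarrow> E N'' \<subseteq> J" for N N'
  proof (intro exI[of _ "N + N'"] allI impI subsetI)
    fix J x assume J: "ideal_on ?U J" and ab: "\<forall>a\<in>E N. \<forall>b\<in>E N'. a * b \<in> J" and "x \<in> E (N + N')"
    then obtain w i j where w: "x = ?W w $$ (i, j)" "w \<in> lists {..<s}" "length w = N + N'" "i < n" "j < n"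
      unfolding E_def by blast
    have "x = (\<Sum>k<n. ?W (take N w) $$ (i, k) * ?W (drop N w) $$ (k, j))"
      using prod_entry[OF w(4,5), of "take N w" "drop N w"] w(1) by simp
    also have "\<dots> \<in> J"
    proof (rule ideal_on_sum[OF J])
      fix k assume "k \<in> {..<n}"
      then have "?W (take N w) $$ (i, k) \<in> E N" "?W (drop N w) $$ (k, j) \<in> E N'"
        using w by (auto intro!: EI dest: in_set_takeD in_set_dropD)
      then show "?W (take N w) $$ (i, k) * ?W (drop N w) $$ (k, j) \<in> J" using ab by blast
    qed
    finally show "x \<in> J" .
  qed
  have "\<exists>N. E N \<subseteq> I"
  proof (rule ccontr)
    assume "\<not> ?thesis"
    then have "\<not> E N \<subseteq> I" for N by blast
    from prime_avoiding[OF U I fE EU this mult] obtain P where P: "prime_on ?U P" "I \<subseteq> P" "\<forall>N. \<not> E N \<subseteq> P" by blast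
    \<comment> \<open>Length n is the one at which \<open>short_words_nilpotent_imp_zero\<close>
      applies: at a point where all elements of \<open>?C\<close> vanish, every word of length n is
      zero, while the Nullstellensatz keeps this entry from vanishing.\<close>
    then obtain b where b: "b \<in> E n" "b \<notin> P" by blast
    then obtain w i j where w: "b = ?W w $$ (i, j)" "w \<in> lists {..<s}" "length w = n" "i < n" "j < n"
      unfolding E_def by blast
    let ?\<kappa> = "\<lambda>c :: 'k. Poly_Mapping.single 0 [:c:] :: (nat \<times> nat \<times> nat \<Rightarrow>\<^sub>0 nat) \<Rightarrow>\<^sub>0 'k poly"
    have hp: "comm_ring_hom (poly_point (to_ac :: 'k \<Rightarrow> _) 0)" by (rule comm_ring_hom_poly_point[OF comm_ring_hom_to_ac])
    have hk: "mpoly_eval (poly_point to_ac 0) z (?\<kappa> c) = to_ac c" for z and c :: 'k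
      by (simp add: mpoly_eval_const[OF hp] poly_point_simps[OF comm_ring_hom_to_ac])
    have vU: "mvar ` set (var_list n s) \<subseteq> ?U" using mvar_in_poly_subring by (auto simp: set_var_list)
    have bU: "b \<in> adjoin_list (range ?\<kappa>) (map mvar (var_list n s))" using b EU by (auto simp: poly_subring_def)
    from mpoly_nullstellensatz[OF comm_ring_hom_single_const comm_ring_hom_to_ac hp hk U const_in_poly_subring vU P(1) bU b(2)]
    obtain z where z: "\<forall>p\<in>P \<inter> ?U. mpoly_eval (poly_point to_ac 0) z p = 0" "mpoly_eval (poly_point to_ac 0) z b \<noteq> 0"
      unfolding poly_subring_def by blast
    have zero: "point_coeff n u k z = 0" if u: "u \<in> lists {..<s}" "1 \<le> length u" "length u \<le> n" "k < n" for u k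
    proof -
      have "gen_coeff n u k \<in> ?C" unfolding short_coeffs_def using u by auto
      then have "gen_coeff n u k \<in> P \<inter> ?U" using CI P(2) CU by blast
      then show ?thesis using z(1) mpoly_eval_gen_coeff[OF hp] by metis
    qed
    have "word_mat (point_mat n z) n w = 0\<^sub>m n n"
    proof (rule short_words_nilpotent_imp_zero[OF point_mat_carrier _ w(2,3)])
      fix u \<mu> assume u: "u \<in> lists {..<s}" "1 \<le> length u" "length u \<le> n"
        and r: "poly (char_poly (word_mat (point_mat n z) n u)) \<mu> = 0"
      have c: "word_mat (point_mat n z) n u \<in> carrier_mat n n" by simp
      have "poly (char_poly (word_mat (point_mat n z) n u)) \<mu> = (\<Sum>k\<le>n. point_coeff n u k z * \<mu> ^ k)"
        using degree_monic_char_poly[OF c] by (simp add: poly_altdef point_coeff_def)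
      also have "\<dots> = (\<Sum>k\<in>{n}. point_coeff n u k z * \<mu> ^ k)"
        using zero[OF u] by (intro sum.mono_neutral_right) auto
      also have "\<dots> = \<mu> ^ n" using degree_monic_char_poly[OF c] by (simp add: point_coeff_def)
      finally show "\<mu> = 0" using r by simp
    qed
    moreover have "mpoly_eval (poly_point to_ac 0) z b = word_mat (point_mat n z) n w $$ (i, j)"
      unfolding w(1) using map_mat_gen_word[OF hp, of z n w] w carrier_matD[OF word_mat_carrier[of "gen_mat n" n w, OF gen_mat_carrier]]
      by (metis index_map_mat(1))
    ultimately show False using z(2) w by simp
  qed
  then obtain N where N: "E N \<subseteq> I" by blast
  \<comment> \<open>One more letter keeps the entries in the ideal and guarantees a positive length,
    as N may be 0.\<close>
  have "E (Suc N) \<subseteq> I"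
  proof
    fix x assume "x \<in> E (Suc N)"
    then obtain w i j where w: "x = ?W w $$ (i, j)" "w \<in> lists {..<s}" "length w = Suc N" "i < n" "j < n"
      unfolding E_def by blast
    have "x = (\<Sum>k<n. ?W (take 1 w) $$ (i, k) * ?W (drop 1 w) $$ (k, j))"
      using prod_entry[OF w(4,5), of "take 1 w" "drop 1 w"] w(1) by simp
    also have "\<dots> \<in> I"
    proof (rule ideal_on_sum[OF I])
      fix k assume k: "k \<in> {..<n}"
      then have "?W (drop 1 w) $$ (k, j) \<in> I" using w N by (intro subsetD[OF N] EI) (auto dest: in_set_dropD)
      moreover have "?W (take 1 w) $$ (i, k) \<in> ?U"
        using w k by (intro gen_word_in_poly_subring) (auto dest: in_set_takeD)
      ultimately show "?W (take 1 w) $$ (i, k) * ?W (drop 1 w) $$ (k, j) \<in> I" by (rule ideal_onD(4)[OF I, rotated])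
    qed
    finally show "x \<in> I" .
  qed
  then have "\<exists>h. (\<forall>c. h c \<in> ?U) \<and> ?W w $$ (i, j) = (\<Sum>c\<in>?C. c * h c)"
    if "w \<in> lists {..<s}" "length w = Suc N" "i < n" "j < n" for w i j
    using EI[OF that] unfolding I_def by blast
  then show ?thesis by (intro exI[of _ "Suc N"]) blast
qed

text \<open>Substituting c X for X in the characteristic polynomial of c A turns the defining matrix
  into c times that of A; compare coefficients in the resulting identity, whose right-hand side is
  c^n times the characteristic polynomial of A.\<close>

lemma char_poly_smult_coeff:
  fixes A :: "'a::field mat"
  assumes A: "A \<in> carrier_mat n n" and c: "c \<noteq> 0" and i: "i \<le> n"
  shows "coeff (char_poly (c \<cdot>\<^sub>m A)) i = c ^ (n - i) * coeff (char_poly A) i"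
proof -
  have cA: "c \<cdot>\<^sub>m A \<in> carrier_mat n n" using A by simp
  let ?h = "\<lambda>p :: 'a poly. p \<circ>\<^sub>p [:0, c:]"
  have hom: "comm_ring_hom ?h"
    by unfold_locales (simp_all add: pcompose_add pcompose_mult)
  have M: "char_poly_matrix (c \<cdot>\<^sub>m A) \<in> carrier_mat n n" "char_poly_matrix A \<in> carrier_mat n n" using A by auto
  have "map_mat ?h (char_poly_matrix (c \<cdot>\<^sub>m A)) = [:c:] \<cdot>\<^sub>m char_poly_matrix A"
    using A by (intro eq_matI) (auto simp: char_poly_matrix_def pcompose_pCons)
  then have "?h (char_poly (c \<cdot>\<^sub>m A)) = det ([:c:] \<cdot>\<^sub>m char_poly_matrix A)"
    unfolding char_poly_def by (simp flip: comm_ring_hom.hom_det[OF hom])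
  also have "\<dots> = [:c:] ^ n * char_poly A"
    using M by (simp add: det_smult char_poly_def)
  also have "[:c:] ^ n = [:c ^ n:]" by (induction n) (simp_all add: mult.commute)
  finally have "coeff (?h (char_poly (c \<cdot>\<^sub>m A))) i = c ^ n * coeff (char_poly A) i" by simp
  moreover have "coeff (?h p) i = c ^ i * coeff p i" for p i
  proof (induction p arbitrary: i)
    case (pCons a p)
    then show ?case by (cases i) (auto simp: pcompose_pCons)
  qed simp
  ultimately have "c ^ i * coeff (char_poly (c \<cdot>\<^sub>m A)) i = c ^ i * (c ^ (n - i) * coeff (char_poly A) i)"
    using i by (simp flip: power_add mult.assoc)
  then show ?thesis using c by simp
qed

lemma word_mat_smult:
  assumes Z: "\<And>l. Z l \<in> carrier_mat n n" and "\<And>l. Y l \<in> carrier_mat n n"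
    and eq: "\<And>l. l \<in> set w \<Longrightarrow> Y l = c \<cdot>\<^sub>m Z l"
  shows "word_mat Y n w = c ^ length w \<cdot>\<^sub>m word_mat Z n w"
  using eq
proof (induction w)
  case Nil
  then show ?case by (intro eq_matI) auto
next
  case (Cons l w)
  have W: "word_mat Z n w \<in> carrier_mat n n" using Z by simp
  have Zl: "Z l \<in> carrier_mat n n" by (rule Z)
  have "word_mat Y n (l # w) = (c \<cdot>\<^sub>m Z l) * (c ^ length w \<cdot>\<^sub>m word_mat Z n w)" using Cons by simp
  also have "\<dots> = c \<cdot>\<^sub>m (c ^ length w \<cdot>\<^sub>m (Z l * word_mat Z n w))"
    by (simp add: mult_smult_assoc_mat[OF Zl smult_carrier_mat[OF W]] mult_smult_distrib[OF Zl W])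
  also have "\<dots> = c ^ length (l # w) \<cdot>\<^sub>m word_mat Z n (l # w)"
    using Z[of l] W by (intro eq_matI) auto
  finally show ?case .
qed

lemma word_mat_conj:
  assumes Z: "\<And>l. Z l \<in> carrier_mat n n" and g: "g \<in> carrier_mat n n" "g' \<in> carrier_mat n n" "g * g' = 1\<^sub>m n" "g' * g = 1\<^sub>m n"
  shows "word_mat (\<lambda>l. g' * Z l * g) n w = g' * word_mat Z n w * g"
proof (induction w)
  case Nil
  show ?case using g by simp
next
  case (Cons l w)
  have W: "word_mat Z n w \<in> carrier_mat n n" using Z by simp
  have "word_mat (\<lambda>l. g' * Z l * g) n (l # w) = (g' * Z l * g) * (g' * word_mat Z n w * g)" using Cons by simp
  also have "\<dots> = g' * (Z l * ((g * g') * (word_mat Z n w * g)))"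
    using Z[of l] W g(1,2) by (simp add: assoc_mult_mat[of _ n n _ n _ n])
  also have "\<dots> = g' * (Z l * word_mat Z n w) * g"
    using Z[of l] W g by (simp add: assoc_mult_mat[of _ n n _ n _ n])
  finally show ?case by simp
qed

lemma char_poly_conj:
  assumes "A \<in> carrier_mat n n" "g \<in> carrier_mat n n" "g' \<in> carrier_mat n n" "g * g' = 1\<^sub>m n" "g' * g = 1\<^sub>m n"
  shows "char_poly (g' * A * g) = char_poly (A :: 'a::comm_ring_1 mat)"
proof (rule char_poly_similar)
  show "similar_mat (g' * A * g) A" unfolding similar_mat_def
    by (intro exI[of _ g'] exI[of _ g] similar_mat_witI[of _ _ n]) (use assms in auto)
qed

text \<open>
  If the entries lie in \<open>D V\<close>, then the scaled tuple \<open>y = D\<^sup>-\<^sup>1 Z\<close> is integral and its short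
  coefficients lie in \<open>D\<^sup>-\<^sup>1 V\<close>, so words of length \<open>M\<close> in \<open>Z\<close> gain a factor: they lie in \<open>D\<^sup>M\<^sup>-\<^sup>1 V\<close>.
\<close>

lemma shrink_entries:
  fixes Z :: "nat \<Rightarrow> 'b::field mat" and \<phi> :: "'k::field \<Rightarrow> 'b"
  assumes V: "valuation_ring V" and \<phi>: "comm_ring_hom \<phi>" "range \<phi> \<subseteq> V"
    and Z: "\<And>l. Z l \<in> carrier_mat n n"
    and M: "0 < M" "\<And>w i j. w \<in> lists {..<s} \<Longrightarrow> length w = M \<Longrightarrow> i < n \<Longrightarrow> j < n \<Longrightarrow>
      \<exists>h. (\<forall>c. h c \<in> poly_subring n s) \<and>
      word_mat (gen_mat n) n w $$ (i, j) = (\<Sum>c\<in>short_coeffs n s. c * h c :: (nat \<times> nat \<times> nat \<Rightarrow>\<^sub>0 nat) \<Rightarrow>\<^sub>0 'k poly)"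
    and D: "D \<noteq> 0" "inverse D \<in> V" "\<And>l i j. l < s \<Longrightarrow> i < n \<Longrightarrow> j < n \<Longrightarrow> Z l $$ (i, j) / D \<in> V"
    and D': "D' ^ M = D ^ (M - 1)" "D' \<noteq> 0"
    and cc: "\<And>w i. w \<in> lists {..<s} \<Longrightarrow> 1 \<le> length w \<Longrightarrow> length w \<le> n \<Longrightarrow> i < n \<Longrightarrow> coeff (char_poly (word_mat Z n w)) i \<in> V"
  shows "\<exists>g\<in>carrier_mat n n. \<exists>g'\<in>carrier_mat n n. g * g' = 1\<^sub>m n \<and> g' * g = 1\<^sub>m n \<and>
    (\<forall>l<s. \<forall>i<n. \<forall>j<n. (g' * Z l * g) $$ (i, j) / D' \<in> V)"
proof (rule balance_words[OF V Z D'(2) M(1)])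
  fix w i j assume w: "w \<in> lists {..<s}" "length w = M" and ij: "i < n" "j < n"
  have s: "subring_on V" using V by (simp add: valuation_ring_def)
  define y where "y = (\<lambda>(i, j, l). Z l $$ (i, j) / D)"
  have yZ: "point_mat n y l = inverse D \<cdot>\<^sub>m Z l" for l
    using Z[of l] by (intro eq_matI) (auto simp: y_def point_mat_def divide_inverse mult.commute)
  have yw: "word_mat (point_mat n y) n u = inverse D ^ length u \<cdot>\<^sub>m word_mat Z n u" for u
    by (rule word_mat_smult[OF Z point_mat_carrier yZ])
  have cw: "word_mat Z n u \<in> carrier_mat n n" for u using Z by simp
  have pc: "point_coeff n u k y / inverse D \<in> V" if u: "u \<in> lists {..<s}" "1 \<le> length u" "length u \<le> n" "k < n" for u k
  proof -
    have "point_coeff n u k y = (inverse D ^ length u) ^ (n - k) * coeff (char_poly (word_mat Z n u)) k"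
      unfolding point_coeff_def yw using D u by (intro char_poly_smult_coeff[OF cw]) auto
    \<comment> \<open>Both \<open>length u\<close> and \<open>n - k\<close> are positive, so at
      least one factor \<open>inverse D\<close> is available. This one factor is the whole gain of
      the lemma.\<close>
    moreover have "(inverse D ^ length u) ^ (n - k) = inverse D ^ Suc (length u * (n - k) - 1)"
    proof -
      have "0 < length u * (n - k)" using u by auto
      then show ?thesis by (simp flip: power_mult)
    qed
    ultimately have "point_coeff n u k y / inverse D = inverse D ^ (length u * (n - k) - 1) * coeff (char_poly (word_mat Z n u)) k"
      using D(1) by simp
    then show ?thesis using cc[OF u] D(2) by (auto intro!: subring_onD(4)[OF s] subring_on_power[OF s])
  qed
  obtain h where h: "\<forall>c. h c \<in> poly_subring n s"
    "word_mat (gen_mat n) n w $$ (i, j) = (\<Sum>c\<in>short_coeffs n s. c * h c :: (nat \<times> nat \<times> nat \<Rightarrow>\<^sub>0 nat) \<Rightarrow>\<^sub>0 'k poly)"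
    using M(2)[OF w ij] by blast
  have hp: "comm_ring_hom (poly_point \<phi> 0)" by (rule comm_ring_hom_poly_point[OF \<phi>(1)])
  let ?ev = "mpoly_eval (poly_point \<phi> 0) y"
  interpret ev: comm_ring_hom ?ev by (rule comm_ring_hom_mpoly_eval[OF hp])
  have evV: "?ev p \<in> V" if "p \<in> poly_subring n s" for p
  proof -
    have "subring_on {p. ?ev p \<in> V}" unfolding subring_on_def
      using subring_onD[OF s] by (simp add: ev.hom_add ev.hom_mult ev.hom_uminus ev.hom_zero ev.hom_one)
    moreover have "range (\<lambda>c. Poly_Mapping.single 0 [:c:]) \<subseteq> {p. ?ev p \<in> V}"
      using \<phi>(2) by (auto simp: mpoly_eval_const[OF hp] poly_point_simps[OF \<phi>(1)])
    moreover have "set (map mvar (var_list n s)) \<subseteq> {p. ?ev p \<in> V}"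
      using D(3) by (auto simp: mpoly_eval_mvar[OF hp] y_def set_var_list)
    ultimately have "poly_subring n s \<subseteq> {p. ?ev p \<in> V}" unfolding poly_subring_def by (rule adjoin_list_least)
    then show ?thesis using that by blast
  qed
  \<comment> \<open>Since D'^M = D^(M-1), division by D'^M is the normalisation by D^M with one
    factor of D given back, and the short coefficients absorb that factor.\<close>
  have "word_mat Z n w $$ (i, j) / D' ^ M = (inverse D ^ M * word_mat Z n w $$ (i, j)) / inverse D"
  proof -
    obtain m where m: "M = Suc m" using M(1) by (cases M) auto
    show ?thesis unfolding D'(1) using D(1) by (simp add: m field_simps)
  qed
  also have "inverse D ^ M * word_mat Z n w $$ (i, j) = word_mat (point_mat n y) n w $$ (i, j)"
    unfolding yw using w ij carrier_matD[OF cw[of w]] by simp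
  also have "\<dots> = ?ev (word_mat (gen_mat n) n w $$ (i, j))"
    using map_mat_gen_word[OF hp, of y n w] ij carrier_matD[OF word_mat_carrier[of "gen_mat n" n w, OF gen_mat_carrier]]
    by (metis index_map_mat(1))
  also have "\<dots> = (\<Sum>c\<in>short_coeffs n s. ?ev c * ?ev (h c))"
    unfolding h(2) by (simp add: ev.hom_sum ev.hom_mult)
  also have "\<dots> / inverse D = (\<Sum>c\<in>short_coeffs n s. (?ev c / inverse D) * ?ev (h c))"
    by (simp add: sum_divide_distrib)
  also have "\<dots> \<in> V"
  proof (intro subring_on_sum[OF s] subring_onD(4)[OF s])
    fix c assume "c \<in> (short_coeffs n s :: ((nat \<times> nat \<times> nat \<Rightarrow>\<^sub>0 nat) \<Rightarrow>\<^sub>0 'k poly) set)"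
    then obtain u k where u: "c = gen_coeff n u k" "u \<in> lists {..<s}" "1 \<le> length u" "length u \<le> n" "k < n"
      unfolding short_coeffs_def by auto
    show "?ev c / inverse D \<in> V" unfolding u(1) mpoly_eval_gen_coeff[OF hp] by (rule pc[OF u(2-)])
    show "?ev (h c) \<in> V" using h(1) by (intro evV) blast
  qed
  finally show "word_mat Z n w $$ (i, j) / D' ^ M \<in> V" .
qed

text \<open>Determines how many rounds of shrinking suffice: the ratio M / (M - 1) exceeds 1, so its
  powers outgrow K. For M = 1 the left-hand side is already 0 at j = 1.\<close>

lemma power_ratio_unbounded:
  fixes M K :: nat
  assumes "0 < M"
  shows "\<exists>j. K * (M - 1) ^ j < M ^ j"
proof (cases "M = 1")
  case True
  then show ?thesis by (intro exI[of _ 1]) simp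
next
  case False
  then have M: "1 < M" using assms by simp
  then have "1 < real M / real (M - 1)" by (simp add: field_simps)
  then obtain j where j: "real K < (real M / real (M - 1)) ^ j" using real_arch_pow by blast
  have "real K * real (M - 1) ^ j < real M ^ j"
    using j M by (simp add: power_divide field_simps)
  then have "real (K * (M - 1) ^ j) < real (M ^ j)" by simp
  then show ?thesis using of_nat_less_iff by blast
qed

text \<open>The invariant \<open>D ^ (M ^ j) = v ^ (N * (M - 1) ^ j)\<close> says that D is v to the
  power N ((M-1)/M)^j; roots exist in the algebraically closed field, and working with powers
  replaces a value group. Conjugation preserves all characteristic polynomials, so the coefficient
  of w keeps its value v. Being homogeneous of degree e = |w| (n - i), it gives v = D^e r with r in
  \<open>V\<close>, and for large j a positive power of v would lie in \<open>V\<close>.\<close>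

theorem integral_short_coeffs_imp_integral:
  fixes x :: "nat \<times> nat \<times> nat \<Rightarrow> 'b::alg_closed_field" and \<phi> :: "'k::field \<Rightarrow> 'b"
  assumes V: "valuation_ring V" and \<phi>: "comm_ring_hom \<phi>" "range \<phi> \<subseteq> V" and v: "v \<notin> V"
    and arch: "\<And>y. \<exists>N. y / v ^ N \<in> V"
    and cc: "\<And>w i. w \<in> lists {..<s} \<Longrightarrow> 1 \<le> length w \<Longrightarrow> length w \<le> n \<Longrightarrow> i < n \<Longrightarrow> point_coeff n w i x \<in> V"
    and w: "w \<in> lists {..<s}" and i: "i < n"
  shows "point_coeff n w i x \<noteq> v"
proof
  assume wv: "point_coeff n w i x = v"
  have s: "subring_on V" using V by (simp add: valuation_ring_def)
  have v0: "v \<noteq> 0" using v subring_onD(1)[OF s] by auto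
  have iv: "inverse v \<in> V" using V v by (auto simp: valuation_ring_def)
  obtain M where M: "0 < M" "\<And>w i j. w \<in> lists {..<s} \<Longrightarrow> length w = M \<Longrightarrow> i < n \<Longrightarrow> j < n \<Longrightarrow>
      \<exists>h. (\<forall>c. h c \<in> poly_subring n s) \<and>
      word_mat (gen_mat n) n w $$ (i, j) = (\<Sum>c\<in>short_coeffs n s. c * h c :: (nat \<times> nat \<times> nat \<Rightarrow>\<^sub>0 nat) \<Rightarrow>\<^sub>0 'k poly)"
    using long_words_in_coeff_ideal[of s n, where ?'k = 'k] by blast
  from choice[of "\<lambda>y N. y / v ^ N \<in> V"] arch obtain Nf where Nf: "\<forall>y. y / v ^ Nf y \<in> V" by blast
  \<comment> \<open>A common exponent for all entries; enlarging an individual exponent is harmless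
    because 1/v lies in \<open>V\<close>.\<close>
  define N where "N = (\<Sum>a\<in>{..<n} \<times> {..<n} \<times> {..<s}. Nf (x a))"
  have xN: "x a / v ^ N \<in> V" if a: "a \<in> {..<n} \<times> {..<n} \<times> {..<s}" for a
  proof -
    have "Nf (x a) \<le> N" unfolding N_def using a by (intro member_le_sum) auto
    then have "x a / v ^ N = x a / v ^ Nf (x a) * inverse v ^ (N - Nf (x a))"
      using v0 by (simp add: power_diff field_simps)
    also have "\<dots> \<in> V" using Nf iv by (intro subring_onD(4)[OF s] subring_on_power[OF s]) auto
    finally show ?thesis .
  qed
  have main: "\<exists>Z D. (\<forall>l. Z l \<in> carrier_mat n n) \<and> (\<forall>w. char_poly (word_mat Z n w) = char_poly (word_mat (point_mat n x) n w)) \<and>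
    D \<noteq> 0 \<and> inverse D \<in> V \<and> D ^ (M ^ j) = v ^ (N * (M - 1) ^ j) \<and>
    (\<forall>l<s. \<forall>i<n. \<forall>j<n. Z l $$ (i, j) / D \<in> V)" for j
  proof (induction j)
    case 0
    have "inverse (v ^ N) \<in> V" using subring_on_power[OF s iv, of N] by (simp add: power_inverse)
    then show ?case using v0 xN
      by (intro exI[of _ "point_mat n x"] exI[of _ "v ^ N"])
        (auto simp: point_mat_def)
  next
    case (Suc j)
    then obtain Z D where Z: "\<forall>l. Z l \<in> carrier_mat n n" "\<forall>w. char_poly (word_mat Z n w) = char_poly (word_mat (point_mat n x) n w)"
      and D: "D \<noteq> 0" "inverse D \<in> V" "D ^ (M ^ j) = v ^ (N * (M - 1) ^ j)" "\<forall>l<s. \<forall>i<n. \<forall>j<n. Z l $$ (i, j) / D \<in> V" by blast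
    obtain D' where D': "D' ^ M = D ^ (M - 1)" using nth_root_exists[OF M(1)] by blast
    have D'0: "D' \<noteq> 0" using D' D(1) M(1) by (metis power_not_zero zero_power)
    have "inverse D' ^ M = inverse D ^ (M - 1)" using D' by (simp add: power_inverse)
    then have iD': "inverse D' \<in> V"
      using valuation_ring_power[OF V M(1), of "inverse D'"] subring_on_power[OF s D(2)] by simp
    have "D' ^ (M ^ Suc j) = (D ^ (M - 1)) ^ (M ^ j)" unfolding D'[symmetric] by (simp add: power_mult)
    also have "\<dots> = (D ^ (M ^ j)) ^ (M - 1)" by (simp add: mult.commute flip: power_mult)
    also have "\<dots> = v ^ (N * (M - 1) ^ Suc j)" unfolding D(3) by (simp add: mult_ac flip: power_mult)
    finally have pD': "D' ^ (M ^ Suc j) = v ^ (N * (M - 1) ^ Suc j)" .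
    have "\<exists>g\<in>carrier_mat n n. \<exists>g'\<in>carrier_mat n n. g * g' = 1\<^sub>m n \<and> g' * g = 1\<^sub>m n \<and>
      (\<forall>l<s. \<forall>i<n. \<forall>j<n. (g' * Z l * g) $$ (i, j) / D' \<in> V)"
    proof (rule shrink_entries[OF V \<phi> _ M D(1,2) _ D' D'0])
      show "Z l \<in> carrier_mat n n" for l using Z by blast
      show "Z l $$ (i, j) / D \<in> V" if "l < s" "i < n" "j < n" for l i j using D(4) that by blast
      show "coeff (char_poly (word_mat Z n w)) i \<in> V" if "w \<in> lists {..<s}" "1 \<le> length w" "length w \<le> n" "i < n" for w i
        using cc[OF that] Z(2) by (simp add: point_coeff_def)
    qed
    then obtain g g' where g: "g \<in> carrier_mat n n" "g' \<in> carrier_mat n n" "g * g' = 1\<^sub>m n" "g' * g = 1\<^sub>m n"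
      and e: "\<forall>l<s. \<forall>i<n. \<forall>j<n. (g' * Z l * g) $$ (i, j) / D' \<in> V" by blast
    have Zc: "\<And>l. Z l \<in> carrier_mat n n" using Z(1) by blast
    have "char_poly (word_mat (\<lambda>l. g' * Z l * g) n w) = char_poly (word_mat (point_mat n x) n w)" for w
      unfolding word_mat_conj[OF Zc g] using char_poly_conj[OF word_mat_carrier[of Z n w, OF Zc] g] Z(2) by simp
    then show ?case using g Zc e D'0 iD' pD'
      by (intro exI[of _ "\<lambda>l. g' * Z l * g"] exI[of _ D']) auto
  qed
  define e where "e = length w * (n - i)"
  obtain j where j: "e * N * (M - 1) ^ j < M ^ j" using power_ratio_unbounded[OF M(1)] by blast
  obtain Z D where Z: "\<forall>l. Z l \<in> carrier_mat n n" "\<forall>w. char_poly (word_mat Z n w) = char_poly (word_mat (point_mat n x) n w)"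
    and D: "D \<noteq> 0" "inverse D \<in> V" "D ^ (M ^ j) = v ^ (N * (M - 1) ^ j)" "\<forall>l<s. \<forall>i<n. \<forall>j<n. Z l $$ (i, j) / D \<in> V"
    using main[of j] by blast
  have Zc: "\<And>l. Z l \<in> carrier_mat n n" using Z(1) by blast
  define Y where "Y l = inverse D \<cdot>\<^sub>m Z l" for l
  have Yc: "Y l \<in> carrier_mat n n" for l using Zc by (simp add: Y_def)
  have cz: "coeff (char_poly (word_mat Z n w)) i = v" using wv Z(2) by (simp add: point_coeff_def)
  have weq: "word_mat Z n w = D ^ length w \<cdot>\<^sub>m word_mat Y n w"
  proof (rule word_mat_smult[OF Yc Zc])
    show "Z l = D \<cdot>\<^sub>m Y l" for l using D(1) Zc[of l] by (intro eq_matI) (auto simp: Y_def)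
  qed
  have "v = (D ^ length w) ^ (n - i) * coeff (char_poly (word_mat Y n w)) i"
    using char_poly_smult_coeff[OF word_mat_carrier[of Y n w, OF Yc], of "D ^ length w" i] D(1) i cz
    unfolding weq by simp
  then have "v = D ^ e * coeff (char_poly (word_mat Y n w)) i" by (simp add: e_def power_mult)
  then obtain r where r: "v = D ^ e * r" "r = coeff (char_poly (word_mat Y n w)) i" by blast
  have "r \<in> V" unfolding r(2)
  proof (rule char_poly_in_subring[OF s word_mat_carrier[of Y n w, OF Yc]])
    show "word_mat Y n w $$ (a, b) \<in> V" if "a < n" "b < n" for a b
    proof (rule word_mat_in_subring[OF s Yc _ that])
      fix l a b assume "l \<in> set w" "a < n" "b < n"
      then show "Y l $$ (a, b) \<in> V" using D(4) w Zc[of l] by (auto simp: Y_def divide_inverse mult.commute)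
    qed
  qed
  have "v ^ (M ^ j) = (D ^ (M ^ j)) ^ e * r ^ (M ^ j)"
    by (subst r(1)) (simp add: power_mult_distrib mult.commute flip: power_mult)
  also have "(D ^ (M ^ j)) ^ e = v ^ (e * N * (M - 1) ^ j)" unfolding D(3) by (simp add: mult_ac flip: power_mult)
  finally have vv: "v ^ (M ^ j) = v ^ (e * N * (M - 1) ^ j) * r ^ (M ^ j)" .
  have "v ^ (M ^ j) = v ^ (e * N * (M - 1) ^ j) * v ^ (M ^ j - e * N * (M - 1) ^ j)"
    using j by (simp flip: power_add)
  with vv have "v ^ (M ^ j - e * N * (M - 1) ^ j) = r ^ (M ^ j)" using v0 by simp
  then have "v ^ (M ^ j - e * N * (M - 1) ^ j) \<in> V" using subring_on_power[OF s \<open>r \<in> V\<close>] by simp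
  then show False using valuation_ring_power[OF V, of "M ^ j - e * N * (M - 1) ^ j" v] j v by simp
qed

section \<open>The place at infinity of \<open>k(v)\<close>\<close>

lemma valuation_ring_root:
  assumes V: "valuation_ring V" and c: "\<And>i. i \<le> e \<Longrightarrow> c i \<in> V" and lc: "c e \<noteq> 0" "inverse (c e) \<in> V"
    and root: "(\<Sum>i\<le>e. c i * y ^ i) = 0"
  shows "y \<in> V"
proof -
  have s: "subring_on V" using V by (simp add: valuation_ring_def)
  define q where "q = (\<Sum>i\<le>e. monom (inverse (c e) * c i) i)"
  have cq: "coeff q i = (if i \<le> e then inverse (c e) * c i else 0)" for i
    by (auto simp: q_def coeff_sum coeff_monom)
  have dq: "degree q = e"
  proof (rule antisym)
    show "degree q \<le> e" by (rule degree_le) (auto simp: cq)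
    show "e \<le> degree q" by (rule le_degree) (use lc in \<open>auto simp: cq\<close>)
  qed
  have "poly q y = inverse (c e) * (\<Sum>i\<le>e. c i * y ^ i)"
    by (simp add: q_def poly_sum poly_monom sum_distrib_left mult.assoc)
  then have "poly q y = 0" using root by simp
  moreover have "q \<in> polys_over V"
    using c lc(2) subring_onD(1)[OF s] by (intro polys_overI) (auto simp: cq intro: subring_onD(4)[OF s])
  moreover have "lead_coeff q = 1" using dq lc by (simp add: cq)
  ultimately show ?thesis using valuation_ring_integrally_closed[OF V] by blast
qed

lemma poly_map_poly_sum:
  fixes f :: "'a::zero \<Rightarrow> 'b::comm_ring_1"
  assumes "f 0 = 0"
  shows "poly (map_poly f p) y = (\<Sum>i\<le>degree p. f (coeff p i) * y ^ i)"
proof -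
  have "(\<Sum>i\<le>degree p. coeff (map_poly f p) i * y ^ i) = poly (map_poly f p) y"
    unfolding poly_altdef
    by (rule sum.mono_neutral_right) (auto intro: le_degree order_trans[OF degree_map_poly_le])
  then show ?thesis using assms by (simp add: coeff_map_poly)
qed

lemma common_denominator:
  fixes p :: "'a::idom fract poly"
  shows "\<exists>c q. c \<noteq> 0 \<and> smult (to_fract c) p = map_poly to_fract q"
proof (induction p)
  case 0
  show ?case by (intro exI[of _ 1] exI[of _ 0]) simp
next
  case (pCons x p)
  then obtain c q where c: "c \<noteq> 0" "smult (to_fract c) p = map_poly to_fract q" by blast
  obtain a b where x: "x = Fract a b" "b \<noteq> 0" by (cases x)
  have bx: "to_fract b * x = to_fract a" using x by (simp add: to_fract_def eq_fract)
  have m: "map_poly to_fract (pCons u r) = pCons (to_fract u) (map_poly to_fract r)" for u :: 'a and r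
    by (intro poly_eqI) (simp add: coeff_map_poly coeff_pCons split: nat.split)
  have sm: "map_poly to_fract (smult b q) = smult (to_fract b) (map_poly to_fract q)"
    by (intro poly_eqI) (simp add: coeff_map_poly)
  have "smult (to_fract (b * c)) (pCons x p) = pCons (to_fract c * (to_fract b * x)) (smult (to_fract b) (smult (to_fract c) p))"
    by (simp add: mult_ac)
  also have "\<dots> = map_poly to_fract (pCons (c * a) (smult b q))" unfolding bx c(2) m sm by simp
  finally show ?case using c(1) x(2) by (intro exI[of _ "b * c"]) auto
qed

context
  fixes dummy :: "'k::field itself"
begin

abbreviation base_emb :: "'k \<Rightarrow> 'k poly fract alg_closure" where
  "base_emb a \<equiv> to_ac (Fract [:a:] 1)"

abbreviation v_ac :: "'k poly fract alg_closure" where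
  "v_ac \<equiv> to_ac (Fract [:0, 1:] 1)"

text \<open>Evaluation at v is the inclusion of k[v] into the closure of k(v). It is injective,
  which is how the transcendence of v is used below.\<close>

lemma eval_at_v: "poly (map_poly base_emb p) v_ac = to_ac (to_fract p)"
proof (induction p)
  case (pCons a p)
  have "pCons a p = [:a:] + [:0, 1:] * p" by simp
  then have "to_fract (pCons a p) = Fract [:a:] 1 + Fract [:0, 1:] 1 * to_fract p"
    by (simp only: to_fract_add to_fract_mult) (simp add: to_fract_def)
  then show ?case using pCons(2)
    by (simp only: map_poly_pCons_comm_ring_hom[OF comm_ring_hom_comp_base] poly_pCons to_ac_add to_ac_mult)
qed simp

lemma place_at_infinity:
  "\<exists>V. valuation_ring V \<and> range base_emb \<subseteq> V \<and> v_ac \<notin> V"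
proof -
  interpret b: comm_ring_hom base_emb by (rule comm_ring_hom_comp_base)
  have R: "subring_on (range base_emb)" by (rule comm_ring_hom_range_subring[OF comm_ring_hom_comp_base])
  let ?A = "adjoin (range base_emb) (inverse v_ac)"
  have v0: "v_ac \<noteq> 0"
  proof
    assume "v_ac = 0"
    then have "to_ac (to_fract [:0, 1 :: 'k:]) = 0" by (simp add: to_fract_def)
    then show False by simp
  qed
  have "v_ac \<notin> ?A"
  proof
    assume "v_ac \<in> ?A"
    then obtain q where q: "q \<in> polys_over (range base_emb)" "v_ac = poly q (inverse v_ac)" by (auto simp: adjoin_def)
    have "\<forall>i. \<exists>a. coeff q i = base_emb a" using polys_overD[OF q(1)] by blast
    from choice[OF this] obtain a where a: "\<forall>i. coeff q i = base_emb (a i)" by blast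
    define d where "d = degree q"
    \<comment> \<open>If v were a polynomial of degree d in 1/v, multiplication by v^d would make v
      a root of this monic polynomial of degree d + 1 over k.\<close>
    define r where "r = monom 1 (Suc d) - (\<Sum>i\<le>d. monom (a i) (d - i))"
    have "coeff r (Suc d) = 1" by (auto simp: r_def coeff_sum coeff_monom intro!: sum.neutral)
    then have r0: "r \<noteq> 0" by auto
    interpret m: map_poly_comm_ring_hom base_emb ..
    have mm: "map_poly base_emb (monom c i) = monom (base_emb c) i" for c i
      by (intro poly_eqI) (simp add: coeff_map_poly coeff_monom b.hom_zero)
    have "poly (map_poly base_emb r) v_ac = v_ac ^ Suc d - (\<Sum>i\<le>d. base_emb (a i) * v_ac ^ (d - i))"
      by (simp add: r_def m.hom_minus m.hom_sum mm poly_sum poly_monom b.hom_one del: power_Suc)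
    also have "(\<Sum>i\<le>d. base_emb (a i) * v_ac ^ (d - i)) = (\<Sum>i\<le>d. coeff q i * inverse v_ac ^ i * v_ac ^ d)"
      using v0 a by (intro sum.cong) (simp_all add: power_diff field_simps)
    also have "\<dots> = poly q (inverse v_ac) * v_ac ^ d" by (simp add: poly_altdef d_def sum_distrib_right)
    also have "v_ac ^ Suc d - poly q (inverse v_ac) * v_ac ^ d = 0" using q(2) by simp
    finally have "to_ac (to_fract r) = 0" by (simp add: eval_at_v)
    then show False using r0 by simp
  qed
  then obtain V where "valuation_ring V" "?A \<subseteq> V" "v_ac \<notin> V"
    using valuation_ring_exists[OF subring_on_adjoin[OF R] adjoin_gen[OF R]] by blast
  then show ?thesis using adjoin_base[OF R] by blast
qed

context
  fixes V :: "'k poly fract alg_closure set"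
  assumes V: "valuation_ring V" and bV: "range base_emb \<subseteq> V" and vV: "v_ac \<notin> V"
begin

lemma V_subring: "subring_on V" using V by (simp add: valuation_ring_def)

lemma v_nonzero: "v_ac \<noteq> 0" using vV subring_onD(1)[OF V_subring] by metis

lemma inverse_v_in_V: "inverse v_ac \<in> V" using V vV by (auto simp: valuation_ring_def)

lemma base_emb_unit: "c \<noteq> 0 \<Longrightarrow> base_emb c \<noteq> 0 \<and> inverse (base_emb c) \<in> V"
proof -
  interpret b: comm_ring_hom base_emb by (rule comm_ring_hom_comp_base)
  assume "c \<noteq> 0"
  then have "base_emb c * base_emb (inverse c) = 1" unfolding b.hom_mult[symmetric] by (simp add: b.hom_one)
  then have "inverse (base_emb c) = base_emb (inverse c)" "base_emb c \<noteq> 0" by (metis inverse_unique, metis mult_zero_left zero_neq_one)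
  then show ?thesis using bV by auto
qed

text \<open>Nonzero constants are units of \<open>V\<close>, so an equation over k can be made monic
  and \<open>V\<close> is integrally closed.\<close>

lemma algebraic_in_V:
  assumes "p \<noteq> 0" "poly (map_poly base_emb p) y = 0"
  shows "y \<in> V"
proof (rule valuation_ring_root[OF V, of "degree p" "\<lambda>i. base_emb (coeff p i)"])
  interpret b: comm_ring_hom base_emb by (rule comm_ring_hom_comp_base)
  show "base_emb (lead_coeff p) \<noteq> 0" "inverse (base_emb (lead_coeff p)) \<in> V"
    using base_emb_unit[of "lead_coeff p"] assms(1) by auto
  show "(\<Sum>i\<le>degree p. base_emb (coeff p i) * y ^ i) = 0"
    using assms(2) poly_map_poly_sum[of base_emb p y, OF b.hom_zero] by simp
qed (use bV in auto)

text \<open>If the value of a nonconstant polynomial a at v were in \<open>V\<close>, then v would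
  be a root of a(X) - a(v), a polynomial over \<open>V\<close> whose leading coefficient is a unit;
  v would then lie in \<open>V\<close>. So this value is outside \<open>V\<close>, and its inverse
  is inside.\<close>

lemma inverse_polynomial_in_V:
  assumes "a \<noteq> 0"
  shows "inverse (to_ac (to_fract a)) \<in> V"
proof (cases "degree a = 0")
  case True
  then obtain c where "a = [:c:]" by (elim degree_eq_zeroE)
  then show ?thesis using base_emb_unit[of c] assms by (simp add: to_fract_def)
next
  case False
  interpret b: comm_ring_hom base_emb by (rule comm_ring_hom_comp_base)
  show ?thesis
  proof (rule ccontr)
    assume "\<not> ?thesis"
    then have aV: "to_ac (to_fract a) \<in> V" using V by (metis inverse_inverse_eq valuation_ring_def)
    define c where "c i = base_emb (coeff a i) - (if i = 0 then to_ac (to_fract a) else 0)" for i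
    have "v_ac \<in> V"
    proof (rule valuation_ring_root[OF V, of "degree a" c])
      show "c i \<in> V" for i using bV aV subring_onD(1)[OF V_subring] unfolding c_def
        by (intro subring_onD(6)[OF V_subring]) auto
      show "c (degree a) \<noteq> 0" "inverse (c (degree a)) \<in> V"
        using base_emb_unit[of "lead_coeff a"] assms False by (auto simp: c_def)
      have "(\<Sum>i\<le>degree a. c i * v_ac ^ i) = (\<Sum>i\<le>degree a. base_emb (coeff a i) * v_ac ^ i) - (\<Sum>i\<le>degree a. (if i = 0 then to_ac (to_fract a) else 0) * v_ac ^ i)"
        by (simp add: c_def left_diff_distrib sum_subtractf)
      also have "(\<Sum>i\<le>degree a. (if i = 0 then to_ac (to_fract a) else 0) * v_ac ^ i) = (\<Sum>i\<in>{0}. (if i = 0 then to_ac (to_fract a) else 0) * v_ac ^ i)"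
        by (rule sum.mono_neutral_right) auto
      also have "(\<Sum>i\<le>degree a. base_emb (coeff a i) * v_ac ^ i) = poly (map_poly base_emb a) v_ac"
        using poly_map_poly_sum[of base_emb a v_ac, OF b.hom_zero] by simp
      finally show "(\<Sum>i\<le>degree a. c i * v_ac ^ i) = 0" by (simp add: eval_at_v)
    qed
    then show False using vV by blast
  qed
qed

lemma polynomial_bound:
  assumes "degree a \<le> N"
  shows "to_ac (to_fract a) * inverse v_ac ^ N \<in> V"
proof -
  interpret b: comm_ring_hom base_emb by (rule comm_ring_hom_comp_base)
  have "to_ac (to_fract a) = (\<Sum>i\<le>degree a. base_emb (coeff a i) * v_ac ^ i)"
    using poly_map_poly_sum[of base_emb a v_ac, OF b.hom_zero] by (simp add: eval_at_v)
  then have "to_ac (to_fract a) * inverse v_ac ^ N = (\<Sum>i\<le>degree a. base_emb (coeff a i) * (v_ac ^ i * inverse v_ac ^ N))"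
    by (simp add: sum_distrib_right mult.assoc)
  also have "\<dots> = (\<Sum>i\<le>degree a. base_emb (coeff a i) * inverse v_ac ^ (N - i))"
  proof (intro sum.cong refl)
    fix i assume "i \<in> {..degree a}"
    then have "inverse v_ac ^ N = inverse v_ac ^ i * inverse v_ac ^ (N - i)" using assms by (simp flip: power_add)
    then show "base_emb (coeff a i) * (v_ac ^ i * inverse v_ac ^ N) = base_emb (coeff a i) * inverse v_ac ^ (N - i)"
      using v_nonzero by (simp add: power_mult_distrib[symmetric] mult.assoc[symmetric])
  qed
  also have "\<dots> \<in> V" using bV inverse_v_in_V
    by (intro subring_on_sum[OF V_subring] subring_onD(4)[OF V_subring] subring_on_power[OF V_subring]) auto
  finally show ?thesis .
qed

text \<open>Clear denominators in an equation of y over k(v), put y = v^N y' and divide by the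
  leading coefficient and by v^(N e). The coefficient at i < e acquires the factor v^(-N (e - i)),
  which dominates its degree in v once N bounds all degrees, and inverses of nonzero polynomials lie
  in \<open>V\<close>. Hence y' is integral over \<open>V\<close>.\<close>

lemma archimedean_at_infinity: "\<exists>N. y / v_ac ^ N \<in> V"
proof -
  obtain p :: "'k poly fract poly" where p: "p \<noteq> 0" "poly (map_poly to_ac p) y = 0" by (rule alg_closure_algebraic)
  obtain c q where cq: "c \<noteq> 0" "smult (to_fract c) p = map_poly to_fract q" using common_denominator by blast
  have q0: "q \<noteq> 0" using cq p by auto
  define e where "e = degree q"
  define \<psi> where "\<psi> a = to_ac (to_fract a)" for a :: "'k poly"
  interpret m: map_poly_comm_ring_hom "to_ac :: 'k poly fract \<Rightarrow> _" by (intro map_poly_comm_ring_hom.intro comm_ring_hom_to_ac)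
  have "poly (map_poly to_ac (smult (to_fract c) p)) y = \<psi> c * poly (map_poly to_ac p) y"
  proof -
    have "map_poly to_ac (smult (to_fract c) p) = smult (\<psi> c) (map_poly to_ac p)"
      by (intro poly_eqI) (simp add: coeff_map_poly \<psi>_def)
    then show ?thesis by simp
  qed
  then have "poly (map_poly to_ac (map_poly to_fract q)) y = 0" using p cq by simp
  moreover have "map_poly to_ac (map_poly to_fract q) = map_poly \<psi> q"
    by (intro poly_eqI) (simp add: coeff_map_poly \<psi>_def)
  ultimately have root: "(\<Sum>i\<le>e. \<psi> (coeff q i) * y ^ i) = 0"
    using poly_map_poly_sum[of \<psi> q y] by (simp add: \<psi>_def e_def)
  define N where "N = (\<Sum>i\<le>e. degree (coeff q i))"
  have Nd: "degree (coeff q i) \<le> N" if "i \<le> e" for i unfolding N_def using that by (intro member_le_sum) auto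
  have le0: "coeff q e \<noteq> 0" using q0 by (simp add: e_def)
  then have ie: "\<psi> (coeff q e) \<noteq> 0" "inverse (\<psi> (coeff q e)) \<in> V" using inverse_polynomial_in_V by (auto simp: \<psi>_def)
  define y' where "y' = y / v_ac ^ N"
  have y: "y = v_ac ^ N * y'" using v_nonzero by (simp add: y'_def)
  define d where "d i = (if i = e then 1 else inverse (\<psi> (coeff q e)) * (\<psi> (coeff q i) * inverse v_ac ^ (N * (e - i))))" for i
  have "y' \<in> V"
  proof (rule valuation_ring_root[OF V, of e d])
    show "d i \<in> V" if "i \<le> e" for i
    proof (cases "i = e")
      case False
      then have "1 \<le> e - i" using that by simp
      then have "N \<le> N * (e - i)" by simp
      then have "\<psi> (coeff q i) * inverse v_ac ^ (N * (e - i)) \<in> V"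
        unfolding \<psi>_def using Nd[OF that] by (intro polynomial_bound) (rule order_trans)
      then show ?thesis using False ie(2) by (simp add: d_def subring_onD(4)[OF V_subring])
    qed (use subring_onD(2)[OF V_subring] in \<open>simp add: d_def\<close>)
    show "d e \<noteq> 0" "inverse (d e) \<in> V" using subring_onD(2)[OF V_subring] by (simp_all add: d_def)
    have t: "d i * y' ^ i = inverse (\<psi> (coeff q e)) * inverse v_ac ^ (N * e) * (\<psi> (coeff q i) * y ^ i)" if "i \<le> e" for i
    proof -
      have "y ^ i = v_ac ^ (N * i) * y' ^ i" unfolding y by (simp add: power_mult_distrib power_mult)
      moreover have "inverse v_ac ^ (N * e) = inverse v_ac ^ (N * (e - i)) * inverse v_ac ^ (N * i)"
        using that by (simp flip: power_add add: diff_mult_distrib2)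
      moreover have "v_ac ^ (N * i) * inverse v_ac ^ (N * i) = 1"
        using v_nonzero by (simp flip: power_mult_distrib)
      ultimately have r: "inverse v_ac ^ (N * e) * y ^ i = inverse v_ac ^ (N * (e - i)) * y' ^ i"
        by (simp add: mult.assoc mult.left_commute)
      have "d i = inverse (\<psi> (coeff q e)) * (\<psi> (coeff q i) * inverse v_ac ^ (N * (e - i)))"
        using ie(1) by (auto simp: d_def)
      then show ?thesis using r by (simp add: mult.assoc mult.left_commute)
    qed
    have "(\<Sum>i\<le>e. d i * y' ^ i) = inverse (\<psi> (coeff q e)) * inverse v_ac ^ (N * e) * (\<Sum>i\<le>e. \<psi> (coeff q i) * y ^ i)"
      unfolding sum_distrib_left by (rule sum.cong[OF refl]) (simp add: t)
    then show "(\<Sum>i\<le>e. d i * y' ^ i) = 0" using root by simp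
  qed
  then show ?thesis unfolding y'_def by blast
qed

end

end

theorem all_J_ideals_trivial:
  fixes f :: "nat \<Rightarrow> (nat list \<Rightarrow>\<^sub>0 'k::field)"
  assumes f: "\<forall>r<t. f r \<in> carrier (free_algebra s)"
    and triv: "\<forall>c\<in>CharCoefs n s. 1 \<in> J_ideal n s t f c"
    and w: "w \<in> lists {..<s}" and i: "i < n"
  shows "1 \<in> J_ideal n s t f (gen_coeff n w i)"
proof (rule ccontr)
  assume "\<not> ?thesis"
  then obtain x where x: "rel_point n t f (\<lambda>a. to_ac (Fract [:a:] 1)) x"
    "point_coeff n w i x = to_ac (Fract [:0, 1 :: 'k:] 1)"
    using J_ideal_proper_imp_transcendental_point[OF f w i] by blast
  obtain V where V: "valuation_ring V" "range (\<lambda>a :: 'k. to_ac (Fract [:a:] 1)) \<subseteq> V" "to_ac (Fract [:0, 1 :: 'k:] 1) \<notin> V"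
    using place_at_infinity by blast
  have "point_coeff n u k x \<in> V" if u: "u \<in> lists {..<s}" "1 \<le> length u" "length u \<le> n" "k < n" for u k
  proof -
    have "gen_coeff n u k \<in> CharCoefs n s" unfolding CharCoefs_eq using u by auto
    then have "1 \<in> J_ideal n s t f (gen_coeff n u k)" using triv by blast
    from J_ideal_one_imp_algebraic[OF f u(1,4) this, where ?'b = "'k poly fract alg_closure"]
    obtain d where "d \<noteq> 0" "poly (map_poly (\<lambda>a. to_ac (Fract [:a:] 1)) d) (point_coeff n u k x) = 0"
      using comm_ring_hom_comp_base x(1) by blast
    then show ?thesis by (rule algebraic_in_V[OF V])
  qed
  from integral_short_coeffs_imp_integral[OF V(1) comm_ring_hom_comp_base V(2,3) archimedean_at_infinity[OF V] this w i]
  show False using x(2) by blast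
qed

section \<open>Burnside's theorem\<close>

definition mat_subspace :: "nat \<Rightarrow> nat \<Rightarrow> 'a::field mat set \<Rightarrow> bool" where
  "mat_subspace m k S \<longleftrightarrow> S \<subseteq> carrier_mat m k \<and> 0\<^sub>m m k \<in> S \<and> (\<forall>x\<in>S. \<forall>y\<in>S. x + y \<in> S) \<and> (\<forall>c. \<forall>x\<in>S. c \<cdot>\<^sub>m x \<in> S)"

lemma mat_subspaceD:
  assumes "mat_subspace m k S"
  shows "S \<subseteq> carrier_mat m k" "0\<^sub>m m k \<in> S" "x \<in> S \<Longrightarrow> y \<in> S \<Longrightarrow> x + y \<in> S" "x \<in> S \<Longrightarrow> c \<cdot>\<^sub>m x \<in> S"
  using assms unfolding mat_subspace_def by auto

lemma adj_inverse:
  fixes Q :: "'a::field mat"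
  assumes Q: "Q \<in> carrier_mat m m" and d: "det Q \<noteq> 0"
  shows "\<exists>R\<in>carrier_mat m m. Q * R = 1\<^sub>m m \<and> R * Q = 1\<^sub>m m"
proof (intro bexI conjI)
  let ?R = "inverse (det Q) \<cdot>\<^sub>m adj_mat Q"
  show "?R \<in> carrier_mat m m" using adj_mat(1)[OF Q] by simp
  show "Q * ?R = 1\<^sub>m m" "?R * Q = 1\<^sub>m m"
    using adj_mat[OF Q] d Q
    by (auto simp: mult_smult_distrib[OF Q adj_mat(1)[OF Q]] mult_smult_assoc_mat[OF adj_mat(1)[OF Q] Q] intro!: eq_matI)
qed

text \<open>Column vectors are \<open>m \<times> 1\<close> matrices.\<close>

definition colm :: "nat \<Rightarrow> 'a mat \<Rightarrow> nat \<Rightarrow> 'a mat" where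
  "colm m Q j = mat m 1 (\<lambda>(i, _). Q $$ (i, j))"

lemma colm_carrier [simp]: "colm m Q j \<in> carrier_mat m 1"
  by (simp add: colm_def)

text \<open>Dimension expressed by invertible matrices: the columns of Q form a basis of the whole
  space whose first r members lie in \<open>S\<close>. The largest possible r is the dimension of
  \<open>S\<close>.\<close>

definition adapted :: "nat \<Rightarrow> 'a::field mat set \<Rightarrow> nat \<Rightarrow> 'a mat \<Rightarrow> bool" where
  "adapted m S r Q \<longleftrightarrow> r \<le> m \<and> Q \<in> carrier_mat m m \<and> det Q \<noteq> 0 \<and> (\<forall>j<r. colm m Q j \<in> S)"

definition sdim :: "nat \<Rightarrow> 'a::field mat set \<Rightarrow> nat" where
  "sdim m S = (GREATEST r. \<exists>Q. adapted m S r Q)"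

lemma sdim_adapted: "\<exists>Q. adapted m S (sdim m S) Q"
  unfolding sdim_def
proof (rule GreatestI_nat[where k = 0 and b = m])
  show "\<exists>Q. adapted m S 0 Q" by (intro exI[of _ "1\<^sub>m m"]) (simp add: adapted_def)
qed (auto simp: adapted_def)

lemma sdim_greatest: "adapted m S r Q \<Longrightarrow> r \<le> sdim m S"
  unfolding sdim_def by (rule Greatest_le_nat[where b = m]) (auto simp: adapted_def)

lemma sdim_le: "sdim m S \<le> m"
  using sdim_adapted[of m S] by (auto simp: adapted_def)

text \<open>If x in \<open>S\<close> had a nonzero coordinate at some i \<ge> r, replacing column i
  of Q by x would keep the determinant nonzero by Cramer's rule. Swapping that column into position
  r would give r + 1 leading columns in \<open>S\<close>, against the maximality of r.\<close>

lemma adapted_normal_form: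
  fixes S :: "'a::field mat set"
  assumes S: "mat_subspace m 1 S" and ad: "adapted m S r Q" and r: "r = sdim m S"
    and R: "R \<in> carrier_mat m m" "Q * R = 1\<^sub>m m" "R * Q = 1\<^sub>m m" and x: "x \<in> carrier_mat m 1"
  shows "x \<in> S \<longleftrightarrow> (\<forall>i. r \<le> i \<longrightarrow> i < m \<longrightarrow> (R * x) $$ (i, 0) = 0)"
proof -
  have Q: "Q \<in> carrier_mat m m" "det Q \<noteq> 0" "\<forall>j<r. colm m Q j \<in> S" and rm: "r \<le> m"
    using ad by (auto simp: adapted_def)
  have fwd: "(R * x) $$ (i, 0) = 0" if x: "x \<in> S" and i: "r \<le> i" "i < m" for x i
  proof (rule ccontr)
    assume nz: "(R * x) $$ (i, 0) \<noteq> 0"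
    have xc: "x \<in> carrier_mat m 1" using x mat_subspaceD(1)[OF S] by blast
    define xv where "xv = col x 0"
    have xv: "xv \<in> carrier_vec m" using carrier_matD(1)[OF xc] by (intro carrier_vecI) (simp add: xv_def)
    define Q1 where "Q1 = replace_col Q xv i"
    have Q1: "Q1 \<in> carrier_mat m m" using Q(1) by (simp add: Q1_def replace_col_def)
    have "Q *\<^sub>v (R *\<^sub>v xv) = xv" using R Q(1) xv by (simp flip: assoc_mult_mat_vec[OF Q(1) R(1) xv])
    then have "det Q1 = (R *\<^sub>v xv) $ i * det Q"
      using cramer_lemma_mat[OF Q(1) _ i(2), of "R *\<^sub>v xv"] R(1) xv by (simp add: Q1_def)
    also have "(R *\<^sub>v xv) $ i = (R * x) $$ (i, 0)" using R(1) xc i by (simp add: xv_def)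
    finally have d1: "det Q1 \<noteq> 0" using nz Q(2) by simp
    define Q2 where "Q2 = (if i = r then Q1 else swapcols r i Q1)"
    have Q2: "Q2 \<in> carrier_mat m m" using Q1 by (simp add: Q2_def)
    have "det Q2 \<noteq> 0"
    proof (cases "i = r")
      case False
      then have "det (swapcols r i Q1) = - det Q1" using i Q1 by (intro det_swapcols[of _ m]) auto
      then show ?thesis using d1 False by (simp add: Q2_def)
    qed (use d1 in \<open>simp add: Q2_def\<close>)
    moreover have "colm m Q2 j \<in> S" if j: "j < Suc r" for j
    proof (cases "j = r")
      case True
      have "colm m Q2 j = x" using True xc i Q1 Q(1)
        by (intro eq_matI) (auto simp: colm_def Q2_def Q1_def replace_col_def xv_def)
      then show ?thesis using x by simp
    next
      case False
      then have "colm m Q2 j = colm m Q j" using j i Q1 Q(1)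
        by (intro eq_matI) (auto simp: colm_def Q2_def Q1_def replace_col_def)
      then show ?thesis using Q(3) j False by simp
    qed
    ultimately have "adapted m S (Suc r) Q2" unfolding adapted_def using Q2 i by auto
    then show False using sdim_greatest r by fastforce
  qed
  have bwd: "x \<in> S" if x: "x \<in> carrier_mat m 1" and z: "\<forall>i. r \<le> i \<longrightarrow> i < m \<longrightarrow> (R * x) $$ (i, 0) = 0" for x
  proof -
    define y where "y = R * x"
    have y: "y \<in> carrier_mat m 1" using R(1) x by (simp add: y_def)
    have x': "x = Q * y" using R Q(1) x by (simp add: y_def flip: assoc_mult_mat[OF Q(1) R(1) x])
    define part where "part k = mat m 1 (\<lambda>(i, _). \<Sum>j<k. Q $$ (i, j) * y $$ (j, 0))" for k
    have "part k \<in> S" if "k \<le> r" for k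
      using that
    proof (induction k)
      case 0
      have "part 0 = 0\<^sub>m m 1" by (intro eq_matI) (auto simp: part_def)
      then show ?case using mat_subspaceD(2)[OF S] by simp
    next
      case (Suc k)
      have "part (Suc k) = part k + y $$ (k, 0) \<cdot>\<^sub>m colm m Q k"
        by (intro eq_matI) (auto simp: part_def colm_def)
      then show ?case using Suc Q(3) mat_subspaceD(3,4)[OF S] by simp
    qed
    moreover have "x = part r"
    proof (rule eq_matI)
      fix i j assume "i < dim_row (part r)" "j < dim_col (part r)"
      then have ij: "i < m" "j = 0" by (simp_all add: part_def)
      have "x $$ (i, j) = (\<Sum>k<m. Q $$ (i, k) * y $$ (k, 0))"
        unfolding x' using ij Q(1) y by (simp add: times_mat_def scalar_prod_def atLeast0LessThan)
      also have "\<dots> = (\<Sum>k<r. Q $$ (i, k) * y $$ (k, 0))"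
        using rm z by (intro sum.mono_neutral_right) (auto simp: y_def)
      finally show "x $$ (i, j) = part r $$ (i, j)" using ij by (simp add: part_def)
    qed (use x in \<open>auto simp: part_def\<close>)
    ultimately show ?thesis by simp
  qed
  show ?thesis using fwd bwd x by blast
qed

text \<open>A matrix adapted to the smaller subspace is also adapted to the larger one. With equal
  dimensions the normal form describes both subspaces by the same equations.\<close>

lemma sdim_strict_mono:
  assumes S: "mat_subspace m 1 S" and T: "mat_subspace m 1 T" and sub: "S \<subset> T"
  shows "sdim m S < sdim m T"
proof (rule ccontr)
  assume n: "\<not> ?thesis"
  obtain Q where Q: "adapted m S (sdim m S) Q" using sdim_adapted by blast
  then have QT: "adapted m T (sdim m S) Q" using sub by (auto simp: adapted_def)
  with n have e: "sdim m S = sdim m T" using sdim_greatest by fastforce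
  obtain R where R: "R \<in> carrier_mat m m" "Q * R = 1\<^sub>m m" "R * Q = 1\<^sub>m m"
    using adj_inverse[of Q m] Q by (auto simp: adapted_def)
  have "x \<in> S \<longleftrightarrow> x \<in> T" if "x \<in> carrier_mat m 1" for x
    using adapted_normal_form[OF S Q refl R that] adapted_normal_form[OF T QT e R that] by blast
  then show False using sub mat_subspaceD(1)[OF S] mat_subspaceD(1)[OF T] by blast
qed

lemma subspace_normal_form:
  fixes S :: "'a::field mat set"
  assumes S: "mat_subspace m 1 S"
  shows "\<exists>Q\<in>carrier_mat m m. \<exists>R\<in>carrier_mat m m. Q * R = 1\<^sub>m m \<and> R * Q = 1\<^sub>m m \<and>
    (\<forall>x\<in>carrier_mat m 1. x \<in> S \<longleftrightarrow> (\<forall>i. sdim m S \<le> i \<longrightarrow> i < m \<longrightarrow> (R * x) $$ (i, 0) = 0))"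
proof -
  obtain Q where Q: "adapted m S (sdim m S) Q" using sdim_adapted by blast
  then have Qc: "Q \<in> carrier_mat m m" "det Q \<noteq> 0" by (auto simp: adapted_def)
  obtain R where R: "R \<in> carrier_mat m m" "Q * R = 1\<^sub>m m" "R * Q = 1\<^sub>m m" using adj_inverse[OF Qc] by blast
  show ?thesis using Qc(1) R adapted_normal_form[OF S Q refl R] by blast
qed

section \<open>Irreducible algebras of matrices\<close>

definition mat_algebra :: "nat \<Rightarrow> 'a::field mat set \<Rightarrow> bool" where
  "mat_algebra m A \<longleftrightarrow> mat_subspace m m A \<and> 1\<^sub>m m \<in> A \<and> (\<forall>x\<in>A. \<forall>y\<in>A. x * y \<in> A)"

lemma mat_algebraD:
  assumes "mat_algebra m A"
  shows "mat_subspace m m A" "1\<^sub>m m \<in> A" "x \<in> A \<Longrightarrow> y \<in> A \<Longrightarrow> x * y \<in> A" "x \<in> A \<Longrightarrow> x \<in> carrier_mat m m"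
  using assms unfolding mat_algebra_def mat_subspace_def by auto

definition invariant_subspace :: "nat \<Rightarrow> 'a::field mat set \<Rightarrow> 'a mat set \<Rightarrow> bool" where
  "invariant_subspace m A S \<longleftrightarrow> mat_subspace m 1 S \<and> (\<forall>a\<in>A. \<forall>x\<in>S. a * x \<in> S)"

definition irreducible_action :: "nat \<Rightarrow> 'a::field mat set \<Rightarrow> bool" where
  "irreducible_action m A \<longleftrightarrow> (\<forall>S. invariant_subspace m A S \<longrightarrow> S = {0\<^sub>m m 1} \<or> S = carrier_mat m 1)"

text \<open>The orbit A u is an invariant subspace, and it contains u because the algebra is
  unital.\<close>

lemma irreducible_transitive:
  assumes A: "mat_algebra m A" and irr: "irreducible_action m A"
    and u: "u \<in> carrier_mat m 1" "u \<noteq> 0\<^sub>m m 1" and w: "w \<in> carrier_mat m 1"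
  shows "\<exists>a\<in>A. a * u = w"
proof -
  note s = mat_algebraD(1)[OF A] and Ac = mat_algebraD(4)[OF A]
  have "invariant_subspace m A ((\<lambda>a. a * u) ` A)" unfolding invariant_subspace_def mat_subspace_def
  proof (intro conjI ballI allI)
    show "(\<lambda>a. a * u) ` A \<subseteq> carrier_mat m 1" by (intro image_subsetI mult_carrier_mat[OF Ac u(1)])
    show "0\<^sub>m m 1 \<in> (\<lambda>a. a * u) ` A" using mat_subspaceD(2)[OF s] left_mult_zero_mat[OF u(1), of m]
      by (metis image_eqI)
    fix x assume "x \<in> (\<lambda>a. a * u) ` A"
    then obtain a where a: "a \<in> A" "x = a * u" by blast
    { fix y assume "y \<in> (\<lambda>a. a * u) ` A"
      then obtain b where b: "b \<in> A" "y = b * u" by blast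
      have "x + y = (a + b) * u" using a b add_mult_distrib_mat[OF Ac[OF a(1)] Ac[OF b(1)] u(1)] by simp
      then show "x + y \<in> (\<lambda>a. a * u) ` A" using mat_subspaceD(3)[OF s a(1) b(1)] by blast }
    { fix c
      have "c \<cdot>\<^sub>m x = (c \<cdot>\<^sub>m a) * u" using a mult_smult_assoc_mat[OF Ac[OF a(1)] u(1)] by simp
      then show "c \<cdot>\<^sub>m x \<in> (\<lambda>a. a * u) ` A" using mat_subspaceD(4)[OF s a(1)] by blast }
    { fix b assume b: "b \<in> A"
      have "b * x = (b * a) * u" using a assoc_mult_mat[OF Ac[OF b] Ac[OF a(1)] u(1)] by simp
      then show "b * x \<in> (\<lambda>a. a * u) ` A" using mat_algebraD(3)[OF A b a(1)] by blast }
  qed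
  moreover have "u \<in> (\<lambda>a. a * u) ` A" using mat_algebraD(2)[OF A] left_mult_one_mat[OF u(1)] by (metis image_eqI)
  ultimately have "(\<lambda>a. a * u) ` A = carrier_mat m 1" using irr u(2) unfolding irreducible_action_def by blast
  with w have "w \<in> (\<lambda>a. a * u) ` A" by (simp only:)
  then obtain a where "w = a * u" "a \<in> A" by (rule imageE)
  then show ?thesis by (intro bexI[of _ a]) (simp only:)
qed


lemma kernel_subspace:
  assumes a: "a \<in> carrier_mat m m"
  shows "mat_subspace m 1 {x \<in> carrier_mat m 1. a * x = 0\<^sub>m m 1}"
  unfolding mat_subspace_def
proof (intro conjI ballI allI)
  show "0\<^sub>m m 1 \<in> {x \<in> carrier_mat m 1. a * x = 0\<^sub>m m 1}" using right_mult_zero_mat[OF a] by simp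
  fix x assume x: "x \<in> {x \<in> carrier_mat m 1. a * x = 0\<^sub>m m 1}"
  then have xc: "x \<in> carrier_mat m 1" "a * x = 0\<^sub>m m 1" by auto
  { fix y assume "y \<in> {x \<in> carrier_mat m 1. a * x = 0\<^sub>m m 1}"
    then have y: "y \<in> carrier_mat m 1" "a * y = 0\<^sub>m m 1" by auto
    have "a * (x + y) = 0\<^sub>m m 1" using mult_add_distrib_mat[OF a xc(1) y(1)] xc y by simp
    moreover have "x + y \<in> carrier_mat m 1" by (rule add_carrier_mat[OF y(1)])
    ultimately show "x + y \<in> {x \<in> carrier_mat m 1. a * x = 0\<^sub>m m 1}" by simp }
  { fix c
    have "a * (c \<cdot>\<^sub>m x) = c \<cdot>\<^sub>m 0\<^sub>m m 1" using mult_smult_distrib[OF a xc(1)] xc by simp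
    also have "\<dots> = 0\<^sub>m m 1" by (intro eq_matI) auto
    finally show "c \<cdot>\<^sub>m x \<in> {x \<in> carrier_mat m 1. a * x = 0\<^sub>m m 1}" using smult_carrier_mat[OF xc(1)] by simp }
qed auto

lemma mult_colm: "a \<in> carrier_mat m m \<Longrightarrow> M \<in> carrier_mat m m \<Longrightarrow> j < m \<Longrightarrow> a * colm m M j = colm m (a * M) j"
  by (intro eq_matI) (auto simp: colm_def times_mat_def scalar_prod_def)

lemma colm_eq_zero_imp: "(a :: 'a::field mat) \<in> carrier_mat m m \<Longrightarrow> (\<And>x. x \<in> carrier_mat m 1 \<Longrightarrow> a * x = 0\<^sub>m m 1) \<Longrightarrow> a = 0\<^sub>m m m"
proof -
  assume a: "(a :: 'a mat) \<in> carrier_mat m m" and z: "\<And>x. x \<in> carrier_mat m 1 \<Longrightarrow> a * x = 0\<^sub>m m 1"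
  show ?thesis
  proof (rule eq_matI)
    fix i j assume "i < dim_row (0\<^sub>m m m :: 'a mat)" "j < dim_col (0\<^sub>m m m :: 'a mat)"
    then have ij: "i < m" "j < m" by auto
    have "colm m (a * 1\<^sub>m m) j = 0\<^sub>m m 1" using mult_colm[OF a one_carrier_mat ij(2)] z[OF colm_carrier] by simp
    then have "colm m a j $$ (i, 0) = 0" using a ij by simp
    then show "a $$ (i, j) = 0\<^sub>m m m $$ (i, j)" using ij by (simp add: colm_def)
  qed (use a in auto)
qed

text \<open>N preserves the span of the first r unit vectors and acts on the quotient by its lower
  right block. An eigenvector of that block is lifted with zeros in the first r coordinates, so the
  eigenvalue equation holds only in the remaining ones.\<close>

lemma quotient_eigenvector:
  fixes N :: "'a::alg_closed_field mat"
  assumes N: "N \<in> carrier_mat m m" and r: "r < m"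
    and low: "\<And>i j. r \<le> i \<Longrightarrow> i < m \<Longrightarrow> j < r \<Longrightarrow> N $$ (i, j) = 0"
  shows "\<exists>\<mu>. \<exists>z\<in>carrier_mat m 1. (\<exists>i. r \<le> i \<and> i < m \<and> z $$ (i, 0) \<noteq> 0) \<and>
    (\<forall>i. r \<le> i \<longrightarrow> i < m \<longrightarrow> (N * z) $$ (i, 0) = \<mu> * z $$ (i, 0))"
proof -
  define B where "B = mat (m - r) (m - r) (\<lambda>(i, j). N $$ (r + i, r + j))"
  have B: "B \<in> carrier_mat (m - r) (m - r)" by (simp add: B_def)
  have "degree (char_poly B) = m - r" using degree_monic_char_poly[OF B] by blast
  then obtain \<mu> where "poly (char_poly B) \<mu> = 0" using alg_closed_imp_poly_has_root[of "char_poly B"] r by auto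
  then have "eigenvalue B \<mu>" using eigenvalue_root_char_poly[OF B] by blast
  then obtain v where v: "v \<in> carrier_vec (m - r)" "v \<noteq> 0\<^sub>v (m - r)" "B *\<^sub>v v = \<mu> \<cdot>\<^sub>v v"
    using B by (auto simp: eigenvalue_def eigenvector_def)
  define z where "z = mat m 1 (\<lambda>(i, _). if i < r then 0 else v $ (i - r))"
  have z: "z \<in> carrier_mat m 1" by (simp add: z_def)
  have "\<exists>i<m - r. v $ i \<noteq> 0"
  proof (rule ccontr)
    assume "\<not> ?thesis"
    then have "v = 0\<^sub>v (m - r)" using v(1) by (intro eq_vecI) auto
    then show False using v(2) by simp
  qed
  then obtain i where i: "i < m - r" "v $ i \<noteq> 0" by blast
  have "(N * z) $$ (k, 0) = \<mu> * z $$ (k, 0)" if k: "r \<le> k" "k < m" for k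
  proof -
    have "(N * z) $$ (k, 0) = (\<Sum>j<m. N $$ (k, j) * z $$ (j, 0))"
      using N z k by (simp add: times_mat_def scalar_prod_def atLeast0LessThan)
    also have "\<dots> = (\<Sum>j\<in>{r..<m}. N $$ (k, j) * v $ (j - r))"
    proof -
      have "(\<Sum>j<m. N $$ (k, j) * z $$ (j, 0)) = (\<Sum>j\<in>{r..<m}. N $$ (k, j) * z $$ (j, 0))"
        by (intro sum.mono_neutral_right) (auto simp: z_def)
      then show ?thesis by (simp add: z_def)
    qed
    also have "\<dots> = (\<Sum>j<m - r. N $$ (k, r + j) * v $ j)"
      using r by (intro sum.reindex_bij_witness[of _ "\<lambda>j. r + j" "\<lambda>j. j - r"]) auto
    also have "\<dots> = (B *\<^sub>v v) $ (k - r)"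
      using k v(1) by (simp add: B_def scalar_prod_def atLeast0LessThan)
    also have "\<dots> = \<mu> * z $$ (k, 0)" using k v by (simp add: z_def)
    finally show ?thesis .
  qed
  moreover have "r \<le> r + i \<and> r + i < m \<and> z $$ (r + i, 0) \<noteq> 0" using i by (simp add: z_def)
  ultimately show ?thesis using z by blast
qed

text \<open>
  A nonzero \<open>a \<in> A\<close> with the largest kernel has rank one: if \<open>a x\<close> and \<open>a y\<close> were independent and
  \<open>b a x = y\<close>, then \<open>a b a - \<mu> a\<close> would be nonzero with a larger kernel for an eigenvalue \<open>\<mu>\<close> of
  \<open>b a\<close> modulo the kernel of \<open>a\<close>.
\<close>

lemma rank_one_element:
  fixes A :: "'a::alg_closed_field mat set"
  assumes A: "mat_algebra m A" and irr: "irreducible_action m A" and m: "0 < m"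
  shows "\<exists>a\<in>A. \<exists>x\<in>carrier_mat m 1. a * x \<noteq> 0\<^sub>m m 1 \<and> (\<forall>y\<in>carrier_mat m 1. \<exists>c. a * y = c \<cdot>\<^sub>m (a * x))"
proof -
  note s = mat_algebraD(1)[OF A] and Ac = mat_algebraD(4)[OF A]
  define K where "K a = {x \<in> carrier_mat m 1. a * x = 0\<^sub>m m 1}" for a :: "'a mat"
  have Ks: "mat_subspace m 1 (K a)" if "a \<in> A" for a unfolding K_def by (rule kernel_subspace[OF Ac[OF that]])
  have one: "1\<^sub>m m \<in> A \<and> 1\<^sub>m m \<noteq> (0\<^sub>m m m :: 'a mat)"
  proof
    show "1\<^sub>m m \<noteq> (0\<^sub>m m m :: 'a mat)"
    proof
      assume "1\<^sub>m m = (0\<^sub>m m m :: 'a mat)"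
      from arg_cong[OF this, of "\<lambda>M. M $$ (0, 0)"] show False using m by simp
    qed
  qed (rule mat_algebraD(2)[OF A])
  have "\<forall>a. a \<in> A \<and> a \<noteq> 0\<^sub>m m m \<longrightarrow> sdim m (K a) < Suc m" using sdim_le by (metis less_Suc_eq_le)
  from ex_has_greatest_nat[of "\<lambda>a. a \<in> A \<and> a \<noteq> 0\<^sub>m m m", OF one this]
  obtain a where a: "a \<in> A" "a \<noteq> 0\<^sub>m m m"
    and max: "\<And>b. b \<in> A \<Longrightarrow> b \<noteq> 0\<^sub>m m m \<Longrightarrow> sdim m (K b) \<le> sdim m (K a)" by blast
  have ac: "a \<in> carrier_mat m m" by (rule Ac[OF a(1)])
  obtain x where x: "x \<in> carrier_mat m 1" "a * x \<noteq> 0\<^sub>m m 1" using colm_eq_zero_imp[OF ac] a(2) by blast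
  have ax: "a * x \<in> carrier_mat m 1" by (rule mult_carrier_mat[OF ac x(1)])
  have "\<exists>c. a * y = c \<cdot>\<^sub>m (a * x)" if y: "y \<in> carrier_mat m 1" for y
  proof (rule ccontr)
    assume n: "\<not> ?thesis"
    obtain b where b: "b \<in> A" "b * (a * x) = y" using irreducible_transitive[OF A irr ax x(2) y] by blast
    have bc: "b \<in> carrier_mat m m" by (rule Ac[OF b(1)])
    have ba: "b * a \<in> carrier_mat m m" by (rule mult_carrier_mat[OF bc ac])
    obtain Q R where Q: "Q \<in> carrier_mat m m" "R \<in> carrier_mat m m" "Q * R = 1\<^sub>m m" "R * Q = 1\<^sub>m m"
      and nf: "\<forall>x\<in>carrier_mat m 1. x \<in> K a \<longleftrightarrow> (\<forall>i. sdim m (K a) \<le> i \<longrightarrow> i < m \<longrightarrow> (R * x) $$ (i, 0) = 0)"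
      using subspace_normal_form[OF Ks[OF a(1)]] by blast
    define r where "r = sdim m (K a)"
    have r: "r < m"
    proof (rule ccontr)
      assume "\<not> ?thesis"
      then have "x \<in> K a" using nf x(1) by (simp add: r_def)
      then show False using x(2) by (simp add: K_def)
    qed
    define N where "N = R * (b * a) * Q"
    have Nc: "N \<in> carrier_mat m m" unfolding N_def by (intro mult_carrier_mat[OF mult_carrier_mat[OF Q(2) ba] Q(1)])
    have R_Nz: "R * (b * a * (Q * z)) = N * z" if "z \<in> carrier_mat m 1" for z
      unfolding N_def using Q(1,2) ba that by (simp add: assoc_mult_mat[of _ m m _ m _ 1] assoc_mult_mat[of _ m m _ m _ m])
    have RQz: "R * (Q * z) = z" if z: "z \<in> carrier_mat m 1" for z
      using assoc_mult_mat[OF Q(2,1) z] Q(4) left_mult_one_mat[OF z] by simp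
    have low: "N $$ (i, j) = 0" if ij: "r \<le> i" "i < m" "j < r" for i j
    proof -
      have jm: "j < m" using ij r by simp
      have e: "colm m (1\<^sub>m m) j \<in> carrier_mat m 1" by (rule colm_carrier)
      have "Q * colm m (1\<^sub>m m) j \<in> K a"
        using nf[rule_format, OF mult_carrier_mat[OF Q(1) e]] RQz[OF e] ij jm
        by (auto simp: colm_def r_def)
      then have az: "a * (Q * colm m (1\<^sub>m m) j) = 0\<^sub>m m 1" by (simp add: K_def)
      have "N * colm m (1\<^sub>m m) j = R * (b * (a * (Q * colm m (1\<^sub>m m) j)))"
        using R_Nz[OF e] assoc_mult_mat[OF bc ac mult_carrier_mat[OF Q(1) e]] by simp
      also have "\<dots> = 0\<^sub>m m 1" unfolding az right_mult_zero_mat[OF bc] right_mult_zero_mat[OF Q(2)] ..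
      finally have "colm m N j = 0\<^sub>m m 1" using mult_colm[OF Nc one_carrier_mat jm] right_mult_one_mat[OF Nc] by simp
      from arg_cong[OF this, of "\<lambda>M. M $$ (i, 0)"] show ?thesis using ij by (simp add: colm_def)
    qed
    from quotient_eigenvector[OF Nc r low] obtain \<mu> z where z: "z \<in> carrier_mat m 1"
      "\<exists>i. r \<le> i \<and> i < m \<and> z $$ (i, 0) \<noteq> 0" "\<forall>i. r \<le> i \<longrightarrow> i < m \<longrightarrow> (N * z) $$ (i, 0) = \<mu> * z $$ (i, 0)" by blast
    define t where "t = a * (b * a) + (- \<mu>) \<cdot>\<^sub>m a"
    have tA: "t \<in> A" unfolding t_def
      by (intro mat_subspaceD(3,4)[OF s] mat_algebraD(3)[OF A] a(1) b(1))
    have t: "t * w = a * (b * (a * w) + (- \<mu>) \<cdot>\<^sub>m w)" if w: "w \<in> carrier_mat m 1" for w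
    proof -
      have aw: "a * w \<in> carrier_mat m 1" by (rule mult_carrier_mat[OF ac w])
      have "t * w = a * (b * a) * w + ((- \<mu>) \<cdot>\<^sub>m a) * w" unfolding t_def
        by (rule add_mult_distrib_mat[OF mult_carrier_mat[OF ac ba] smult_carrier_mat[OF ac] w])
      also have "a * (b * a) * w = a * (b * (a * w))"
        unfolding assoc_mult_mat[OF ac ba w] assoc_mult_mat[OF bc ac w] ..
      also have "((- \<mu>) \<cdot>\<^sub>m a) * w = a * ((- \<mu>) \<cdot>\<^sub>m w)"
        unfolding mult_smult_assoc_mat[OF ac w] mult_smult_distrib[OF ac w] ..
      also have "a * (b * (a * w)) + a * ((- \<mu>) \<cdot>\<^sub>m w) = a * (b * (a * w) + (- \<mu>) \<cdot>\<^sub>m w)"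
        by (rule mult_add_distrib_mat[OF ac mult_carrier_mat[OF bc aw] smult_carrier_mat[OF w], symmetric])
      finally show ?thesis .
    qed
    have tx: "t * x \<noteq> 0\<^sub>m m 1"
    proof
      assume "t * x = 0\<^sub>m m 1"
      then have e: "a * y + (- \<mu>) \<cdot>\<^sub>m (a * x) = 0\<^sub>m m 1"
        using t[OF x(1)] b(2) mult_add_distrib_mat[OF ac y smult_carrier_mat[OF x(1)], of "- \<mu>"] mult_smult_distrib[OF ac x(1), of "- \<mu>"] by simp
      have "a * y = \<mu> \<cdot>\<^sub>m (a * x)"
      proof (rule eq_matI)
        fix i j assume "i < dim_row (\<mu> \<cdot>\<^sub>m (a * x))" "j < dim_col (\<mu> \<cdot>\<^sub>m (a * x))"
        then have ij: "i < m" "j < 1" using ax by auto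
        have ay: "a * y \<in> carrier_mat m 1" by (rule mult_carrier_mat[OF ac y])
        from arg_cong[OF e, of "\<lambda>M. M $$ (i, j)"] show "(a * y) $$ (i, j) = (\<mu> \<cdot>\<^sub>m (a * x)) $$ (i, j)"
          using ij carrier_matD[OF ax] carrier_matD[OF ay] by (simp add: add_eq_0_iff)
      qed (use carrier_matD[OF ax] carrier_matD[OF mult_carrier_mat[OF ac y]] in auto)
      then show False using n by blast
    qed
    then have t0: "t \<noteq> 0\<^sub>m m m" using left_mult_zero_mat[OF x(1), of m] by auto
    have sub: "K a \<subseteq> K t"
    proof
      fix w assume w: "w \<in> K a"
      then have wc: "w \<in> carrier_mat m 1" "a * w = 0\<^sub>m m 1" by (auto simp: K_def)
      have "t * w = a * (0\<^sub>m m 1 + (- \<mu>) \<cdot>\<^sub>m w)" using t[OF wc(1)] wc(2) right_mult_zero_mat[OF bc] by simp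
      also have "0\<^sub>m m 1 + (- \<mu>) \<cdot>\<^sub>m w = (- \<mu>) \<cdot>\<^sub>m w" by (rule left_add_zero_mat[OF smult_carrier_mat[OF wc(1)]])
      also have "a * ((- \<mu>) \<cdot>\<^sub>m w) = (- \<mu>) \<cdot>\<^sub>m 0\<^sub>m m 1" unfolding mult_smult_distrib[OF ac wc(1)] wc(2) ..
      also have "\<dots> = 0\<^sub>m m 1" by (intro eq_matI) auto
      finally show "w \<in> K t" using wc by (simp add: K_def)
    qed
    \<comment> \<open>The lifted eigenvector: w is not in the kernel of a, but b a w - \<mu> w is,
      so t w = 0 and the kernel of t is strictly larger.\<close>
    define w where "w = Q * z"
    have wc: "w \<in> carrier_mat m 1" unfolding w_def by (rule mult_carrier_mat[OF Q(1) z(1)])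
    have wna: "w \<notin> K a" using nf[rule_format, OF wc] z(2) RQz[OF z(1)] by (auto simp: w_def r_def)
    define y2 where "y2 = b * (a * w) + (- \<mu>) \<cdot>\<^sub>m w"
    have baw: "b * (a * w) \<in> carrier_mat m 1" by (rule mult_carrier_mat[OF bc mult_carrier_mat[OF ac wc]])
    have y2c: "y2 \<in> carrier_mat m 1" unfolding y2_def by (rule add_carrier_mat[OF smult_carrier_mat[OF wc]])
    have "R * y2 = N * z + (- \<mu>) \<cdot>\<^sub>m z"
      unfolding y2_def mult_add_distrib_mat[OF Q(2) baw smult_carrier_mat[OF wc]] mult_smult_distrib[OF Q(2) wc]
      using R_Nz[OF z(1)] RQz[OF z(1)] assoc_mult_mat[OF bc ac wc] by (simp add: w_def)
    then have "(R * y2) $$ (i, 0) = 0" if "r \<le> i" "i < m" for i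
      using z that carrier_matD[OF z(1)] carrier_matD[OF Nc] by simp
    then have "y2 \<in> K a" using nf[rule_format, OF y2c] by (simp add: r_def)
    then have "t * w = 0\<^sub>m m 1" using t[OF wc] by (simp add: y2_def K_def)
    then have "w \<in> K t" using wc by (simp add: K_def)
    then have "K a \<subset> K t" using sub wna by blast
    from sdim_strict_mono[OF Ks[OF a(1)] Ks[OF tA] this] show False using max[OF tA t0] by simp
  qed
  then show ?thesis using a(1) x by blast
qed

text \<open>With u spanning the image of a rank one element a, let \<open>S\<close> be the space of
  all y for which the product of u with the transpose of y lies in \<open>A\<close>. If
  \<open>S\<close> were proper, some nonzero z would be orthogonal to it. Transitivity gives c with
  c z = x; then a c is u times the transpose of some \<psi> in \<open>S\<close>, so a x = a c z = 0,
  a contradiction. Hence \<open>S\<close> is everything, and multiplying such products from the left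
  moves u to any prescribed column.\<close>

theorem burnside:
  fixes A :: "'a::alg_closed_field mat set"
  assumes A: "mat_algebra m A" and irr: "irreducible_action m A" and m: "0 < m"
  shows "A = carrier_mat m m"
proof -
  note s = mat_algebraD(1)[OF A] and Ac = mat_algebraD(4)[OF A]
  obtain a x where a: "a \<in> A" "x \<in> carrier_mat m 1" "a * x \<noteq> 0\<^sub>m m 1"
    and rk: "\<forall>y\<in>carrier_mat m 1. \<exists>c. a * y = c \<cdot>\<^sub>m (a * x)" using rank_one_element[OF A irr m] by blast
  have ac: "a \<in> carrier_mat m m" by (rule Ac[OF a(1)])
  define u where "u = a * x"
  have uc: "u \<in> carrier_mat m 1" unfolding u_def by (rule mult_carrier_mat[OF ac a(2)])
  define op where "op y = mat m m (\<lambda>(i, j). u $$ (i, 0) * y $$ (j, 0))" for y :: "'a mat"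
  have opc: "op y \<in> carrier_mat m m" for y by (simp add: op_def)
  define S where "S = {y \<in> carrier_mat m 1. op y \<in> A}"
  have S: "mat_subspace m 1 S" unfolding mat_subspace_def
  proof (intro conjI ballI allI)
    have "op (0\<^sub>m m 1) = 0\<^sub>m m m" by (intro eq_matI) (auto simp: op_def)
    then show "0\<^sub>m m 1 \<in> S" using mat_subspaceD(2)[OF s] by (simp add: S_def)
    fix y assume "y \<in> S" then have y: "y \<in> carrier_mat m 1" "op y \<in> A" by (auto simp: S_def)
    { fix z assume "z \<in> S" then have z: "z \<in> carrier_mat m 1" "op z \<in> A" by (auto simp: S_def)
      have "op (y + z) = op y + op z" using carrier_matD[OF y(1)] carrier_matD[OF z(1)]
        by (intro eq_matI) (auto simp: op_def distrib_left)
      then show "y + z \<in> S" using mat_subspaceD(3)[OF s y(2) z(2)] add_carrier_mat[OF z(1)] by (simp add: S_def) }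
    { fix c have "op (c \<cdot>\<^sub>m y) = c \<cdot>\<^sub>m op y" using carrier_matD[OF y(1)]
        by (intro eq_matI) (auto simp: op_def)
      then show "c \<cdot>\<^sub>m y \<in> S" using mat_subspaceD(4)[OF s y(2)] smult_carrier_mat[OF y(1)] by (simp add: S_def) }
  qed (auto simp: S_def)
  have Sall: "y \<in> S" if y: "y \<in> carrier_mat m 1" for y
  proof (rule ccontr)
    assume yS: "y \<notin> S"
    obtain Q R where Q: "Q \<in> carrier_mat m m" "R \<in> carrier_mat m m" "Q * R = 1\<^sub>m m" "R * Q = 1\<^sub>m m"
      and nf: "\<forall>x\<in>carrier_mat m 1. x \<in> S \<longleftrightarrow> (\<forall>i. sdim m S \<le> i \<longrightarrow> i < m \<longrightarrow> (R * x) $$ (i, 0) = 0)"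
      using subspace_normal_form[OF S] by blast
    obtain k where k: "sdim m S \<le> k" "k < m" "(R * y) $$ (k, 0) \<noteq> 0" using nf y yS by blast
    define z where "z = mat m 1 (\<lambda>(i, _). R $$ (k, i))"
    have z: "z \<in> carrier_mat m 1" by (simp add: z_def)
    have Rz: "(R * w) $$ (k, 0) = (\<Sum>i<m. z $$ (i, 0) * w $$ (i, 0))" if w: "w \<in> carrier_mat m 1" for w
      using Q(2) k carrier_matD[OF w] by (simp add: times_mat_def scalar_prod_def z_def atLeast0LessThan)
    have z0: "z \<noteq> 0\<^sub>m m 1" using k(3) Rz[OF y] by (auto intro: sum.neutral)
    obtain c where c: "c \<in> A" "c * z = x" using irreducible_transitive[OF A irr z z0 a(2)] by blast
    have cc: "c \<in> carrier_mat m m" by (rule Ac[OF c(1)])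
    have accm: "a * c \<in> carrier_mat m m" by (rule mult_carrier_mat[OF ac cc])
    have "\<forall>j. \<exists>d. a * (c * colm m (1\<^sub>m m) j) = d \<cdot>\<^sub>m u"
      unfolding u_def using rk mult_carrier_mat[OF cc colm_carrier] by blast
    from choice[OF this] obtain d where d: "\<forall>j. a * (c * colm m (1\<^sub>m m) j) = d j \<cdot>\<^sub>m u" by blast
    define \<psi> where "\<psi> = mat m 1 (\<lambda>(j, _). d j)"
    have \<psi>: "\<psi> \<in> carrier_mat m 1" by (simp add: \<psi>_def)
    have "op \<psi> = a * c"
    proof (rule eq_matI)
      fix i j assume "i < dim_row (a * c)" "j < dim_col (a * c)"
      then have ij: "i < m" "j < m" using accm by auto
      have "colm m (a * c) j = d j \<cdot>\<^sub>m u"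
        using d mult_colm[OF accm one_carrier_mat ij(2)] right_mult_one_mat[OF accm] assoc_mult_mat[OF ac cc colm_carrier] by metis
      from arg_cong[OF this, of "\<lambda>M. M $$ (i, 0)"] show "op \<psi> $$ (i, j) = (a * c) $$ (i, j)"
        using ij carrier_matD[OF uc] by (simp add: colm_def op_def \<psi>_def mult.commute)
    qed (simp_all only: carrier_matD[OF accm] carrier_matD[OF opc])
    then have "\<psi> \<in> S" using mat_algebraD(3)[OF A a(1) c(1)] \<psi> by (simp add: S_def)
    then have "(R * \<psi>) $$ (k, 0) = 0" using nf \<psi> k by blast
    then have zero: "(\<Sum>i<m. d i * z $$ (i, 0)) = 0" using Rz[OF \<psi>] by (simp add: \<psi>_def mult.commute)
    have "op \<psi> * z = 0\<^sub>m m 1"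
    proof (rule eq_matI)
      fix i j assume "i < dim_row (0\<^sub>m m 1 :: 'a mat)" "j < dim_col (0\<^sub>m m 1 :: 'a mat)"
      then have ij: "i < m" "j = 0" by auto
      have "(op \<psi> * z) $$ (i, j) = (\<Sum>l<m. (u $$ (i, 0) * d l) * z $$ (l, 0))"
        using ij carrier_matD[OF z] by (simp add: times_mat_def scalar_prod_def op_def \<psi>_def atLeast0LessThan)
      also have "\<dots> = u $$ (i, 0) * (\<Sum>l<m. d l * z $$ (l, 0))" by (simp add: sum_distrib_left mult.assoc)
      finally show "(op \<psi> * z) $$ (i, j) = 0\<^sub>m m 1 $$ (i, j)" using zero ij by simp
    qed (use carrier_matD[OF z] in \<open>auto simp: op_def\<close>)
    then have "a * x = 0\<^sub>m m 1" using \<open>op \<psi> = a * c\<close> assoc_mult_mat[OF ac cc z] c(2) by simp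
    then show False using a(3) by simp
  qed
  have "M \<in> A" if M: "M \<in> carrier_mat m m" for M
  proof -
    define part where "part k = mat m m (\<lambda>(i, j). if j < k then M $$ (i, j) else 0)" for k
    have "part k \<in> A" if "k \<le> m" for k
      using that
    proof (induction k)
      case 0
      have "part 0 = 0\<^sub>m m m" by (intro eq_matI) (auto simp: part_def)
      then show ?case using mat_subspaceD(2)[OF s] by simp
    next
      case (Suc k)
      have u0: "u \<noteq> 0\<^sub>m m 1" using a(3) by (simp add: u_def)
      obtain b where b: "b \<in> A" "b * u = colm m M k" using irreducible_transitive[OF A irr uc u0 colm_carrier] by blast
      have bc: "b \<in> carrier_mat m m" by (rule Ac[OF b(1)])
      have "b * op (colm m (1\<^sub>m m) k) \<in> A"
        using Sall[OF colm_carrier, of "1\<^sub>m m" k] by (intro mat_algebraD(3)[OF A b(1)]) (simp only: S_def mem_Collect_eq)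
      moreover have "part (Suc k) = part k + b * op (colm m (1\<^sub>m m) k)"
      proof (rule eq_matI)
        fix i j assume "i < dim_row (part k + b * op (colm m (1\<^sub>m m) k))" "j < dim_col (part k + b * op (colm m (1\<^sub>m m) k))"
        then have ij: "i < m" "j < m" using bc by (auto simp: part_def op_def)
        have "(b * op (colm m (1\<^sub>m m) k)) $$ (i, j) = (\<Sum>l<m. b $$ (i, l) * (u $$ (l, 0) * (if j = k then 1 else 0)))"
          using ij bc Suc.prems by (auto simp: times_mat_def scalar_prod_def op_def colm_def atLeast0LessThan intro!: sum.cong sum.neutral)
        also have "\<dots> = (\<Sum>l<m. b $$ (i, l) * u $$ (l, 0)) * (if j = k then 1 else 0)" by (simp add: sum_distrib_right)
        also have "(\<Sum>l<m. b $$ (i, l) * u $$ (l, 0)) = (b * u) $$ (i, 0)"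
          using ij bc carrier_matD[OF uc] by (simp add: times_mat_def scalar_prod_def atLeast0LessThan)
        also have "\<dots> = M $$ (i, k)" unfolding b(2) using ij by (simp add: colm_def)
        finally show "part (Suc k) $$ (i, j) = (part k + b * op (colm m (1\<^sub>m m) k)) $$ (i, j)"
          using ij bc by (auto simp: part_def op_def less_Suc_eq)
      qed (use bc in \<open>auto simp: part_def op_def\<close>)
      ultimately show ?case using Suc mat_subspaceD(3)[OF s] by simp
    qed
    then have "part m \<in> A" by simp
    moreover have "part m = M" using M by (intro eq_matI) (auto simp: part_def)
    ultimately show ?thesis by simp
  qed
  then show ?thesis using Ac by blast
qed

section \<open>Semisimplification\<close>

abbreviation mspan :: "nat \<Rightarrow> 'a::field mat set \<Rightarrow> 'a mat set" where
  "mspan m \<equiv> LinearCombinations.module.span class_ring (module_mat TYPE('a) m m)"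

lemma mspan_subspace:
  fixes S :: "'a::field mat set"
  assumes S: "S \<subseteq> carrier_mat m m"
  shows "mat_subspace m m (mspan m S)" "S \<subseteq> mspan m S"
proof -
  interpret vectorspace class_ring "module_mat TYPE('a) m m" by (rule matrix_vs)
  have c: "S \<subseteq> carrier (module_mat TYPE('a) m m)" using S by (simp add: module_mat_simps)
  interpret sm: LinearCombinations.submodule class_ring "mspan m S" "module_mat TYPE('a) m m"
    by (rule span_is_submodule[OF c])
  show "S \<subseteq> mspan m S" by (rule in_own_span[OF c])
  show "mat_subspace m m (mspan m S)" unfolding mat_subspace_def
    using sm.subset sm.zero_closed sm.m_closed sm.smult_closed by (simp add: module_mat_simps)
qed

lemma mspan_least:
  fixes S :: "'a::field mat set"
  assumes N: "mat_subspace m m N" and S: "S \<subseteq> N"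
  shows "mspan m S \<subseteq> N"
proof -
  interpret vectorspace class_ring "module_mat TYPE('a) m m" by (rule matrix_vs)
  have "LinearCombinations.submodule class_ring N (module_mat TYPE('a) m m)"
    by (intro LinearCombinations.submodule.intro module_axioms)
      (use mat_subspaceD[OF N] in \<open>simp_all add: module_mat_simps\<close>)
  then show ?thesis by (rule span_is_subset[OF S])
qed

text \<open>Closure under products extends from S to its span one factor at a time, since for a
  fixed second factor the admissible first factors form a subspace, and vice versa.\<close>

lemma mspan_algebra:
  fixes S :: "'a::field mat set"
  assumes S: "S \<subseteq> carrier_mat m m" and one: "1\<^sub>m m \<in> S" and mult: "\<And>x y. x \<in> S \<Longrightarrow> y \<in> S \<Longrightarrow> x * y \<in> S"
  shows "mat_algebra m (mspan m S)"
proof -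
  note sp = mspan_subspace[OF S]
  note c = subsetD[OF mat_subspaceD(1)[OF sp(1)]]
  have left: "mat_subspace m m {x \<in> carrier_mat m m. x * y \<in> mspan m S}" if y: "y \<in> carrier_mat m m" for y
    unfolding mat_subspace_def
  proof (intro conjI ballI allI)
    show "0\<^sub>m m m \<in> {x \<in> carrier_mat m m. x * y \<in> mspan m S}"
      using y mat_subspaceD(2)[OF sp(1)] by simp
  qed (use y mat_subspaceD(3,4)[OF sp(1)] in \<open>auto simp: add_mult_distrib_mat[of _ m m] mult_smult_assoc_mat[of _ m m]\<close>)
  have right: "mat_subspace m m {y \<in> carrier_mat m m. x * y \<in> mspan m S}" if x: "x \<in> carrier_mat m m" for x
    unfolding mat_subspace_def
  proof (intro conjI ballI allI)
    show "0\<^sub>m m m \<in> {y \<in> carrier_mat m m. x * y \<in> mspan m S}"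
      using x mat_subspaceD(2)[OF sp(1)] by simp
  qed (use x mat_subspaceD(3,4)[OF sp(1)] in \<open>auto simp: mult_add_distrib_mat[of _ m m] mult_smult_distrib[of _ m m]\<close>)
  have a: "x * y \<in> mspan m S" if x: "x \<in> mspan m S" and y: "y \<in> S" for x y
  proof -
    have "mspan m S \<subseteq> {x \<in> carrier_mat m m. x * y \<in> mspan m S}"
      by (intro mspan_least left) (use S sp(2) mult y in blast)+
    then show ?thesis using x by blast
  qed
  have "x * y \<in> mspan m S" if x: "x \<in> mspan m S" and y: "y \<in> mspan m S" for x y
  proof -
    have "mspan m S \<subseteq> {y \<in> carrier_mat m m. x * y \<in> mspan m S}"
      by (intro mspan_least right c x) (use S a x in blast)
    then show ?thesis using y by blast
  qed
  then show ?thesis unfolding mat_algebra_def using sp one by blast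
qed

section \<open>Conjugation and block triangular form of representations\<close>

lemma representationD:
  assumes "representation R \<sigma> m \<rho>"
  shows "a \<in> carrier R \<Longrightarrow> \<rho> a \<in> carrier_mat m m"
    and "a \<in> carrier R \<Longrightarrow> b \<in> carrier R \<Longrightarrow> \<rho> (a \<otimes>\<^bsub>R\<^esub> b) = \<rho> a * \<rho> b"
    and "a \<in> carrier R \<Longrightarrow> b \<in> carrier R \<Longrightarrow> \<rho> (a \<oplus>\<^bsub>R\<^esub> b) = \<rho> a + \<rho> b"
    and "\<rho> \<one>\<^bsub>R\<^esub> = 1\<^sub>m m"
    and "\<rho> (\<sigma> c) = to_ac c \<cdot>\<^sub>m 1\<^sub>m m"
    and "\<rho> (\<sigma> c) \<in> carrier_mat m m"
  using assms unfolding representation_def Ring.ring_hom_def by (auto simp: ring_mat_simps)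

lemma representationI:
  assumes "\<And>a. a \<in> carrier R \<Longrightarrow> \<rho> a \<in> carrier_mat m m"
    and "\<And>a b. a \<in> carrier R \<Longrightarrow> b \<in> carrier R \<Longrightarrow> \<rho> (a \<otimes>\<^bsub>R\<^esub> b) = \<rho> a * \<rho> b"
    and "\<And>a b. a \<in> carrier R \<Longrightarrow> b \<in> carrier R \<Longrightarrow> \<rho> (a \<oplus>\<^bsub>R\<^esub> b) = \<rho> a + \<rho> b"
    and "\<rho> \<one>\<^bsub>R\<^esub> = 1\<^sub>m m"
    and "\<And>c. \<rho> (\<sigma> c) = to_ac c \<cdot>\<^sub>m 1\<^sub>m m"
  shows "representation R \<sigma> m \<rho>"
  using assms unfolding representation_def by (auto intro!: ring_hom_memI simp: ring_mat_simps)

lemma representation_cong: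
  assumes "representation R \<sigma> m \<rho>" "ring R" "\<And>a. a \<in> carrier R \<or> a \<in> range \<sigma> \<Longrightarrow> \<rho>' a = \<rho> a"
  shows "representation R \<sigma> m \<rho>'"
proof -
  interpret ring R by fact
  show ?thesis by (rule representationI) (use representationD[OF assms(1)] assms(3) in auto)
qed

lemma representation_conj:
  assumes rep: "representation R \<sigma> m \<rho>"
    and Q: "Q \<in> carrier_mat m m" "Q' \<in> carrier_mat m m" "Q * Q' = 1\<^sub>m m" "Q' * Q = 1\<^sub>m m"
  shows "representation R \<sigma> m (\<lambda>a. Q' * \<rho> a * Q)"
proof (rule representationI)
  note D = representationD[OF rep]
  fix a b assume a: "a \<in> carrier R" and b: "b \<in> carrier R"
  note ac = D(1)[OF a] and bc = D(1)[OF b]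
  have "Q' * \<rho> a * Q * (Q' * \<rho> b * Q) = Q' * \<rho> a * (Q * Q') * \<rho> b * Q"
    using ac bc Q(1,2) by (simp add: assoc_mult_mat[of _ m m _ m _ m])
  also have "\<dots> = Q' * (\<rho> a * \<rho> b) * Q"
    using ac bc Q(1,2) unfolding Q(3) by (simp add: assoc_mult_mat[of _ m m _ m _ m])
  finally show "Q' * \<rho> (a \<otimes>\<^bsub>R\<^esub> b) * Q = Q' * \<rho> a * Q * (Q' * \<rho> b * Q)" by (simp add: D(2)[OF a b])
  show "Q' * \<rho> (a \<oplus>\<^bsub>R\<^esub> b) * Q = Q' * \<rho> a * Q + Q' * \<rho> b * Q"
    using ac bc Q(1,2) by (simp add: D(3)[OF a b] mult_add_distrib_mat[of _ m m] add_mult_distrib_mat[of _ m m])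
next
  fix c
  have "Q' * (to_ac c \<cdot>\<^sub>m 1\<^sub>m m) * Q = to_ac c \<cdot>\<^sub>m (Q' * Q)"
    using mult_smult_distrib[OF Q(2) one_carrier_mat] mult_smult_assoc_mat[OF Q(2,1)] right_mult_one_mat[OF Q(2)] by simp
  then show "Q' * \<rho> (\<sigma> c) * Q = to_ac c \<cdot>\<^sub>m 1\<^sub>m m" by (simp add: representationD(5)[OF rep] Q(4))
qed (use Q representationD(1,4)[OF rep] in auto)

lemma sum_lessThan_split: "(\<Sum>k<r + d. f k) = (\<Sum>k<r. f k) + (\<Sum>k<d. f (k + r :: nat) :: 'a::comm_monoid_add)"
  by (induction d) (simp_all add: ac_simps)

lemma char_poly_block_triangular:
  fixes A1 :: "'a::idom mat"
  assumes A: "A1 \<in> carrier_mat r r" "A2 \<in> carrier_mat r d" "A4 \<in> carrier_mat d d"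
  shows "char_poly (four_block_mat A1 A2 (0\<^sub>m d r) A4) = char_poly A1 * char_poly A4"
proof -
  let ?cm = "\<lambda>A. [:0, 1:] \<cdot>\<^sub>m 1\<^sub>m (dim_row A) + map_mat (\<lambda>a. [:- a:]) A"
  have "char_poly (four_block_mat A1 A2 (0\<^sub>m d r) A4) = det (?cm (four_block_mat A1 A2 (0\<^sub>m d r) A4))"
    unfolding char_poly_defs using A by simp
  also have "?cm (four_block_mat A1 A2 (0\<^sub>m d r) A4) =
      four_block_mat (?cm A1) (map_mat (\<lambda>a. [:- a:]) A2) (0\<^sub>m d r) (?cm A4)"
    by (rule eq_matI) (use A in \<open>auto simp: one_poly_def\<close>)
  also have "det \<dots> = det (?cm A1) * det (?cm A4)"
    by (rule det_four_block_mat_lower_left_zero) (use A in auto)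
  also have "\<dots> = char_poly A1 * char_poly A4" unfolding char_poly_defs using A by simp
  finally show ?thesis .
qed

text \<open>The zero block says that the span of the first r unit vectors is invariant; the two
  diagonal blocks are the subrepresentation and the quotient representation.\<close>

lemma representation_blocks:
  assumes rep: "representation R \<sigma> n \<rho>" and R: "ring R" and n: "n = r + d"
    and low: "\<And>a i j. a \<in> carrier R \<Longrightarrow> r \<le> i \<Longrightarrow> i < n \<Longrightarrow> j < r \<Longrightarrow> \<rho> a $$ (i, j) = 0"
  shows "representation R \<sigma> r (\<lambda>a. mat r r (\<lambda>ij. \<rho> a $$ ij))" (is ?A)
    and "representation R \<sigma> d (\<lambda>a. mat d d (\<lambda>(i, j). \<rho> a $$ (i + r, j + r)))" (is ?B)
    and "a \<in> carrier R \<Longrightarrow> char_poly (\<rho> a) =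
      char_poly (mat r r (\<lambda>ij. \<rho> a $$ ij)) * char_poly (mat d d (\<lambda>(i, j). \<rho> a $$ (i + r, j + r)))"
proof -
  interpret ring R by fact
  note D = representationD[OF rep]
  have mult: "\<rho> (a \<otimes>\<^bsub>R\<^esub> b) $$ (i, j) = (\<Sum>k<r. \<rho> a $$ (i, k) * \<rho> b $$ (k, j)) + (\<Sum>k<d. \<rho> a $$ (i, k + r) * \<rho> b $$ (k + r, j))"
    if "a \<in> carrier R" "b \<in> carrier R" "i < n" "j < n" for a b i j
  proof -
    have "\<rho> (a \<otimes>\<^bsub>R\<^esub> b) $$ (i, j) = (\<Sum>k<r + d. \<rho> a $$ (i, k) * \<rho> b $$ (k, j))"
      using that D(1)[OF that(1)] D(1)[OF that(2)] by (simp add: D(2) times_mat_def scalar_prod_def n atLeast0LessThan)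
    then show ?thesis by (simp only: sum_lessThan_split)
  qed
  show ?A
  proof (rule representationI)
    fix a b assume ab: "a \<in> carrier R" "b \<in> carrier R"
    show "mat r r (\<lambda>ij. \<rho> (a \<otimes>\<^bsub>R\<^esub> b) $$ ij) = mat r r (\<lambda>ij. \<rho> a $$ ij) * mat r r (\<lambda>ij. \<rho> b $$ ij)"
      by (intro eq_matI) (use low[OF ab(2)] in \<open>auto simp: mult[OF ab] n times_mat_def scalar_prod_def atLeast0LessThan intro!: sum.neutral\<close>)
    show "mat r r (\<lambda>ij. \<rho> (a \<oplus>\<^bsub>R\<^esub> b) $$ ij) = mat r r (\<lambda>ij. \<rho> a $$ ij) + mat r r (\<lambda>ij. \<rho> b $$ ij)"
      by (intro eq_matI) (use D(1)[OF ab(1)] D(1)[OF ab(2)] in \<open>auto simp: D(3)[OF ab] n\<close>)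
  qed (auto simp: D(4,5) n intro!: eq_matI)
  show ?B
  proof (rule representationI)
    fix a b assume ab: "a \<in> carrier R" "b \<in> carrier R"
    show "mat d d (\<lambda>(i, j). \<rho> (a \<otimes>\<^bsub>R\<^esub> b) $$ (i + r, j + r)) =
        mat d d (\<lambda>(i, j). \<rho> a $$ (i + r, j + r)) * mat d d (\<lambda>(i, j). \<rho> b $$ (i + r, j + r))"
      by (intro eq_matI) (use low[OF ab(1)] in \<open>auto simp: mult[OF ab] n times_mat_def scalar_prod_def atLeast0LessThan intro!: sum.neutral\<close>)
    show "mat d d (\<lambda>(i, j). \<rho> (a \<oplus>\<^bsub>R\<^esub> b) $$ (i + r, j + r)) =
        mat d d (\<lambda>(i, j). \<rho> a $$ (i + r, j + r)) + mat d d (\<lambda>(i, j). \<rho> b $$ (i + r, j + r))"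
      by (intro eq_matI) (use D(1)[OF ab(1)] D(1)[OF ab(2)] in \<open>auto simp: D(3)[OF ab] n\<close>)
  qed (auto simp: D(4,5) n intro!: eq_matI)
  assume a: "a \<in> carrier R"
  have "\<rho> a = four_block_mat (mat r r (\<lambda>ij. \<rho> a $$ ij)) (mat r d (\<lambda>(i, j). \<rho> a $$ (i, j + r))) (0\<^sub>m d r)
      (mat d d (\<lambda>(i, j). \<rho> a $$ (i + r, j + r)))"
    by (intro eq_matI) (use low[OF a] D(1)[OF a] in \<open>auto simp: n\<close>)
  then show "char_poly (\<rho> a) = char_poly (mat r r (\<lambda>ij. \<rho> a $$ ij)) * char_poly (mat d d (\<lambda>(i, j). \<rho> a $$ (i + r, j + r)))"
    using char_poly_block_triangular[of "mat r r (\<lambda>ij. \<rho> a $$ ij)" r "mat r d (\<lambda>(i, j). \<rho> a $$ (i, j + r))" d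
        "mat d d (\<lambda>(i, j). \<rho> a $$ (i + r, j + r))"] by simp
qed

lemma char_poly_dim_0:
  assumes "(A :: 'a::comm_ring_1 mat) \<in> carrier_mat 0 0"
  shows "char_poly A = 1"
proof -
  have "degree (char_poly A) = 0" and c: "coeff (char_poly A) 0 = 1" using degree_monic_char_poly[OF assms] by auto
  then obtain c where "char_poly A = [:c:]" by (elim degree_eq_zeroE)
  with c show ?thesis by (simp add: one_pCons)
qed

text \<open>Strong induction on the dimension along invariant subspaces, that is, a composition
  series. Burnside's theorem converts irreducibility of the action into the spanning condition of
  \<open>irreducible_rep\<close>. Only characteristic polynomials are recorded: they are
  multiplicative along block triangular form, and they are what separates classes later.\<close>

lemma semisimplification:
  fixes \<rho> :: "'r \<Rightarrow> 'k::field alg_closure mat"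
  assumes R: "ring R" and rep: "representation R \<sigma> n \<rho>"
  shows "\<exists>bs. (\<forall>(m, \<tau>)\<in>set bs. 0 < m \<and> irreducible_rep R \<sigma> m \<tau>) \<and> sum_list (map fst bs) = n \<and>
    (\<forall>a\<in>carrier R. char_poly (\<rho> a) = (\<Prod>(m, \<tau>)\<leftarrow>bs. char_poly (\<tau> a)))"
  using rep
proof (induction n arbitrary: \<rho> rule: less_induct)
  case (less n)
  interpret ring R by fact
  note D = representationD[OF less.prems]
  define A where "A = mspan n (\<rho> ` carrier R)"
  have img: "\<rho> ` carrier R \<subseteq> carrier_mat n n" using D(1) by blast
  have A: "mat_algebra n A" unfolding A_def
  proof (rule mspan_algebra[OF img])
    show "1\<^sub>m n \<in> \<rho> ` carrier R" using D(4) one_closed by (metis image_eqI)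
    fix x y assume "x \<in> \<rho> ` carrier R" "y \<in> \<rho> ` carrier R"
    then obtain a b where ab: "a \<in> carrier R" "b \<in> carrier R" "x = \<rho> a" "y = \<rho> b" by blast
    then show "x * y \<in> \<rho> ` carrier R" using D(2)[OF ab(1,2)] m_closed by (metis image_eqI)
  qed
  consider "n = 0" | "0 < n" "irreducible_action n A" | "0 < n" "\<not> irreducible_action n A" by blast
  then show ?case
  proof cases
    case 1
    have "char_poly (\<rho> a) = 1" if "a \<in> carrier R" for a
      using char_poly_dim_0 D(1)[OF that] 1 by blast
    then show ?thesis using 1 by (intro exI[of _ "[]"]) simp
  next
    case 2
    have "irreducible_rep R \<sigma> n \<rho>" unfolding irreducible_rep_def
      using less.prems burnside[OF A 2(2,1)] by (simp add: A_def)
    then show ?thesis using 2(1) by (intro exI[of _ "[(n, \<rho>)]"]) simp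
  next
    case 3
    then obtain S where S: "invariant_subspace n A S" "S \<noteq> {0\<^sub>m n 1}" "S \<noteq> carrier_mat n 1"
      unfolding irreducible_action_def by blast
    have sp: "mat_subspace n 1 S" and inv: "\<forall>a\<in>A. \<forall>x\<in>S. a * x \<in> S" using S(1) by (auto simp: invariant_subspace_def)
    define r where "r = sdim n S"
    have "mat_subspace n 1 {0\<^sub>m n 1 :: 'k alg_closure mat}" by (auto simp: mat_subspace_def)
    moreover have "{0\<^sub>m n 1} \<subset> S" using S(2) mat_subspaceD(2)[OF sp] by blast
    ultimately have r0: "0 < r" using sdim_strict_mono[OF _ sp] unfolding r_def by fastforce
    have "mat_subspace n 1 (carrier_mat n 1 :: 'k alg_closure mat set)" by (auto simp: mat_subspace_def)
    moreover have "S \<subset> carrier_mat n 1" using S(3) mat_subspaceD(1)[OF sp] by blast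
    ultimately have rn: "r < n" using sdim_strict_mono[OF sp] sdim_le unfolding r_def by (meson less_le_trans)
    obtain Q Q' where Q: "Q \<in> carrier_mat n n" "Q' \<in> carrier_mat n n" "Q * Q' = 1\<^sub>m n" "Q' * Q = 1\<^sub>m n"
      and nf: "\<forall>x\<in>carrier_mat n 1. x \<in> S \<longleftrightarrow> (\<forall>i. r \<le> i \<longrightarrow> i < n \<longrightarrow> (Q' * x) $$ (i, 0) = 0)"
      using subspace_normal_form[OF sp] unfolding r_def by blast
    define M where "M a = Q' * \<rho> a * Q" for a
    have rep: "representation R \<sigma> n M" unfolding M_def by (rule representation_conj[OF less.prems Q])
    have low: "M a $$ (i, j) = 0" if a: "a \<in> carrier R" and ij: "r \<le> i" "i < n" "j < r" for a i j
    proof -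
      have jn: "j < n" using ij rn by simp
      define e :: "'k alg_closure mat" where "e = colm n (1\<^sub>m n) j"
      have e: "e \<in> carrier_mat n 1" unfolding e_def by (rule colm_carrier)
      have Qe: "Q * e \<in> carrier_mat n 1" by (rule mult_carrier_mat[OF Q(1) e])
      have "Q' * (Q * e) = e" using assoc_mult_mat[OF Q(2,1) e] Q(4) left_mult_one_mat[OF e] by simp
      then have "Q * e \<in> S" using nf[rule_format, OF Qe] ij jn by (auto simp: e_def colm_def)
      moreover have "\<rho> a \<in> A" using a mspan_subspace(2)[OF img] by (auto simp: A_def)
      ultimately have "\<rho> a * (Q * e) \<in> S" using inv by blast
      then have z: "(Q' * (\<rho> a * (Q * e))) $$ (i, 0) = 0"
        using nf[rule_format, OF mult_carrier_mat[OF D(1)[OF a] Qe]] ij by blast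
      have "Q' * (\<rho> a * (Q * e)) = M a * e" unfolding M_def
        using assoc_mult_mat[OF Q(2) D(1)[OF a] Qe] assoc_mult_mat[OF mult_carrier_mat[OF Q(2) D(1)[OF a]] Q(1) e] by simp
      also have "\<dots> = colm n (M a) j"
        unfolding e_def using mult_colm[OF representationD(1)[OF rep a] one_carrier_mat jn] right_mult_one_mat[OF representationD(1)[OF rep a]] by simp
      finally show ?thesis using z ij by (simp add: colm_def)
    qed
    have nrd: "n = r + (n - r)" using rn by simp
    note blocks = representation_blocks[OF rep R nrd low]
    define T1 where "T1 = (\<lambda>a. mat r r (\<lambda>ij. M a $$ ij))"
    define T2 where "T2 = (\<lambda>a. mat (n - r) (n - r) (\<lambda>(i, j). M a $$ (i + r, j + r)))"
    have T1: "representation R \<sigma> r T1" unfolding T1_def by (rule blocks(1))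
    have T2: "representation R \<sigma> (n - r) T2" unfolding T2_def by (rule blocks(2))
    obtain bs1 where b1: "\<forall>(m, \<tau>)\<in>set bs1. 0 < m \<and> irreducible_rep R \<sigma> m \<tau>" "sum_list (map fst bs1) = r"
      "\<forall>a\<in>carrier R. char_poly (T1 a) = (\<Prod>(m, \<tau>)\<leftarrow>bs1. char_poly (\<tau> a))" using less.IH[OF rn T1] by blast
    have "n - r < n" using r0 rn by simp
    then obtain bs2 where b2: "\<forall>(m, \<tau>)\<in>set bs2. 0 < m \<and> irreducible_rep R \<sigma> m \<tau>" "sum_list (map fst bs2) = n - r"
      "\<forall>a\<in>carrier R. char_poly (T2 a) = (\<Prod>(m, \<tau>)\<leftarrow>bs2. char_poly (\<tau> a))" using less.IH[OF _ T2] by blast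
    have "char_poly (\<rho> a) = (\<Prod>(m, \<tau>)\<leftarrow>bs1 @ bs2. char_poly (\<tau> a))" if a: "a \<in> carrier R" for a
    proof -
      have "char_poly (\<rho> a) = char_poly (M a)" unfolding M_def by (rule char_poly_conj[OF D(1)[OF a] Q, symmetric])
      also have "\<dots> = char_poly (T1 a) * char_poly (T2 a)" unfolding T1_def T2_def by (rule blocks(3)[OF _ _ _ _ a])
      finally show ?thesis using b1(3) b2(3) a by simp
    qed
    moreover have "\<forall>(m, \<tau>)\<in>set (bs1 @ bs2). 0 < m \<and> irreducible_rep R \<sigma> m \<tau>" using b1(1) b2(1) by auto
    moreover have "sum_list (map fst (bs1 @ bs2)) = n" using b1(2) b2(2) rn by simp
    ultimately show ?thesis by blast
  qed
qed

section \<open>Direct sums of representations\<close>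

lemma representation_direct_sum:
  assumes R: "ring R" and rep: "representation R \<sigma> m \<tau>" "representation R \<sigma> p \<rho>"
  shows "representation R \<sigma> (m + p) (\<lambda>a. four_block_mat (\<tau> a) (0\<^sub>m m p) (0\<^sub>m p m) (\<rho> a))"
proof (rule representationI)
  note D = representationD[OF rep(1)] and E = representationD[OF rep(2)]
  fix a b assume ab: "a \<in> carrier R" "b \<in> carrier R"
  note [simp] = D(2,3)[OF ab] E(2,3)[OF ab] and c = D(1)[OF ab(1)] D(1)[OF ab(2)] E(1)[OF ab(1)] E(1)[OF ab(2)]
  show "four_block_mat (\<tau> (a \<otimes>\<^bsub>R\<^esub> b)) (0\<^sub>m m p) (0\<^sub>m p m) (\<rho> (a \<otimes>\<^bsub>R\<^esub> b)) =
      four_block_mat (\<tau> a) (0\<^sub>m m p) (0\<^sub>m p m) (\<rho> a) * four_block_mat (\<tau> b) (0\<^sub>m m p) (0\<^sub>m p m) (\<rho> b)"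
    using c by (subst mult_four_block_mat[of _ m m _ p _ p _ _ m _ p]) auto
  show "four_block_mat (\<tau> (a \<oplus>\<^bsub>R\<^esub> b)) (0\<^sub>m m p) (0\<^sub>m p m) (\<rho> (a \<oplus>\<^bsub>R\<^esub> b)) =
      four_block_mat (\<tau> a) (0\<^sub>m m p) (0\<^sub>m p m) (\<rho> a) + four_block_mat (\<tau> b) (0\<^sub>m m p) (0\<^sub>m p m) (\<rho> b)"
    using c by (subst add_four_block_mat[of _ m m _ p _ p]) auto
qed (use representationD[OF rep(1)] representationD[OF rep(2)] in \<open>auto intro!: eq_matI\<close>)

abbreviation diag_rep :: "(nat \<times> ('r \<Rightarrow> 'a::zero mat)) list \<Rightarrow> 'r \<Rightarrow> 'a mat" where
  "diag_rep bs \<equiv> \<lambda>a. diag_block_mat (map (\<lambda>(m, \<tau>). \<tau> a) bs)"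

lemma representation_diag_rep:
  assumes R: "ring R" and bs: "\<forall>(m, \<tau>)\<in>set bs. representation R \<sigma> m \<tau>"
  shows "representation R \<sigma> (sum_list (map fst bs)) (diag_rep bs)"
  using bs
proof (induction bs)
  case Nil
  show ?case by (rule representationI) (auto intro!: eq_matI)
next
  case (Cons b bs)
  obtain m \<tau> where b: "b = (m, \<tau>)" by (cases b)
  have \<tau>: "representation R \<sigma> m \<tau>" and IH: "representation R \<sigma> (sum_list (map fst bs)) (diag_rep bs)"
    using Cons by (auto simp: b)
  show ?case unfolding b list.map sum_list.Cons fst_conv
  proof (rule representation_cong[OF representation_direct_sum[OF R \<tau> IH] R])
    fix a assume "a \<in> carrier R \<or> a \<in> range \<sigma>"
    then have "\<tau> a \<in> carrier_mat m m" "diag_rep bs a \<in> carrier_mat (sum_list (map fst bs)) (sum_list (map fst bs))"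
      using representationD(1,6)[OF \<tau>] representationD(1,6)[OF IH] by blast+
    then show "diag_block_mat ((case (m, \<tau>) of (m, \<tau>) \<Rightarrow> \<tau> a) # map (\<lambda>(m, \<tau>). \<tau> a) bs) =
        four_block_mat (\<tau> a) (0\<^sub>m m (sum_list (map fst bs))) (0\<^sub>m (sum_list (map fst bs)) m) (diag_rep bs a)"
      by (simp only: diag_block_mat.simps Let_def prod.case carrier_matD)
  qed
qed

lemma char_poly_diag_block_mat:
  fixes As :: "'a::idom mat list"
  assumes "\<forall>A\<in>set As. square_mat A"
  shows "char_poly (diag_block_mat As) = (\<Prod>A\<leftarrow>As. char_poly A)"
  using assms
proof (induction As)
  case Nil
  have "char_poly (0\<^sub>m 0 0 :: 'a mat) = 1" by (rule char_poly_dim_0[OF zero_carrier_mat])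
  then show ?case by simp
next
  case (Cons A As)
  have sq: "square_mat (diag_block_mat As)" using Cons.prems by (intro diag_block_mat_square) simp
  have A: "A \<in> carrier_mat (dim_row A) (dim_row A)" using Cons.prems by auto
  have B: "diag_block_mat As \<in> carrier_mat (dim_row (diag_block_mat As)) (dim_row (diag_block_mat As))"
    using sq by (auto simp del: dim_diag_block_mat)
  have "diag_block_mat (A # As) = four_block_mat A (0\<^sub>m (dim_row A) (dim_row (diag_block_mat As)))
      (0\<^sub>m (dim_row (diag_block_mat As)) (dim_row A)) (diag_block_mat As)"
    using carrier_matD(2)[OF A] carrier_matD(2)[OF B] by (simp only: diag_block_mat.simps Let_def)
  then show ?case using char_poly_block_triangular[OF A zero_carrier_mat B] Cons by simp
qed

lemma rep_equivalent_refl: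
  assumes "representation R \<sigma> m \<rho>"
  shows "rep_equivalent R m \<rho> \<rho>"
  unfolding rep_equivalent_def
proof (intro bexI conjI ballI)
  fix a assume "a \<in> carrier R"
  then show "\<rho> a = 1\<^sub>m m * \<rho> a * 1\<^sub>m m" using representationD(1)[OF assms, of a] by simp
qed auto

lemma semisimple_diag_rep:
  assumes R: "ring R" and bs: "\<forall>(m, \<tau>)\<in>set bs. 0 < m \<and> irreducible_rep R \<sigma> m \<tau>" and n: "sum_list (map fst bs) = n"
  shows "semisimple_rep R \<sigma> n (diag_rep bs)"
proof -
  have "\<forall>(m, \<tau>)\<in>set bs. representation R \<sigma> m \<tau>" using bs by (auto simp: irreducible_rep_def)
  from representation_diag_rep[OF R this] have rep: "representation R \<sigma> n (diag_rep bs)" by (simp only: n)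
  then show ?thesis unfolding semisimple_rep_def using bs n rep_equivalent_refl[OF rep] by blast
qed

text \<open>The conjugating matrix is block diagonal. Dimensions and the representation property of
  both sums are part of the conclusion because the induction step needs the carriers of the partial
  sums.\<close>

lemma rep_equivalent_diag_rep:
  assumes R: "ring R" and bs: "list_all2 (\<lambda>(m, \<tau>) (m', \<tau>'). m = m' \<and> representation R \<sigma> m \<tau> \<and>
      representation R \<sigma> m \<tau>' \<and> rep_equivalent R m \<tau> \<tau>') bs bs'"
  shows "sum_list (map fst bs) = sum_list (map fst bs') \<and> representation R \<sigma> (sum_list (map fst bs)) (diag_rep bs) \<and>
    representation R \<sigma> (sum_list (map fst bs)) (diag_rep bs') \<and>
    rep_equivalent R (sum_list (map fst bs)) (diag_rep bs) (diag_rep bs')"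
  using bs
proof (induction rule: list_all2_induct)
  case Nil
  have "representation R \<sigma> (sum_list (map fst ([] :: (nat \<times> ('a \<Rightarrow> 'b alg_closure mat)) list))) (diag_rep [])"
    by (rule representation_diag_rep[OF R]) simp
  then show ?case using rep_equivalent_refl by auto
next
  case (Cons b bs b' bs')
  obtain m \<tau> where b: "b = (m, \<tau>)" by (cases b)
  obtain m' \<tau>' where b': "b' = (m', \<tau>')" by (cases b')
  define p where "p = sum_list (map fst bs)"
  have mm: "m' = m" and reps: "representation R \<sigma> m \<tau>" "representation R \<sigma> m \<tau>'" and e: "rep_equivalent R m \<tau> \<tau>'"
    using Cons.hyps by (auto simp: b b')
  have p': "sum_list (map fst bs') = p" and reps2: "representation R \<sigma> p (diag_rep bs)" "representation R \<sigma> p (diag_rep bs')"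
    and e2: "rep_equivalent R p (diag_rep bs) (diag_rep bs')" using Cons.IH by (auto simp: p_def)
  have eq: "diag_block_mat (\<tau>0 a # map (\<lambda>(m, \<tau>). \<tau> a) cs) =
      four_block_mat (\<tau>0 a) (0\<^sub>m m p) (0\<^sub>m p m) (diag_rep cs a)"
    if "representation R \<sigma> m \<tau>0" "representation R \<sigma> p (diag_rep cs)" "a \<in> carrier R \<or> a \<in> range \<sigma>" for \<tau>0 cs a
  proof -
    have "\<tau>0 a \<in> carrier_mat m m" "diag_rep cs a \<in> carrier_mat p p"
      using that(3) representationD(1,6)[OF that(1)] representationD(1,6)[OF that(2)] by blast+
    then show ?thesis by (simp only: diag_block_mat.simps Let_def carrier_matD)
  qed
  have r1: "representation R \<sigma> (m + p) (diag_rep (b # bs))" "representation R \<sigma> (m + p) (diag_rep (b' # bs'))"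
    using representation_cong[OF representation_direct_sum[OF R reps(1) reps2(1)] R eq[OF reps(1) reps2(1)]]
      representation_cong[OF representation_direct_sum[OF R reps(2) reps2(2)] R eq[OF reps(2) reps2(2)]] by (simp_all add: b b')
  obtain Q1 Q1' where Q1: "Q1 \<in> carrier_mat m m" "Q1' \<in> carrier_mat m m" "Q1 * Q1' = 1\<^sub>m m" "Q1' * Q1 = 1\<^sub>m m"
    "\<forall>a\<in>carrier R. \<tau>' a = Q1 * \<tau> a * Q1'" using e unfolding rep_equivalent_def by blast
  obtain Q2 Q2' where Q2: "Q2 \<in> carrier_mat p p" "Q2' \<in> carrier_mat p p" "Q2 * Q2' = 1\<^sub>m p" "Q2' * Q2 = 1\<^sub>m p"
    "\<forall>a\<in>carrier R. diag_rep bs' a = Q2 * diag_rep bs a * Q2'" using e2 unfolding rep_equivalent_def by blast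
  define ds where "ds A B = four_block_mat A (0\<^sub>m m p) (0\<^sub>m p m) B" for A B :: "'b alg_closure mat"
  have dsc: "ds A B \<in> carrier_mat (m + p) (m + p)" if "A \<in> carrier_mat m m" "B \<in> carrier_mat p p" for A B
    using that unfolding ds_def by (rule four_block_carrier_mat)
  have dsm: "ds A B * ds A' B' = ds (A * A') (B * B')"
    if "A \<in> carrier_mat m m" "B \<in> carrier_mat p p" "A' \<in> carrier_mat m m" "B' \<in> carrier_mat p p" for A B A' B'
    unfolding ds_def using that by (subst mult_four_block_mat[of _ m m _ p _ p _ _ m _ p]) auto
  have ds1: "ds (1\<^sub>m m) (1\<^sub>m p) = 1\<^sub>m (m + p)" unfolding ds_def by (intro eq_matI) auto
  have "rep_equivalent R (m + p) (diag_rep (b # bs)) (diag_rep (b' # bs'))" unfolding rep_equivalent_def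
  proof (intro bexI conjI ballI)
    show "ds Q1 Q2 * ds Q1' Q2' = 1\<^sub>m (m + p)" "ds Q1' Q2' * ds Q1 Q2 = 1\<^sub>m (m + p)" using Q1 Q2 by (simp_all add: dsm ds1)
    fix a assume a: "a \<in> carrier R"
    note c = representationD(1)[OF reps(1) a] representationD(1)[OF reps2(1) a]
    have "diag_rep (b' # bs') a = ds (\<tau>' a) (diag_rep bs' a)" using eq[OF reps(2) reps2(2)] a by (simp add: b' ds_def)
    also have "\<dots> = ds (Q1 * \<tau> a * Q1') (Q2 * diag_rep bs a * Q2')" using Q1(5) Q2(5) a by simp
    also have "\<dots> = ds Q1 Q2 * ds (\<tau> a) (diag_rep bs a) * ds Q1' Q2'" using Q1 Q2 c by (simp add: dsm)
    also have "ds (\<tau> a) (diag_rep bs a) = diag_rep (b # bs) a" using eq[OF reps(1) reps2(1)] a by (simp add: b ds_def)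
    finally show "diag_rep (b' # bs') a = ds Q1 Q2 * diag_rep (b # bs) a * ds Q1' Q2'" .
  qed (use dsc Q1 Q2 in auto)
  then show ?case using r1 p' by (simp add: b b' mm p_def)
qed

section \<open>Irreducible representations are determined by traces\<close>

definition mtr :: "nat \<Rightarrow> 'a::comm_ring_1 mat \<Rightarrow> 'a" where
  "mtr m A = (\<Sum>i<m. A $$ (i, i))"

lemma mtr_add: "B \<in> carrier_mat m m \<Longrightarrow> mtr m (A + B) = mtr m A + mtr m B"
  by (simp add: mtr_def sum.distrib)

lemma mtr_smult: "A \<in> carrier_mat m m \<Longrightarrow> mtr m (c \<cdot>\<^sub>m A) = c * mtr m A"
  by (simp add: mtr_def sum_distrib_left)

lemma mtr_mult: "A \<in> carrier_mat m m \<Longrightarrow> B \<in> carrier_mat m m \<Longrightarrow> mtr m (A * B) = (\<Sum>a<m. \<Sum>b<m. A $$ (a, b) * B $$ (b, a))"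
  by (simp add: mtr_def times_mat_def scalar_prod_def atLeast0LessThan)

text \<open>The three assertions are proved together: the subleading coefficient for k + 2 factors
  uses the leading coefficient for k + 1 factors, which in turn uses the vanishing of higher
  coefficients.\<close>

lemma coeff_prod_linear:
  fixes a :: "nat \<Rightarrow> 'a::comm_ring_1"
  shows "coeff (\<Prod>i<Suc k. [:- a i, 1:]) k = - (\<Sum>i<Suc k. a i) \<and>
    coeff (\<Prod>i<k. [:- a i, 1:]) k = 1 \<and> (\<forall>j>k. coeff (\<Prod>i<k. [:- a i, 1:]) j = 0)"
proof (induction k)
  case 0
  show ?case by simp
next
  case (Suc k)
  have step: "coeff (\<Prod>i<Suc q. [:- a i, 1:]) (Suc j) = coeff (\<Prod>i<q. [:- a i, 1:]) j - a q * coeff (\<Prod>i<q. [:- a i, 1:]) (Suc j)" for q j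
    by (simp add: mult_pCons_right)
  have top: "coeff (\<Prod>i<Suc k. [:- a i, 1:]) (Suc k) = 1" using Suc step[of k k] by simp
  have "coeff (\<Prod>i<Suc k. [:- a i, 1:]) j = 0" if "j > Suc k" for j
    using that Suc step[of k "j - 1"] by (cases j) auto
  moreover have "coeff (\<Prod>i<Suc (Suc k). [:- a i, 1:]) (Suc k) = - (\<Sum>i<Suc (Suc k). a i)"
    using step[of "Suc k" k] top conjunct1[OF Suc] sum.lessThan_Suc[of a "Suc k"]
    by (simp del: prod.lessThan_Suc sum.lessThan_Suc)
  ultimately show ?case using top by blast
qed

text \<open>A permutation other than the identity moves at least two indices, so its term in the
  determinant has degree at most m - 2. Only the product of the diagonal entries reaches degree m -
  1.\<close>

lemma coeff_char_poly_trace: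
  fixes A :: "'a::idom mat"
  assumes A: "A \<in> carrier_mat m m" and m: "0 < m"
  shows "coeff (char_poly A) (m - 1) = - mtr m A"
proof -
  define C where "C = [:0, 1:] \<cdot>\<^sub>m 1\<^sub>m (dim_row A) + map_mat (\<lambda>a. [:- a:]) A"
  have C: "C \<in> carrier_mat m m" using A by (auto simp: C_def)
  have Cij: "C $$ (i, j) = (if i = j then [:- A $$ (i, j), 1:] else [:- A $$ (i, j):])" if "i < m" "j < m" for i j
    using that A by (auto simp: C_def)
  define T where "T p = (\<Prod>i = 0..<m. C $$ (i, p i))" for p
  have cp: "char_poly A = (\<Sum>p | p permutes {0..<m}. signof p * T p)"
    unfolding char_poly_defs T_def C_def[symmetric] by (rule det_def'[OF C])
  have T0: "coeff (signof p * T p) (m - 1) = 0" if p: "p permutes {0..<m}" and "p \<noteq> id" for p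
  proof -
    obtain i where i: "i < m" "p i \<noteq> i"
      using \<open>p \<noteq> id\<close> permutes_not_in[OF p] by (metis atLeastLessThan_iff eq_id_iff zero_le)
    define j where "j = p i"
    have pm: "p k < m" if "k < m" for k using permutes_in_image[OF p, of k] that by simp
    have j: "j < m" "p j \<noteq> j" "j \<noteq> i" using i pm[OF i(1)] permutes_inj[OF p] by (auto simp: j_def inj_eq)
    have "degree (T p) \<le> (\<Sum>k = 0..<m. degree (C $$ (k, p k)))"
      unfolding T_def using degree_prod_sum_le[of "{0..<m}" "\<lambda>k. C $$ (k, p k)"] by (simp add: o_def)
    also have "\<dots> \<le> (\<Sum>k = 0..<m. if k \<in> {i, j} then 0 else 1)"
      by (rule sum_mono) (use i j pm Cij in \<open>auto simp: j_def\<close>)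
    also have "\<dots> = card ({0..<m} - {i, j})"
      by (simp add: sum.If_cases Int_absorb1 set_diff_eq Collect_conj_eq flip: Diff_eq)
    also have "\<dots> = m - 2" using i j by (subst card_Diff_subset) auto
    also have "\<dots> < m - 1" using i j by linarith
    finally have "coeff (T p) (m - 1) = 0" by (rule coeff_eq_0)
    then show ?thesis by (simp add: sign_def)
  qed
  have "coeff (char_poly A) (m - 1) = (\<Sum>p | p permutes {0..<m}. coeff (signof p * T p) (m - 1))"
    by (simp only: cp coeff_sum)
  also have "\<dots> = coeff (signof id * T id) (m - 1)"
  proof (rule sum.remove[THEN trans])
    show "coeff (signof id * T id) (m - 1) + (\<Sum>p\<in>{p. p permutes {0..<m}} - {id}. coeff (signof p * T p) (m - 1)) =
        coeff (signof id * T id) (m - 1)"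
      using T0 by (simp add: sum.neutral)
  qed (auto simp: finite_permutations permutes_id)
  also have "signof id * T id = (\<Prod>i<m. [:- A $$ (i, i), 1:])"
    by (auto simp: T_def Cij atLeast0LessThan intro!: prod.cong)
  also have "coeff \<dots> (m - 1) = - mtr m A"
    using coeff_prod_linear[of "\<lambda>i. A $$ (i, i)" "m - 1"] m by (simp add: mtr_def del: prod.lessThan_Suc sum.lessThan_Suc)
  finally show ?thesis .
qed

text \<open>
  The pairs of matrices of the prefixes of length at most \<open>2 m\<^sup>2\<close> of a longer word satisfy a linear
  relation. Solving it for the longest prefix that occurs in it expresses the word by shorter ones.
\<close>

lemma trace_words_determined:
  fixes Z Z' :: "nat \<Rightarrow> 'a::field mat"
  assumes Z: "\<And>l. Z l \<in> carrier_mat m m" and Z': "\<And>l. Z' l \<in> carrier_mat m m"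
    and short: "\<And>w. w \<in> lists L \<Longrightarrow> length w \<le> 2 * m * m \<Longrightarrow> mtr m (word_mat Z m w) = mtr m (word_mat Z' m w)"
  shows "w \<in> lists L \<Longrightarrow> mtr m (word_mat Z m w) = mtr m (word_mat Z' m w)"
proof (induction "length w" arbitrary: w rule: less_induct)
  case less
  let ?N = "2 * m * m"
  show ?case
  proof (cases "length w \<le> ?N")
    case True
    then show ?thesis using short less.prems by blast
  next
    case False
    \<comment> \<open>The pair of matrices of the prefix of length i, flattened to one vector of
      length 2 m^2: the first m^2 positions hold the entries for Z row by row, the others those for
      Z'. One relation thus holds for both tuples.\<close>
    define v where "v i c = (if c < m * m then word_mat Z m (take i w) $$ (c div m, c mod m)
      else word_mat Z' m (take i w) $$ ((c - m * m) div m, (c - m * m) mod m))" for i c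
    obtain \<alpha> where "(\<exists>i\<le>?N. \<alpha> i \<noteq> 0) \<and> (\<forall>c<?N. (\<Sum>i\<le>?N. \<alpha> i * v i c) = 0)"
      using linear_relation[of ?N v] by (rule exE)
    then have \<alpha>: "\<exists>i\<le>?N. \<alpha> i \<noteq> 0" and rel: "\<forall>c<?N. (\<Sum>i\<le>?N. \<alpha> i * v i c) = 0" by (rule conjunct1, rule conjunct2)
    have ab: "a * m + b < m * m" if "a < m" "b < m" for a b
    proof -
      have "a * m + b < Suc a * m" using that by simp
      also have "\<dots> \<le> m * m" using that by (intro mult_le_mono1) simp
      finally show ?thesis .
    qed
    have rZ: "(\<Sum>i\<le>?N. \<alpha> i * word_mat Z m (take i w) $$ (a, b)) = 0" if "a < m" "b < m" for a b
      using rel[rule_format, of "a * m + b"] ab[OF that] that by (simp add: v_def)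
    have rZ': "(\<Sum>i\<le>?N. \<alpha> i * word_mat Z' m (take i w) $$ (a, b)) = 0" if "a < m" "b < m" for a b
      using rel[rule_format, of "m * m + (a * m + b)"] ab[OF that] that by (simp add: v_def)
    define k where "k = Max {i. i \<le> ?N \<and> \<alpha> i \<noteq> 0}"
    have fin: "finite {i. i \<le> ?N \<and> \<alpha> i \<noteq> 0}" by simp
    have "k \<in> {i. i \<le> ?N \<and> \<alpha> i \<noteq> 0}" unfolding k_def by (rule Max_in[OF fin]) (use \<alpha> in blast)
    then have k: "k \<le> ?N" "\<alpha> k \<noteq> 0" by auto
    have kmax: "\<alpha> i = 0" if "k < i" "i \<le> ?N" for i
      using Max_ge[OF fin, of i] that unfolding k_def by fastforce
    \<comment> \<open>Multiplying the relation by the rest \<open>drop k w\<close> turns its term at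
      k into w itself, while the terms with i < k become shorter words.\<close>
    have tr: "(\<Sum>i\<le>?N. \<alpha> i * mtr m (word_mat Y m (take i w @ drop k w))) = 0"
      if Y: "\<And>l. Y l \<in> carrier_mat m m"
        and r: "\<And>a b. a < m \<Longrightarrow> b < m \<Longrightarrow> (\<Sum>i\<le>?N. \<alpha> i * word_mat Y m (take i w) $$ (a, b)) = 0" for Y
    proof -
      note wc = word_mat_carrier[of Y m, OF Y]
      have "(\<Sum>i\<le>?N. \<alpha> i * mtr m (word_mat Y m (take i w @ drop k w))) =
          (\<Sum>i\<le>?N. \<Sum>a<m. \<Sum>b<m. \<alpha> i * word_mat Y m (take i w) $$ (a, b) * word_mat Y m (drop k w) $$ (b, a))"
        by (simp add: word_mat_append[of Y m, OF Y] mtr_mult[OF wc wc] sum_distrib_left mult.assoc)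
      also have "\<dots> = (\<Sum>a<m. \<Sum>b<m. \<Sum>i\<le>?N. \<alpha> i * word_mat Y m (take i w) $$ (a, b) * word_mat Y m (drop k w) $$ (b, a))"
        by (subst sum.swap) (intro sum.cong refl sum.swap)
      also have "\<dots> = (\<Sum>a<m. \<Sum>b<m. (\<Sum>i\<le>?N. \<alpha> i * word_mat Y m (take i w) $$ (a, b)) * word_mat Y m (drop k w) $$ (b, a))"
        by (simp only: sum_distrib_right)
      also have "\<dots> = 0" using r by simp
      finally show ?thesis .
    qed
    let ?d = "\<lambda>u. mtr m (word_mat Z m u) - mtr m (word_mat Z' m u)"
    have "(\<Sum>i\<le>?N. \<alpha> i * ?d (take i w @ drop k w)) = 0"
      using tr[of Z, OF Z rZ] tr[of Z', OF Z' rZ'] by (simp add: right_diff_distrib sum_subtractf)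
    moreover have "(\<Sum>i\<le>?N. \<alpha> i * ?d (take i w @ drop k w)) = (\<Sum>i\<in>{k}. \<alpha> i * ?d (take i w @ drop k w))"
    proof (rule sum.mono_neutral_right)
      show "\<forall>i\<in>{..?N} - {k}. \<alpha> i * ?d (take i w @ drop k w) = 0"
      proof
        fix i assume i: "i \<in> {..?N} - {k}"
        show "\<alpha> i * ?d (take i w @ drop k w) = 0"
        proof (cases "i < k")
          case True
          have "set (take i w) \<subseteq> set w" "set (drop k w) \<subseteq> set w" by (rule set_take_subset, rule set_drop_subset)
          then have "take i w @ drop k w \<in> lists L" using less.prems unfolding in_lists_conv_set by auto
          moreover have "length (take i w @ drop k w) < length w" using True False k(1) by simp
          ultimately show ?thesis using less.hyps by simp
        next
          case False
          then show ?thesis using i kmax by simp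
        qed
      qed
    qed (use k in auto)
    ultimately show ?thesis using k(2) by simp
  qed
qed

text \<open>The linear span of the pairs (\<tau> a, \<tau>' a). It is a relation because it is not
  known to be single-valued until the traces are compared.\<close>

inductive linked :: "('r, 'z) ring_scheme \<Rightarrow> ('r \<Rightarrow> 'a::field mat) \<Rightarrow> ('r \<Rightarrow> 'a mat) \<Rightarrow> 'a mat \<Rightarrow> 'a mat \<Rightarrow> bool"
  for R \<tau> \<tau>' where
  gen: "a \<in> carrier R \<Longrightarrow> linked R \<tau> \<tau>' (\<tau> a) (\<tau>' a)"
| add: "linked R \<tau> \<tau>' A A' \<Longrightarrow> linked R \<tau> \<tau>' B B' \<Longrightarrow> linked R \<tau> \<tau>' (A + B) (A' + B')"
| smult: "linked R \<tau> \<tau>' A A' \<Longrightarrow> linked R \<tau> \<tau>' (c \<cdot>\<^sub>m A) (c \<cdot>\<^sub>m A')"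

lemma linked_sym: "linked R \<tau> \<tau>' A A' \<Longrightarrow> linked R \<tau>' \<tau> A' A"
  by (induction rule: linked.induct) (auto intro: linked.intros)

lemma linked_carrier:
  assumes "representation R \<sigma> m \<tau>" "representation R \<sigma> m \<tau>'"
  shows "linked R \<tau> \<tau>' A A' \<Longrightarrow> A \<in> carrier_mat m m \<and> A' \<in> carrier_mat m m"
  by (induction rule: linked.induct) (use representationD(1)[OF assms(1)] representationD(1)[OF assms(2)] in auto)

lemma linked_trace:
  assumes rep: "representation R \<sigma> m \<tau>" "representation R \<sigma> m \<tau>'"
    and tr: "\<And>a. a \<in> carrier R \<Longrightarrow> mtr m (\<tau> a) = mtr m (\<tau>' a)"
  shows "linked R \<tau> \<tau>' A A' \<Longrightarrow> mtr m A = mtr m A'"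
proof (induction rule: linked.induct)
  case (add A A' B B')
  then show ?case using linked_carrier[OF rep] by (metis mtr_add)
next
  case (smult A A' c)
  then show ?case using linked_carrier[OF rep] by (metis mtr_smult)
qed (rule tr)

lemma linked_mult:
  assumes R: "ring R" and rep: "representation R \<sigma> m \<tau>" "representation R \<sigma> m \<tau>'"
    and A: "linked R \<tau> \<tau>' A A'" and B: "linked R \<tau> \<tau>' B B'"
  shows "linked R \<tau> \<tau>' (A * B) (A' * B')"
proof -
  interpret ring R by fact
  note D = representationD[OF rep(1)] and D' = representationD[OF rep(2)] and c = linked_carrier[OF rep]
  have gen: "linked R \<tau> \<tau>' (A * \<tau> b) (A' * \<tau>' b)" if b: "b \<in> carrier R" for b
    using A
  proof (induction rule: linked.induct)
    case (gen a)
    then show ?case using linked.gen[of "a \<otimes>\<^bsub>R\<^esub> b" R \<tau> \<tau>'] b by (simp add: D(2) D'(2))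
  next
    case (add A A' B B')
    note ab = c[OF add.hyps(1)] c[OF add.hyps(2)]
    show ?case using linked.add[OF add.IH] ab D(1)[OF b] D'(1)[OF b] by (simp add: add_mult_distrib_mat[of _ m m])
  next
    case (smult A A' k)
    show ?case using linked.smult[OF smult.IH, of k] c[OF smult.hyps] D(1)[OF b] D'(1)[OF b] by (simp add: mult_smult_assoc_mat[of _ m m])
  qed
  note ac = c[OF A]
  show ?thesis using B
  proof (induction rule: linked.induct)
    case (gen a)
    then show ?case using \<open>\<And>b. b \<in> carrier R \<Longrightarrow> linked R \<tau> \<tau>' (A * \<tau> b) (A' * \<tau>' b)\<close> by blast
  next
    case (add B B' C C')
    note ab = c[OF add.hyps(1)] c[OF add.hyps(2)]
    show ?case using linked.add[OF add.IH] ab ac by (simp add: mult_add_distrib_mat[of _ m m _ m])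
  next
    case (smult B B' k)
    show ?case using linked.smult[OF smult.IH, of k] c[OF smult.hyps] ac by (simp add: mult_smult_distrib[of _ m m _ m])
  qed
qed

text \<open>Irreducibility of \<tau> means that the matrices \<tau> a span everything, so the
  subspace of matrices related to something is the whole space.\<close>

lemma linked_surj:
  fixes \<tau> \<tau>' :: "'r \<Rightarrow> 'k::field alg_closure mat"
  assumes R: "ring R" and irr: "irreducible_rep R \<sigma> m \<tau>" and rep': "representation R \<sigma> m \<tau>'" and M: "M \<in> carrier_mat m m"
  shows "\<exists>M'. linked R \<tau> \<tau>' M M'"
proof -
  interpret ring R by fact
  have rep: "representation R \<sigma> m \<tau>" and sp: "mspan m (\<tau> ` carrier R) = carrier_mat m m"
    using irr by (auto simp: irreducible_rep_def)
  have "mspan m (\<tau> ` carrier R) \<subseteq> {M \<in> carrier_mat m m. \<exists>M'. linked R \<tau> \<tau>' M M'}"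
  proof (rule mspan_least)
    have "0\<^sub>m m m = 0 \<cdot>\<^sub>m \<tau> \<one>\<^bsub>R\<^esub>" using representationD(4)[OF rep] by (auto intro!: eq_matI)
    then have "linked R \<tau> \<tau>' (0\<^sub>m m m) (0 \<cdot>\<^sub>m \<tau>' \<one>\<^bsub>R\<^esub>)" using linked.smult[OF linked.gen[OF one_closed]] by metis
    then show "mat_subspace m m {M \<in> carrier_mat m m. \<exists>M'. linked R \<tau> \<tau>' M M'}"
      unfolding mat_subspace_def by (auto intro: linked.add linked.smult)
    show "\<tau> ` carrier R \<subseteq> {M \<in> carrier_mat m m. \<exists>M'. linked R \<tau> \<tau>' M M'}"
      using representationD(1)[OF rep] by (auto intro: linked.gen)
  qed
  then show ?thesis using M sp by blast
qed

text \<open>Multiplication by the matrix unit at (j, i) makes the trace read off the entry at (i,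
  j).\<close>

lemma trace_form_nondegenerate:
  fixes A :: "'a::comm_ring_1 mat"
  assumes A: "A \<in> carrier_mat m m" and z: "\<And>B. B \<in> carrier_mat m m \<Longrightarrow> mtr m (A * B) = 0"
  shows "A = 0\<^sub>m m m"
proof (rule eq_matI)
  fix i j assume "i < dim_row (0\<^sub>m m m :: 'a mat)" "j < dim_col (0\<^sub>m m m :: 'a mat)"
  then have ij: "i < m" "j < m" by auto
  define E :: "'a mat" where "E = mat m m (\<lambda>(a, b). if a = j \<and> b = i then 1 else 0)"
  have E: "E \<in> carrier_mat m m" by (simp add: E_def)
  have "mtr m (A * E) = (\<Sum>a<m. \<Sum>b<m. if b = j then (if a = i then A $$ (a, b) else 0) else 0)"
    unfolding mtr_mult[OF A E] by (intro sum.cong refl) (auto simp: E_def)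
  also have "\<dots> = A $$ (i, j)" using ij by simp
  finally show "A $$ (i, j) = 0\<^sub>m m m $$ (i, j)" using z[OF E] ij by simp
qed (use A in auto)

text \<open>
  Since the trace form is nondegenerate, the relation \<^const>\<open>linked\<close> is the graph of an automorphism
  of the matrix algebra. The images of the matrix units of the first column, applied to a fixed
  vector, are the columns of an intertwiner.
\<close>

lemma irreducible_reps_trace_equivalent:
  fixes \<tau> \<tau>' :: "'r \<Rightarrow> 'k::field alg_closure mat"
  assumes R: "ring R" and m: "0 < m" and irr: "irreducible_rep R \<sigma> m \<tau>" "irreducible_rep R \<sigma> m \<tau>'"
    and tr: "\<And>a. a \<in> carrier R \<Longrightarrow> mtr m (\<tau> a) = mtr m (\<tau>' a)"
  shows "rep_equivalent R m \<tau> \<tau>'"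
proof -
  interpret ring R by fact
  have rep: "representation R \<sigma> m \<tau>" "representation R \<sigma> m \<tau>'" using irr by (auto simp: irreducible_rep_def)
  let ?L = "linked R \<tau> \<tau>'"
  note c = linked_carrier[OF rep] and mult = linked_mult[OF R rep]
  have trace: "mtr m A = mtr m A'" if "?L A A'" for A A' using linked_trace[OF rep _ that] tr by blast
  note surj = linked_surj[OF R irr(1) rep(2)]
  have surj': "\<exists>M. ?L M M'" if "M' \<in> carrier_mat m m" for M'
    using linked_surj[OF R irr(2) rep(1) that] linked_sym by blast
  \<comment> \<open>Linked pairs multiply and have equal traces, so a matrix linked to 0 is
    orthogonal under the trace form to everything that is linked to something.\<close>
  have inj: "U' = 0\<^sub>m m m" if L: "?L (0\<^sub>m m m) U'" for U'
  proof (rule trace_form_nondegenerate)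
    show "U' \<in> carrier_mat m m" using c[OF L] by blast
    fix Y' :: "'k alg_closure mat" assume "Y' \<in> carrier_mat m m"
    then obtain Y where Y: "?L Y Y'" using surj' by blast
    have "mtr m (0\<^sub>m m m * Y) = mtr m (U' * Y')" by (rule trace[OF mult[OF L Y]])
    then show "mtr m (U' * Y') = 0" using c[OF Y] left_mult_zero_mat[of Y m m m] by (simp add: mtr_def)
  qed
  have inj': "U' = 0\<^sub>m m m" if L: "?L U' (0\<^sub>m m m)" for U'
  proof (rule trace_form_nondegenerate)
    show "U' \<in> carrier_mat m m" using c[OF L] by blast
    fix Y :: "'k alg_closure mat" assume "Y \<in> carrier_mat m m"
    then obtain Y' where Y: "?L Y Y'" using surj by blast
    have "mtr m (U' * Y) = mtr m (0\<^sub>m m m * Y')" by (rule trace[OF mult[OF L Y]])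
    then show "mtr m (U' * Y) = 0" using c[OF Y] left_mult_zero_mat[of Y' m m m] by (simp add: mtr_def)
  qed
  have fct: "U' = Y'" if L: "?L U U'" "?L U Y'" for U U' Y'
  proof -
    note cc = c[OF L(1)] c[OF L(2)]
    have "?L (U + (- 1) \<cdot>\<^sub>m U) (U' + (- 1) \<cdot>\<^sub>m Y')" by (intro linked.add linked.smult L)
    moreover have "U + (- 1) \<cdot>\<^sub>m U = 0\<^sub>m m m" using cc by (auto intro!: eq_matI)
    ultimately have z: "U' + (- 1) \<cdot>\<^sub>m Y' = 0\<^sub>m m m" using inj by simp
    show ?thesis
    proof (rule eq_matI)
      fix i j assume ij: "i < dim_row Y'" "j < dim_col Y'"
      from arg_cong[OF z, of "\<lambda>M. M $$ (i, j)"] show "U' $$ (i, j) = Y' $$ (i, j)" using ij cc by auto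
    qed (use cc in auto)
  qed
  define E :: "nat \<Rightarrow> 'k alg_closure mat" where "E i = mat m m (\<lambda>(a, b). if a = i \<and> b = 0 then 1 else 0)" for i
  have Ec: "E i \<in> carrier_mat m m" for i by (simp add: E_def)
  have "\<forall>i. \<exists>F. ?L (E i) F" using surj Ec by blast
  from choice[OF this] obtain F where F: "\<forall>i. ?L (E i) (F i)" by (elim exE)
  have Fc: "F i \<in> carrier_mat m m" for i using c[OF F[rule_format, of i]] by blast
  have "F 0 \<noteq> 0\<^sub>m m m"
  proof
    assume "F 0 = 0\<^sub>m m m"
    then have "E 0 = 0\<^sub>m m m" using inj' F by metis
    from arg_cong[OF this, of "\<lambda>M. M $$ (0, 0)"] show False using m by (simp add: E_def)
  qed
  \<comment> \<open>The fixed vector for the intertwiner is the unit vector q, chosen so that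
    \<open>F 0\<close> does not kill it; p marks a nonzero coordinate of the image.\<close>
  then obtain p q where pq: "p < m" "q < m" "F 0 $$ (p, q) \<noteq> 0"
    using eq_matI[of "F 0" "0\<^sub>m m m"] Fc[of 0] by (metis carrier_matD index_zero_mat)
  define Q where "Q = mat m m (\<lambda>(k, i). F i $$ (k, q))"
  have Qc: "Q \<in> carrier_mat m m" by (simp add: Q_def)
  have zero: "?L (0\<^sub>m m m) (0\<^sub>m m m)"
  proof -
    have "?L (0 \<cdot>\<^sub>m \<tau> \<one>\<^bsub>R\<^esub>) (0 \<cdot>\<^sub>m \<tau>' \<one>\<^bsub>R\<^esub>)" by (intro linked.smult linked.gen one_closed)
    moreover have "0 \<cdot>\<^sub>m 1\<^sub>m m = (0\<^sub>m m m :: 'k alg_closure mat)" by (intro eq_matI) auto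
    ultimately show ?thesis by (simp only: representationD(4)[OF rep(1)] representationD(4)[OF rep(2)])
  qed
  have lin: "?L (mat m m (\<lambda>(a, b). if a < j \<and> b = 0 then d a else 0)) (mat m m (\<lambda>(a, b). \<Sum>k<j. d k * F k $$ (a, b)))"
    if "j \<le> m" for d :: "nat \<Rightarrow> 'k alg_closure" and j
    using that
  proof (induction j)
    case 0
    have "mat m m (\<lambda>(a, b). if a < 0 \<and> b = 0 then d a else 0) = 0\<^sub>m m m"
      "mat m m (\<lambda>(a, b). \<Sum>k<0. d k * F k $$ (a, b)) = 0\<^sub>m m m" by (auto intro!: eq_matI)
    then show ?case using zero by (simp only:)
  next
    case (Suc j)
    have "mat m m (\<lambda>(a, b). if a < Suc j \<and> b = 0 then d a else 0) =
        mat m m (\<lambda>(a, b). if a < j \<and> b = 0 then d a else 0) + d j \<cdot>\<^sub>m E j"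
      by (intro eq_matI) (auto simp: E_def less_Suc_eq)
    moreover have "mat m m (\<lambda>(a, b). \<Sum>k<Suc j. d k * F k $$ (a, b)) =
        mat m m (\<lambda>(a, b). \<Sum>k<j. d k * F k $$ (a, b)) + d j \<cdot>\<^sub>m F j"
      using Fc[of j] by (intro eq_matI) auto
    ultimately show ?case
      using linked.add[OF Suc.IH[OF Suc_leD[OF Suc.prems]] linked.smult[OF F[rule_format, of j], of "d j"]] by (simp only:)
  qed
  \<comment> \<open>The product U E_i is the combination of the E_k with the entries of column i of
    U as coefficients. The relation carries this identity to U' and the F_k, and its column q is the
    asserted equation in column i.\<close>
  have inter: "U' * Q = Q * U" if L: "?L U U'" for U U'
  proof (rule eq_matI)
    have cc: "U \<in> carrier_mat m m" "U' \<in> carrier_mat m m" "dim_row U = m" "dim_col U = m" "dim_row U' = m" "dim_col U' = m"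
      using c[OF L] by auto
    fix a i assume "a < dim_row (Q * U)" "i < dim_col (Q * U)"
    then have ai: "a < m" "i < m" using cc Qc by auto
    have "U * E i = mat m m (\<lambda>(a, b). if a < m \<and> b = 0 then U $$ (a, i) else 0)"
    proof (rule eq_matI)
      fix a b assume "a < dim_row (mat m m (\<lambda>(a, b). if a < m \<and> b = 0 then U $$ (a, i) else 0))"
        "b < dim_col (mat m m (\<lambda>(a, b). if a < m \<and> b = 0 then U $$ (a, i) else 0))"
      then have ab: "a < m" "b < m" by auto
      have "(U * E i) $$ (a, b) = (\<Sum>k<m. U $$ (a, k) * (if k = i \<and> b = 0 then 1 else 0))"
        using ab cc by (simp add: times_mat_def scalar_prod_def E_def atLeast0LessThan)
      also have "\<dots> = (\<Sum>k<m. if k = i then (if b = 0 then U $$ (a, k) else 0) else 0)" by (intro sum.cong) auto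
      also have "\<dots> = (if b = 0 then U $$ (a, i) else 0)" using ai by simp
      finally show "(U * E i) $$ (a, b) = mat m m (\<lambda>(a, b). if a < m \<and> b = 0 then U $$ (a, i) else 0) $$ (a, b)"
        using ab by simp
    qed (use cc in \<open>auto simp: E_def\<close>)
    with lin[of m "\<lambda>k. U $$ (k, i)"] have "?L (U * E i) (mat m m (\<lambda>(a, b). \<Sum>k<m. U $$ (k, i) * F k $$ (a, b)))" by simp
    then have "U' * F i = mat m m (\<lambda>(a, b). \<Sum>k<m. U $$ (k, i) * F k $$ (a, b))"
      using fct[OF mult[OF L F[rule_format, of i]]] by blast
    from arg_cong[OF this, of "\<lambda>M. M $$ (a, q)"]
    have "(U' * F i) $$ (a, q) = (\<Sum>k<m. U $$ (k, i) * F k $$ (a, q))" using ai pq by simp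
    moreover have "(U' * F i) $$ (a, q) = (U' * Q) $$ (a, i)"
      using ai pq cc carrier_matD[OF Fc[of i]] by (simp add: times_mat_def scalar_prod_def Q_def)
    moreover have "(Q * U) $$ (a, i) = (\<Sum>k<m. U $$ (k, i) * F k $$ (a, q))"
      using ai pq cc by (simp add: times_mat_def scalar_prod_def Q_def atLeast0LessThan mult.commute)
    ultimately show "(U' * Q) $$ (a, i) = (Q * U) $$ (a, i)" by simp
  qed (use c[OF L] Qc in auto)
  have "det Q \<noteq> 0"
  proof
    assume "det Q = 0"
    then obtain v where v: "v \<in> carrier_vec m" "v \<noteq> 0\<^sub>v m" "Q *\<^sub>v v = 0\<^sub>v m" using det_0_iff_vec_prod_zero[OF Qc] by blast
    then obtain l where l: "l < m" "v $ l \<noteq> 0" using eq_vecI[of v "0\<^sub>v m"] by (metis carrier_vecD index_zero_vec)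
    \<comment> \<open>This U maps the kernel vector v to the unit vector 0. Then Q U v is column 0
      of Q, whose coordinate p is nonzero, although Q U v = U' Q v = 0.\<close>
    define U where "U = mat m m (\<lambda>(a, b). if a = 0 \<and> b = l then 1 / v $ l else 0)"
    have Uc: "U \<in> carrier_mat m m" by (simp add: U_def)
    obtain U' where L: "?L U U'" using surj[OF Uc] by blast
    have U': "U' \<in> carrier_mat m m" using c[OF L] by blast
    have "(Q * U) *\<^sub>v v = U' *\<^sub>v (Q *\<^sub>v v)" using inter[OF L] assoc_mult_mat_vec[OF U' Qc v(1)] by simp
    also have "\<dots> = 0\<^sub>v m" unfolding v(3) using U' by (intro eq_vecI) (auto simp: scalar_prod_def)
    finally have z: "((Q * U) *\<^sub>v v) $ p = 0" using pq by simp
    have ent: "(N *\<^sub>v v) $ p = (\<Sum>b<m. N $$ (p, b) * v $ b)" if "N \<in> carrier_mat m m" for N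
      using pq v(1) that by (simp add: scalar_prod_def atLeast0LessThan)
    have QU: "(Q * U) $$ (p, b) = (if b = l then F 0 $$ (p, q) / v $ l else 0)" if "b < m" for b
    proof -
      have "(Q * U) $$ (p, b) = (\<Sum>k<m. F k $$ (p, q) * (if k = 0 \<and> b = l then 1 / v $ l else 0))"
        using that pq by (simp add: times_mat_def scalar_prod_def Q_def U_def atLeast0LessThan)
      also have "\<dots> = (\<Sum>k<m. if k = 0 then (if b = l then F k $$ (p, q) / v $ l else 0) else 0)" by (intro sum.cong) auto
      also have "\<dots> = (if b = l then F 0 $$ (p, q) / v $ l else 0)" using m by simp
      finally show ?thesis .
    qed
    have "((Q * U) *\<^sub>v v) $ p = (\<Sum>b<m. (Q * U) $$ (p, b) * v $ b)" by (rule ent[OF mult_carrier_mat[OF Qc Uc]])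
    also have "\<dots> = (\<Sum>b<m. if b = l then F 0 $$ (p, q) / v $ l * v $ b else 0)"
      by (intro sum.cong refl) (simp add: QU)
    also have "\<dots> = F 0 $$ (p, q)" using l by simp
    finally show False using z pq by simp
  qed
  then obtain Q' where Q': "Q' \<in> carrier_mat m m" "Q * Q' = 1\<^sub>m m" "Q' * Q = 1\<^sub>m m" using adj_inverse[OF Qc] by blast
  have "\<tau>' a = Q * \<tau> a * Q'" if a: "a \<in> carrier R" for a
  proof -
    have "\<tau>' a = \<tau>' a * Q * Q'"
      using assoc_mult_mat[OF representationD(1)[OF rep(2) a] Qc Q'(1)] Q'(2) right_mult_one_mat[OF representationD(1)[OF rep(2) a]] by simp
    then show ?thesis using inter[OF linked.gen[OF a]] by simp
  qed
  then show ?thesis unfolding rep_equivalent_def using Qc Q' by blast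
qed

section \<open>Representations of finitely presented algebras as points\<close>

lemma sum_single_lookup: "(\<Sum>k\<in>Poly_Mapping.keys p. Poly_Mapping.single k (Poly_Mapping.lookup p k)) = p"
  by (rule poly_mapping_eqI) (auto simp: lookup_sum lookup_single when_def sum.delta' in_keys_iff)

lemma falg_eval_single:
  assumes "\<kappa> 0 = 0" and Z: "\<And>l. Z l \<in> carrier_mat n n"
  shows "falg_eval \<kappa> Z n (Poly_Mapping.single w c) = \<kappa> c \<cdot>\<^sub>m word_mat Z n w"
  using carrier_matD[OF word_mat_carrier[of Z n w, OF Z]] assms(1)
  by (intro eq_matI) (auto simp: falg_eval_def)

lemma falg_eval_add:
  assumes "comm_ring_hom \<kappa>"
  shows "falg_eval \<kappa> Z n (g + h) = falg_eval \<kappa> Z n g + falg_eval \<kappa> Z n h"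
proof -
  interpret comm_ring_hom \<kappa> by fact
  show ?thesis unfolding falg_eval_def
    by (subst setsum_keys_plus_distrib) (auto simp: hom_add algebra_simps intro!: eq_matI)
qed

lemma falg_eval_mult:
  assumes \<kappa>: "comm_ring_hom \<kappa>" and Z: "\<And>l. Z l \<in> carrier_mat n n"
  shows "falg_eval \<kappa> Z n (g * h) = falg_eval \<kappa> Z n g * falg_eval \<kappa> Z n h"
proof -
  interpret comm_ring_hom \<kappa> by fact
  note single = falg_eval_single[of \<kappa> Z n, OF hom_zero Z] and wc = word_mat_carrier[of Z n, OF Z]
    and add = falg_eval_add[OF \<kappa>]
  show ?thesis
  proof (induction g rule: poly_mapping_single_sum_induct)
    case (single u a)
    show ?case
    proof (induction h rule: poly_mapping_single_sum_induct)
      case (single w b)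
      have "falg_eval \<kappa> Z n (Poly_Mapping.single u a * Poly_Mapping.single w b) =
          (\<kappa> a * \<kappa> b) \<cdot>\<^sub>m (word_mat Z n u * word_mat Z n w)"
        by (simp add: mult_single \<open>\<And>w c. falg_eval \<kappa> Z n (Poly_Mapping.single w c) = \<kappa> c \<cdot>\<^sub>m word_mat Z n w\<close>
          plus_list_def word_mat_append[of Z n, OF Z] hom_mult)
      also have "\<dots> = (\<kappa> a \<cdot>\<^sub>m word_mat Z n u) * (\<kappa> b \<cdot>\<^sub>m word_mat Z n w)"
        using mult_smult_assoc_mat[OF wc[of u] smult_carrier_mat[OF wc[of w]]] mult_smult_distrib[OF wc[of u] wc[of w]]
        by (intro eq_matI) (auto simp: mult.assoc)
      finally show ?case by (simp add: \<open>\<And>w c. falg_eval \<kappa> Z n (Poly_Mapping.single w c) = \<kappa> c \<cdot>\<^sub>m word_mat Z n w\<close>)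
    next
      case (sum h1 h2)
      then show ?case
        by (simp add: distrib_left add mult_add_distrib_mat[OF falg_eval_carrier falg_eval_carrier falg_eval_carrier])
    qed
  next
    case (sum g1 g2)
    then show ?case
      by (simp add: distrib_right add add_mult_distrib_mat[OF falg_eval_carrier falg_eval_carrier falg_eval_carrier])
  qed
qed

lemma falg_eval_ring_hom:
  fixes \<kappa> :: "'k::field \<Rightarrow> 'r::comm_ring_1"
  assumes \<kappa>: "comm_ring_hom \<kappa>" and Z: "\<And>l. Z l \<in> carrier_mat n n"
  shows "falg_eval \<kappa> Z n \<in> Ring.ring_hom (free_algebra s) (ring_mat TYPE('r) n ())"
proof (rule ring_hom_memI)
  interpret comm_ring_hom \<kappa> by fact
  have "falg_eval \<kappa> Z n (Poly_Mapping.single [] 1) = 1\<^sub>m n"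
    using falg_eval_single[of \<kappa> Z n "[]" 1, OF hom_zero Z] by (auto simp: hom_one intro!: eq_matI)
  then show "falg_eval \<kappa> Z n \<one>\<^bsub>free_algebra s\<^esub> = \<one>\<^bsub>ring_mat TYPE('r) n ()\<^esub>"
    by (simp add: free_algebra_def ring_mat_simps zero_list_def flip: single_one)
qed (simp_all add: ring_mat_simps free_algebra_def falg_eval_mult[of \<kappa> Z n, OF \<kappa> Z] falg_eval_add[OF \<kappa>])

lemma mtr_falg_eval: "mtr n (falg_eval \<kappa> Z n p) = (\<Sum>w\<in>Poly_Mapping.keys p. \<kappa> (Poly_Mapping.lookup p w) * mtr n (word_mat Z n w))"
proof -
  have "mtr n (falg_eval \<kappa> Z n p) = (\<Sum>i<n. \<Sum>w\<in>Poly_Mapping.keys p. \<kappa> (Poly_Mapping.lookup p w) * word_mat Z n w $$ (i, i))"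
    by (simp add: mtr_def falg_eval_def)
  also have "\<dots> = (\<Sum>w\<in>Poly_Mapping.keys p. \<Sum>i<n. \<kappa> (Poly_Mapping.lookup p w) * word_mat Z n w $$ (i, i))" by (rule sum.swap)
  finally show ?thesis by (simp add: mtr_def sum_distrib_left)
qed

abbreviation fp_class :: "nat \<Rightarrow> nat \<Rightarrow> (nat \<Rightarrow> nat list \<Rightarrow>\<^sub>0 'k::field) \<Rightarrow> (nat list \<Rightarrow>\<^sub>0 'k) \<Rightarrow> (nat list \<Rightarrow>\<^sub>0 'k) set" where
  "fp_class s t f p \<equiv> rel_ideal s t f +>\<^bsub>free_algebra s\<^esub> p"

context
  fixes n s t :: nat and f :: "nat \<Rightarrow> (nat list \<Rightarrow>\<^sub>0 'k::field)"
  assumes f: "\<forall>r<t. f r \<in> carrier (free_algebra s)"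
begin

lemma ideal_rel_ideal: "ideal (rel_ideal s t f) (free_algebra s)"
  unfolding rel_ideal_def using f by (intro ring.genideal_ideal ring_free_algebra) auto

lemma ring_fp_algebra: "ring (fp_algebra s t f)"
  unfolding fp_algebra_def by (rule ideal.quotient_is_ring[OF ideal_rel_ideal])

lemma fp_class_hom: "fp_class s t f \<in> Ring.ring_hom (free_algebra s) (fp_algebra s t f)"
  unfolding fp_algebra_def by (rule ideal.rcos_ring_hom[OF ideal_rel_ideal])

lemma fp_class_surj: "carrier (fp_algebra s t f) = fp_class s t f ` carrier (free_algebra s)"
  by (auto simp: fp_algebra_def FactRing_def A_RCOSETS_def')

lemma single_in_free_algebra: "w \<in> lists {..<s} \<Longrightarrow> Poly_Mapping.single w (c :: 'k) \<in> carrier (free_algebra s)"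
  by (simp add: free_algebra_def)

lemma point_representation:
  assumes z: "rel_point n t f to_ac z"
  shows "\<exists>\<rho>. representation (fp_algebra s t f) (fp_scalar s t f) n \<rho> \<and>
    (\<forall>w\<in>lists {..<s}. \<rho> (fp_class s t f (Poly_Mapping.single w 1)) = word_mat (point_mat n z) n w)"
proof -
  interpret F: ring "free_algebra s :: (nat list \<Rightarrow>\<^sub>0 'k) ring" by (rule ring_free_algebra)
  interpret I: ideal "rel_ideal s t f" "free_algebra s" by (rule ideal_rel_ideal)
  interpret to_ac: comm_ring_hom "to_ac :: 'k \<Rightarrow> _" by (rule comm_ring_hom_to_ac)
  let ?M = "ring_mat TYPE('k alg_closure) n ()"
  define \<phi> where "\<phi> = falg_eval (to_ac :: 'k \<Rightarrow> _) (point_mat n z) n"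
  have hom: "\<phi> \<in> Ring.ring_hom (free_algebra s) ?M"
    unfolding \<phi>_def
    by (rule falg_eval_ring_hom[of to_ac "point_mat n z" n s, OF comm_ring_hom_to_ac]) (rule point_mat_carrier)
  interpret H: ring_hom_ring "free_algebra s" ?M \<phi>
    by (rule ring_hom_ringI2[OF ring_free_algebra ring_mat hom])
  have "rel_ideal s t f \<subseteq> a_kernel (free_algebra s) ?M \<phi>"
    unfolding rel_ideal_def
  proof (rule F.genideal_minimal[OF H.kernel_is_ideal], rule image_subsetI)
    fix r assume "r \<in> {..<t}"
    then have r: "r < t" by simp
    have "f r \<in> carrier (free_algebra s)" by (rule f[rule_format, OF r])
    moreover have "\<phi> (f r) = 0\<^sub>m n n" unfolding \<phi>_def by (rule z[unfolded rel_point_def, rule_format, OF r])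
    ultimately show "f r \<in> a_kernel (free_algebra s) ?M \<phi>" unfolding a_kernel_def' ring_mat_simps by blast
  qed
  then have ker: "\<phi> i = 0\<^sub>m n n" if "i \<in> rel_ideal s t f" for i
    using that unfolding a_kernel_def' ring_mat_simps by blast
  \<comment> \<open>The evaluation is constant on cosets of the relation ideal, so the image of a
    coset is a singleton.\<close>
  define \<rho> where "\<rho> A = the_elem (\<phi> ` A)" for A
  have \<phi>c: "\<phi> p \<in> carrier_mat n n" for p by (simp add: \<phi>_def)
  have \<rho>: "\<rho> (fp_class s t f p) = \<phi> p" if p: "p \<in> carrier (free_algebra s)" for p
  proof -
    have e: "\<phi> (i \<oplus>\<^bsub>free_algebra s\<^esub> p) = \<phi> p" if "i \<in> rel_ideal s t f" for i
      using ring_hom_add[OF hom I.a_Hcarr[OF that] p] ker[OF that] \<phi>c[of p] by (simp add: ring_mat_simps)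
    have "rel_ideal s t f \<noteq> {}" using I.zero_closed by blast
    then have "\<phi> ` fp_class s t f p = {\<phi> p}" unfolding a_r_coset_def' using e by (auto simp: image_UN)
    then show ?thesis by (simp add: \<rho>_def)
  qed
  have rep: "representation (fp_algebra s t f) (fp_scalar s t f) n \<rho>"
  proof (rule representationI)
    fix a assume "a \<in> carrier (fp_algebra s t f)"
    then obtain p where p: "p \<in> carrier (free_algebra s)" "a = fp_class s t f p" by (auto simp: fp_class_surj)
    then show "\<rho> a \<in> carrier_mat n n" using \<rho> \<phi>c by simp
    fix b assume "b \<in> carrier (fp_algebra s t f)"
    then obtain q where q: "q \<in> carrier (free_algebra s)" "b = fp_class s t f q" by (auto simp: fp_class_surj)
    show "\<rho> (a \<otimes>\<^bsub>fp_algebra s t f\<^esub> b) = \<rho> a * \<rho> b"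
      using ring_hom_mult[OF fp_class_hom p(1) q(1)] ring_hom_mult[OF hom p(1) q(1)] \<rho>[OF p(1)] \<rho>[OF q(1)]
        \<rho>[OF F.m_closed[OF p(1) q(1)]] by (simp add: p(2) q(2) ring_mat_simps)
    show "\<rho> (a \<oplus>\<^bsub>fp_algebra s t f\<^esub> b) = \<rho> a + \<rho> b"
      using ring_hom_add[OF fp_class_hom p(1) q(1)] ring_hom_add[OF hom p(1) q(1)] \<rho>[OF p(1)] \<rho>[OF q(1)]
        \<rho>[OF F.a_closed[OF p(1) q(1)]] by (simp add: p(2) q(2) ring_mat_simps)
  next
    show "\<rho> \<one>\<^bsub>fp_algebra s t f\<^esub> = 1\<^sub>m n"
      using ring_hom_one[OF fp_class_hom] ring_hom_one[OF hom] \<rho>[OF F.one_closed] by (simp add: ring_mat_simps)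
    fix c
    show "\<rho> (fp_scalar s t f c) = to_ac c \<cdot>\<^sub>m 1\<^sub>m n" unfolding fp_scalar_def
      using \<rho>[OF single_in_free_algebra[of "[]" c]] falg_eval_single[of to_ac "point_mat n z" n "[]" c] by (simp add: \<phi>_def)
  qed
  have "\<rho> (fp_class s t f (Poly_Mapping.single w 1)) = word_mat (point_mat n z) n w" if "w \<in> lists {..<s}" for w
    using \<rho>[OF single_in_free_algebra[OF that, of 1]] falg_eval_single[of to_ac "point_mat n z" n w 1]
    by (auto simp: \<phi>_def intro!: eq_matI)
  with rep show ?thesis by blast
qed

text \<open>The coordinates of z are the entries of the images of the generators. With
  \<open>point_representation\<close> this identifies representations with points. The last conjunct
  recovers the representation on all elements, which is needed to compare traces beyond single
  words.\<close>

lemma representation_point: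
  assumes rep: "representation (fp_algebra s t f) (fp_scalar s t f) n \<rho>"
  shows "\<exists>z. rel_point n t f to_ac z \<and>
    (\<forall>w\<in>lists {..<s}. \<rho> (fp_class s t f (Poly_Mapping.single w 1)) = word_mat (point_mat n z) n w) \<and>
    (\<forall>p\<in>carrier (free_algebra s). \<rho> (fp_class s t f p) = falg_eval to_ac (point_mat n z) n p)"
proof -
  interpret F: ring "free_algebra s :: (nat list \<Rightarrow>\<^sub>0 'k) ring" by (rule ring_free_algebra)
  interpret I: ideal "rel_ideal s t f" "free_algebra s" by (rule ideal_rel_ideal)
  note D = representationD[OF rep]
  let ?c = "fp_class s t f"
  have cc: "?c p \<in> carrier (fp_algebra s t f)" if "p \<in> carrier (free_algebra s)" for p
    using ring_hom_closed[OF fp_class_hom that] .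
  have mult: "\<rho> (?c (p * q)) = \<rho> (?c p) * \<rho> (?c q)" if "p \<in> carrier (free_algebra s)" "q \<in> carrier (free_algebra s)" for p q
    using ring_hom_mult[OF fp_class_hom that] D(2)[OF cc[OF that(1)] cc[OF that(2)]] by (simp add: free_algebra_def)
  have add: "\<rho> (?c (p + q)) = \<rho> (?c p) + \<rho> (?c q)" if "p \<in> carrier (free_algebra s)" "q \<in> carrier (free_algebra s)" for p q
    using ring_hom_add[OF fp_class_hom that] D(3)[OF cc[OF that(1)] cc[OF that(2)]] by (simp add: free_algebra_def)
  have scal: "\<rho> (?c (Poly_Mapping.single [] c)) = to_ac c \<cdot>\<^sub>m 1\<^sub>m n" for c
    using D(5)[of c] by (simp add: fp_scalar_def)
  define z where "z = (\<lambda>(i, j, l). \<rho> (?c (Poly_Mapping.single [l] 1)) $$ (i, j))"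
  have Z: "point_mat n z l = \<rho> (?c (Poly_Mapping.single [l] 1))" if "l < s" for l
    using D(1)[OF cc[OF single_in_free_algebra[of "[l]" 1]]] that
    by (intro eq_matI) (auto simp: point_mat_def z_def)
  note wc = word_mat_carrier[of "point_mat n z" n, OF point_mat_carrier]
  have word: "\<rho> (?c (Poly_Mapping.single w 1)) = word_mat (point_mat n z) n w" if "w \<in> lists {..<s}" for w
    using that
  proof (induction w)
    case Nil
    show ?case using scal[of 1] by (auto intro!: eq_matI)
  next
    case (Cons l w)
    then have l: "l < s" "[l] \<in> lists {..<s}" "w \<in> lists {..<s}" by auto
    have "Poly_Mapping.single (l # w) (1 :: 'k) = Poly_Mapping.single [l] 1 * Poly_Mapping.single w 1"
      by (simp add: mult_single plus_list_def)
    then show ?case using mult[OF single_in_free_algebra[OF l(2), of 1] single_in_free_algebra[OF l(3), of 1]] Cons.IH l Z[OF l(1)]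
      by simp
  qed
  have single: "\<rho> (?c (Poly_Mapping.single w c)) = falg_eval to_ac (point_mat n z) n (Poly_Mapping.single w c)"
    if "w \<in> lists {..<s}" for w c
  proof -
    have "Poly_Mapping.single w c = Poly_Mapping.single [] c * Poly_Mapping.single w 1"
      by (simp add: mult_single plus_list_def)
    then have "\<rho> (?c (Poly_Mapping.single w c)) = (to_ac c \<cdot>\<^sub>m 1\<^sub>m n) * word_mat (point_mat n z) n w"
      using mult[OF single_in_free_algebra[of "[]" c] single_in_free_algebra[OF that, of 1]] scal word[OF that] by simp
    also have "\<dots> = to_ac c \<cdot>\<^sub>m word_mat (point_mat n z) n w"
      using mult_smult_assoc_mat[OF one_carrier_mat wc[of w]] left_mult_one_mat[OF wc[of w]] by simp
    finally show ?thesis using falg_eval_single[of to_ac "point_mat n z" n w c] by simp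
  qed
  have sum: "\<rho> (?c (\<Sum>w\<in>K. Poly_Mapping.single w (g w))) = falg_eval to_ac (point_mat n z) n (\<Sum>w\<in>K. Poly_Mapping.single w (g w)) \<and>
      (\<Sum>w\<in>K. Poly_Mapping.single w (g w)) \<in> carrier (free_algebra s)"
    if "finite K" "K \<subseteq> lists {..<s}" for K g
    using that
  proof (induction K rule: finite_induct)
    case empty
    have "\<rho> (?c 0) = falg_eval to_ac (point_mat n z) n 0" using single[of "[]" 0] by simp
    then show ?case by (simp add: free_algebra_def)
  next
    case (insert w K)
    have w: "w \<in> lists {..<s}" and IH: "\<rho> (?c (\<Sum>w\<in>K. Poly_Mapping.single w (g w))) = falg_eval to_ac (point_mat n z) n (\<Sum>w\<in>K. Poly_Mapping.single w (g w))"
      "(\<Sum>w\<in>K. Poly_Mapping.single w (g w)) \<in> carrier (free_algebra s)" using insert by auto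
    have "Poly_Mapping.single w (g w) + (\<Sum>w\<in>K. Poly_Mapping.single w (g w)) \<in> carrier (free_algebra s)"
      using F.a_closed[OF single_in_free_algebra[OF w, of "g w"] IH(2)] by (simp add: free_algebra_def)
    then show ?case
      using insert.hyps add[OF single_in_free_algebra[OF w, of "g w"] IH(2)] IH(1) single[OF w]
      by (simp add: falg_eval_add[OF comm_ring_hom_to_ac])
  qed
  have all: "\<rho> (?c p) = falg_eval to_ac (point_mat n z) n p" if "p \<in> carrier (free_algebra s)" for p
    using conjunct1[OF sum[of "Poly_Mapping.keys p" "Poly_Mapping.lookup p"]] that
    by (simp add: sum_single_lookup free_algebra_def)
  have "falg_eval to_ac (point_mat n z) n (f r) = 0\<^sub>m n n" if r: "r < t" for r
  proof -
    have fr: "f r \<in> carrier (free_algebra s)" using f r by blast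
    have "f ` {..<t} \<subseteq> rel_ideal s t f" unfolding rel_ideal_def using f by (intro F.genideal_self) auto
    then have "f r \<in> rel_ideal s t f" using r by blast
    then have "?c (f r) = ?c 0" using I.a_rcos_const I.zero_closed by (metis free_algebra_def ring.simps(1))
    then have "\<rho> (?c (f r)) = falg_eval to_ac (point_mat n z) n 0" using all[of 0] by (simp add: free_algebra_def)
    also have "\<dots> = 0\<^sub>m n n" by (intro eq_matI) (auto simp: falg_eval_def)
    finally show ?thesis using all[OF fr] by simp
  qed
  then have "rel_point n t f to_ac z" by (simp add: rel_point_def)
  then show ?thesis using word all by blast
qed

end

section \<open>Finiteness of the set of classes\<close>

lemma finite_monic_polys_coeff:
  assumes B: "finite (B :: 'a::idom set)"
  shows "finite {p :: 'a poly. degree p = n \<and> coeff p n = 1 \<and> (\<forall>i<n. coeff p i \<in> B)}"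
proof (rule finite_subset)
  let ?G = "{g :: nat \<Rightarrow> 'a. \<forall>i. (i \<in> {..n} \<longrightarrow> g i \<in> insert 1 B) \<and> (i \<notin> {..n} \<longrightarrow> g i = 0)}"
  show "finite ((\<lambda>g. \<Sum>i\<le>n. monom (g i) i) ` ?G)" by (intro finite_imageI finite_set_of_finite_funs) (use B in auto)
  show "{p. degree p = n \<and> coeff p n = 1 \<and> (\<forall>i<n. coeff p i \<in> B)} \<subseteq> (\<lambda>g. \<Sum>i\<le>n. monom (g i) i) ` ?G"
  proof
    fix p assume p: "p \<in> {p. degree p = n \<and> coeff p n = 1 \<and> (\<forall>i<n. coeff p i \<in> B)}"
    then have "p = (\<Sum>i\<le>n. monom (coeff p i) i)" using poly_as_sum_of_monoms[of p] by simp
    moreover have "coeff p \<in> ?G" using p by (auto simp: le_less coeff_eq_0)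
    ultimately show "p \<in> (\<lambda>g. \<Sum>i\<le>n. monom (g i) i) ` ?G" by blast
  qed
qed

text \<open>Over an algebraically closed field such a polynomial is the product of linear factors
  over a list of length m with entries in E.\<close>

lemma finite_monic_polys_roots:
  assumes E: "finite (E :: 'a::alg_closed_field set)"
  shows "finite {p :: 'a poly. degree p = m \<and> coeff p m = 1 \<and> (\<forall>x. poly p x = 0 \<longrightarrow> x \<in> E)}"
proof (rule finite_subset)
  show "finite ((\<lambda>xs. \<Prod>x\<in>#mset xs. [:- x, 1:]) ` {xs. set xs \<subseteq> E \<and> length xs = m})"
    by (intro finite_imageI finite_lists_length_eq E)
  show "{p. degree p = m \<and> coeff p m = 1 \<and> (\<forall>x. poly p x = 0 \<longrightarrow> x \<in> E)} \<subseteq>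
      (\<lambda>xs. \<Prod>x\<in>#mset xs. [:- x, 1:]) ` {xs. set xs \<subseteq> E \<and> length xs = m}"
  proof
    fix p :: "'a poly" assume p: "p \<in> {p. degree p = m \<and> coeff p m = 1 \<and> (\<forall>x. poly p x = 0 \<longrightarrow> x \<in> E)}"
    then have "p \<noteq> 0" by auto
    then obtain A where A: "size A = degree p" "p = smult (lead_coeff p) (\<Prod>x\<in>#A. [:-x, 1:])"
      using alg_closed_imp_factorization by blast
    obtain xs where xs: "mset xs = A" using ex_mset by blast
    have pA: "p = (\<Prod>x\<in>#A. [:-x, 1:])" using A(2) p by auto
    have "x \<in> E" if "x \<in> set xs" for x
    proof -
      have "x \<in># A" using that xs by (metis set_mset_mset)
      then have "[:- x, 1:] dvd p" unfolding pA by (intro dvd_prod_mset) auto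
      then have "poly p x = 0" by (simp add: poly_eq_0_iff_dvd)
      then show ?thesis using p by blast
    qed
    moreover have "length xs = m" using A(1) p xs by (auto simp flip: size_mset)
    ultimately show "p \<in> (\<lambda>xs. \<Prod>x\<in>#mset xs. [:- x, 1:]) ` {xs. set xs \<subseteq> E \<and> length xs = m}" using pA xs by blast
  qed
qed

section \<open>Equivalence classes and block traces\<close>

context
  fixes n s t :: nat and f :: "nat \<Rightarrow> (nat list \<Rightarrow>\<^sub>0 'k::field)"
  assumes f: "\<forall>r<t. f r \<in> carrier (free_algebra s)"
begin

private abbreviation (input) "R \<equiv> fp_algebra s t f"
private abbreviation (input) "\<sigma> \<equiv> fp_scalar s t f"
private abbreviation (input) "wcls w \<equiv> fp_class s t f (Poly_Mapping.single w (1 :: 'k))"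

lemma word_class_carrier: "w \<in> lists {..<s} \<Longrightarrow> wcls w \<in> carrier R"
  using fp_class_surj[OF f] single_in_free_algebra[OF f] by blast

definition irreducible_blocks :: "(nat \<times> ((nat list \<Rightarrow>\<^sub>0 'k) set \<Rightarrow> 'k alg_closure mat)) list \<Rightarrow> bool" where
  "irreducible_blocks bs \<longleftrightarrow> (\<forall>(m, \<tau>)\<in>set bs. 0 < m \<and> irreducible_rep R \<sigma> m \<tau>) \<and> sum_list (map fst bs) = n"

lemma irreducible_blocks_semisimple: "irreducible_blocks bs \<Longrightarrow> semisimple_rep R \<sigma> n (diag_rep bs)"
  unfolding irreducible_blocks_def by (elim conjE, rule semisimple_diag_rep[OF ring_fp_algebra[OF f]])

lemma char_poly_diag_rep:
  assumes bs: "irreducible_blocks bs" and a: "a \<in> carrier R"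
  shows "char_poly (diag_rep bs a) = (\<Prod>(m, \<tau>)\<leftarrow>bs. char_poly (\<tau> a))"
proof -
  have "\<forall>A\<in>set (map (\<lambda>(m, \<tau>). \<tau> a) bs). square_mat A"
  proof
    fix A assume "A \<in> set (map (\<lambda>(m, \<tau>). \<tau> a) bs)"
    then obtain m \<tau> where b: "(m, \<tau>) \<in> set bs" "A = \<tau> a" by auto
    then have "irreducible_rep R \<sigma> m \<tau>" using bs by (auto simp: irreducible_blocks_def)
    then have "A \<in> carrier_mat m m" using representationD(1)[OF _ a] by (auto simp: irreducible_rep_def b(2))
    then show "square_mat A" by auto
  qed
  from char_poly_diag_block_mat[OF this] show ?thesis by (simp add: o_def case_prod_unfold)
qed

lemma trace_equal_on_words:
  fixes \<tau> \<tau>' :: "(nat list \<Rightarrow>\<^sub>0 'k) set \<Rightarrow> 'k alg_closure mat"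
  assumes rep: "representation R \<sigma> m \<tau>" "representation R \<sigma> m \<tau>'"
    and tr: "\<And>w. w \<in> lists {..<s} \<Longrightarrow> length w \<le> 2 * m * m \<Longrightarrow> mtr m (\<tau> (wcls w)) = mtr m (\<tau>' (wcls w))"
    and a: "a \<in> carrier R"
  shows "mtr m (\<tau> a) = mtr m (\<tau>' a)"
proof -
  obtain z where z: "\<forall>w\<in>lists {..<s}. \<tau> (wcls w) = word_mat (point_mat m z) m w"
    "\<forall>p\<in>carrier (free_algebra s). \<tau> (fp_class s t f p) = falg_eval to_ac (point_mat m z) m p"
    using representation_point[OF f rep(1)] by blast
  obtain z' where z': "\<forall>w\<in>lists {..<s}. \<tau>' (wcls w) = word_mat (point_mat m z') m w"
    "\<forall>p\<in>carrier (free_algebra s). \<tau>' (fp_class s t f p) = falg_eval to_ac (point_mat m z') m p"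
    using representation_point[OF f rep(2)] by blast
  have w: "mtr m (word_mat (point_mat m z) m w) = mtr m (word_mat (point_mat m z') m w)" if "w \<in> lists {..<s}" for w
    by (rule trace_words_determined[OF point_mat_carrier point_mat_carrier _ that]) (use tr z(1) z'(1) in auto)
  obtain p where p: "p \<in> carrier (free_algebra s)" "a = fp_class s t f p" using a fp_class_surj[OF f] by blast
  have kp: "Poly_Mapping.keys p \<subseteq> lists {..<s}" using p(1) by (simp add: free_algebra_def)
  have "mtr m (falg_eval to_ac (point_mat m z) m p) = mtr m (falg_eval to_ac (point_mat m z') m p)"
    unfolding mtr_falg_eval by (intro sum.cong refl) (simp only: w[OF subsetD[OF kp]])
  then show ?thesis using z(2) z'(2) p by simp
qed

text \<open>The bound serves all blocks at once: every block dimension m is at most n, so 2 m^2 is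
  at most 2 n^2.\<close>

definition short_words :: "nat list set" where
  "short_words = {w. set w \<subseteq> {..<s} \<and> length w \<le> 2 * n * n}"

text \<open>The invariant that determines an irreducible block up to equivalence. The default 0 off
  \<open>short_words\<close> lets the signatures range over a finite set of functions as soon as the
  traces do.\<close>

definition block_signature :: "nat \<times> ((nat list \<Rightarrow>\<^sub>0 'k) set \<Rightarrow> 'k alg_closure mat) \<Rightarrow> nat \<times> (nat list \<Rightarrow> 'k alg_closure)" where
  "block_signature = (\<lambda>(m, \<tau>). (m, \<lambda>w. if w \<in> short_words then mtr m (\<tau> (wcls w)) else 0))"

lemma block_dim_le:
  assumes "irreducible_blocks bs" "(m, \<tau>) \<in> set bs"
  shows "m \<le> n"
  using assms member_le_sum_list[of m "map fst bs"] by (force simp: irreducible_blocks_def)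

lemma signature_determines:
  assumes bs: "irreducible_blocks bs" "irreducible_blocks bs'" and sig: "map block_signature bs = map block_signature bs'"
  shows "rep_equivalent R n (diag_rep bs) (diag_rep bs')"
proof -
  have len: "length bs = length bs'" using sig by (rule map_eq_imp_length_eq)
  have "list_all2 (\<lambda>(m, \<tau>) (m', \<tau>'). m = m' \<and> representation R \<sigma> m \<tau> \<and>
      representation R \<sigma> m \<tau>' \<and> rep_equivalent R m \<tau> \<tau>') bs bs'"
    unfolding list_all2_conv_all_nth
  proof (intro conjI len allI impI)
    fix i assume i: "i < length bs"
    obtain m \<tau> where b: "bs ! i = (m, \<tau>)" by (cases "bs ! i")
    obtain m' \<tau>' where b': "bs' ! i = (m', \<tau>')" by (cases "bs' ! i")
    have in_bs: "(m, \<tau>) \<in> set bs" "(m', \<tau>') \<in> set bs'" using i len b b' by (metis nth_mem)+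
    have "block_signature (m, \<tau>) = block_signature (m', \<tau>')" using arg_cong[OF sig, of "\<lambda>xs. xs ! i"] i len b b' by simp
    then have m: "m' = m" and fe: "(\<lambda>w. if w \<in> short_words then mtr m (\<tau> (wcls w)) else 0) =
        (\<lambda>w. if w \<in> short_words then mtr m' (\<tau>' (wcls w)) else 0)"
      by (simp_all add: block_signature_def)
    have irr: "0 < m" "irreducible_rep R \<sigma> m \<tau>" "irreducible_rep R \<sigma> m \<tau>'"
      using bs in_bs by (auto simp: irreducible_blocks_def m)
    have rep: "representation R \<sigma> m \<tau>" "representation R \<sigma> m \<tau>'" using irr by (auto simp: irreducible_rep_def)
    have mn: "2 * m * m \<le> 2 * n * n" using block_dim_le[OF bs(1) in_bs(1)] by (intro mult_le_mono) auto
    have "mtr m (\<tau> (wcls w)) = mtr m (\<tau>' (wcls w))" if "w \<in> lists {..<s}" "length w \<le> 2 * m * m" for w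
    proof -
      have "w \<in> short_words" using that mn by (auto simp: short_words_def)
      then show ?thesis using fun_cong[OF fe, of w] by (simp only: m if_True)
    qed
    then have "mtr m (\<tau> a) = mtr m (\<tau>' a)" if "a \<in> carrier R" for a
      using trace_equal_on_words[OF rep _ that] by blast
    then have "rep_equivalent R m \<tau> \<tau>'"
      by (intro irreducible_reps_trace_equivalent[OF ring_fp_algebra[OF f] irr])
    then show "(\<lambda>(m, \<tau>) (m', \<tau>'). m = m' \<and> representation R \<sigma> m \<tau> \<and>
        representation R \<sigma> m \<tau>' \<and> rep_equivalent R m \<tau> \<tau>') (bs ! i) (bs' ! i)"
      using rep m by (simp add: b b')
  qed
  from rep_equivalent_diag_rep[OF ring_fp_algebra[OF f] this]
  have "rep_equivalent R (sum_list (map fst bs)) (diag_rep bs) (diag_rep bs')" by blast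
  moreover have "sum_list (map fst bs) = n" using bs(1) by (simp add: irreducible_blocks_def)
  ultimately show ?thesis by (simp only:)
qed

private abbreviation (input) "ss_rel \<equiv> {(\<rho>, \<rho>'). semisimple_rep R \<sigma> n \<rho> \<and> semisimple_rep R \<sigma> n \<rho>' \<and> rep_equivalent R n \<rho> \<rho>'}"

lemma class_contains_diag_rep:
  assumes C: "C \<in> semisimple_classes R \<sigma> n"
  shows "\<exists>bs. irreducible_blocks bs \<and> diag_rep bs \<in> C"
proof -
  obtain \<rho> where \<rho>: "semisimple_rep R \<sigma> n \<rho>" "C = ss_rel `` {\<rho>}"
    using C unfolding semisimple_classes_def by (elim quotientE) blast
  then obtain bs where bs: "irreducible_blocks bs" "rep_equivalent R n \<rho> (diag_rep bs)"
    unfolding semisimple_rep_def irreducible_blocks_def by blast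
  then show ?thesis using \<rho> irreducible_blocks_semisimple by blast
qed

text \<open>The hypothesis concerns characteristic coefficients of the whole n-dimensional
  representation, whereas the signature needs traces of the single blocks. Eigenvalues are the
  bridge: the characteristic polynomial of a block divides the whole one, so its roots lie in the
  finite set \<open>E w\<close>, and only finitely many monic polynomials of given degree have all
  roots there.\<close>

lemma finite_semisimple_classes:
  assumes coeffs: "\<And>w i. w \<in> lists {..<s} \<Longrightarrow> i < n \<Longrightarrow> finite {point_coeff n w i z | z :: nat \<times> nat \<times> nat \<Rightarrow> 'k alg_closure. rel_point n t f to_ac z}"
  shows "finite (semisimple_classes R \<sigma> n)"
proof -
  define P where "P w = {char_poly (word_mat (point_mat n z) n w) | z :: nat \<times> nat \<times> nat \<Rightarrow> 'k alg_closure. rel_point n t f to_ac z}" for w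
  have finP: "finite (P w)" if w: "w \<in> lists {..<s}" for w
  proof -
    let ?B = "\<Union>i<n. {point_coeff n w i z | z :: nat \<times> nat \<times> nat \<Rightarrow> 'k alg_closure. rel_point n t f to_ac z}"
    have "finite ?B" using coeffs[OF w] by blast
    from finite_monic_polys_coeff[OF this, of n] show ?thesis
    proof (rule rev_finite_subset, intro subsetI)
      fix p assume "p \<in> P w"
      then obtain z where z: "rel_point n t f to_ac z" "p = char_poly (word_mat (point_mat n z) n w)" by (auto simp: P_def)
      have "degree p = n \<and> coeff p n = 1"
        unfolding z(2) by (rule degree_monic_char_poly, rule word_mat_carrier, rule point_mat_carrier)
      moreover have "coeff p i \<in> ?B" if "i < n" for i using z that by (auto simp: point_coeff_def)
      ultimately show "p \<in> {p. degree p = n \<and> coeff p n = 1 \<and> (\<forall>i<n. coeff p i \<in> ?B)}" by blast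
    qed
  qed
  define E where "E w = (\<Union>p\<in>P w. {x. poly p x = 0})" for w
  have finE: "finite (E w)" if w: "w \<in> lists {..<s}" for w
    unfolding E_def
  proof (intro finite_UN_I finP w)
    fix p assume "p \<in> P w"
    then obtain z :: "nat \<times> nat \<times> nat \<Rightarrow> 'k alg_closure" where p: "p = char_poly (word_mat (point_mat n z) n w)" by (auto simp: P_def)
    have "coeff p n = 1"
      unfolding p by (rule conjunct2[OF degree_monic_char_poly], rule word_mat_carrier, rule point_mat_carrier)
    then show "finite {x. poly p x = 0}" by (intro poly_roots_finite) auto
  qed
  define T where "T = (\<Union>w\<in>short_words. \<Union>m\<in>{1..n}. (\<lambda>q. - coeff q (m - 1)) `
    {q :: 'k alg_closure poly. degree q = m \<and> coeff q m = 1 \<and> (\<forall>x. poly q x = 0 \<longrightarrow> x \<in> E w)})"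
  have finW: "finite short_words" unfolding short_words_def by (rule finite_lists_length_le) simp
  have finT: "finite T" unfolding T_def
    by (intro finite_UN_I finW finite_imageI finite_monic_polys_roots finE) (auto simp: short_words_def)
  have trT: "mtr m (\<tau> (wcls w)) \<in> T" if bs: "irreducible_blocks bs" and b: "(m, \<tau>) \<in> set bs" and w: "w \<in> short_words" for bs m \<tau> w
  proof -
    have wl: "w \<in> lists {..<s}" using w by (auto simp: short_words_def)
    note wc = word_class_carrier[OF wl]
    have m: "0 < m" "m \<le> n" and rep: "representation R \<sigma> m \<tau>"
      using bs b block_dim_le[OF bs b] by (auto simp: irreducible_blocks_def irreducible_rep_def)
    note \<tau>c = representationD(1)[OF rep wc]
    have "representation R \<sigma> n (diag_rep bs)" using irreducible_blocks_semisimple[OF bs] by (simp add: semisimple_rep_def)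
    then obtain z where z: "rel_point n t f to_ac z" "diag_rep bs (wcls w) = word_mat (point_mat n z) n w"
      using representation_point[OF f] wl by blast
    have "char_poly (\<tau> (wcls w)) dvd (\<Prod>(m, \<tau>)\<leftarrow>bs. char_poly (\<tau> (wcls w)))"
    proof -
      obtain xs ys where "bs = xs @ (m, \<tau>) # ys" using split_list[OF b] by blast
      then show ?thesis by simp
    qed
    then have "char_poly (\<tau> (wcls w)) dvd char_poly (word_mat (point_mat n z) n w)"
      using char_poly_diag_rep[OF bs wc] z(2) by simp
    then have "x \<in> E w" if "poly (char_poly (\<tau> (wcls w))) x = 0" for x
      using that z(1) by (auto simp: E_def P_def dvd_def)
    moreover have "mtr m (\<tau> (wcls w)) = - coeff (char_poly (\<tau> (wcls w))) (m - 1)"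
      using coeff_char_poly_trace[OF \<tau>c m(1)] by simp
    ultimately show ?thesis unfolding T_def
      using m degree_monic_char_poly[OF \<tau>c] w by (intro UN_I[of w] UN_I[of m] image_eqI[of _ _ "char_poly (\<tau> (wcls w))"]) auto
  qed
  define G where "G = {1..n} \<times> {g :: nat list \<Rightarrow> 'k alg_closure. \<forall>w. (w \<in> short_words \<longrightarrow> g w \<in> T) \<and> (w \<notin> short_words \<longrightarrow> g w = 0)}"
  have finG: "finite G" unfolding G_def by (intro finite_cartesian_product finite_set_of_finite_funs finW finT) simp
  have sigG: "map block_signature bs \<in> {xs. set xs \<subseteq> G \<and> length xs \<le> n}" if bs: "irreducible_blocks bs" for bs
  proof -
    have "block_signature b \<in> G" if "b \<in> set bs" for b
    proof -
      obtain m \<tau> where b: "b = (m, \<tau>)" by (cases b)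
      have "0 < m" "m \<le> n" using bs that block_dim_le[OF bs] by (auto simp: irreducible_blocks_def b)
      then show ?thesis using trT[OF bs, of m \<tau>] that by (auto simp: G_def block_signature_def b)
    qed
    moreover have "length bs \<le> n"
    proof -
      have "\<forall>b\<in>set bs. 1 \<le> fst b" using bs by (auto simp: irreducible_blocks_def)
      then have "length bs \<le> sum_list (map fst bs)" by (induction bs) auto
      then show ?thesis using bs by (simp add: irreducible_blocks_def)
    qed
    ultimately show ?thesis by auto
  qed
  have "\<forall>C\<in>semisimple_classes R \<sigma> n. \<exists>bs. irreducible_blocks bs \<and> diag_rep bs \<in> C" using class_contains_diag_rep by blast
  from bchoice[OF this] obtain bl where bl: "\<forall>C\<in>semisimple_classes R \<sigma> n. irreducible_blocks (bl C) \<and> diag_rep (bl C) \<in> C" by (elim exE)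
  show ?thesis
  proof (rule inj_on_finite)
    show "finite {xs. set xs \<subseteq> G \<and> length xs \<le> n}" by (rule finite_lists_length_le[OF finG])
    show "(\<lambda>C. map block_signature (bl C)) ` semisimple_classes R \<sigma> n \<subseteq> {xs. set xs \<subseteq> G \<and> length xs \<le> n}" using bl sigG by blast
    show "inj_on (\<lambda>C. map block_signature (bl C)) (semisimple_classes R \<sigma> n)"
    proof (rule inj_onI)
      fix C D assume CD: "C \<in> semisimple_classes R \<sigma> n" "D \<in> semisimple_classes R \<sigma> n"
        and eq: "map block_signature (bl C) = map block_signature (bl D)"
      have b: "irreducible_blocks (bl C)" "irreducible_blocks (bl D)" "diag_rep (bl C) \<in> C" "diag_rep (bl D) \<in> D" using bl CD by blast+
      have "(diag_rep (bl C), diag_rep (bl D)) \<in> ss_rel"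
        using signature_determines[OF b(1,2) eq] irreducible_blocks_semisimple[OF b(1)] irreducible_blocks_semisimple[OF b(2)] by blast
      then show "C = D"
        using quotient_eq_iff[OF equiv_rep_equivalent CD[unfolded semisimple_classes_def] b(3,4)] by blast
    qed
  qed
qed

text \<open>A characteristic coefficient is constant on equivalence classes, so any representative
  may be used to define its value on a class. The semisimplification of the representation at a
  point has the same characteristic polynomials, so every value at a point is the value of some
  class.\<close>

lemma infinite_semisimple_classes:
  assumes w: "w \<in> lists {..<s}" and inf: "infinite {point_coeff n w i z | z :: nat \<times> nat \<times> nat \<Rightarrow> 'k alg_closure. rel_point n t f to_ac z}"
  shows "infinite (semisimple_classes R \<sigma> n)"
proof
  assume fin: "finite (semisimple_classes R \<sigma> n)"
  note wc = word_class_carrier[OF w]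
  define h where "h C = coeff (char_poly ((SOME \<rho>. \<rho> \<in> C) (wcls w))) i" for C :: "((nat list \<Rightarrow>\<^sub>0 'k) set \<Rightarrow> 'k alg_closure mat) set"
  have "{point_coeff n w i z | z :: nat \<times> nat \<times> nat \<Rightarrow> 'k alg_closure. rel_point n t f to_ac z} \<subseteq> h ` semisimple_classes R \<sigma> n"
  proof
    fix x assume "x \<in> {point_coeff n w i z | z :: nat \<times> nat \<times> nat \<Rightarrow> 'k alg_closure. rel_point n t f to_ac z}"
    then obtain z :: "nat \<times> nat \<times> nat \<Rightarrow> 'k alg_closure" where z: "rel_point n t f to_ac z" "x = point_coeff n w i z" by blast
    obtain \<rho> where rep: "representation R \<sigma> n \<rho>" and \<rho>w: "\<rho> (wcls w) = word_mat (point_mat n z) n w"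
      using point_representation[OF f z(1)] w by blast
    obtain bs where "(\<forall>(m, \<tau>)\<in>set bs. 0 < m \<and> irreducible_rep R \<sigma> m \<tau>) \<and> sum_list (map fst bs) = n"
      and cp: "\<forall>a\<in>carrier R. char_poly (\<rho> a) = (\<Prod>(m, \<tau>)\<leftarrow>bs. char_poly (\<tau> a))"
      using semisimplification[OF ring_fp_algebra[OF f] rep] by blast
    then have bs: "irreducible_blocks bs" by (simp add: irreducible_blocks_def)
    note ss = irreducible_blocks_semisimple[OF bs]
    define C where "C = ss_rel `` {diag_rep bs}"
    have C: "C \<in> semisimple_classes R \<sigma> n" unfolding C_def semisimple_classes_def using ss by (intro quotientI) simp
    have "diag_rep bs \<in> C" unfolding C_def
      using equiv_class_self[OF equiv_rep_equivalent[of R \<sigma> n]] ss by blast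
    then have "(SOME \<rho>. \<rho> \<in> C) \<in> C" by (rule someI[of "\<lambda>\<rho>. \<rho> \<in> C"])
    then have "rep_equivalent R n (diag_rep bs) (SOME \<rho>. \<rho> \<in> C)" by (auto simp: C_def)
    then obtain Q Q' where Q: "Q \<in> carrier_mat n n" "Q' \<in> carrier_mat n n" "Q * Q' = 1\<^sub>m n" "Q' * Q = 1\<^sub>m n"
      and e: "\<forall>a\<in>carrier R. (SOME \<rho>. \<rho> \<in> C) a = Q * diag_rep bs a * Q'" unfolding rep_equivalent_def by blast
    have dc: "diag_rep bs (wcls w) \<in> carrier_mat n n"
      using ss representationD(1)[OF _ wc] by (auto simp: semisimple_rep_def)
    have "char_poly ((SOME \<rho>. \<rho> \<in> C) (wcls w)) = char_poly (diag_rep bs (wcls w))"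
      using char_poly_conj[OF dc Q(2,1,4,3)] e wc by simp
    also have "\<dots> = char_poly (word_mat (point_mat n z) n w)"
      using char_poly_diag_rep[OF bs wc] cp[rule_format, OF wc] \<rho>w by simp
    finally have "h C = x" by (simp add: h_def z(2) point_coeff_def)
    then show "x \<in> h ` semisimple_classes R \<sigma> n" using C by blast
  qed
  from inf finite_subset[OF this finite_imageI[OF fin]] show False by (rule notE)
qed

end

theorem mainTheorem1:
  fixes n s t :: nat
    and f :: "nat \<Rightarrow> (nat list \<Rightarrow>\<^sub>0 'k::field)"
  assumes "0 < n"
    and "\<And>r. r < t \<Longrightarrow> f r \<in> carrier (free_algebra s)"
  shows "infinite (semisimple_classes (fp_algebra s t f) (fp_scalar s t f) n) \<longleftrightarrow>
         (\<exists>c\<in>CharCoefs n s. 1 \<notin> J_ideal n s t f c)"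
proof -
  have f: "\<forall>r<t. f r \<in> carrier (free_algebra s)" using assms(2) by blast
  show ?thesis
  proof
    assume inf: "infinite (semisimple_classes (fp_algebra s t f) (fp_scalar s t f) n)"
    show "\<exists>c\<in>CharCoefs n s. 1 \<notin> J_ideal n s t f c"
    proof (rule ccontr)
      assume "\<not> (\<exists>c\<in>CharCoefs n s. 1 \<notin> J_ideal n s t f c)"
      then have triv: "\<forall>c\<in>CharCoefs n s. 1 \<in> J_ideal n s t f c" by blast
      have "finite {point_coeff n w i z | z :: nat \<times> nat \<times> nat \<Rightarrow> 'k alg_closure. rel_point n t f to_ac z}"
        if w: "w \<in> lists {..<s}" and i: "i < n" for w i
      proof -
        \<comment> \<open>One nonzero polynomial over k annihilates the values of this coefficient
          at all points, so these values are among its finitely many roots.\<close>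
        obtain d where d: "d \<noteq> 0" "\<forall>(\<phi> :: 'k \<Rightarrow> 'k alg_closure) z. comm_ring_hom \<phi> \<longrightarrow> rel_point n t f \<phi> z \<longrightarrow>
            poly (map_poly \<phi> d) (point_coeff n w i z) = 0"
          using J_ideal_one_imp_algebraic[where ?'b = "'k alg_closure", OF f w i all_J_ideals_trivial[OF f triv w i]]
          by (elim exE conjE)
        have "coeff (map_poly (to_ac :: 'k \<Rightarrow> _) d) (degree d) \<noteq> 0" using d(1) by (simp add: coeff_map_poly)
        then have "finite {x. poly (map_poly to_ac d) x = 0}" by (intro poly_roots_finite) auto
        then show ?thesis by (rule rev_finite_subset) (use d(2) comm_ring_hom_to_ac in blast)
      qed
      from finite_semisimple_classes[OF f this] show False using inf by blast
    qed
  next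
    assume "\<exists>c\<in>CharCoefs n s. 1 \<notin> J_ideal n s t f c"
    then obtain w i where w: "w \<in> lists {..<s}" and i: "i < n" and J: "1 \<notin> J_ideal n s t f (gen_coeff n w i)"
      unfolding CharCoefs_eq by blast
    show "infinite (semisimple_classes (fp_algebra s t f) (fp_scalar s t f) n)"
      by (rule infinite_semisimple_classes[OF f w J_ideal_proper_imp_infinite_values[OF f w i J]])
  qed
qed

end
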